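(* Let $Y_1,\dots,Y_n$ be i.i.d. copies of a random variable $Y$ with $\mathbb{E}Y^4<\infty$, mean $\mu$ and variance $\sigma^2>0$. Then there exist an absolute positive constant $c_1$ and positive constants $c_2$ and $A$ depending on $\sigma$, $\mathbb{E}|Y|^3$ and $\mathbb{E}Y^4$ such that for $$\tau\ge c_1n^{1/6}\max\{(\mathbb{E}Y^4)^{1/2}/\sigma,\,(\mathbb{E}Y^4/\sigma)^{1/3}\}$$ it holds that $$\mathbb{P}(S^*_{\tau,n}>x)=[1-\Phi(x)]\exp\Big\{-\frac{x^3\mathbb{E}(Y-\mu)^3}{3\sqrt n\sigma^3}\Big\}\Big[1+O_1\Big(\frac{1+x^4}{n}+\frac{(1+x)\sqrt n}{\tau^3}+\frac{1+x}{\sqrt n}\Big)\Big]$$ uniformly for $x\in(0,c_2\min\{n^{1/4},\tau^3n^{-1/2}\})$, where $|O_1|\le A$.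
   Context: For $\tau>0$, $f(x)=x\mathbb{1}(|x|\le\tau)+\tau\mathbb{1}(x>\tau)-\tau\mathbb{1}(x<-\tau)$, and the self-normalized winsorized mean is $S^*_{\tau,n}=\dfrac{\sum_{i=1}^n(f(Y_i)-\mu)}{\sqrt{\sum_{i=1}^n(f(Y_i)-\mu)^2}}$. $\Phi$ is the standard normal distribution function. *)

theory Defs
  imports "HOL-Probability.Probability"
begin

definition Phi :: "real \<Rightarrow> real" where
  "Phi x = (\<integral>t. indicator {..x} t * std_normal_density t \<partial>lborel)"

definition winsor :: "real \<Rightarrow> real \<Rightarrow> real" where
  "winsor \<tau> y = (if \<bar>y\<bar> \<le> \<tau> then y else if y > \<tau> then \<tau> else - \<tau>)"

definition selfnorm_winsor :: "real \<Rightarrow> real \<Rightarrow> nat \<Rightarrow> (nat \<Rightarrow> real) \<Rightarrow> real" where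
  "selfnorm_winsor \<tau> \<mu> n Y =
     (\<Sum>i<n. winsor \<tau> (Y i) - \<mu>) / sqrt (\<Sum>i<n. (winsor \<tau> (Y i) - \<mu>)\<^sup>2)"

end

theory Submission
  imports Defs
begin

text \<open>
  The scaled summands X have mean e of order \<open>\<tau>\<close>^-3, second moment 1 and bounded fourth moment.
  With b = x / sqrt n, S = \<open>\<Sum>\<close> X and V^2 = \<open>\<Sum>\<close> X^2, the event S > x V contains T > x^2/2, where
  T = b S - b^2 V^2 / 2 is a sum of i.i.d. terms, and is contained in T > x^2/2 - (b V - x)^2 / 2.
  Tilting by e^T costs E e^T = exp(- x^3 E X^3 / (3 sqrt n) + small), because
  exp(s - s^2/2) = 1 + s - s^3/3 + O(s^4) for all real s, and under the tilted law the Berry-Esseen theorem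
  (proved by Stein's method) evaluates the probability of T > x^2/2.
  The window between the two half lines is handled by splitting the sample: its width is controlled by
  each half separately, and the concentration inequality is applied to the other half.
  Large deviations of V are handled by exponential moments when all b |X| are at most 1; removing a
  summand with b |X| > 1 replaces x^2 by x^2 - 1, which gives an induction on n.
\<close>


subsection \<open>Sums of independent copies\<close>

text \<open>The Mills ratio is of order 1/(1+x), so a relative error \<open>err\<close> requires
  every absolute error under the tilted law to be of order \<open>err\<close>/(1+x): this turns the
  Berry-Esseen rate 1/sqrt n into (1+x)/sqrt n. The term (1+x^4)/n comes from fourth-order
  remainders n b^4 and from large summands. The term (1+x) sqrt n / \<open>\<tau>\<close>^3 is a
  bias: the sum is centred at the mean of Y and not at that of the winsorized variable. The obstacle
  is that constants may depend on four moments only, so the exponential moments of V^2 that the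
  argument needs are out of reach while summands with b |X| > 1 are present. The exponent in the
  theorem contains the third moment of Y itself; exchanging it for that of the winsorized variable
  costs x^3 / (sqrt n \<open>\<tau>\<close>), a weighted geometric mean of two admissible terms.
  Thresholds such as 1/10000 only have to be small enough; no numerical constant is
  optimized.\<close>

definition psum :: "('a \<Rightarrow> real) \<Rightarrow> nat set \<Rightarrow> (nat \<Rightarrow> 'a) \<Rightarrow> real" where
  "psum h I \<omega> = (\<Sum>i\<in>I. h (\<omega> i))"

lemma psum_measurable[measurable]:
  assumes [measurable]: "h \<in> borel_measurable D"
  shows "psum h I \<in> borel_measurable (PiM I (\<lambda>_. D))"
  unfolding psum_def by measurable

lemma psum_upd:
  assumes "i \<notin> J" "finite J"
  shows "psum h (insert i J) (fun_upd \<omega> i y) = h y + psum h J \<omega>"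
proof -
  have "(\<Sum>j\<in>J. h (fun_upd \<omega> i y j)) = (\<Sum>j\<in>J. h (\<omega> j))"
    using assms by (intro sum.cong) auto
  then show ?thesis using assms by (simp add: psum_def)
qed

lemma psum_upd_same:
  assumes "i \<notin> J"
  shows "psum h J (fun_upd \<omega> i y) = psum h J \<omega>"
  unfolding psum_def using assms by (intro sum.cong) auto

lemma psum_remove:
  assumes "finite I" "i \<in> I"
  shows "psum h I \<omega> = h (\<omega> i) + psum h (I - {i}) \<omega>"
  using assms by (simp add: psum_def sum.remove)

lemma psum_merge:
  assumes "I \<inter> J = {}" "finite I" "finite J"
  shows "psum h (I \<union> J) (merge I J (\<omega>, \<omega>')) = psum h I \<omega> + psum h J \<omega>'"
proof -
  have "(\<Sum>i\<in>I. h (merge I J (\<omega>, \<omega>') i)) = (\<Sum>i\<in>I. h (\<omega> i))"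
    by (intro sum.cong) (auto simp: merge_def)
  moreover have "(\<Sum>i\<in>J. h (merge I J (\<omega>, \<omega>') i)) = (\<Sum>i\<in>J. h (\<omega>' i))"
    using assms by (intro sum.cong) (auto simp: merge_def)
  ultimately show ?thesis
    using assms by (simp add: psum_def sum.union_disjoint)
qed

context prob_space
begin

lemma product_sf: "product_sigma_finite (\<lambda>_::nat. M)"
  by standard

lemma prob_space_Pi: "prob_space (PiM I (\<lambda>_::nat. M))"
  by (rule prob_space_PiM) (rule prob_space_axioms)

lemma pair_sf: "finite I \<Longrightarrow> pair_sigma_finite M (PiM I (\<lambda>_::nat. M))"
proof -
  interpret Q: prob_space "PiM I (\<lambda>_::nat. M)" by (rule prob_space_Pi)
  show ?thesis by standard
qed

lemma component_distr: "i \<in> I \<Longrightarrow> distr (PiM I (\<lambda>_::nat. M)) M (\<lambda>\<omega>. \<omega> i) = M"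
  using distr_PiM_component[of I "\<lambda>_. M" i] prob_space_axioms by simp

lemma integrable_component:
  fixes g :: "'a \<Rightarrow> real"
  assumes "integrable M g" "i \<in> I"
  shows "integrable (PiM I (\<lambda>_::nat. M)) (\<lambda>\<omega>. g (\<omega> i))"
proof -
  have "integrable (distr (PiM I (\<lambda>_::nat. M)) M (\<lambda>\<omega>. \<omega> i)) g"
    using assms by (simp add: component_distr)
  then show ?thesis
    using assms by (subst (asm) integrable_distr_eq) auto
qed

lemma upd_measurable[measurable]:
  "(\<lambda>p. fun_upd (snd p) i (fst p)) \<in> measurable (M \<Otimes>\<^sub>M PiM J (\<lambda>_::nat. M)) (PiM (insert i J) (\<lambda>_. M))"
  by measurable

text \<open>Splitting off one coordinate turns its independence from the others into Fubini on a
  pair. Both measures agree on boxes, and these determine a measure on the product.\<close>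

lemma PiM_insert_eq_distr:
  assumes "finite J" "i \<notin> J"
  shows "PiM (insert i J) (\<lambda>_::nat. M) =
    distr (M \<Otimes>\<^sub>M PiM J (\<lambda>_. M)) (PiM (insert i J) (\<lambda>_. M)) (\<lambda>p. fun_upd (snd p) i (fst p))"
    (is "?P = ?D")
proof -
  interpret PS: product_sigma_finite "\<lambda>_::nat. M" by (rule product_sf)
  interpret J: finite_product_sigma_finite "\<lambda>_::nat. M" J by standard (rule assms)
  have "?D = ?P"
  proof (rule PS.PiM_eqI)
    show "finite (insert i J)" using assms by simp
    show "sets ?D = sets ?P" by simp
    fix A :: "nat \<Rightarrow> 'a set" assume A: "\<And>j. j \<in> insert i J \<Longrightarrow> A j \<in> sets M"
    have *: "(\<lambda>p. fun_upd (snd p) i (fst p)) -` (Pi\<^sub>E (insert i J) A) \<inter> space (M \<Otimes>\<^sub>M PiM J (\<lambda>_. M)) = A i \<times> Pi\<^sub>E J A"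
      using assms A[THEN sets.sets_into_space]
      by (auto simp: space_PiM space_pair_measure PiE_iff extensional_def split: if_splits)
    have "emeasure ?D (Pi\<^sub>E (insert i J) A) = emeasure (M \<Otimes>\<^sub>M PiM J (\<lambda>_. M)) (A i \<times> Pi\<^sub>E J A)"
      using A assms by (subst emeasure_distr) (auto simp: * intro!: sets_PiM_I_finite)
    also have "\<dots> = emeasure M (A i) * (\<Prod>j\<in>J. emeasure M (A j))"
      using A assms by (subst J.emeasure_pair_measure_Times) (auto intro!: sets_PiM_I_finite simp: J.measure_times)
    finally show "emeasure ?D (Pi\<^sub>E (insert i J) A) = (\<Prod>j\<in>insert i J. emeasure M (A j))"
      using assms by simp
  qed
  then show ?thesis by simp
qed

lemma integrable_insert_iff:
  fixes F :: "(nat \<Rightarrow> 'a) \<Rightarrow> real"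
  assumes "finite J" "i \<notin> J" "F \<in> borel_measurable (PiM (insert i J) (\<lambda>_. M))"
  shows "integrable (PiM (insert i J) (\<lambda>_. M)) F \<longleftrightarrow>
    integrable (M \<Otimes>\<^sub>M PiM J (\<lambda>_. M)) (\<lambda>p. F (fun_upd (snd p) i (fst p)))"
  using assms by (subst PiM_insert_eq_distr) (auto simp: integrable_distr_eq)

lemma integral_insert_eq:
  fixes F :: "(nat \<Rightarrow> 'a) \<Rightarrow> real"
  assumes "finite J" "i \<notin> J" "F \<in> borel_measurable (PiM (insert i J) (\<lambda>_. M))"
  shows "(\<integral>\<omega>. F \<omega> \<partial>PiM (insert i J) (\<lambda>_. M)) =
    (\<integral>p. F (fun_upd (snd p) i (fst p)) \<partial>(M \<Otimes>\<^sub>M PiM J (\<lambda>_. M)))"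
  using assms by (subst PiM_insert_eq_distr) (auto simp: integral_distr)

end

lemma (in pair_sigma_finite) integrable_times:
  fixes f g :: "_ \<Rightarrow> real"
  assumes f: "integrable M1 f" and g: "integrable M2 g"
  shows "integrable (M1 \<Otimes>\<^sub>M M2) (\<lambda>p. f (fst p) * g (snd p))"
proof (rule Fubini_integrable)
  show "(\<lambda>p. f (fst p) * g (snd p)) \<in> borel_measurable (M1 \<Otimes>\<^sub>M M2)"
    using f g by measurable
  show "integrable M1 (\<lambda>x. \<integral>y. norm (f (fst (x, y)) * g (snd (x, y))) \<partial>M2)"
    using f g by (auto simp: abs_mult)
qed (use g in auto)

lemma (in pair_sigma_finite) integral_times:
  fixes f g :: "_ \<Rightarrow> real"
  assumes f: "integrable M1 f" and g: "integrable M2 g"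
  shows "(\<integral>p. f (fst p) * g (snd p) \<partial>(M1 \<Otimes>\<^sub>M M2)) = (\<integral>x. f x \<partial>M1) * (\<integral>y. g y \<partial>M2)"
  using integral_fst'[OF integrable_times[OF assms]] by simp

context prob_space
begin

text \<open>A coordinate is independent of any sum over other indices, so expectations factor. The
  function \<open>k\<close> is left free: powers are inserted for second moments, the clamp for the
  leave-one-out identity.\<close>

lemma
  fixes g :: "'a \<Rightarrow> real"
  assumes J: "finite J" "i \<notin> J" and g: "integrable M g"
    and [measurable]: "h \<in> borel_measurable M" "k \<in> borel_measurable borel"
    and k: "integrable (PiM J (\<lambda>_. M)) (\<lambda>\<omega>. k (psum h J \<omega>))"
  shows integrable_indep_times:
      "integrable (PiM (insert i J) (\<lambda>_. M)) (\<lambda>\<omega>. g (\<omega> i) * (k (psum h J \<omega>) :: real))"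
    and integral_indep_times:
      "(\<integral>\<omega>. g (\<omega> i) * (k (psum h J \<omega>) :: real) \<partial>PiM (insert i J) (\<lambda>_. M)) =
        (\<integral>y. g y \<partial>M) * (\<integral>\<omega>. k (psum h J \<omega>) \<partial>PiM J (\<lambda>_. M))"
proof -
  interpret pair_sigma_finite M "PiM J (\<lambda>_. M)" by (rule pair_sf) fact
  have [measurable]: "g \<in> borel_measurable M" using g by auto
  have [measurable]: "psum h J \<in> borel_measurable (PiM (insert i J) (\<lambda>_. M))"
    unfolding psum_def by measurable
  show "integrable (PiM (insert i J) (\<lambda>_. M)) (\<lambda>\<omega>. g (\<omega> i) * (k (psum h J \<omega>) :: real))"
    using integrable_times[OF g k] J by (subst integrable_insert_iff) (auto simp: psum_upd_same)
  show "(\<integral>\<omega>. g (\<omega> i) * (k (psum h J \<omega>) :: real) \<partial>PiM (insert i J) (\<lambda>_. M)) =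
        (\<integral>y. g y \<partial>M) * (\<integral>\<omega>. k (psum h J \<omega>) \<partial>PiM J (\<lambda>_. M))"
    using integral_times[OF g k] J by (subst integral_insert_eq) (auto simp: psum_upd_same)
qed

lemma integrable_psum: "integrable M h \<Longrightarrow> integrable (PiM I (\<lambda>_. M)) (psum h I)"
  unfolding psum_def[abs_def] by (intro Bochner_Integration.integrable_sum integrable_component)

lemma integrable_of_square:
  fixes h :: "'a \<Rightarrow> real"
  assumes [measurable]: "h \<in> borel_measurable M" and "integrable M (\<lambda>y. (h y)\<^sup>2)"
  shows "integrable M h"
proof (rule Bochner_Integration.integrable_bound[of _ "\<lambda>y. 1 + (h y)\<^sup>2"])
  show "AE y in M. norm (h y) \<le> norm (1 + (h y)\<^sup>2)"
  proof (rule AE_I2)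
    fix y
    have "0 \<le> (\<bar>h y\<bar> - 1)\<^sup>2" by simp
    then have "2 * \<bar>h y\<bar> \<le> 1 + (h y)\<^sup>2" by (simp add: power2_eq_square algebra_simps)
    then show "norm (h y) \<le> norm (1 + (h y)\<^sup>2)" by simp
  qed
qed (use assms in auto)

text \<open>A new index contributes its variance and a cross term that carries the factor E h = 0;
  hence induction over the index set.\<close>

lemma psum_second_moment:
  assumes "finite I" and [measurable]: "h \<in> borel_measurable M"
    and sq: "integrable M (\<lambda>y. (h y)\<^sup>2)" and zero: "(\<integral>y. h y \<partial>M) = 0"
  shows "integrable (PiM I (\<lambda>_. M)) (\<lambda>\<omega>. (psum h I \<omega>)\<^sup>2) \<and>
    (\<integral>\<omega>. (psum h I \<omega>)\<^sup>2 \<partial>PiM I (\<lambda>_. M)) = card I * (\<integral>y. (h y)\<^sup>2 \<partial>M)"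
  using \<open>finite I\<close>
proof induction
  case empty
  then show ?case by (simp add: psum_def)
next
  case (insert i J)
  have h: "integrable M h" using sq by (rule integrable_of_square[rotated]) simp
  \<comment> \<open>The factors 1 give all three terms the product shape
    \<open>g (\<omega> i) * k (psum h J \<omega>)\<close> of the independence lemma.\<close>
  have eq: "(psum h (insert i J) \<omega>)\<^sup>2 = (h (\<omega> i))\<^sup>2 * 1 + 2 * (h (\<omega> i) * psum h J \<omega>) + 1 * (psum h J \<omega>)\<^sup>2" for \<omega>
    using insert.hyps psum_remove[of "insert i J" i h \<omega>] by (simp add: power2_eq_square algebra_simps)
  interpret Q: prob_space "PiM J (\<lambda>_. M)" by (rule prob_space_Pi)
  have S: "integrable (PiM J (\<lambda>_. M)) (psum h J)" by (rule integrable_psum[OF h])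
  have one: "integrable M (\<lambda>_. 1::real)" by simp
  have Q1: "integrable (PiM J (\<lambda>_. M)) (\<lambda>_. 1::real)" by simp
  have S2: "integrable (PiM J (\<lambda>_. M)) (\<lambda>\<omega>. (psum h J \<omega>)\<^sup>2)" using insert.IH by blast
  have m1: "(\<lambda>_. 1::real) \<in> borel_measurable borel" "(\<lambda>x. x::real) \<in> borel_measurable borel"
    "(\<lambda>x::real. x\<^sup>2) \<in> borel_measurable borel" by measurable
  note a1 = integrable_indep_times[OF insert.hyps sq assms(2) m1(1) Q1]
    and t2 = integrable_indep_times[OF insert.hyps h assms(2) m1(2) S]
    and a3 = integrable_indep_times[OF insert.hyps one assms(2) m1(3) S2]
  note u1 = integral_indep_times[OF insert.hyps sq assms(2) m1(1) Q1]
    and u2 = integral_indep_times[OF insert.hyps h assms(2) m1(2) S]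
    and u3 = integral_indep_times[OF insert.hyps one assms(2) m1(3) S2]
  have a2: "integrable (PiM (insert i J) (\<lambda>_. M)) (\<lambda>\<omega>. 2 * (h (\<omega> i) * psum h J \<omega>))"
    by (rule integrable_mult_right[OF t2])
  have b1: "(\<integral>\<omega>. (h (\<omega> i))\<^sup>2 * 1 \<partial>PiM (insert i J) (\<lambda>_. M)) = (\<integral>y. (h y)\<^sup>2 \<partial>M)"
    unfolding u1 by (simp add: Q.prob_space)
  have b2: "(\<integral>\<omega>. 2 * (h (\<omega> i) * psum h J \<omega>) \<partial>PiM (insert i J) (\<lambda>_. M)) = 0"
    by (simp add: u2 zero)
  have b3: "(\<integral>\<omega>. 1 * (psum h J \<omega>)\<^sup>2 \<partial>PiM (insert i J) (\<lambda>_. M)) = card J * (\<integral>y. (h y)\<^sup>2 \<partial>M)"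
    unfolding u3 using insert.IH by (simp add: prob_space)
  have "(\<integral>\<omega>. (psum h (insert i J) \<omega>)\<^sup>2 \<partial>PiM (insert i J) (\<lambda>_. M)) =
      (\<integral>y. (h y)\<^sup>2 \<partial>M) + 0 + card J * (\<integral>y. (h y)\<^sup>2 \<partial>M)"
    unfolding eq
    by (subst Bochner_Integration.integral_add[OF Bochner_Integration.integrable_add[OF a1 a2] a3],
        subst Bochner_Integration.integral_add[OF a1 a2]) (simp only: b1 b2 b3)
  also have "\<dots> = card (insert i J) * (\<integral>y. (h y)\<^sup>2 \<partial>M)"
    using insert.hyps by (simp add: distrib_right)
  finally have "(\<integral>\<omega>. (psum h (insert i J) \<omega>)\<^sup>2 \<partial>PiM (insert i J) (\<lambda>_. M)) = card (insert i J) * (\<integral>y. (h y)\<^sup>2 \<partial>M)" .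
  moreover have "integrable (PiM (insert i J) (\<lambda>_. M)) (\<lambda>\<omega>. (psum h (insert i J) \<omega>)\<^sup>2)"
    unfolding eq by (intro Bochner_Integration.integrable_add a1 a2 a3)
  ultimately show ?case by blast
qed

text \<open>Cauchy-Schwarz, read off from the nonnegative variance of the absolute value of the
  sum.\<close>

lemma psum_abs_moment:
  assumes "finite I" and [measurable]: "h \<in> borel_measurable M"
    and sq: "integrable M (\<lambda>y. (h y)\<^sup>2)" and zero: "(\<integral>y. h y \<partial>M) = 0"
  shows "(\<integral>\<omega>. \<bar>psum h I \<omega>\<bar> \<partial>PiM I (\<lambda>_. M)) \<le> sqrt (card I * (\<integral>y. (h y)\<^sup>2 \<partial>M))"
proof -
  interpret Q: prob_space "PiM I (\<lambda>_. M)" by (rule prob_space_Pi)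
  have h: "integrable M h" using sq by (rule integrable_of_square[rotated]) simp
  note 2 = psum_second_moment[OF assms]
  have "(\<integral>\<omega>. \<bar>psum h I \<omega>\<bar> \<partial>PiM I (\<lambda>_. M))\<^sup>2 \<le> (\<integral>\<omega>. \<bar>psum h I \<omega>\<bar>\<^sup>2 \<partial>PiM I (\<lambda>_. M))"
    using Q.variance_eq[of "\<lambda>\<omega>. \<bar>psum h I \<omega>\<bar>"] Q.variance_positive[of "\<lambda>\<omega>. \<bar>psum h I \<omega>\<bar>"]
      2 integrable_psum[OF h] by simp
  then show ?thesis using 2 by (auto intro!: real_le_rsqrt)
qed

end

subsection \<open>The concentration inequality\<close>

text \<open>Each difference of the two sides is (y - s)^2 times a nonnegative linear form: weighted
  AM-GM with equality at y = s. Integrated at s = sqrt v, these replace Hoelder's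
  inequality.\<close>

lemma cube_tangent:
  fixes y s :: real
  assumes "y \<ge> 0" "s \<ge> 0"
  shows "3 * s * y\<^sup>2 \<le> 2 * y ^ 3 + s ^ 3" "3 * s\<^sup>2 * y \<le> y ^ 3 + 2 * s ^ 3"
proof -
  have "2 * y ^ 3 + s ^ 3 - 3 * s * y\<^sup>2 = (y - s)\<^sup>2 * (2 * y + s)"
    by (simp add: power2_eq_square power3_eq_cube algebra_simps)
  then show "3 * s * y\<^sup>2 \<le> 2 * y ^ 3 + s ^ 3"
    using assms by (smt (verit) mult_nonneg_nonneg zero_le_power2)
  have "y ^ 3 + 2 * s ^ 3 - 3 * s\<^sup>2 * y = (y - s)\<^sup>2 * (y + 2 * s)"
    by (simp add: power2_eq_square power3_eq_cube algebra_simps)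
  then show "3 * s\<^sup>2 * y \<le> y ^ 3 + 2 * s ^ 3"
    using assms by (smt (verit) mult_nonneg_nonneg zero_le_power2)
qed

context prob_space
begin

lemma integrable_lower_moments:
  fixes h :: "'a \<Rightarrow> real"
  assumes [measurable]: "h \<in> borel_measurable M" and 3: "integrable M (\<lambda>y. \<bar>h y\<bar> ^ 3)"
  shows "integrable M (\<lambda>y. (h y)\<^sup>2)" "integrable M h"
proof -
  show "integrable M (\<lambda>y. (h y)\<^sup>2)"
  proof (rule Bochner_Integration.integrable_bound[of _ "\<lambda>y. 1 + \<bar>h y\<bar> ^ 3"])
    show "AE y in M. norm ((h y)\<^sup>2) \<le> norm (1 + \<bar>h y\<bar> ^ 3)"
    proof (rule AE_I2)
      fix y
      have *: "3 * p \<le> 3 * (1 + q)" if "0 \<le> q" "3 * p \<le> 2 * q + 1" for p q :: real using that by simp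
      have "3 * \<bar>h y\<bar>\<^sup>2 \<le> 3 * (1 + \<bar>h y\<bar> ^ 3)"
        by (rule *) (use cube_tangent(1)[OF abs_ge_zero zero_le_one, of "h y"] in simp_all)
      then show "norm ((h y)\<^sup>2) \<le> norm (1 + \<bar>h y\<bar> ^ 3)" by simp
    qed
  qed (use 3 in auto)
  then show "integrable M h" by (rule integrable_of_square[rotated]) simp
qed

text \<open>Lyapunov's inequalities, from \<open>cube_tangent\<close> at s = sqrt v. They absorb
  every lower moment of the Stein error into the third one.\<close>

lemma third_moment_bounds:
  fixes h :: "'a \<Rightarrow> real" and v :: real
  assumes [measurable]: "h \<in> borel_measurable M" and 3: "integrable M (\<lambda>y. \<bar>h y\<bar> ^ 3)"
    and v: "(\<integral>y. (h y)\<^sup>2 \<partial>M) = v" "v > 0"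
  shows "v * sqrt v \<le> (\<integral>y. \<bar>h y\<bar> ^ 3 \<partial>M)" "v * (\<integral>y. \<bar>h y\<bar> \<partial>M) \<le> (\<integral>y. \<bar>h y\<bar> ^ 3 \<partial>M)"
proof -
  note i = integrable_lower_moments[OF assms(1,2)]
  let ?s = "sqrt v" and ?r = "\<integral>y. \<bar>h y\<bar> ^ 3 \<partial>M"
  have s: "?s > 0" "?s\<^sup>2 = v" "?s ^ 3 = v * ?s" using v by (auto simp: power3_eq_cube)
  have "(\<integral>y. 3 * ?s * (h y)\<^sup>2 \<partial>M) \<le> (\<integral>y. 2 * \<bar>h y\<bar> ^ 3 + ?s ^ 3 \<partial>M)"
    using 3 i s cube_tangent(1)[of "\<bar>h _\<bar>" ?s] by (intro integral_mono) auto
  then show 1: "v * ?s \<le> ?r" using 3 i v s by (simp add: prob_space)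
  have "(\<integral>y. 3 * v * \<bar>h y\<bar> \<partial>M) \<le> (\<integral>y. \<bar>h y\<bar> ^ 3 + 2 * ?s ^ 3 \<partial>M)"
    using 3 i s cube_tangent(2)[of "\<bar>h _\<bar>" ?s] by (intro integral_mono) auto
  then show "v * (\<integral>y. \<bar>h y\<bar> \<partial>M) \<le> ?r" using 3 i v s 1 by (simp add: prob_space)
qed

end

text \<open>The clamp has slope 1 on an interval that exceeds [a, a+l] by \<open>\<delta>\<close> on
  either side, so a step of length |y| from a point of [a, a+l] changes it by at least the minimum
  of |y| and \<open>\<delta>\<close>. Monotonicity makes the left side nonnegative everywhere
  else.\<close>

lemma clamp_increment:
  fixes y w a l \<delta> :: real
  assumes "l \<ge> 0" "\<delta> > 0"
  defines "f \<equiv> \<lambda>w. max (- (l / 2 + \<delta>)) (min (l / 2 + \<delta>) (w - (a + l / 2)))"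
  shows "y * (f w - f (w - y)) \<ge> indicator {a..a+l} w * (\<bar>y\<bar> * min \<bar>y\<bar> \<delta>)"
proof (cases "y \<ge> 0")
  case True
  have "f w - f (w - y) \<ge> indicator {a..a+l} w * min y \<delta>"
    using assms(1,2) True unfolding f_def indicator_def by auto
  then have "y * (f w - f (w - y)) \<ge> y * (indicator {a..a+l} w * min y \<delta>)"
    using True by (rule mult_left_mono)
  then show ?thesis using True by (simp add: mult_ac)
next
  case False
  have "f (w - y) - f w \<ge> indicator {a..a+l} w * min (-y) \<delta>"
    using assms(1,2) False unfolding f_def indicator_def by auto
  then have "(-y) * (f (w - y) - f w) \<ge> (-y) * (indicator {a..a+l} w * min (-y) \<delta>)"
    using False by (intro mult_left_mono) auto
  then show ?thesis using False by (simp add: mult_ac algebra_simps)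
qed

text \<open>The parabola y - y^2 / (4 \<open>\<delta>\<close>) lies below both y and
  \<open>\<delta>\<close>; it touches the level \<open>\<delta>\<close> at y = 2
  \<open>\<delta>\<close>.\<close>

lemma min_quadratic_lower:
  fixes y \<delta> :: real
  assumes "y \<ge> 0" "\<delta> > 0"
  shows "y * min y \<delta> \<ge> y\<^sup>2 - y ^ 3 / (4 * \<delta>)"
proof -
  have "min y \<delta> \<ge> y - y\<^sup>2 / (4 * \<delta>)"
  proof (cases "y \<le> \<delta>")
    case False
    have "0 \<le> (y - 2 * \<delta>)\<^sup>2" by simp
    then have "4 * \<delta> * y \<le> 4 * \<delta> * \<delta> + y\<^sup>2" by (simp add: power2_eq_square algebra_simps)
    then have "y - y\<^sup>2 / (4 * \<delta>) \<le> \<delta>" using assms by (simp add: field_simps power2_eq_square)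
    then show ?thesis using False by simp
  qed (use assms in auto)
  then have "y * min y \<delta> \<ge> y * (y - y\<^sup>2 / (4 * \<delta>))" using assms by (intro mult_left_mono)
  then show ?thesis by (simp add: power2_eq_square power3_eq_cube algebra_simps)
qed

text \<open>Chen and Shao's concentration inequality: a clamped linear function is used as test
  function in the identity E S f(S) = sum of E h_i (f(S) - f(S - h_i)).\<close>

lemma (in prob_space) psum_concentration:
  fixes h :: "'a \<Rightarrow> real" and v \<rho> a l :: real
  assumes I: "finite I" "I \<noteq> {}" and [measurable]: "h \<in> borel_measurable M"
    and 3: "integrable M (\<lambda>y. \<bar>h y\<bar> ^ 3)"
    and zero: "(\<integral>y. h y \<partial>M) = 0" and v: "(\<integral>y. (h y)\<^sup>2 \<partial>M) = v" "v > 0"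
    and \<rho>: "(\<integral>y. \<bar>h y\<bar> ^ 3 \<partial>M) = \<rho>" and l: "l \<ge> 0"
  shows "measure (PiM I (\<lambda>_. M)) {\<omega> \<in> space (PiM I (\<lambda>_. M)). a \<le> psum h I \<omega> \<and> psum h I \<omega> \<le> a + l}
    \<le> (l + 2 * \<rho> / v) / sqrt (card I * v)"
proof -
  let ?P = "PiM I (\<lambda>_. M)"
  interpret P: prob_space ?P by (rule prob_space_Pi)
  define A where "A = {\<omega> \<in> space ?P. a \<le> psum h I \<omega> \<and> psum h I \<omega> \<le> a + l}"
  have [measurable]: "A \<in> sets ?P" unfolding A_def by measurable
  define N where "N = real (card I)"
  have N: "N > 0" using I by (simp add: N_def card_gt_0_iff)
  note i = integrable_lower_moments[OF assms(3) 3]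
  have \<rho>0: "\<rho> > 0" using third_moment_bounds(1)[OF assms(3) 3 v] v \<rho>
    by (smt (verit) mult_pos_pos real_sqrt_gt_zero)
  \<comment> \<open>With this margin the cubic correction of \<open>min_quadratic_lower\<close>
    consumes exactly half of the variance: \<open>\<rho>\<close> / (4 \<open>\<delta>\<close>) =
    v/2.\<close>
  define \<delta> where "\<delta> = \<rho> / (2 * v)"
  have \<delta>: "\<delta> > 0" using \<rho>0 v by (simp add: \<delta>_def)
  define L where "L = l / 2 + \<delta>"
  have L: "L > 0" using l \<delta> by (simp add: L_def)
  define f where "f = (\<lambda>w. max (- (l / 2 + \<delta>)) (min (l / 2 + \<delta>) (w - (a + l / 2))))"
  have [measurable]: "f \<in> borel_measurable borel" unfolding f_def by measurable
  have fL: "\<bar>f w\<bar> \<le> L" for w using L unfolding f_def L_def by auto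
  define g where "g = (\<lambda>y. \<bar>h y\<bar> * min \<bar>h y\<bar> \<delta>)"
  have [measurable]: "g \<in> borel_measurable M" unfolding g_def by measurable
  have gb: "0 \<le> g y" "g y \<le> (h y)\<^sup>2" "(g y)\<^sup>2 \<le> \<delta>\<^sup>2 * (h y)\<^sup>2" for y
  proof -
    show "0 \<le> g y" using \<delta> by (auto simp: g_def)
    have "\<bar>h y\<bar> * min \<bar>h y\<bar> \<delta> \<le> \<bar>h y\<bar> * \<bar>h y\<bar>" by (intro mult_left_mono) auto
    then show "g y \<le> (h y)\<^sup>2" by (simp add: g_def power2_eq_square)
    have "\<bar>h y\<bar> * min \<bar>h y\<bar> \<delta> \<le> \<bar>h y\<bar> * \<delta>" by (intro mult_left_mono) auto
    then have "(g y)\<^sup>2 \<le> (\<bar>h y\<bar> * \<delta>)\<^sup>2" using \<open>0 \<le> g y\<close> unfolding g_def by (intro power_mono) auto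
    then show "(g y)\<^sup>2 \<le> \<delta>\<^sup>2 * (h y)\<^sup>2" by (simp add: power_mult_distrib mult.commute)
  qed
  have gi: "integrable M g" by (rule Bochner_Integration.integrable_bound[OF i(1)]) (use gb in auto)
  have gi2: "integrable M (\<lambda>y. (g y)\<^sup>2)"
    by (rule Bochner_Integration.integrable_bound[where f="\<lambda>y. \<delta>\<^sup>2 * (h y)\<^sup>2"]) (use gb i in auto)
  define q where "q = (\<integral>y. g y \<partial>M)"
  have q: "q \<ge> v / 2"
  proof -
    have "(\<integral>y. (h y)\<^sup>2 - \<bar>h y\<bar> ^ 3 / (4 * \<delta>) \<partial>M) \<le> q"
      unfolding q_def g_def using gi i 3 min_quadratic_lower[OF _ \<delta>, of "\<bar>h _\<bar>"]
      by (intro integral_mono) (auto simp: g_def)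
    moreover have "(\<integral>y. (h y)\<^sup>2 - \<bar>h y\<bar> ^ 3 / (4 * \<delta>) \<partial>M) = v - \<rho> / (4 * \<delta>)"
      using i 3 v \<rho> by simp
    moreover have "\<rho> / (4 * \<delta>) = v / 2" using \<rho>0 v by (simp add: \<delta>_def)
    ultimately show ?thesis by simp
  qed
  define S where "S = psum h I"
  have [measurable]: "S \<in> borel_measurable ?P" by (simp add: S_def)
  have Si: "integrable ?P S" using i by (simp add: S_def integrable_psum)
  have hf: "integrable ?P (\<lambda>\<omega>. h (\<omega> j) * f (S \<omega>))" if "j \<in> I" for j
    by (rule Bochner_Integration.integrable_bound[where f="\<lambda>\<omega>. L * h (\<omega> j)"])
       (use integrable_component[OF i(2) that] that fL L in \<open>auto simp: abs_mult mult.commute intro!: mult_right_mono\<close>)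
  have fz: "integrable ?P (\<lambda>\<omega>. h (\<omega> j) * f (S \<omega> - h (\<omega> j))) \<and> (\<integral>\<omega>. h (\<omega> j) * f (S \<omega> - h (\<omega> j)) \<partial>?P) = 0"
    if "j \<in> I" for j
  proof -
    interpret J: prob_space "PiM (I - {j}) (\<lambda>_. M)" by (rule prob_space_Pi)
    have eq: "S \<omega> - h (\<omega> j) = psum h (I - {j}) \<omega>" for \<omega>
      using psum_remove[OF I(1) that, of h \<omega>] by (simp add: S_def)
    have k: "integrable (PiM (I - {j}) (\<lambda>_. M)) (\<lambda>\<omega>. f (psum h (I - {j}) \<omega>))"
      by (rule J.integrable_const_bound[of _ L]) (use fL in auto)
    show ?thesis unfolding eq
      using integrable_indep_times[of "I - {j}" j h h f, OF _ _ i(2) _ _ k]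
        integral_indep_times[of "I - {j}" j h h f, OF _ _ i(2) _ _ k] I zero
      by (simp add: insert_absorb[OF that])
  qed
  have Sf: "(\<integral>\<omega>. S \<omega> * f (S \<omega>) \<partial>?P) = (\<Sum>j\<in>I. \<integral>\<omega>. h (\<omega> j) * (f (S \<omega>) - f (S \<omega> - h (\<omega> j))) \<partial>?P)"
  proof -
    have "(\<integral>\<omega>. S \<omega> * f (S \<omega>) \<partial>?P) = (\<integral>\<omega>. (\<Sum>j\<in>I. h (\<omega> j) * f (S \<omega>)) \<partial>?P)"
      by (simp add: S_def psum_def sum_distrib_right)
    also have "\<dots> = (\<Sum>j\<in>I. \<integral>\<omega>. h (\<omega> j) * f (S \<omega>) \<partial>?P)"
      using hf by simp
    also have "\<dots> = (\<Sum>j\<in>I. \<integral>\<omega>. h (\<omega> j) * (f (S \<omega>) - f (S \<omega> - h (\<omega> j))) \<partial>?P)"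
      using hf fz by (intro sum.cong refl) (simp add: right_diff_distrib)
    finally show ?thesis .
  qed
  have A_ind: "indicator A \<omega> = (indicator {a..a+l} (S \<omega>) :: real)" if "\<omega> \<in> space ?P" for \<omega>
    using that by (auto simp: A_def S_def indicator_def)
  \<comment> \<open>On the event each increment contributes at least \<open>g (\<omega> j)\<close>,
    so a likely event would make E S f(S) large; the clamp bound \<open>up\<close> forbids
    this.\<close>
  have low: "(\<integral>\<omega>. indicator A \<omega> * psum g I \<omega> \<partial>?P) \<le> (\<integral>\<omega>. S \<omega> * f (S \<omega>) \<partial>?P)"
  proof -
    have ii: "integrable ?P (\<lambda>\<omega>. indicator A \<omega> * g (\<omega> j))" if "j \<in> I" for j
      by (rule Bochner_Integration.integrable_bound[OF integrable_component[OF gi that]])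
         (use that in \<open>auto simp: indicator_def\<close>)
    have "(\<integral>\<omega>. indicator A \<omega> * psum g I \<omega> \<partial>?P) = (\<Sum>j\<in>I. \<integral>\<omega>. indicator A \<omega> * g (\<omega> j) \<partial>?P)"
      using ii by (simp add: psum_def sum_distrib_left)
    also have "\<dots> \<le> (\<Sum>j\<in>I. \<integral>\<omega>. h (\<omega> j) * (f (S \<omega>) - f (S \<omega> - h (\<omega> j))) \<partial>?P)"
    proof (intro sum_mono integral_mono)
      fix j \<omega> assume "j \<in> I" "\<omega> \<in> space ?P"
      then show "indicator A \<omega> * g (\<omega> j) \<le> h (\<omega> j) * (f (S \<omega>) - f (S \<omega> - h (\<omega> j)))"
        using clamp_increment[OF l \<delta>, of a "S \<omega>" "h (\<omega> j)"] by (simp add: A_ind f_def g_def)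
    qed (use ii hf fz in \<open>auto simp: right_diff_distrib\<close>)
    finally show ?thesis using Sf by simp
  qed
  have up: "(\<integral>\<omega>. S \<omega> * f (S \<omega>) \<partial>?P) \<le> L * sqrt (N * v)"
  proof -
    have iSf: "integrable ?P (\<lambda>\<omega>. S \<omega> * f (S \<omega>))"
      by (rule Bochner_Integration.integrable_bound[where f="\<lambda>\<omega>. L * S \<omega>"])
         (use Si fL L in \<open>auto simp: abs_mult mult.commute[of L] intro!: mult_left_mono\<close>)
    have "S \<omega> * f (S \<omega>) \<le> L * \<bar>S \<omega>\<bar>" for \<omega>
    proof -
      have "S \<omega> * f (S \<omega>) \<le> \<bar>S \<omega>\<bar> * \<bar>f (S \<omega>)\<bar>" by (metis abs_ge_self abs_mult)
      also have "\<dots> \<le> \<bar>S \<omega>\<bar> * L" using fL by (intro mult_left_mono) auto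
      finally show ?thesis by (simp add: mult.commute)
    qed
    then have "(\<integral>\<omega>. S \<omega> * f (S \<omega>) \<partial>?P) \<le> (\<integral>\<omega>. L * \<bar>S \<omega>\<bar> \<partial>?P)"
      using iSf Si by (intro integral_mono) auto
    also have "\<dots> \<le> L * sqrt (N * v)"
      using psum_abs_moment[OF I(1) assms(3) i(1) zero] L v by (simp add: S_def N_def)
    finally show ?thesis .
  qed
  \<comment> \<open>The random sum of the \<open>g (\<omega> j)\<close> is exchanged for its mean N
    q. Its fluctuation has second moment at most N v \<open>\<delta>\<close>^2 because g is at most
    \<open>\<delta>\<close> |h|.\<close>
  define d where "d = psum (\<lambda>y. g y - q) I"
  have [measurable]: "d \<in> borel_measurable ?P" by (simp add: d_def)
  have gq2: "integrable M (\<lambda>y. (g y - q)\<^sup>2)"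
    using gi gi2 by (simp add: power2_diff)
  have dabs: "(\<integral>\<omega>. \<bar>d \<omega>\<bar> \<partial>?P) \<le> \<delta> * sqrt (N * v)"
  proof -
    have "(\<integral>\<omega>. \<bar>d \<omega>\<bar> \<partial>?P) \<le> sqrt (N * (\<integral>y. (g y - q)\<^sup>2 \<partial>M))"
      unfolding d_def N_def using gi gq2 by (intro psum_abs_moment I) (auto simp: prob_space q_def)
    also have "(\<integral>y. (g y - q)\<^sup>2 \<partial>M) \<le> (\<integral>y. (g y)\<^sup>2 \<partial>M)"
      using variance_eq[OF gi gi2] by (simp add: q_def)
    also have "\<dots> \<le> (\<integral>y. \<delta>\<^sup>2 * (h y)\<^sup>2 \<partial>M)"
      using gb gi2 i by (intro integral_mono) auto
    also have "\<dots> = \<delta>\<^sup>2 * v" using v i by simp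
    also have "sqrt (N * (\<delta>\<^sup>2 * v)) = \<delta> * sqrt (N * v)"
      using \<delta> by (simp add: real_sqrt_mult)
    finally show ?thesis using N by simp
  qed
  have di: "integrable ?P d" unfolding d_def using gi by (intro integrable_psum) auto
  have iA: "integrable ?P (\<lambda>\<omega>. indicator A \<omega> * (N * q))"
    by (intro integrable_mult_left integrable_real_indicator) (auto simp: P.emeasure_eq_measure)
  have "measure ?P A * (N * q) - (\<integral>\<omega>. \<bar>d \<omega>\<bar> \<partial>?P) = (\<integral>\<omega>. indicator A \<omega> * (N * q) - \<bar>d \<omega>\<bar> \<partial>?P)"
    using di iA by (subst Bochner_Integration.integral_diff) auto
  also have "\<dots> \<le> (\<integral>\<omega>. indicator A \<omega> * psum g I \<omega> \<partial>?P)"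
  proof (rule integral_mono)
    fix \<omega>
    have "d \<omega> = psum g I \<omega> - N * q" by (simp add: d_def psum_def N_def sum_subtractf)
    then show "indicator A \<omega> * (N * q) - \<bar>d \<omega>\<bar> \<le> indicator A \<omega> * psum g I \<omega>"
      by (auto simp: indicator_def)
  next
    show "integrable ?P (\<lambda>\<omega>. indicator A \<omega> * psum g I \<omega>)"
      by (rule Bochner_Integration.integrable_bound[OF integrable_psum[OF gi, of I]])
         (auto simp: indicator_def)
  qed (use di iA in auto)
  finally have "measure ?P A * (N * q) \<le> (\<delta> + L) * sqrt (N * v)"
    using low up dabs by (simp add: algebra_simps)
  moreover have "measure ?P A * (N * (v / 2)) \<le> measure ?P A * (N * q)"
    using N q by (intro mult_left_mono) auto
  ultimately have "measure ?P A * (N * v) \<le> 2 * (\<delta> + L) * sqrt (N * v)" by (simp add: algebra_simps)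
  moreover have "N * v = sqrt (N * v) * sqrt (N * v)" using N v by simp
  ultimately have "measure ?P A * sqrt (N * v) \<le> 2 * (\<delta> + L)"
    using N v by (metis mult.assoc mult_pos_pos mult_right_le_imp_le real_sqrt_gt_zero)
  then have "measure ?P A \<le> 2 * (\<delta> + L) / sqrt (N * v)"
    using N v by (simp add: field_simps)
  also have "2 * (\<delta> + L) = l + 2 * \<rho> / v" using v by (simp add: L_def \<delta>_def)
  finally show ?thesis unfolding A_def N_def .
qed

subsection \<open>The normal distribution and Stein's equation\<close>

abbreviation phi :: "real \<Rightarrow> real" where "phi \<equiv> std_normal_density"

lemma phi_pos: "phi x > 0"
  by (simp add: normal_density_pos)

lemma phi_shift: "phi (a + u) = phi u * exp (- (a * u) - a\<^sup>2 / 2)"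
proof -
  have "- (a + u)\<^sup>2 / 2 = - u\<^sup>2 / 2 + (- (a * u) - a\<^sup>2 / 2)"
    by (simp add: power2_eq_square field_simps)
  then show ?thesis unfolding std_normal_density_def by (simp only: exp_add mult.assoc)
qed

lemma phi_minus: "phi (- x) = phi x"
  by (simp add: std_normal_density_def)

lemma phi_0_times: "sqrt (2 * pi) * phi 0 = 1"
  by (simp add: std_normal_density_def)

lemma phi_le: "phi x \<le> phi 0"
  by (simp add: std_normal_density_def divide_right_mono)

lemma integrable_phi: "integrable lborel phi"
  by (simp add: integrable_normal_density)

lemma integral_phi: "(\<integral>x. phi x \<partial>lborel) = 1"
  by (simp add: integral_normal_density)

lemma integrable_indicator_phi: "A \<in> sets borel \<Longrightarrow> integrable lborel (\<lambda>x. indicator A x * phi x)"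
  by (rule Bochner_Integration.integrable_bound[OF integrable_phi])
     (auto simp: indicator_def)

lemma Phi_eq: "Phi x = (\<integral>t. indicator {..x} t * phi t \<partial>lborel)"
  by (simp add: Phi_def)

lemma one_minus_Phi: "1 - Phi x = (\<integral>t. indicator {x<..} t * phi t \<partial>lborel)"
proof -
  have "(\<integral>t. phi t \<partial>lborel) = (\<integral>t. indicator {..x} t * phi t + indicator {x<..} t * phi t \<partial>lborel)"
    by (intro Bochner_Integration.integral_cong) (auto simp: indicator_def)
  also have "\<dots> = Phi x + (\<integral>t. indicator {x<..} t * phi t \<partial>lborel)"
    unfolding Phi_eq by (intro Bochner_Integration.integral_add integrable_indicator_phi) auto
  finally show ?thesis by (simp add: integral_phi)
qed

lemma Phi_bounds: "0 \<le> Phi x" "Phi x \<le> 1"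
proof -
  show "0 \<le> Phi x" unfolding Phi_eq by (rule Bochner_Integration.integral_nonneg) (auto simp: indicator_def)
  have "0 \<le> 1 - Phi x" unfolding one_minus_Phi by (rule Bochner_Integration.integral_nonneg) (auto simp: indicator_def)
  then show "Phi x \<le> 1" by simp
qed

lemma Phi_mono: "x \<le> y \<Longrightarrow> Phi x \<le> Phi y"
  unfolding Phi_eq by (intro integral_mono integrable_indicator_phi) (auto simp: indicator_def)

lemma Phi_minus: "Phi (- x) = 1 - Phi x"
proof -
  have "Phi (- x) = (\<integral>t. indicator {..-x} (0 + (-1) * t) * phi (0 + (-1) * t) \<partial>lborel)"
    unfolding Phi_eq using lborel_integral_real_affine[of "-1" "\<lambda>t. indicator {..-x} t * phi t" 0] by simp
  also have "\<dots> = (\<integral>t. indicator {x<..} t * phi t \<partial>lborel)"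
  proof (rule integral_cong_AE)
    show "AE t in lborel. indicator {..-x} (0 + (-1) * t) * phi (0 + (-1) * t) = indicator {x<..} t * phi t"
      using AE_lborel_singleton[of x] by eventually_elim (auto simp: indicator_def phi_minus)
  qed auto
  finally show ?thesis using one_minus_Phi by simp
qed

text \<open>Laplace transform of the normal density on the half line; up to the factor \<open>sqrt (2 * pi)\<close>
  this is the Mills ratio.\<close>

definition mills :: "real \<Rightarrow> real" where
  "mills x = (\<integral>u. indicator {0<..} u * (exp (- (x * u)) * phi u) \<partial>lborel)"

text \<open>Substitution t = x + u in the tail integral. The factor exp(- x^2/2) is the one that
  tilting produces as well, so only \<open>mills x\<close> remains to be approximated.\<close>

lemma one_minus_Phi_mills: "1 - Phi x = exp (- x\<^sup>2 / 2) * mills x"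
proof -
  have "1 - Phi x = (\<integral>u. indicator {x<..} (x + 1 * u) * phi (x + 1 * u) \<partial>lborel)"
    unfolding one_minus_Phi using lborel_integral_real_affine[of 1 "\<lambda>t. indicator {x<..} t * phi t" x] by simp
  also have "\<dots> = (\<integral>u. exp (- x\<^sup>2 / 2) * (indicator {0<..} u * (exp (- (x * u)) * phi u)) \<partial>lborel)"
    by (intro Bochner_Integration.integral_cong) (auto simp: indicator_def phi_shift simp flip: exp_add)
  finally show ?thesis by (simp add: mills_def)
qed

lemma exp_times_phi_le: "x \<ge> 0 \<Longrightarrow> u \<ge> 0 \<Longrightarrow> exp (- (x * u)) * phi u \<le> phi u"
  using phi_pos[of u] by (intro mult_left_le_one_le) auto

lemma mills_integrable:
  assumes "x \<ge> 0"
  shows "integrable lborel (\<lambda>u. indicator {0<..} u * (exp (- (x * u)) * phi u))"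
  by (rule Bochner_Integration.integrable_bound[OF integrable_phi])
     (use assms in \<open>auto simp: indicator_def exp_times_phi_le\<close>)

text \<open>Up to a constant the integrands are the Erlang densities of order 0 and 1, which
  integrate to 1. The first identification fails at the point 0 and therefore holds only almost
  everywhere.\<close>

lemma has_bochner_integral_exp:
  fixes l :: real
  assumes "l > 0"
  shows "has_bochner_integral lborel (\<lambda>u. indicator {0<..} u * exp (- (l * u))) (1 / l)"
    "has_bochner_integral lborel (\<lambda>u. indicator {0<..} u * (u * exp (- (l * u)))) (1 / l\<^sup>2)"
proof -
  have h: "has_bochner_integral lborel (\<lambda>x. erlang_density k l x) 1" for k
  proof (rule has_bochner_integral_nn_integral)
    show "(\<integral>\<^sup>+ x. ennreal (erlang_density k l x) \<partial>lborel) = ennreal 1"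
      using nn_integral_erlang_ith_moment[OF assms, where k=k and i=0] by simp
  qed (use assms in auto)
  have "has_bochner_integral lborel (\<lambda>x. (1 / l) * erlang_density 0 l x) (1 / l)"
    using has_bochner_integral_mult_right[OF h, of "1 / l"] by simp
  then show "has_bochner_integral lborel (\<lambda>u. indicator {0<..} u * exp (- (l * u))) (1 / l)"
  proof (rule has_bochner_integral_cong_AE[THEN iffD1, rotated -1])
    show "AE u in lborel. (1 / l) * erlang_density 0 l u = indicator {0<..} u * exp (- (l * u))"
      using AE_lborel_singleton[of 0]
      by eventually_elim (use assms in \<open>auto simp: indicator_def erlang_density_def mult.commute\<close>)
  qed auto
  have "has_bochner_integral lborel (\<lambda>x. (1 / l\<^sup>2) * erlang_density 1 l x) (1 / l\<^sup>2)"
    using has_bochner_integral_mult_right[OF h, of "1 / l\<^sup>2"] by simp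
  then show "has_bochner_integral lborel (\<lambda>u. indicator {0<..} u * (u * exp (- (l * u)))) (1 / l\<^sup>2)"
  proof (rule has_bochner_integral_cong_AE[THEN iffD1, rotated -1])
    show "AE u in lborel. (1 / l\<^sup>2) * erlang_density 1 l u = indicator {0<..} u * (u * exp (- (l * u)))"
      using assms by (intro AE_I2) (auto simp: indicator_def erlang_density_def mult.commute power2_eq_square)
  qed auto
qed

lemma mills_bounds:
  assumes "x \<ge> 0"
  shows "0 \<le> mills x" "mills x \<le> 1" "x * mills x \<le> phi 0" "exp (-1) * phi 1 \<le> (1 + x) * mills x"
proof -
  note i = mills_integrable[OF assms]
  show "0 \<le> mills x" unfolding mills_def by (rule Bochner_Integration.integral_nonneg) (auto simp: indicator_def)
  have "mills x \<le> (\<integral>u. phi u \<partial>lborel)" unfolding mills_def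
    using i integrable_phi assms by (intro integral_mono) (auto simp: indicator_def exp_times_phi_le)
  then show "mills x \<le> 1" by (simp add: integral_phi)
  show "x * mills x \<le> phi 0"
  proof (cases "x = 0")
    case False
    then have x: "x > 0" using assms by simp
    note e = has_bochner_integral_exp(1)[OF x]
    have "mills x \<le> (\<integral>u. phi 0 * (indicator {0<..} u * exp (- (x * u))) \<partial>lborel)" unfolding mills_def
      using i e phi_le by (intro integral_mono) (auto simp: indicator_def has_bochner_integral_iff mult.commute)
    also have "\<dots> = phi 0 / x" using e by (simp add: has_bochner_integral_iff)
    finally show ?thesis using x by (simp add: field_simps)
  qed (use phi_pos[of 0] in simp)
  \<comment> \<open>For 0 < u <= c both x u <= 1 and u <= 1, so the integrand is at least exp(-1)
    \<open>phi 1\<close> on an interval of length 1/(1+x).\<close>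
  define c where "c = 1 / (1 + x)"
  have c: "c > 0" "c \<le> 1" using assms by (auto simp: c_def)
  have "(exp (-1) * phi 1) * c = (\<integral>u. indicator {0<..c} u * (exp (-1) * phi 1) \<partial>lborel)"
    using c by simp
  also have "\<dots> \<le> mills x" unfolding mills_def
  proof (rule integral_mono)
    fix u :: real
    have "exp (-1) * phi 1 \<le> exp (- (x * u)) * phi u" if u: "0 < u" "u \<le> c"
    proof (rule mult_mono)
      have "x * u \<le> x * c" using u assms by (intro mult_left_mono) auto
      also have "\<dots> \<le> 1" using assms by (simp add: c_def)
      finally show "exp (-1) \<le> exp (- (x * u))" by simp
      have "u\<^sup>2 \<le> 1" using u c by (simp add: power_le_one)
      then show "phi 1 \<le> phi u" by (simp add: std_normal_density_def divide_right_mono)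
    qed (auto simp: phi_pos less_imp_le)
    then show "indicator {0<..c} u * (exp (-1) * phi 1) \<le> indicator {0<..} u * (exp (- (x * u)) * phi u)"
      by (auto simp: indicator_def)
  qed (use i c in auto)
  finally show "exp (-1) * phi 1 \<le> (1 + x) * mills x" using assms by (simp add: c_def field_simps)
qed

text \<open>Cutting the half line at x - 1 leaves an integral over a compact interval around x, to
  which the fundamental theorem of calculus applies.\<close>

lemma Phi_has_derivative: "(Phi has_real_derivative phi x) (at x)"
proof -
  have cont: "continuous_on A phi" for A
    unfolding std_normal_density_def[abs_def] by (intro continuous_intros) auto
  have eq: "Phi y = Phi (x - 1) + integral {x-1..y} phi" if "y \<ge> x - 1" for y
  proof -
    have "Phi y = (\<integral>t. indicator {..x-1} t * phi t + indicator {x-1<..y} t * phi t \<partial>lborel)"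
      unfolding Phi_eq using that by (intro Bochner_Integration.integral_cong) (auto simp: indicator_def)
    also have "\<dots> = Phi (x - 1) + (\<integral>t. indicator {x-1<..y} t * phi t \<partial>lborel)"
      unfolding Phi_eq by (intro Bochner_Integration.integral_add integrable_indicator_phi) auto
    also have "(\<integral>t. indicator {x-1<..y} t * phi t \<partial>lborel) = (\<integral>t. indicator {x-1..y} t * phi t \<partial>lborel)"
      by (intro integral_cong_AE) (use AE_lborel_singleton[of "x-1"] in \<open>auto simp: indicator_def elim!: eventually_mono\<close>)
    also have "\<dots> = integral {x-1..y} phi"
      using set_borel_integral_eq_integral(2)[of "{x-1..y}" phi] integrable_indicator_phi[of "{x-1..y}"]
      by (simp add: set_lebesgue_integral_def set_integrable_def)
    finally show ?thesis .
  qed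
  have "((\<lambda>y. integral {x-1..y} phi) has_real_derivative phi x) (at x within {x-1..x+1})"
    by (rule integral_has_real_derivative[OF cont]) auto
  then have "((\<lambda>y. integral {x-1..y} phi) has_real_derivative phi x) (at x)"
    by (subst (asm) at_within_Icc_at) auto
  then have "((\<lambda>y. Phi (x - 1) + integral {x-1..y} phi) has_real_derivative 0 + phi x) (at x)"
    by (intro DERIV_add DERIV_const)
  then have "((\<lambda>y. Phi (x - 1) + integral {x-1..y} phi) has_real_derivative phi x) (at x)" by simp
  then show ?thesis
    by (rule has_field_derivative_transform_within_open[where S="{x-1<..}"]) (auto intro: eq[symmetric])
qed

lemma phi_has_derivative: "(phi has_real_derivative - (x * phi x)) (at x)"
proof -
  have "((\<lambda>x. 1 / sqrt (2 * pi) * exp (- x\<^sup>2 / 2)) has_real_derivative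
      1 / sqrt (2 * pi) * (exp (- x\<^sup>2 / 2) * (- (2 * x) / 2))) (at x)"
    by (rule DERIV_cmult) (auto intro!: derivative_eq_intros)
  then show ?thesis unfolding std_normal_density_def[abs_def] by (simp add: mult_ac)
qed

text \<open>The bounded solution of Stein's equation f'(w) - w f(w) = 1(w <= z) - Phi(z). The use of
  \<open>min\<close> and \<open>max\<close> merges its two branches w <= z and w > z.\<close>

definition stein :: "real \<Rightarrow> real \<Rightarrow> real" where
  "stein z w = Phi (min w z) * (1 - Phi (max w z)) / phi w"

text \<open>Read off from the equation instead of being defined as a derivative: Stein's equation
  then also holds at w = z, where \<open>stein z\<close> has a kink.\<close>

definition stein' :: "real \<Rightarrow> real \<Rightarrow> real" where
  "stein' z w = w * stein z w + indicator {..z} w - Phi z"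

lemma Mills_bounds:
  assumes "w \<ge> 0"
  shows "(1 - Phi w) / phi w \<le> 3" "w * ((1 - Phi w) / phi w) \<le> 1"
proof -
  have "(1 - Phi w) / phi w = sqrt (2 * pi) * mills w"
    by (simp add: one_minus_Phi_mills std_normal_density_def)
  moreover have "sqrt (2 * pi) \<le> 3" using pi_less_4 by (intro real_le_lsqrt) auto
  moreover have "sqrt (2 * pi) * mills w \<le> 3 * 1"
    using mills_bounds[OF assms] \<open>sqrt (2 * pi) \<le> 3\<close> by (intro mult_mono) auto
  ultimately show "(1 - Phi w) / phi w \<le> 3" by simp
  have "w * (sqrt (2 * pi) * mills w) \<le> sqrt (2 * pi) * phi 0"
    using mills_bounds(3)[OF assms] by (simp add: mult.left_commute)
  then show "w * ((1 - Phi w) / phi w) \<le> 1"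
    using \<open>(1 - Phi w) / phi w = sqrt (2 * pi) * mills w\<close> by (simp add: phi_0_times)
qed

lemma stein_nonneg: "stein z w \<ge> 0"
  unfolding stein_def using Phi_bounds phi_pos[of w] by (auto intro!: divide_nonneg_pos mult_nonneg_nonneg)

text \<open>One factor of the numerator is bounded by 1 and the other by monotonicity of
  \<open>Phi\<close>; for negative w, symmetry turns \<open>Phi w\<close> into a right tail.\<close>

lemma stein_le_Mills: "stein z w \<le> (1 - Phi \<bar>w\<bar>) / phi \<bar>w\<bar>"
proof (cases "w \<ge> 0")
  case True
  have "Phi (min w z) * (1 - Phi (max w z)) \<le> 1 * (1 - Phi w)"
    using Phi_bounds Phi_mono[of w "max w z"] by (intro mult_mono) auto
  then show ?thesis using True phi_pos[of w] by (simp add: stein_def divide_right_mono)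
next
  case False
  have "Phi (min w z) * (1 - Phi (max w z)) \<le> Phi w * 1"
    using Phi_bounds Phi_mono[of "min w z" w] by (intro mult_mono) auto
  then show ?thesis using False phi_pos[of w] Phi_minus[of "-w"] phi_minus[of w]
    by (simp add: stein_def divide_right_mono)
qed

text \<open>The first two bounds are those of the Mills ratio. The third follows from the equation,
  since the indicator and \<open>Phi z\<close> both lie in [0,1].\<close>

lemma stein_bounds: "\<bar>stein z w\<bar> \<le> 3" "\<bar>w * stein z w\<bar> \<le> 1" "\<bar>stein' z w\<bar> \<le> 2"
proof -
  note m = Mills_bounds[OF abs_ge_zero[of w]]
  show "\<bar>stein z w\<bar> \<le> 3" using stein_nonneg[of z w] stein_le_Mills[of z w] m by simp
  have "\<bar>w\<bar> * stein z w \<le> \<bar>w\<bar> * ((1 - Phi \<bar>w\<bar>) / phi \<bar>w\<bar>)"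
    using stein_le_Mills by (intro mult_left_mono) auto
  then show 1: "\<bar>w * stein z w\<bar> \<le> 1" using m stein_nonneg[of z w] by (simp add: abs_mult)
  have "\<bar>indicator {..z} w - Phi z\<bar> \<le> 1" using Phi_bounds[of z] by (auto simp: indicator_def)
  then show "\<bar>stein' z w\<bar> \<le> 2" using 1 unfolding stein'_def by linarith
qed

lemma continuous_Phi: "continuous_on A Phi"
  by (intro continuous_at_imp_continuous_on ballI DERIV_isCont[OF Phi_has_derivative])

lemma continuous_phi: "continuous_on A phi"
  unfolding std_normal_density_def[abs_def] by (intro continuous_intros) auto

lemma continuous_stein: "continuous_on A (stein z)"
proof -
  have ne: "phi w \<noteq> 0" for w using phi_pos[of w] by simp
  have 1: "continuous_on A (\<lambda>w. Phi (min w z))"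
    by (rule continuous_on_compose2[OF continuous_Phi[of UNIV] continuous_on_min[OF continuous_on_id continuous_on_const] subset_UNIV])
  have 2: "continuous_on A (\<lambda>w. Phi (max w z))"
    by (rule continuous_on_compose2[OF continuous_Phi[of UNIV] continuous_on_max[OF continuous_on_id continuous_on_const] subset_UNIV])
  show ?thesis unfolding stein_def[abs_def]
    by (intro continuous_on_divide continuous_on_mult continuous_on_diff continuous_on_const 1 2 continuous_phi)
       (rule ballI, rule ne)
qed

lemma stein_measurable[measurable]: "stein z \<in> borel_measurable borel"
  by (rule borel_measurable_continuous_onI) (rule continuous_stein)

lemma stein'_measurable[measurable]: "stein' z \<in> borel_measurable borel"
  unfolding stein'_def[abs_def] by measurable

lemma stein_has_derivative:
  assumes "w \<noteq> z"
  shows "(stein z has_real_derivative stein' z w) (at w)"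
proof (cases "w < z")
  case True
  have "((\<lambda>w. Phi w * (1 - Phi z) / phi w) has_real_derivative
      (phi w * (1 - Phi z) * phi w - Phi w * (1 - Phi z) * (- (w * phi w))) / (phi w * phi w)) (at w)"
    using phi_pos[of w] by (intro DERIV_divide DERIV_cmult_right Phi_has_derivative phi_has_derivative) auto
  moreover have "(phi w * (1 - Phi z) * phi w - Phi w * (1 - Phi z) * (- (w * phi w))) / (phi w * phi w) = stein' z w"
    using phi_pos[of w] True by (simp add: stein'_def stein_def field_simps)
  ultimately have "((\<lambda>w. Phi w * (1 - Phi z) / phi w) has_real_derivative stein' z w) (at w)" by simp
  then show ?thesis
    by (rule has_field_derivative_transform_within_open[where S="{..<z}"]) (use True in \<open>auto simp: stein_def\<close>)
next
  case False
  then have w: "w > z" using assms by simp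
  have "((\<lambda>w. Phi z * (1 - Phi w) / phi w) has_real_derivative
      (Phi z * (0 - phi w) * phi w - Phi z * (1 - Phi w) * (- (w * phi w))) / (phi w * phi w)) (at w)"
    using phi_pos[of w] by (intro DERIV_divide DERIV_cmult DERIV_diff DERIV_const Phi_has_derivative phi_has_derivative) auto
  moreover have "(Phi z * (0 - phi w) * phi w - Phi z * (1 - Phi w) * (- (w * phi w))) / (phi w * phi w) = stein' z w"
    using phi_pos[of w] w by (simp add: stein'_def stein_def field_simps)
  ultimately have "((\<lambda>w. Phi z * (1 - Phi w) / phi w) has_real_derivative stein' z w) (at w)" by simp
  then show ?thesis
    by (rule has_field_derivative_transform_within_open[where S="{z<..}"]) (use w in \<open>auto simp: stein_def\<close>)
qed

text \<open>Mean value inequality with one exceptional point, as needed for the kink of the Stein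
  solution: the interval is cut at z and the two estimates are added.\<close>

lemma abs_diff_le_of_deriv:
  fixes f f' :: "real \<Rightarrow> real"
  assumes cont: "continuous_on {a..b} f" and d: "\<And>w. a < w \<Longrightarrow> w < b \<Longrightarrow> w \<noteq> z \<Longrightarrow> (f has_real_derivative f' w) (at w)"
    and B: "\<And>w. a < w \<Longrightarrow> w < b \<Longrightarrow> w \<noteq> z \<Longrightarrow> \<bar>f' w\<bar> \<le> B" and ab: "a \<le> b"
  shows "\<bar>f b - f a\<bar> \<le> B * (b - a)"
proof -
  have *: "\<bar>f d - f c\<bar> \<le> B * (d - c)" if "a \<le> c" "c \<le> d" "d \<le> b" "\<not> (c < z \<and> z < d)" for c d
  proof (cases "c = d")
    case False
    then have "c < d" using that by simp
    moreover have "continuous_on {c..d} f" using cont by (rule continuous_on_subset) (use that in auto)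
    moreover have "f differentiable (at x)" if "c < x" "x < d" for x
      using d[of x] that \<open>a \<le> c\<close> \<open>d \<le> b\<close> \<open>\<not> (c < z \<and> z < d)\<close> by (auto simp: real_differentiable_def)
    ultimately obtain l x where x: "c < x" "x < d" "(f has_real_derivative l) (at x)" "f d - f c = (d - c) * l"
      using MVT[of c d f] by blast
    have "x \<noteq> z" "a < x" "x < b" using x that by auto
    then have "l = f' x" using d x by (metis DERIV_unique)
    then have "\<bar>l\<bar> \<le> B" using B \<open>x \<noteq> z\<close> \<open>a < x\<close> \<open>x < b\<close> by simp
    then show ?thesis using x \<open>c < d\<close> by (simp add: abs_mult mult.commute mult_left_mono)
  qed simp
  show ?thesis
  proof (cases "a < z \<and> z < b")
    case True
    have "\<bar>f z - f a\<bar> \<le> B * (z - a)" "\<bar>f b - f z\<bar> \<le> B * (b - z)" using True by (auto intro!: *)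
    then show ?thesis by (simp add: algebra_simps)
  qed (use * ab in auto)
qed

lemma stein_lipschitz: "\<bar>stein z u - stein z v\<bar> \<le> 2 * \<bar>u - v\<bar>"
proof -
  have *: "\<bar>stein z b - stein z a\<bar> \<le> 2 * (b - a)" if "a \<le> b" for a b
    using that by (intro abs_diff_le_of_deriv[where z=z] continuous_stein)
      (auto intro: stein_has_derivative stein_bounds)
  show ?thesis using *[of u v] *[of v u] by (cases "u \<le> v") auto
qed

text \<open>By the equation, the increment is that of w f(w), which is linear in |t|, plus that of
  the indicator, which jumps only if z is within |t| of w. This jump is why a concentration
  inequality is needed.\<close>

lemma stein'_increment:
  "\<bar>stein' z (w + t) - stein' z w\<bar> \<le> (2 * \<bar>w\<bar> + 3) * \<bar>t\<bar> + (if \<bar>w - z\<bar> \<le> \<bar>t\<bar> then 1 else 0)"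
proof -
  have "\<bar>w * (stein z (w + t) - stein z w)\<bar> \<le> \<bar>w\<bar> * (2 * \<bar>t\<bar>)"
    unfolding abs_mult using stein_lipschitz[of z "w + t" w] by (intro mult_left_mono) auto
  moreover have "\<bar>t * stein z (w + t)\<bar> \<le> \<bar>t\<bar> * 3"
    unfolding abs_mult using stein_bounds(1) by (intro mult_left_mono) auto
  moreover have "(w + t) * stein z (w + t) - w * stein z w = w * (stein z (w + t) - stein z w) + t * stein z (w + t)"
    by (simp add: algebra_simps)
  ultimately have "\<bar>(w + t) * stein z (w + t) - w * stein z w\<bar> \<le> (2 * \<bar>w\<bar> + 3) * \<bar>t\<bar>"
    by (simp add: algebra_simps)
  moreover have "\<bar>indicator {..z} (w + t) - indicator {..z} w :: real\<bar> \<le> (if \<bar>w - z\<bar> \<le> \<bar>t\<bar> then 1 else 0)"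
    by (auto simp: indicator_def)
  ultimately show ?thesis unfolding stein'_def by linarith
qed

text \<open>Mean value inequality for the map v -> f(v) - v f'(w), whose derivative at v is f'(v) -
  f'(w).\<close>

lemma stein_taylor:
  "\<bar>stein z (w + t) - stein z w - t * stein' z w\<bar> \<le> \<bar>t\<bar> * ((2 * \<bar>w\<bar> + 3) * \<bar>t\<bar> + (if \<bar>w - z\<bar> \<le> \<bar>t\<bar> then 1 else 0))"
proof -
  define B where "B = (2 * \<bar>w\<bar> + 3) * \<bar>t\<bar> + (if \<bar>w - z\<bar> \<le> \<bar>t\<bar> then 1 else 0 :: real)"
  define f where "f = (\<lambda>v. stein z v - v * stein' z w)"
  have cont: "continuous_on A f" for A unfolding f_def by (intro continuous_intros continuous_stein)
  have d: "(f has_real_derivative (stein' z v - stein' z w)) (at v)" if "v \<noteq> z" for v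
    unfolding f_def using that by (auto intro!: derivative_eq_intros stein_has_derivative)
  have B: "\<bar>stein' z v - stein' z w\<bar> \<le> B" if "\<bar>v - w\<bar> \<le> \<bar>t\<bar>" for v
  proof -
    have "\<bar>stein' z v - stein' z w\<bar> \<le> (2 * \<bar>w\<bar> + 3) * \<bar>v - w\<bar> + (if \<bar>w - z\<bar> \<le> \<bar>v - w\<bar> then 1 else 0)"
      using stein'_increment[of z w "v - w"] by simp
    also have "(2 * \<bar>w\<bar> + 3) * \<bar>v - w\<bar> \<le> (2 * \<bar>w\<bar> + 3) * \<bar>t\<bar>"
      using that by (intro mult_left_mono) auto
    finally show ?thesis using that unfolding B_def by (auto split: if_splits)
  qed
  have "\<bar>f (w + t) - f w\<bar> \<le> B * \<bar>t\<bar>"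
  proof (cases "t \<ge> 0")
    case True
    have "\<bar>f (w + t) - f w\<bar> \<le> B * (w + t - w)"
      using True by (intro abs_diff_le_of_deriv[where z=z, OF cont d B]) auto
    then show ?thesis using True by simp
  next
    case False
    have "\<bar>f w - f (w + t)\<bar> \<le> B * (w - (w + t))"
      using False by (intro abs_diff_le_of_deriv[where z=z, OF cont d B]) auto
    then show ?thesis using False by simp
  qed
  moreover have "f (w + t) - f w = stein z (w + t) - stein z w - t * stein' z w"
    by (simp add: f_def algebra_simps)
  ultimately show ?thesis unfolding B_def by (simp add: mult.commute)
qed

subsection \<open>The Berry-Esseen theorem\<close>

context prob_space
begin

text \<open>With s the sum without index i, independence gives E h_i f(s) = 0 and E (v - h_i^2)
  f'(s) = 0, so the difference is the expectation of Taylor errors at s. Their indicator part is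
  first averaged over s with h_i fixed, where the concentration inequality applies. This yields 8 (v
  E|h| + \<open>\<rho>\<close>) + 6 \<open>\<rho>\<close>, with 8 = 2 + 3 + 3 from E|s| <= 1, the
  Taylor constant and the concentration bound.\<close>

lemma stein_leave_one_out:
  fixes h :: "'a \<Rightarrow> real" and v \<rho> z :: real
  assumes J: "finite J" "i \<notin> J" "J \<noteq> {}" and [measurable]: "h \<in> borel_measurable M"
    and 3: "integrable M (\<lambda>y. \<bar>h y\<bar> ^ 3)"
    and zero: "(\<integral>y. h y \<partial>M) = 0" and v: "(\<integral>y. (h y)\<^sup>2 \<partial>M) = v" "v > 0"
    and \<rho>: "(\<integral>y. \<bar>h y\<bar> ^ 3 \<partial>M) = \<rho>" and norm: "card (insert i J) * v = 1"
  shows "\<bar>v * (\<integral>\<omega>. stein' z (psum h (insert i J) \<omega>) \<partial>PiM (insert i J) (\<lambda>_. M))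
      - (\<integral>\<omega>. h (\<omega> i) * stein z (psum h (insert i J) \<omega>) \<partial>PiM (insert i J) (\<lambda>_. M))\<bar> \<le> 22 * \<rho>"
proof -
  let ?P = "PiM (insert i J) (\<lambda>_. M)" and ?Q = "PiM J (\<lambda>_. M)"
  interpret Q: prob_space ?Q by (rule prob_space_Pi)
  interpret MQ: pair_sigma_finite M ?Q by (rule pair_sf) fact
  note im = integrable_lower_moments[OF assms(4) 3]
  define s where "s = psum h J"
  have [measurable]: "s \<in> borel_measurable ?Q" by (simp add: s_def)
  have iss: "integrable ?Q s" unfolding s_def using im by (intro integrable_psum)
  have J1: "card J \<ge> 1" using J by (simp add: Suc_le_eq card_gt_0_iff)
  have cJ: "card J * v \<le> 1" "card J * v \<ge> 1 / 2"
  proof -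
    have "(card J + 1) * v = 1" using norm J by simp
    then show "card J * v \<le> 1" using v by (simp add: algebra_simps)
    have "(card J + card J) * v \<ge> (card J + 1) * v" using J1 v by (intro mult_right_mono) auto
    then show "card J * v \<ge> 1 / 2" using \<open>(card J + 1) * v = 1\<close> by (simp add: algebra_simps)
  qed
  have abs_s: "(\<integral>\<omega>. \<bar>s \<omega>\<bar> \<partial>?Q) \<le> 1"
  proof -
    have "(\<integral>\<omega>. \<bar>s \<omega>\<bar> \<partial>?Q) \<le> sqrt (card J * v)"
      unfolding s_def using psum_abs_moment[OF J(1) assms(4) im(1) zero] v by simp
    also have "\<dots> \<le> 1" using cJ by simp
    finally show ?thesis .
  qed
  have conc: "measure ?Q {\<omega> \<in> space ?Q. \<bar>s \<omega> - z\<bar> \<le> r} \<le> 3 * r + 3 * \<rho> / v" if "r \<ge> 0" for r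
  proof -
    have "\<rho> \<ge> 0" using \<rho> by (metis Bochner_Integration.integral_nonneg abs_ge_zero zero_le_power)
    have "{\<omega> \<in> space ?Q. \<bar>s \<omega> - z\<bar> \<le> r} = {\<omega> \<in> space ?Q. z - r \<le> psum h J \<omega> \<and> psum h J \<omega> \<le> z - r + 2 * r}"
      unfolding s_def by auto
    then have "measure ?Q {\<omega> \<in> space ?Q. \<bar>s \<omega> - z\<bar> \<le> r} \<le> (2 * r + 2 * \<rho> / v) / sqrt (card J * v)"
      using psum_concentration[OF J(1,3) assms(4) 3 zero v \<rho>, of "2 * r" "z - r"] that by simp
    \<comment> \<open>At least half of the variance survives without index i because J is nonempty,
      and (2/3)^2 < 1/2.\<close>
    also have "\<dots> \<le> (2 * r + 2 * \<rho> / v) / (2 / 3)"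
    proof (rule divide_left_mono)
      have "(2 / 3)\<^sup>2 \<le> card J * v" using cJ by (simp add: power2_eq_square)
      then show "2 / 3 \<le> sqrt (card J * v)" by (rule real_le_rsqrt)
    qed (use v J1 that \<open>\<rho> \<ge> 0\<close> in auto)
    also have "\<dots> = 3 * r + 3 * \<rho> / v" by (simp add: field_simps)
    finally show ?thesis .
  qed
  \<comment> \<open>\<open>E y w\<close> dominates the increment of \<open>stein'\<close> and, after
    multiplication by |y|, the Taylor remainder; a single integral controls both.\<close>
  define E where "E = (\<lambda>y w. (2 * \<bar>w\<bar> + 3) * \<bar>y\<bar> + (if \<bar>w - z\<bar> \<le> \<bar>y\<bar> then 1 else 0 :: real))"
  let ?MQ = "M \<Otimes>\<^sub>M ?Q"
  have i1: "integrable ?MQ (\<lambda>p. g (fst p))" if "integrable M g" for g :: "'a \<Rightarrow> real"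
    using MQ.integrable_times[OF that, of "\<lambda>_. 1"] by simp
  have i2: "integrable ?MQ (\<lambda>p. g (fst p) * s (snd p))" if "integrable M g" for g :: "'a \<Rightarrow> real"
    using MQ.integrable_times[OF that iss] by simp
  have vh: "integrable M (\<lambda>y. (v + (h y)\<^sup>2) * \<bar>h y\<bar>)" "integrable M (\<lambda>y. v + (h y)\<^sup>2)"
  proof -
    have "(v + (h y)\<^sup>2) * \<bar>h y\<bar> = v * \<bar>h y\<bar> + \<bar>h y\<bar> ^ 3" for y
      by (simp add: distrib_right power3_eq_cube power2_eq_square abs_mult_self_eq)
    then show "integrable M (\<lambda>y. (v + (h y)\<^sup>2) * \<bar>h y\<bar>)" using 3 im by simp
    show "integrable M (\<lambda>y. v + (h y)\<^sup>2)" using im by simp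
  qed
  have iE: "integrable ?MQ (\<lambda>p. (v + (h (fst p))\<^sup>2) * E (h (fst p)) (s (snd p)))"
  proof (rule Bochner_Integration.integrable_bound)
    show "integrable ?MQ (\<lambda>p. 2 * \<bar>((v + (h (fst p))\<^sup>2) * \<bar>h (fst p)\<bar>) * s (snd p)\<bar> +
       3 * ((v + (h (fst p))\<^sup>2) * \<bar>h (fst p)\<bar>) + (v + (h (fst p))\<^sup>2))"
      by (intro Bochner_Integration.integrable_add integrable_mult_right integrable_abs i1 i2 vh)
    show "AE p in ?MQ. norm ((v + (h (fst p))\<^sup>2) * E (h (fst p)) (s (snd p))) \<le>
       norm (2 * \<bar>((v + (h (fst p))\<^sup>2) * \<bar>h (fst p)\<bar>) * s (snd p)\<bar> +
         3 * ((v + (h (fst p))\<^sup>2) * \<bar>h (fst p)\<bar>) + (v + (h (fst p))\<^sup>2))"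
    proof (rule AE_I2)
      fix p :: "'a \<times> (nat \<Rightarrow> 'a)"
      let ?c = "v + (h (fst p))\<^sup>2"
      have c: "?c > 0" using v by (simp add: add_pos_nonneg)
      have "?c * E (h (fst p)) (s (snd p)) \<le> ?c * ((2 * \<bar>s (snd p)\<bar> + 3) * \<bar>h (fst p)\<bar> + 1)"
        using c unfolding E_def by (intro mult_left_mono) auto
      also have "\<dots> = 2 * \<bar>(?c * \<bar>h (fst p)\<bar>) * s (snd p)\<bar> + 3 * (?c * \<bar>h (fst p)\<bar>) + ?c"
        unfolding abs_mult abs_abs abs_of_pos[OF c] by (simp only: distrib_left distrib_right mult_ac mult_1_right)
      finally have *: "?c * E (h (fst p)) (s (snd p)) \<le> 2 * \<bar>(?c * \<bar>h (fst p)\<bar>) * s (snd p)\<bar> + 3 * (?c * \<bar>h (fst p)\<bar>) + ?c" .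
      have "0 \<le> ?c * E (h (fst p)) (s (snd p))" using c unfolding E_def by (intro mult_nonneg_nonneg) auto
      then show "norm (?c * E (h (fst p)) (s (snd p))) \<le> norm (2 * \<bar>(?c * \<bar>h (fst p)\<bar>) * s (snd p)\<bar> + 3 * (?c * \<bar>h (fst p)\<bar>) + ?c)"
        using * by simp
    qed
  qed (simp add: E_def)
  have "(\<integral>p. (v + (h (fst p))\<^sup>2) * E (h (fst p)) (s (snd p)) \<partial>?MQ)
      = (\<integral>y. (\<integral>\<omega>. (v + (h y)\<^sup>2) * E (h y) (s \<omega>) \<partial>?Q) \<partial>M)"
    using MQ.integral_fst'[OF iE] by simp
  also have "\<dots> \<le> (\<integral>y. 8 * ((v + (h y)\<^sup>2) * \<bar>h y\<bar>) + (3 * \<rho> / v) * (v + (h y)\<^sup>2) \<partial>M)"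
  proof (rule integral_mono)
    show "integrable M (\<lambda>y. \<integral>\<omega>. (v + (h y)\<^sup>2) * E (h y) (s \<omega>) \<partial>?Q)"
      using MQ.integrable_fst'[OF iE] by simp
    show "integrable M (\<lambda>y. 8 * ((v + (h y)\<^sup>2) * \<bar>h y\<bar>) + (3 * \<rho> / v) * (v + (h y)\<^sup>2))"
      by (intro Bochner_Integration.integrable_add integrable_mult_right vh)
    fix y assume "y \<in> space M"
    define A where "A = {\<omega> \<in> space ?Q. \<bar>s \<omega> - z\<bar> \<le> \<bar>h y\<bar>}"
    have [measurable]: "A \<in> sets ?Q" unfolding A_def by measurable
    have c: "v + (h y)\<^sup>2 > 0" using v by (simp add: add_pos_nonneg)
    have iA: "integrable ?Q (indicator A :: _ \<Rightarrow> real)" by (simp add: Q.emeasure_eq_measure)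
    have "(\<integral>\<omega>. E (h y) (s \<omega>) \<partial>?Q) = (\<integral>\<omega>. (2 * \<bar>h y\<bar>) * \<bar>s \<omega>\<bar> + 3 * \<bar>h y\<bar> + indicator A \<omega> \<partial>?Q)"
      by (intro Bochner_Integration.integral_cong) (auto simp: E_def A_def indicator_def algebra_simps)
    also have "\<dots> = (2 * \<bar>h y\<bar>) * (\<integral>\<omega>. \<bar>s \<omega>\<bar> \<partial>?Q) + 3 * \<bar>h y\<bar> + measure ?Q A"
      using iss iA by (simp add: Q.prob_space)
    also have "\<dots> \<le> (2 * \<bar>h y\<bar>) * 1 + 3 * \<bar>h y\<bar> + (3 * \<bar>h y\<bar> + 3 * \<rho> / v)"
      using abs_s conc[of "\<bar>h y\<bar>"] by (intro add_mono mult_left_mono) (auto simp: A_def)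
    finally have "(\<integral>\<omega>. E (h y) (s \<omega>) \<partial>?Q) \<le> 8 * \<bar>h y\<bar> + 3 * \<rho> / v" by simp
    then have "(v + (h y)\<^sup>2) * (\<integral>\<omega>. E (h y) (s \<omega>) \<partial>?Q) \<le> (v + (h y)\<^sup>2) * (8 * \<bar>h y\<bar> + 3 * \<rho> / v)"
      using c by (intro mult_left_mono) auto
    then show "(\<integral>\<omega>. (v + (h y)\<^sup>2) * E (h y) (s \<omega>) \<partial>?Q) \<le> 8 * ((v + (h y)\<^sup>2) * \<bar>h y\<bar>) + (3 * \<rho> / v) * (v + (h y)\<^sup>2)"
      by (simp only: integral_mult_right_zero) (simp only: distrib_left mult_ac)
  qed
  also have "\<dots> = 8 * (\<integral>y. (v + (h y)\<^sup>2) * \<bar>h y\<bar> \<partial>M) + (3 * \<rho> / v) * (\<integral>y. v + (h y)\<^sup>2 \<partial>M)"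
    using vh by (subst Bochner_Integration.integral_add) (auto simp del: integral_mult_right simp: integral_mult_right_zero)
  also have "(\<integral>y. v + (h y)\<^sup>2 \<partial>M) = 2 * v" using im v by (simp add: prob_space)
  also have "(\<integral>y. (v + (h y)\<^sup>2) * \<bar>h y\<bar> \<partial>M) = v * (\<integral>y. \<bar>h y\<bar> \<partial>M) + \<rho>"
  proof -
    have "(v + (h y)\<^sup>2) * \<bar>h y\<bar> = v * \<bar>h y\<bar> + \<bar>h y\<bar> ^ 3" for y
      by (simp add: distrib_right power3_eq_cube power2_eq_square abs_mult_self_eq)
    then show ?thesis using 3 im \<rho> by simp
  qed
  also have "8 * (v * (\<integral>y. \<bar>h y\<bar> \<partial>M) + \<rho>) + 3 * \<rho> / v * (2 * v) \<le> 22 * \<rho>"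
    using third_moment_bounds(2)[OF assms(4) 3 v] \<rho> v by simp
  finally have bound: "(\<integral>p. (v + (h (fst p))\<^sup>2) * E (h (fst p)) (s (snd p)) \<partial>?MQ) \<le> 22 * \<rho>" .

  define S where "S = (\<lambda>p. h (fst p) + s (snd p))"
  have [measurable]: "S \<in> borel_measurable ?MQ" unfolding S_def by measurable
  interpret MQp: pair_prob_space M ?Q by standard
  have iS': "integrable ?MQ (\<lambda>p. stein' z (S p))"
    by (rule MQp.P.integrable_const_bound[of _ 2]) (use stein_bounds in auto)
  have iS'2: "integrable ?Q (\<lambda>\<omega>. stein' z (s \<omega>))"
    by (rule Q.integrable_const_bound[of _ 2]) (use stein_bounds in auto)
  have is2: "integrable ?Q (\<lambda>\<omega>. stein z (s \<omega>))"
    by (rule Q.integrable_const_bound[of _ 3]) (use stein_bounds in auto)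
  have ihS: "integrable ?MQ (\<lambda>p. h (fst p) * stein z (S p))"
  proof (rule Bochner_Integration.integrable_bound[where f="\<lambda>p. 3 * h (fst p)"])
    show "AE p in ?MQ. norm (h (fst p) * stein z (S p)) \<le> norm (3 * h (fst p))"
      using stein_bounds by (intro AE_I2) (auto simp: abs_mult mult.commute[of 3] intro!: mult_left_mono)
  qed (use i1[OF im(2)] in auto)
  have ihs: "integrable ?MQ (\<lambda>p. h (fst p) * stein z (s (snd p)))" "(\<integral>p. h (fst p) * stein z (s (snd p)) \<partial>?MQ) = 0"
    using MQ.integrable_times[OF im(2) is2] MQ.integral_times[OF im(2) is2] zero by simp_all
  have i0: "integrable M (\<lambda>y. v - (h y)\<^sup>2)" using im by simp
  have ih0: "integrable ?MQ (\<lambda>p. (v - (h (fst p))\<^sup>2) * stein' z (s (snd p)))"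
      "(\<integral>p. (v - (h (fst p))\<^sup>2) * stein' z (s (snd p)) \<partial>?MQ) = 0"
    using MQ.integrable_times[OF i0 iS'2] MQ.integral_times[OF i0 iS'2] im v by (simp_all add: prob_space)
  \<comment> \<open>The two mean-zero terms are inserted so that v f'(S) - h f(S) becomes a
    combination of pure differences.\<close>
  define R where "R = (\<lambda>p. v * (stein' z (S p) - stein' z (s (snd p)))
      - h (fst p) * (stein z (S p) - stein z (s (snd p)) - h (fst p) * stein' z (s (snd p))))"
  have Req: "R p = v * stein' z (S p) - h (fst p) * stein z (S p) + h (fst p) * stein z (s (snd p))
      - (v - (h (fst p))\<^sup>2) * stein' z (s (snd p))" for p
    by (simp add: R_def algebra_simps power2_eq_square)
  have iR: "integrable ?MQ R" unfolding Req[abs_def]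
    by (intro Bochner_Integration.integrable_add Bochner_Integration.integrable_diff integrable_mult_right iS' ihS ihs ih0)
  have intR: "(\<integral>p. R p \<partial>?MQ) = v * (\<integral>p. stein' z (S p) \<partial>?MQ) - (\<integral>p. h (fst p) * stein z (S p) \<partial>?MQ)"
    unfolding Req using iS' ihS ihs ih0 by (simp add: Bochner_Integration.integral_add Bochner_Integration.integral_diff)
  have Rb: "\<bar>R p\<bar> \<le> (v + (h (fst p))\<^sup>2) * E (h (fst p)) (s (snd p))" for p
  proof -
    let ?y = "h (fst p)" and ?w = "s (snd p)"
    have "\<bar>v * (stein' z (S p) - stein' z ?w)\<bar> \<le> v * E ?y ?w"
      unfolding abs_mult E_def S_def using stein'_increment[of z ?w ?y] v by (simp add: add.commute mult_left_mono)
    moreover have "\<bar>?y * (stein z (S p) - stein z ?w - ?y * stein' z ?w)\<bar> \<le> \<bar>?y\<bar> * (\<bar>?y\<bar> * E ?y ?w)"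
      unfolding abs_mult E_def S_def using stein_taylor[of z ?w ?y] by (simp add: add.commute mult_left_mono)
    moreover have "\<bar>?y\<bar> * (\<bar>?y\<bar> * E ?y ?w) = ?y\<^sup>2 * E ?y ?w"
      by (simp add: power2_eq_square flip: mult.assoc)
    ultimately show ?thesis unfolding R_def distrib_right by linarith
  qed
  have "\<bar>\<integral>p. R p \<partial>?MQ\<bar> \<le> (\<integral>p. \<bar>R p\<bar> \<partial>?MQ)" by simp
  also have "\<dots> \<le> (\<integral>p. (v + (h (fst p))\<^sup>2) * E (h (fst p)) (s (snd p)) \<partial>?MQ)"
    using iR iE Rb by (intro integral_mono) auto
  finally have "\<bar>\<integral>p. R p \<partial>?MQ\<bar> \<le> 22 * \<rho>" using bound by linarith
  moreover have "(\<integral>\<omega>. stein' z (psum h (insert i J) \<omega>) \<partial>?P) = (\<integral>p. stein' z (S p) \<partial>?MQ)"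
    using J by (subst integral_insert_eq) (simp_all add: psum_upd S_def s_def)
  moreover have "(\<integral>\<omega>. h (\<omega> i) * stein z (psum h (insert i J) \<omega>) \<partial>?P) = (\<integral>p. h (fst p) * stein z (S p) \<partial>?MQ)"
    using J by (subst integral_insert_eq) (simp_all add: psum_upd S_def s_def)
  ultimately show ?thesis using intR by simp
qed

text \<open>The leave-one-out errors are summed over i, where card I * v = 1 splits E f'(S) into
  equal shares. A single index leaves no remaining sum to concentrate; then v = 1 forces
  \<open>\<rho>\<close> >= 1 and the claim is trivial.\<close>

lemma berry_esseen_normalized:
  fixes h :: "'a \<Rightarrow> real" and v \<rho> z :: real
  assumes I: "finite I" and [measurable]: "h \<in> borel_measurable M"
    and 3: "integrable M (\<lambda>y. \<bar>h y\<bar> ^ 3)"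
    and zero: "(\<integral>y. h y \<partial>M) = 0" and v: "(\<integral>y. (h y)\<^sup>2 \<partial>M) = v"
    and \<rho>: "(\<integral>y. \<bar>h y\<bar> ^ 3 \<partial>M) = \<rho>" and norm: "card I * v = 1"
  shows "\<bar>measure (PiM I (\<lambda>_. M)) {\<omega> \<in> space (PiM I (\<lambda>_. M)). psum h I \<omega> \<le> z} - Phi z\<bar> \<le> 22 * (card I * \<rho>)"
proof -
  let ?P = "PiM I (\<lambda>_. M)"
  interpret P: prob_space ?P by (rule prob_space_Pi)
  define A where "A = {\<omega> \<in> space ?P. psum h I \<omega> \<le> z}"
  have [measurable]: "A \<in> sets ?P" unfolding A_def by measurable
  have v0: "v > 0" using norm by (metis of_nat_0_le_iff zero_less_mult_iff zero_less_one not_less)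
  have I0: "I \<noteq> {}" using norm by auto
  note im = integrable_lower_moments[OF assms(2) 3]
  show ?thesis
  proof (cases "card I = 1")
    case True
    then have "v = 1" using norm by simp
    then have "\<rho> \<ge> 1" using third_moment_bounds(1)[OF assms(2) 3 v v0] \<rho> by simp
    have "0 \<le> measure ?P A" "measure ?P A \<le> 1" by auto
    then have "\<bar>measure ?P A - Phi z\<bar> \<le> 22 * \<rho>" using \<open>\<rho> \<ge> 1\<close> Phi_bounds[of z] by linarith
    then show ?thesis using True unfolding A_def by simp
  next
    case False
    define S where "S = psum h I"
    have [measurable]: "S \<in> borel_measurable ?P" by (simp add: S_def)
    have iS': "integrable ?P (\<lambda>\<omega>. stein' z (S \<omega>))"
      by (rule P.integrable_const_bound[of _ 2]) (use stein_bounds in auto)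
    have ih: "integrable ?P (\<lambda>\<omega>. h (\<omega> i) * stein z (S \<omega>))" if "i \<in> I" for i
    proof (rule Bochner_Integration.integrable_bound[where f="\<lambda>\<omega>. 3 * h (\<omega> i)"])
      show "AE \<omega> in ?P. norm (h (\<omega> i) * stein z (S \<omega>)) \<le> norm (3 * h (\<omega> i))"
        using stein_bounds by (intro AE_I2) (auto simp: abs_mult mult.commute[of 3] intro!: mult_left_mono)
    qed (use integrable_component[OF im(2) that] that in auto)
    have each: "\<bar>v * (\<integral>\<omega>. stein' z (S \<omega>) \<partial>?P) - (\<integral>\<omega>. h (\<omega> i) * stein z (S \<omega>) \<partial>?P)\<bar> \<le> 22 * \<rho>" if "i \<in> I" for i
    proof -
      have "I - {i} \<noteq> {}" using False that by (metis Diff_eq_empty_iff card_1_singleton_iff One_nat_def subset_singletonD empty_iff)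
      then show ?thesis
        using stein_leave_one_out[of "I - {i}" i h v \<rho> z] that I 3 zero v v0 \<rho> norm
        by (simp add: insert_absorb S_def)
    qed
    have "measure ?P A - Phi z = (\<integral>\<omega>. indicator A \<omega> - Phi z \<partial>?P)"
      by (subst Bochner_Integration.integral_diff) (auto simp: P.prob_space P.emeasure_eq_measure)
    also have "\<dots> = (\<integral>\<omega>. stein' z (S \<omega>) - (\<Sum>i\<in>I. h (\<omega> i) * stein z (S \<omega>)) \<partial>?P)"
    proof (rule Bochner_Integration.integral_cong[OF refl])
      fix \<omega> assume "\<omega> \<in> space ?P"
      then have "indicator A \<omega> = (indicator {..z} (S \<omega>) :: real)" by (auto simp: A_def S_def indicator_def)
      then show "indicator A \<omega> - Phi z = stein' z (S \<omega>) - (\<Sum>i\<in>I. h (\<omega> i) * stein z (S \<omega>))"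
        by (simp add: stein'_def S_def psum_def sum_distrib_right)
    qed
    also have "\<dots> = (\<integral>\<omega>. stein' z (S \<omega>) \<partial>?P) - (\<Sum>i\<in>I. \<integral>\<omega>. h (\<omega> i) * stein z (S \<omega>) \<partial>?P)"
      using ih iS' by (subst Bochner_Integration.integral_diff) auto
    also have "(\<integral>\<omega>. stein' z (S \<omega>) \<partial>?P) = (\<Sum>i\<in>I. v * (\<integral>\<omega>. stein' z (S \<omega>) \<partial>?P))"
      using norm by (simp flip: mult.assoc)
    finally have "measure ?P A - Phi z = (\<Sum>i\<in>I. v * (\<integral>\<omega>. stein' z (S \<omega>) \<partial>?P) - (\<integral>\<omega>. h (\<omega> i) * stein z (S \<omega>) \<partial>?P))"
      by (simp add: sum_subtractf)
    also have "\<bar>\<dots>\<bar> \<le> (\<Sum>i\<in>I. 22 * \<rho>)"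
      by (rule order_trans[OF sum_abs]) (intro sum_mono each)
    finally show ?thesis unfolding A_def by simp
  qed
qed

end

lemma (in prob_space) berry_esseen:
  fixes h :: "'a \<Rightarrow> real" and v \<rho> z :: real
  assumes I: "finite I" "I \<noteq> {}" and [measurable]: "h \<in> borel_measurable M"
    and 3: "integrable M (\<lambda>y. \<bar>h y\<bar> ^ 3)"
    and zero: "(\<integral>y. h y \<partial>M) = 0" and v: "(\<integral>y. (h y)\<^sup>2 \<partial>M) = v" "v > 0"
    and \<rho>: "(\<integral>y. \<bar>h y\<bar> ^ 3 \<partial>M) = \<rho>"
  shows "\<bar>measure (PiM I (\<lambda>_. M)) {\<omega> \<in> space (PiM I (\<lambda>_. M)). psum h I \<omega> / sqrt (card I * v) \<le> z} - Phi z\<bar>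
    \<le> 22 * (\<rho> / (v * sqrt v * sqrt (card I)))"
proof -
  define N where "N = real (card I)"
  have N: "N > 0" using I by (simp add: N_def card_gt_0_iff)
  define c where "c = sqrt (N * v)"
  have c: "c > 0" "c\<^sup>2 = N * v" using N v by (simp_all add: c_def)
  have eq: "psum (\<lambda>y. h y / c) I \<omega> = psum h I \<omega> / c" for \<omega>
    by (simp add: psum_def sum_divide_distrib)
  have "\<bar>measure (PiM I (\<lambda>_. M)) {\<omega> \<in> space (PiM I (\<lambda>_. M)). psum (\<lambda>y. h y / c) I \<omega> \<le> z} - Phi z\<bar>
    \<le> 22 * (card I * (\<rho> / c ^ 3))"
  proof (rule berry_esseen_normalized[OF I(1)])
    show "integrable M (\<lambda>y. \<bar>h y / c\<bar> ^ 3)" using 3 c by (simp add: power_divide)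
    show "(\<integral>y. \<bar>h y / c\<bar> ^ 3 \<partial>M) = \<rho> / c ^ 3" using 3 c \<rho> by (simp add: power_divide)
    show "(\<integral>y. h y / c \<partial>M) = 0" using zero by simp
    show "(\<integral>y. (h y / c)\<^sup>2 \<partial>M) = v / (N * v)" using v c by (simp add: power_divide)
    show "card I * (v / (N * v)) = 1" using N v by (simp add: N_def)
  qed simp
  also have "card I * (\<rho> / c ^ 3) = \<rho> / (v * sqrt v * sqrt N)"
  proof -
    have "c ^ 3 = N * v * (sqrt N * sqrt v)"
      using c by (simp add: power3_eq_cube c_def real_sqrt_mult mult_ac flip: power2_eq_square)
    then show ?thesis using N v by (simp add: N_def field_simps)
  qed
  finally show ?thesis unfolding eq by (simp add: c_def N_def)
qed

section \<open>Exponential functionals of normal and nearly normal variables\<close>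

definition mills2 :: "real \<Rightarrow> real \<Rightarrow> real" where
  "mills2 \<kappa> a = (\<integral>u. indicator {0<..} u * (exp (- (\<kappa> * u)) * phi (a + u)) \<partial>lborel)"

lemma mills2_integrable:
  assumes "\<kappa> \<ge> 0"
  shows "integrable lborel (\<lambda>u. indicator {0<..} u * (exp (- (\<kappa> * u)) * phi (a + u)))"
proof (rule Bochner_Integration.integrable_bound)
  show "integrable lborel (\<lambda>u. phi (a + 1 * u))"
    by (rule lborel_integrable_real_affine[OF integrable_phi]) simp
  show "AE u in lborel. norm (indicator {0<..} u * (exp (- (\<kappa> * u)) * phi (a + u))) \<le> norm (phi (a + 1 * u))"
    using phi_pos assms
    by (intro AE_I2) (auto simp: indicator_def abs_mult mult_le_cancel_right1 intro!: mult_left_le_one_le)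
qed simp

text \<open>Completing the square. The Gaussian pays for a factor exp(u), caused by a shift |a| <=
  1, and still leaves decay of rate 1, so small rates do not spoil the integrals.\<close>

lemma exp_quadratic_phi: "phi u * exp u \<le> 8 * exp (- u)"
proof -
  have "0 \<le> (u - 2)\<^sup>2 / 2" by simp
  then have "- u\<^sup>2 / 2 + u \<le> 2 - u" by (simp add: power2_eq_square field_simps)
  then have "exp (- u\<^sup>2 / 2) * exp u \<le> exp 2 * exp (- u)" by (simp flip: exp_add)
  moreover have "exp 2 \<le> (8::real)"
  proof -
    have "exp 2 = exp 1 * exp (1::real)" by (simp flip: exp_add)
    also have "\<dots> \<le> 2.8 * 2.8" using e_less_272 by (intro mult_mono) auto
    finally show ?thesis by simp
  qed
  ultimately have 1: "exp (- u\<^sup>2 / 2) * exp u \<le> 8 * exp (- u)"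
    by (meson exp_ge_zero mult_right_mono order_trans)
  have "1 / sqrt (2 * pi) \<le> 1" using pi_gt3 by (simp add: real_le_rsqrt)
  then have "phi u * exp u \<le> 1 * (exp (- u\<^sup>2 / 2) * exp u)"
    unfolding std_normal_density_def mult.assoc by (intro mult_right_mono) auto
  then show ?thesis using 1 by (simp only: mult_1_left)
qed

lemma exp_diff_le: "\<bar>exp A - exp B\<bar> \<le> \<bar>A - B\<bar> * exp (max A B)" for A B :: real
proof -
  have *: "\<bar>exp q - exp p\<bar> \<le> \<bar>q - p\<bar> * exp q" if "p \<le> q" for p q :: real
  proof -
    have "1 + (p - q) \<le> exp (p - q)" by (rule exp_ge_add_one_self)
    then have "exp q * (1 - exp (p - q)) \<le> exp q * (q - p)" by (intro mult_left_mono) (linarith, simp)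
    moreover have "exp q * (1 - exp (p - q)) = exp q - exp p" by (simp add: right_diff_distrib flip: exp_add)
    ultimately show ?thesis using that by (simp add: mult.commute)
  qed
  show ?thesis using *[of A B] *[of B A] by (cases "A \<le> B") (auto simp: abs_minus_commute max_def)
qed

text \<open>For standard normal N, \<open>mills2 \<kappa> a\<close> is the expectation of exp(-
  \<open>\<kappa>\<close> (N - a)) over N > a, and \<open>mills x\<close> is the case
  \<open>\<kappa>\<close> = x, a = 0. The exponents differ by at most C u + a^2/2; integrating this
  against exp(- (1+m) u) produces the two powers of 1/(1+m), which is the decay needed for a
  relative error.\<close>

lemma mills2_close:
  assumes a: "\<bar>a\<bar> \<le> 1" and m: "0 \<le> m" "m \<le> \<kappa>" "m \<le> x"
  shows "\<bar>mills2 \<kappa> a - mills x\<bar> \<le> 8 * (\<bar>\<kappa> - x\<bar> + \<bar>a\<bar>) / (1 + m)\<^sup>2 + 4 * a\<^sup>2 / (1 + m)"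
proof -
  have i: "integrable lborel (\<lambda>u. indicator {0<..} u * (exp (- (\<kappa> * u)) * phi (a + u)))"
    using m by (intro mills2_integrable) auto
  have i': "integrable lborel (\<lambda>u. indicator {0<..} u * (exp (- (x * u)) * phi u))"
    using m by (intro mills_integrable) auto
  have "1 + m > 0" using m by simp
  note e = has_bochner_integral_exp[OF this]
  define C where "C = \<bar>\<kappa> - x\<bar> + \<bar>a\<bar>"
  let ?d = "\<lambda>u. indicator {0<..} u * (exp (- (\<kappa> * u)) * phi (a + u)) - indicator {0<..} u * (exp (- (x * u)) * phi u)"
  let ?g = "\<lambda>u. (8 * C) * (indicator {0<..} u * (u * exp (- ((1 + m) * u)))) + (4 * a\<^sup>2) * (indicator {0<..} u * exp (- ((1 + m) * u)))"
  have ig: "has_bochner_integral lborel ?g ((8 * C) * (1 / (1 + m)\<^sup>2) + (4 * a\<^sup>2) * (1 / (1 + m)))"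
    by (intro has_bochner_integral_add has_bochner_integral_mult_right e)
  have dg: "\<bar>?d u\<bar> \<le> ?g u" for u :: real
  proof (cases "u > 0")
    case True
    define A where "A = - (\<kappa> * u) + (- (a * u) - a\<^sup>2 / 2)"
    have "?d u = phi u * (exp A - exp (- (x * u)))"
      using True unfolding phi_shift A_def exp_add by (simp add: right_diff_distrib mult_ac)
    also have "\<bar>\<dots>\<bar> = phi u * \<bar>exp A - exp (- (x * u))\<bar>" using phi_pos[of u] by (simp add: abs_mult)
    \<comment> \<open>Both exponentials are at most exp(- m u) up to the factor exp(u) from |a u| <=
      u, which \<open>exp_quadratic_phi\<close> repays.\<close>
    also have "\<dots> \<le> phi u * ((C * u + a\<^sup>2 / 2) * exp (- (m * u) + u))"
    proof (rule mult_left_mono)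
      have au: "\<bar>a * u\<bar> \<le> u" using a True by (simp add: abs_mult mult_left_le_one_le)
      have "m * u \<le> \<kappa> * u" "m * u \<le> x * u" using m True by (auto intro!: mult_right_mono)
      then have mx: "max A (- (x * u)) \<le> - (m * u) + u" using au True zero_le_power2[of a] unfolding A_def
        by (intro max.boundedI) linarith+
      have "\<bar>A - - (x * u)\<bar> \<le> \<bar>(\<kappa> - x) * u\<bar> + \<bar>a * u\<bar> + a\<^sup>2 / 2"
        unfolding A_def left_diff_distrib using zero_le_power2[of a] by linarith
      also have "\<dots> = C * u + a\<^sup>2 / 2" using True by (simp add: C_def abs_mult distrib_right)
      finally have "\<bar>A - - (x * u)\<bar> \<le> C * u + a\<^sup>2 / 2" .
      then have "\<bar>A - - (x * u)\<bar> * exp (max A (- (x * u))) \<le> (C * u + a\<^sup>2 / 2) * exp (- (m * u) + u)"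
        using mx by (intro mult_mono) auto
      then show "\<bar>exp A - exp (- (x * u))\<bar> \<le> (C * u + a\<^sup>2 / 2) * exp (- (m * u) + u)"
        using exp_diff_le[of A "- (x * u)"] by linarith
    qed (use phi_pos[of u] in simp)
    also have "\<dots> = (C * u + a\<^sup>2 / 2) * exp (- (m * u)) * (phi u * exp u)"
      by (simp only: exp_add mult_ac)
    also have "\<dots> \<le> (C * u + a\<^sup>2 / 2) * exp (- (m * u)) * (8 * exp (- u))"
      using True by (intro mult_left_mono exp_quadratic_phi mult_nonneg_nonneg add_nonneg_nonneg) (auto simp: C_def)
    also have "\<dots> = (C * u + a\<^sup>2 / 2) * 8 * exp (- ((1 + m) * u))"
    proof -
      have "exp (- ((1 + m) * u)) = exp (- (m * u)) * exp (- u)" by (simp add: distrib_right flip: exp_add)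
      then show ?thesis by simp
    qed
    also have "\<dots> = ?g u" using True by (simp add: algebra_simps)
    finally show ?thesis .
  qed (simp add: indicator_def)
  have eq: "mills2 \<kappa> a - mills x = (\<integral>u. ?d u \<partial>lborel)"
    unfolding mills2_def mills_def by (rule Bochner_Integration.integral_diff[OF i i', symmetric])
  have id: "integrable lborel ?d" by (rule Bochner_Integration.integrable_diff[OF i i'])
  have ig1: "integrable lborel ?g" using ig unfolding has_bochner_integral_iff by (rule conjunct1)
  have "\<bar>integral\<^sup>L lborel ?d\<bar> \<le> (\<integral>u. \<bar>?d u\<bar> \<partial>lborel)" by (rule integral_abs_bound)
  also have "\<dots> \<le> integral\<^sup>L lborel ?g"
    by (rule integral_mono[OF integrable_abs[OF id] ig1 dg])
  also have "\<dots> = (8 * C) * (1 / (1 + m)\<^sup>2) + (4 * a\<^sup>2) * (1 / (1 + m))"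
    using ig by (rule has_bochner_integral_integral_eq)
  finally have "\<bar>mills2 \<kappa> a - mills x\<bar> \<le> (8 * C) * (1 / (1 + m)\<^sup>2) + (4 * a\<^sup>2) * (1 / (1 + m))"
    unfolding eq .
  then show ?thesis by (simp add: C_def)
qed

lemma exponential_tail:
  assumes "\<kappa> > 0" "t \<ge> 0"
  shows "measure (density lborel (exponential_density \<kappa>)) {t..} = exp (- (\<kappa> * t))"
proof -
  let ?E = "density lborel (exponential_density \<kappa>)"
  interpret E: prob_space ?E using assms by (intro prob_space_exponential_density)
  have D: "distributed ?E lborel (\<lambda>x. x) (exponential_density \<kappa>)"
    unfolding distributed_def by (auto intro!: distr_id2)
  have "measure ?E {t..} = measure ?E {t<..}"
  proof (rule E.finite_measure_eq_AE)
    show "AE x in ?E. (x \<in> {t..}) = (x \<in> {t<..})"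
      using AE_lborel_singleton[of t] by (subst AE_density) (auto elim!: eventually_mono)
  qed auto
  also have "{t<..} = {x \<in> space ?E. t < x}" by auto
  also have "measure ?E \<dots> = exp (- t * \<kappa>)"
    using E.exponential_distributedD_gt[OF D] assms by simp
  finally show ?thesis by (simp add: mult.commute)
qed

text \<open>Both sides are averages of cdf increments over an independent exponential variable.\<close>

lemma exponential_functional_eq:
  fixes N :: "real measure"
  assumes "prob_space N" and [measurable_cong]: "sets N = sets borel" and \<kappa>: "\<kappa> > 0"
  shows "(\<integral>z. indicator {a<..} z * exp (- (\<kappa> * (z - a))) \<partial>N) =
    (\<integral>u. measure N {a<..a+u} \<partial>density lborel (exponential_density \<kappa>))"
proof -
  let ?E = "density lborel (exponential_density \<kappa>)"
  interpret E: prob_space ?E using \<kappa> by (intro prob_space_exponential_density)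
  interpret N: prob_space N by fact
  interpret pair_prob_space N ?E ..
  define F where "F = (\<lambda>z u. if a < z \<and> z \<le> a + u then 1 else 0 :: real)"
  have [measurable]: "case_prod F \<in> borel_measurable (N \<Otimes>\<^sub>M ?E)"
    unfolding F_def by measurable
  have "integrable (N \<Otimes>\<^sub>M ?E) (case_prod F)"
    by (rule P.integrable_const_bound[of _ 1]) (auto simp: F_def)
  then have "(\<integral>u. (\<integral>z. F z u \<partial>N) \<partial>?E) = (\<integral>z. (\<integral>u. F z u \<partial>?E) \<partial>N)"
    by (rule Fubini_integral)
  moreover have "(\<integral>z. F z u \<partial>N) = measure N {a<..a+u}" for u
  proof -
    have "(\<integral>z. F z u \<partial>N) = (\<integral>z. indicator {a<..a+u} z \<partial>N)"
      by (intro Bochner_Integration.integral_cong) (auto simp: F_def indicator_def)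
    then show ?thesis by simp
  qed
  moreover have "(\<integral>u. F z u \<partial>?E) = indicator {a<..} z * exp (- (\<kappa> * (z - a)))" for z
  proof -
    have "(\<integral>u. F z u \<partial>?E) = (\<integral>u. indicator {a<..} z * indicator {z - a..} u \<partial>?E)"
      by (intro Bochner_Integration.integral_cong) (auto simp: F_def indicator_def)
    also have "\<dots> = indicator {a<..} z * measure ?E {z - a..}" by simp
    also have "\<dots> = indicator {a<..} z * exp (- (\<kappa> * (z - a)))"
      using exponential_tail[OF \<kappa>, of "z - a"] by (auto simp: indicator_def)
    finally show ?thesis .
  qed
  ultimately show ?thesis by simp
qed

text \<open>The weight exp(- \<open>\<kappa>\<close> (z - a)) is the probability that an exponential
  variable U of rate \<open>\<kappa>\<close> is at least z - a. The functional is thus the average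
  of P(a < Z <= a + U), and each such increment differs from its normal value by at most twice the
  Kolmogorov distance, uniformly in \<open>\<kappa>\<close>.\<close>

lemma (in prob_space) exponential_functional_normal_approx:
  fixes Z :: "'a \<Rightarrow> real"
  assumes [measurable]: "Z \<in> borel_measurable M" and \<kappa>: "\<kappa> > 0"
    and BE: "\<And>z. \<bar>measure M {\<omega> \<in> space M. Z \<omega> \<le> z} - Phi z\<bar> \<le> \<delta>"
  shows "\<bar>(\<integral>\<omega>. indicator {a<..} (Z \<omega>) * exp (- (\<kappa> * (Z \<omega> - a))) \<partial>M) - mills2 \<kappa> a\<bar> \<le> 2 * \<delta>"
proof -
  let ?E = "density lborel (exponential_density \<kappa>)"
  interpret E: prob_space ?E using \<kappa> by (intro prob_space_exponential_density)
  define N1 where "N1 = distr M borel Z"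
  define N2 where "N2 = density lborel (\<lambda>x. ennreal (phi x))"
  have p1: "prob_space N1" unfolding N1_def by (rule prob_space_distr) simp
  have p2: "prob_space N2" unfolding N2_def by (rule prob_space_normal_density) simp
  interpret N1: prob_space N1 by (rule p1)
  interpret N2: prob_space N2 by (rule p2)
  have s: "sets N1 = sets borel" "sets N2 = sets borel" by (auto simp: N1_def N2_def)
  have c1: "measure N1 {..z} = measure M {\<omega> \<in> space M. Z \<omega> \<le> z}" for z
    unfolding N1_def by (subst measure_distr) (auto intro!: arg_cong[where f="measure M"])
  have c2: "measure N2 {..z} = Phi z" for z
  proof -
    have "measure N2 {..z} = (\<integral>t. indicator {..z} t \<partial>N2)" using s by simp
    also have "\<dots> = Phi z" unfolding N2_def Phi_eq
      by (subst integral_density) (auto simp: phi_pos less_imp_le mult.commute)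
    finally show ?thesis .
  qed
  have int1: "integrable ?E (\<lambda>u. measure N1 {a<..a+u})"
  proof -
    have "(\<lambda>u. measure N1 {a<..a+u}) = (\<lambda>u. if u \<ge> 0 then measure N1 {..a+u} - measure N1 {..a} else 0)"
    proof
      fix u
      show "measure N1 {a<..a+u} = (if u \<ge> 0 then measure N1 {..a+u} - measure N1 {..a} else 0)"
      proof (cases "u \<ge> 0")
        case True
        then have "{a<..a+u} = {..a+u} - {..a}" by auto
        then show ?thesis using N1.finite_measure_Diff[of "{..a+u}" "{..a}"] s True by simp
      qed simp
    qed
    moreover have "mono (\<lambda>u. measure N1 {..a+u})"
      using s by (auto simp: mono_def intro!: N1.finite_measure_mono)
    then have "(\<lambda>u. measure N1 {..a+u}) \<in> borel_measurable borel" by (rule borel_measurable_mono)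
    ultimately have [measurable]: "(\<lambda>u. measure N1 {a<..a+u}) \<in> borel_measurable borel" by simp
    show ?thesis by (rule E.integrable_const_bound[of _ 1]) auto
  qed
  have diff: "measure N1 {a<..a+u} - measure N2 {a<..a+u} = (if u \<ge> 0 then
      (measure N1 {..a+u} - measure N2 {..a+u}) - (measure N1 {..a} - measure N2 {..a}) else 0)" for u
  proof (cases "u \<ge> 0")
    case True
    then have "{a<..a+u} = {..a+u} - {..a}" by auto
    then show ?thesis using N1.finite_measure_Diff[of "{..a+u}" "{..a}"] N2.finite_measure_Diff[of "{..a+u}" "{..a}"] s True
      by simp
  qed simp
  have "\<delta> \<ge> 0" using BE[of 0] by linarith
  have db: "\<bar>measure N1 {a<..a+u} - measure N2 {a<..a+u}\<bar> \<le> 2 * \<delta>" for u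
    unfolding diff using BE[of "a + u"] BE[of a] \<open>\<delta> \<ge> 0\<close> by (auto simp: c1 c2)
  have int2: "integrable ?E (\<lambda>u. measure N2 {a<..a+u})"
  proof -
    have "(\<lambda>u. measure N2 {a<..a+u}) = (\<lambda>u. if u \<ge> 0 then Phi (a + u) - Phi a else 0)"
    proof
      fix u
      show "measure N2 {a<..a+u} = (if u \<ge> 0 then Phi (a + u) - Phi a else 0)"
      proof (cases "u \<ge> 0")
        case True
        then have "{a<..a+u} = {..a+u} - {..a}" by auto
        then show ?thesis using N2.finite_measure_Diff[of "{..a+u}" "{..a}"] s True by (simp add: c2)
      qed simp
    qed
    moreover have "(\<lambda>u. Phi u) \<in> borel_measurable borel"
      by (rule borel_measurable_mono) (auto simp: mono_def Phi_mono)
    ultimately have [measurable]: "(\<lambda>u. measure N2 {a<..a+u}) \<in> borel_measurable borel" by simp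
    show ?thesis by (rule E.integrable_const_bound[of _ 1]) auto
  qed
  have "(\<integral>\<omega>. indicator {a<..} (Z \<omega>) * exp (- (\<kappa> * (Z \<omega> - a))) \<partial>M) = (\<integral>z. indicator {a<..} z * exp (- (\<kappa> * (z - a))) \<partial>N1)"
    unfolding N1_def by (subst integral_distr) auto
  also have "\<dots> = (\<integral>u. measure N1 {a<..a+u} \<partial>?E)"
    by (rule exponential_functional_eq[OF p1 s(1) \<kappa>])
  finally have e1: "(\<integral>\<omega>. indicator {a<..} (Z \<omega>) * exp (- (\<kappa> * (Z \<omega> - a))) \<partial>M) = (\<integral>u. measure N1 {a<..a+u} \<partial>?E)" .
  have "mills2 \<kappa> a = (\<integral>u. indicator {a<..} (a + 1 * u) * (exp (- (\<kappa> * ((a + 1 * u) - a))) * phi (a + 1 * u)) \<partial>lborel)"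
    unfolding mills2_def by (intro Bochner_Integration.integral_cong) (auto simp: indicator_def)
  also have "\<dots> = (\<integral>z. indicator {a<..} z * (exp (- (\<kappa> * (z - a))) * phi z) \<partial>lborel)"
    using lborel_integral_real_affine[of 1 "\<lambda>z. indicator {a<..} z * (exp (- (\<kappa> * (z - a))) * phi z)" a] by simp
  also have "\<dots> = (\<integral>z. indicator {a<..} z * exp (- (\<kappa> * (z - a))) \<partial>N2)"
    unfolding N2_def by (subst integral_density) (auto simp: phi_pos less_imp_le mult_ac intro!: Bochner_Integration.integral_cong)
  also have "\<dots> = (\<integral>u. measure N2 {a<..a+u} \<partial>?E)"
    by (rule exponential_functional_eq[OF p2 s(2) \<kappa>])
  finally have e2: "mills2 \<kappa> a = (\<integral>u. measure N2 {a<..a+u} \<partial>?E)" .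
  have "(\<integral>u. measure N1 {a<..a+u} \<partial>?E) - (\<integral>u. measure N2 {a<..a+u} \<partial>?E) = (\<integral>u. measure N1 {a<..a+u} - measure N2 {a<..a+u} \<partial>?E)"
    using int1 int2 by simp
  also have "\<bar>\<dots>\<bar> \<le> (\<integral>u. \<bar>measure N1 {a<..a+u} - measure N2 {a<..a+u}\<bar> \<partial>?E)"
    by (rule integral_abs_bound)
  also have "\<dots> \<le> (\<integral>u. 2 * \<delta> \<partial>?E)"
    using int1 int2 db by (intro integral_mono) auto
  finally show ?thesis unfolding e1 e2 using E.prob_space by simp
qed

subsection \<open>The tilting factor\<close>

text \<open>Contribution of one summand to e^T, with s = b X. The quadratic term keeps it bounded on
  the whole line, so tilting requires no exponential moment of X.\<close>

definition tilt_factor :: "real \<Rightarrow> real" where "tilt_factor s = exp (s - s\<^sup>2 / 2)"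

lemma tilt_factor_pos: "tilt_factor s > 0" by (simp add: tilt_factor_def)

lemma tilt_factor_measurable[measurable]: "tilt_factor \<in> borel_measurable borel"
  unfolding tilt_factor_def[abs_def] by measurable

lemma tilt_factor_le: "tilt_factor s \<le> 2"
proof -
  have "0 \<le> (s - 1)\<^sup>2 / 2" by simp
  then have "s - s\<^sup>2 / 2 \<le> 1 / 2" by (simp add: power2_eq_square field_simps)
  then have "tilt_factor s \<le> exp (1 / 2)" by (simp add: tilt_factor_def)
  also have "\<dots> \<le> 2"
    using exp_bound[of "1 / 2"] by (simp add: power2_eq_square)
  finally show ?thesis .
qed

text \<open>Half of the Gaussian decay is set aside: s - s^2/2 <= 1 - s^2/4, and exp(- s^2/4) beats
  powers up to the fourth. The value 90 is 32 e rounded up.\<close>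

lemma power_times_tilt_factor_le:
  assumes "k \<le> 4"
  shows "\<bar>s\<bar> ^ k * tilt_factor s \<le> 90"
proof -
  have "0 \<le> (s - 2)\<^sup>2 / 4" by simp
  then have "s - s\<^sup>2 / 2 \<le> 1 - s\<^sup>2 / 4" by (simp add: power2_eq_square field_simps)
  then have "tilt_factor s \<le> exp 1 * exp (- (s\<^sup>2 / 4))" by (simp add: tilt_factor_def flip: exp_add)
  also have "\<dots> = exp 1 / exp (s\<^sup>2 / 4)" by (simp add: exp_minus field_simps)
  finally have t: "tilt_factor s * exp (s\<^sup>2 / 4) \<le> exp 1" by (simp add: pos_le_divide_eq)
  have s4: "\<bar>s\<bar> ^ k \<le> 1 + s ^ 4"
  proof (cases "\<bar>s\<bar> \<le> 1")
    case True
    have "\<bar>s\<bar> ^ k \<le> 1" using True by (simp add: power_le_one)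
    moreover have "0 \<le> s ^ 4" by simp
    ultimately show ?thesis by linarith
  next
    case False
    then have "\<bar>s\<bar> ^ k \<le> \<bar>s\<bar> ^ 4" using assms by (intro power_increasing) auto
    then show ?thesis by (simp add: power_even_abs)
  qed
  have e: "1 + s\<^sup>2 / 4 + (s\<^sup>2 / 4)\<^sup>2 / 2 \<le> exp (s\<^sup>2 / 4)"
    by (rule exp_lower_Taylor_quadratic) simp
  have "(s\<^sup>2)\<^sup>2 = s ^ 4" by (simp flip: power_mult)
  then have "1 + s ^ 4 \<le> 32 * (1 + s\<^sup>2 / 4 + (s\<^sup>2 / 4)\<^sup>2 / 2)" using zero_le_power2[of s]
    by (simp add: power_divide) 
  then have "1 + s ^ 4 \<le> 32 * exp (s\<^sup>2 / 4)"
    by (rule order_trans) (intro mult_left_mono e, simp)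
  then have "\<bar>s\<bar> ^ k \<le> 32 * exp (s\<^sup>2 / 4)" using s4 by (rule order_trans[rotated])
  then have "\<bar>s\<bar> ^ k * tilt_factor s \<le> 32 * exp (s\<^sup>2 / 4) * tilt_factor s" using tilt_factor_pos[of s] by (intro mult_right_mono) auto
  also have "\<dots> = 32 * (tilt_factor s * exp (s\<^sup>2 / 4))" by (simp add: mult_ac)
  also have "\<dots> \<le> 32 * exp 1" using t by simp
  also have "\<dots> \<le> 90" using e_less_272 by simp
  finally show ?thesis .
qed

lemma abs_powers_small:
  fixes s :: real
  assumes "\<bar>s\<bar> \<le> 1"
  shows "s ^ 4 \<le> \<bar>s\<bar> ^ 3" "\<bar>s\<bar> ^ 3 \<le> \<bar>s\<bar>" "\<bar>s\<bar> ^ 3 \<le> s\<^sup>2" "s\<^sup>2 \<le> \<bar>s\<bar>"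
proof -
  have "\<bar>s\<bar> ^ 4 \<le> \<bar>s\<bar> ^ 3" "\<bar>s\<bar> ^ 3 \<le> \<bar>s\<bar> ^ 1" "\<bar>s\<bar> ^ 3 \<le> \<bar>s\<bar> ^ 2" "\<bar>s\<bar> ^ 2 \<le> \<bar>s\<bar> ^ 1"
    using assms by (intro power_decreasing; simp)+
  then show "s ^ 4 \<le> \<bar>s\<bar> ^ 3" "\<bar>s\<bar> ^ 3 \<le> \<bar>s\<bar>" "\<bar>s\<bar> ^ 3 \<le> s\<^sup>2" "s\<^sup>2 \<le> \<bar>s\<bar>"
    by (simp_all add: power_even_abs)
qed

lemma abs_powers_large:
  fixes s :: real
  assumes "\<not> \<bar>s\<bar> \<le> 1"
  shows "1 \<le> \<bar>s\<bar> ^ 3" "\<bar>s\<bar> \<le> \<bar>s\<bar> ^ 3" "s\<^sup>2 \<le> \<bar>s\<bar> ^ 3" "\<bar>s\<bar> \<le> s\<^sup>2"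
proof -
  have "\<bar>s\<bar> ^ 1 \<le> \<bar>s\<bar> ^ 3" "\<bar>s\<bar> ^ 2 \<le> \<bar>s\<bar> ^ 3" "\<bar>s\<bar> ^ 1 \<le> \<bar>s\<bar> ^ 2" "1 \<le> \<bar>s\<bar> ^ 3"
    using assms by (intro power_increasing one_le_power; simp)+
  then show "1 \<le> \<bar>s\<bar> ^ 3" "\<bar>s\<bar> \<le> \<bar>s\<bar> ^ 3" "s\<^sup>2 \<le> \<bar>s\<bar> ^ 3" "\<bar>s\<bar> \<le> s\<^sup>2"
    by (simp_all add: power_even_abs)
qed

text \<open>For w = s - s^2/2 the quadratic terms of w and w^2/2 cancel, and the cubic terms of
  w^2/2 and w^3/6 add up to - s^3/3. After the mean, the third moment is therefore the first to
  enter the cost of tilting.\<close>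

lemma tilt_factor_taylor_small:
  assumes s: "\<bar>s\<bar> \<le> 1"
  shows "\<bar>tilt_factor s - 1 - s + s ^ 3 / 3\<bar> \<le> 2 * s ^ 4"
proof -
  define w where "w = s - s\<^sup>2 / 2"
  have "\<bar>s\<^sup>2 / 2\<bar> \<le> \<bar>s\<bar> / 2" using abs_powers_small(4)[OF s] by simp
  then have w: "\<bar>w\<bar> \<le> 3 / 2 * \<bar>s\<bar>" unfolding w_def by linarith
  obtain t where t: "\<bar>t\<bar> \<le> \<bar>w\<bar>" "exp w = (\<Sum>m<4. w ^ m / fact m) + exp t / fact 4 * w ^ 4"
    using Maclaurin_exp_le[of w 4] by blast
  have p: "(\<Sum>m<4. w ^ m / fact m) = 1 + w + w\<^sup>2 / 2 + w ^ 3 / 6"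
    by (simp add: eval_nat_numeral)
  have "exp t \<le> exp (3 / 2)" using t w s by simp
  also have "exp (3 / 2) \<le> exp (1::real) * 2"
  proof -
    have "exp (3 / 2) = exp 1 * exp (1 / 2 :: real)" by (simp flip: exp_add)
    then show ?thesis using exp_bound[of "1 / 2"] by (simp add: power2_eq_square)
  qed
  also have "\<dots> \<le> 6" using e_less_272 by simp
  finally have et: "exp t \<le> 6" .
  have w4: "w ^ 4 \<le> 82 / 16 * s ^ 4"
  proof -
    have "\<bar>w\<bar> ^ 4 \<le> (3 / 2 * \<bar>s\<bar>) ^ 4" using w by (intro power_mono) auto
    also have "\<dots> = 81 / 16 * s ^ 4" by (simp add: power4_eq_xxxx flip: power2_eq_square) (simp add: power2_eq_square)
    also have "\<dots> \<le> 82 / 16 * s ^ 4" by (intro mult_right_mono) auto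
    finally show ?thesis by (simp add: power_even_abs)
  qed
  have "exp t / fact 4 * w ^ 4 \<le> 6 / fact 4 * (82 / 16 * s ^ 4)"
    using et w4 by (intro mult_mono divide_right_mono) auto
  then have r1: "exp t / fact 4 * w ^ 4 \<le> 82 / 64 * s ^ 4" by (simp add: fact_numeral)
  have r0: "0 \<le> exp t / fact 4 * w ^ 4" by simp
  have poly: "1 + w + w\<^sup>2 / 2 + w ^ 3 / 6 - 1 - s + s ^ 3 / 3 = s ^ 4 * (- 1 / 8 + s / 8 - s\<^sup>2 / 48)"
    unfolding w_def by (simp add: field_simps power2_eq_square power3_eq_cube power4_eq_xxxx)
  have s2: "s\<^sup>2 \<le> 1" using s by (simp add: abs_square_le_1)
  have "\<bar>- 1 / 8 + s / 8 - s\<^sup>2 / 48\<bar> \<le> 13 / 48"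
    using s s2 zero_le_power2[of s] by linarith
  then have "\<bar>s ^ 4 * (- 1 / 8 + s / 8 - s\<^sup>2 / 48)\<bar> \<le> s ^ 4 * (13 / 48)"
    unfolding abs_mult by (intro mult_mono) auto
  then have bX: "\<bar>1 + w + w\<^sup>2 / 2 + w ^ 3 / 6 - 1 - s + s ^ 3 / 3\<bar> \<le> s ^ 4 * (13 / 48)"
    unfolding poly .
  have eqX: "tilt_factor s - 1 - s + s ^ 3 / 3 = (1 + w + w\<^sup>2 / 2 + w ^ 3 / 6 - 1 - s + s ^ 3 / 3) + exp t / fact 4 * w ^ 4"
    unfolding tilt_factor_def w_def[symmetric] t(2) p by simp
  have lin: "\<bar>X + R\<bar> \<le> 2 * q" if "\<bar>X\<bar> \<le> q * (13 / 48)" "0 \<le> R" "R \<le> 82 / 64 * q" "0 \<le> q" for X R q :: real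
    using that by linarith
  show ?thesis unfolding eqX by (rule lin[OF bX r0 r1]) simp
qed

text \<open>For |s| > 1 each of 1, |s| and |s|^3 is at most s^4 and the factor is at most 2, so the
  local expansion holds globally with a larger constant.\<close>

lemma tilt_factor_taylor: "\<bar>tilt_factor s - 1 - s + s ^ 3 / 3\<bar> \<le> 5 * s ^ 4"
proof (cases "\<bar>s\<bar> \<le> 1")
  case True
  then show ?thesis using tilt_factor_taylor_small[OF True] zero_le_even_power[of 4 s] by simp
next
  case False
  have "\<bar>s\<bar> ^ 1 \<le> \<bar>s\<bar> ^ 4" "\<bar>s\<bar> ^ 3 \<le> \<bar>s\<bar> ^ 4" "1 \<le> \<bar>s\<bar> ^ 4"
    using False by (intro power_increasing one_le_power; simp)+
  then have *: "\<bar>s\<bar> \<le> s ^ 4" "\<bar>s ^ 3\<bar> \<le> s ^ 4" "1 \<le> s ^ 4" by (simp_all add: power_even_abs power_abs)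
  show ?thesis using * tilt_factor_pos[of s] tilt_factor_le[of s] by linarith
qed

lemma tilt_factor_minus_linear: "\<bar>s\<bar> \<le> 1 \<Longrightarrow> \<bar>tilt_factor s - 1 - s\<bar> \<le> 3 * \<bar>s\<bar> ^ 3"
  using tilt_factor_taylor_small[of s] abs_powers_small[of s] power_abs[of s 3] by linarith

lemma tilt_factor_minus_one: "\<bar>s\<bar> \<le> 1 \<Longrightarrow> \<bar>tilt_factor s - 1\<bar> \<le> 4 * \<bar>s\<bar>"
  using tilt_factor_minus_linear[of s] abs_powers_small[of s] by linarith

definition tilt_exponent :: "real \<Rightarrow> real" where "tilt_exponent s = s - s\<^sup>2 / 2"

lemma tilt_exponent_measurable[measurable]: "tilt_exponent \<in> borel_measurable borel"
  unfolding tilt_exponent_def[abs_def] by measurable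

lemma tilt_factor_tilt_exponent: "tilt_factor s = exp (tilt_exponent s)" by (simp add: tilt_factor_def tilt_exponent_def)

lemma tilt_exponent_abs: "\<bar>s\<bar> \<le> 1 \<Longrightarrow> \<bar>tilt_exponent s\<bar> \<le> 3 / 2 * \<bar>s\<bar>" "\<not> \<bar>s\<bar> \<le> 1 \<Longrightarrow> \<bar>tilt_exponent s\<bar> \<le> 3 / 2 * s\<^sup>2"
  using abs_powers_small[of s] abs_powers_large[of s] zero_le_power2[of s] unfolding tilt_exponent_def by linarith+

text \<open>Integrated with s = b h, this puts the tilted mean of one summand near b^2/2, hence that
  of T near n b^2/2 = x^2/2: the tilt places T at the boundary of the event.\<close>

lemma tilt_exponent_tilt_factor_first: "\<bar>tilt_exponent s * tilt_factor s - s - s\<^sup>2 / 2\<bar> \<le> 10 * \<bar>s\<bar> ^ 3"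
proof (cases "\<bar>s\<bar> \<le> 1")
  case True
  have "tilt_exponent s * tilt_factor s - s - s\<^sup>2 / 2 = tilt_exponent s * (tilt_factor s - 1 - s) - s ^ 3 / 2"
    by (simp add: tilt_exponent_def field_simps power2_eq_square power3_eq_cube)
  moreover have "\<bar>tilt_exponent s * (tilt_factor s - 1 - s)\<bar> \<le> 3 / 2 * (3 * \<bar>s\<bar> ^ 3)"
    unfolding abs_mult using tilt_exponent_abs(1)[OF True] tilt_factor_minus_linear[OF True] True by (intro mult_mono) auto
  ultimately show ?thesis using power_abs[of s 3] zero_le_power[of "\<bar>s\<bar>" 3] by linarith
next
  case False
  have "\<bar>tilt_exponent s * tilt_factor s\<bar> \<le> 3 / 2 * s\<^sup>2 * 2"
    unfolding abs_mult using tilt_exponent_abs(2)[OF False] tilt_factor_le[of s] tilt_factor_pos[of s] by (intro mult_mono) auto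
  then show ?thesis using abs_powers_large[OF False] by linarith
qed

text \<open>Integrated, this makes the tilted variance of T close to n b^2 = x^2. For |s| > 1 no
  expansion is used; 9/4 * 90 from \<open>power_times_tilt_factor_le\<close> is rounded up to 203,
  and s^2 is at most |s|^3.\<close>

lemma tilt_exponent_tilt_factor_second: "\<bar>(tilt_exponent s)\<^sup>2 * tilt_factor s - s\<^sup>2\<bar> \<le> 204 * \<bar>s\<bar> ^ 3"
proof (cases "\<bar>s\<bar> \<le> 1")
  case True
  have eq: "(tilt_exponent s)\<^sup>2 * tilt_factor s - s\<^sup>2 = s\<^sup>2 * ((1 - s / 2)\<^sup>2 * (tilt_factor s - 1) + (s\<^sup>2 / 4 - s))"
    by (simp add: tilt_exponent_def algebra_simps power2_eq_square) (simp add: field_simps)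
  have "(1 - s / 2)\<^sup>2 \<le> (3 / 2)\<^sup>2" using True by (intro power2_le_iff_abs_le[THEN iffD2]) auto
  then have "\<bar>(1 - s / 2)\<^sup>2 * (tilt_factor s - 1)\<bar> \<le> (3 / 2)\<^sup>2 * (4 * \<bar>s\<bar>)"
    unfolding abs_mult using tilt_factor_minus_one[OF True] by (intro mult_mono) auto
  then have "\<bar>(1 - s / 2)\<^sup>2 * (tilt_factor s - 1)\<bar> \<le> 9 * \<bar>s\<bar>" by (simp add: power2_eq_square[of "3/2"])
  then have "\<bar>(1 - s / 2)\<^sup>2 * (tilt_factor s - 1) + (s\<^sup>2 / 4 - s)\<bar> \<le> 11 * \<bar>s\<bar>"
    using abs_powers_small(4)[OF True] zero_le_power2[of s] by linarith
  then have "s\<^sup>2 * \<bar>(1 - s / 2)\<^sup>2 * (tilt_factor s - 1) + (s\<^sup>2 / 4 - s)\<bar> \<le> s\<^sup>2 * (11 * \<bar>s\<bar>)"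
    by (intro mult_left_mono) auto
  also have "\<dots> = 11 * \<bar>s\<bar> ^ 3" by (simp add: power3_eq_cube power2_eq_square)
  also have "\<dots> \<le> 204 * \<bar>s\<bar> ^ 3" by (intro mult_right_mono) auto
  finally have "s\<^sup>2 * \<bar>(1 - s / 2)\<^sup>2 * (tilt_factor s - 1) + (s\<^sup>2 / 4 - s)\<bar> \<le> 204 * \<bar>s\<bar> ^ 3" .
  then show ?thesis unfolding eq by (simp add: abs_mult)
next
  case False
  have "\<bar>tilt_exponent s\<bar>\<^sup>2 \<le> (3 / 2 * s\<^sup>2)\<^sup>2" using tilt_exponent_abs(2)[OF False] by (intro power_mono) auto
  also have "\<dots> = 9 / 4 * s ^ 4" by (simp add: power2_eq_square power4_eq_xxxx)
  finally have "(tilt_exponent s)\<^sup>2 * tilt_factor s \<le> 9 / 4 * s ^ 4 * tilt_factor s" using tilt_factor_pos[of s] by (intro mult_right_mono) auto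
  also have "\<dots> = 9 / 4 * (\<bar>s\<bar> ^ 4 * tilt_factor s)" by (simp add: power_even_abs)
  also have "\<dots> \<le> 9 / 4 * 90" using power_times_tilt_factor_le[of 4 s] by (intro mult_left_mono) auto
  finally have "(tilt_exponent s)\<^sup>2 * tilt_factor s \<le> 203" by simp
  moreover have "0 \<le> (tilt_exponent s)\<^sup>2 * tilt_factor s" using tilt_factor_pos[of s] by simp
  ultimately show ?thesis using abs_powers_large[OF False] zero_le_power2[of s] by linarith
qed

text \<open>For |s| > 1 the exponent grows like s^2, so its cube has degree six; three of these
  powers are spent on the bounded product with the factor, giving 27/8 * 90.\<close>

lemma tilt_exponent_tilt_factor_third: "\<bar>tilt_exponent s\<bar> ^ 3 * tilt_factor s \<le> 304 * \<bar>s\<bar> ^ 3"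
proof (cases "\<bar>s\<bar> \<le> 1")
  case True
  have "\<bar>tilt_exponent s\<bar> ^ 3 \<le> (3 / 2 * \<bar>s\<bar>) ^ 3" using tilt_exponent_abs(1)[OF True] by (intro power_mono) auto
  also have "\<dots> = 27 / 8 * \<bar>s\<bar> ^ 3" by (simp add: power3_eq_cube)
  finally have "\<bar>tilt_exponent s\<bar> ^ 3 * tilt_factor s \<le> 27 / 8 * \<bar>s\<bar> ^ 3 * 2" using tilt_factor_pos[of s] tilt_factor_le[of s] by (intro mult_mono) auto
  then show ?thesis using zero_le_power[of "\<bar>s\<bar>" 3] by linarith
next
  case False
  have "\<bar>tilt_exponent s\<bar> ^ 3 \<le> (3 / 2 * s\<^sup>2) ^ 3" using tilt_exponent_abs(2)[OF False] by (intro power_mono) auto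
  also have "\<dots> = 27 / 8 * (\<bar>s\<bar> ^ 3 * \<bar>s\<bar> ^ 3)" by (simp add: power3_eq_cube power2_eq_square)
  finally have "\<bar>tilt_exponent s\<bar> ^ 3 * tilt_factor s \<le> 27 / 8 * (\<bar>s\<bar> ^ 3 * \<bar>s\<bar> ^ 3) * tilt_factor s" using tilt_factor_pos[of s] by (intro mult_right_mono) auto
  also have "\<dots> = 27 / 8 * \<bar>s\<bar> ^ 3 * (\<bar>s\<bar> ^ 3 * tilt_factor s)" by simp
  also have "\<dots> \<le> 27 / 8 * \<bar>s\<bar> ^ 3 * 90" using power_times_tilt_factor_le[of 3 s] by (intro mult_left_mono) auto
  finally show ?thesis using zero_le_power[of "\<bar>s\<bar>" 3] by linarith
qed

text \<open>The first form yields the tilted mean of the squares. The second yields the same mean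
  for squares cut off at |s| <= 1, which are bounded and so have exponential moments.\<close>

lemma square_tilt_factor: "\<bar>s\<^sup>2 * tilt_factor s - s\<^sup>2\<bar> \<le> 4 * \<bar>s\<bar> ^ 3"
    "\<bar>(if \<bar>s\<bar> \<le> 1 then s\<^sup>2 else 0) * tilt_factor s - s\<^sup>2\<bar> \<le> 4 * \<bar>s\<bar> ^ 3"
proof -
  have small: "\<bar>s\<^sup>2 * tilt_factor s - s\<^sup>2\<bar> \<le> 4 * \<bar>s\<bar> ^ 3" if True: "\<bar>s\<bar> \<le> 1"
  proof -
    have "s\<^sup>2 * \<bar>tilt_factor s - 1\<bar> \<le> s\<^sup>2 * (4 * \<bar>s\<bar>)" using tilt_factor_minus_one[OF True] by (intro mult_left_mono) auto
    also have "\<dots> = 4 * \<bar>s\<bar> ^ 3" by (simp add: power3_eq_cube power2_eq_square)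
    finally have "\<bar>s\<^sup>2 * (tilt_factor s - 1)\<bar> \<le> 4 * \<bar>s\<bar> ^ 3" by (simp add: abs_mult)
    then show ?thesis by (simp add: right_diff_distrib)
  qed
  have large: "0 \<le> s\<^sup>2 * tilt_factor s" "s\<^sup>2 * tilt_factor s \<le> s\<^sup>2 * 2"
    using tilt_factor_pos[of s] tilt_factor_le[of s] by (auto intro!: mult_left_mono)
  show "\<bar>s\<^sup>2 * tilt_factor s - s\<^sup>2\<bar> \<le> 4 * \<bar>s\<bar> ^ 3"
    using small large abs_powers_large[of s] zero_le_power2[of s] by (cases "\<bar>s\<bar> \<le> 1") (simp, linarith)
  show "\<bar>(if \<bar>s\<bar> \<le> 1 then s\<^sup>2 else 0) * tilt_factor s - s\<^sup>2\<bar> \<le> 4 * \<bar>s\<bar> ^ 3"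
    using small abs_powers_large[of s] by (cases "\<bar>s\<bar> \<le> 1") auto
qed

subsection \<open>Exponential tilting\<close>

text \<open>A summand with second moment exactly 1 whose mean need not vanish, since the bias of
  winsorizing has to be carried along. The number b stands for x / sqrt n, but n enters only later;
  smallness of b * K makes each remainder a small fraction of its main term.\<close>

locale tilting = prob_space M for M :: "'a measure" +
  fixes h :: "'a \<Rightarrow> real" and K b :: real
  assumes h_meas[measurable]: "h \<in> borel_measurable M"
    and h4: "integrable M (\<lambda>y. h y ^ 4)" and var1: "(\<integral>y. (h y)\<^sup>2 \<partial>M) = 1" and K: "(\<integral>y. h y ^ 4 \<partial>M) \<le> K"
    and b0: "b > 0" and bK: "b * K \<le> 1 / 10000" and e16: "\<bar>\<integral>y. h y \<partial>M\<bar> \<le> 1 / 16"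
begin

definition e :: real where "e = (\<integral>y. h y \<partial>M)"
definition g3 :: real where "g3 = (\<integral>y. h y ^ 3 \<partial>M)"
definition W :: "'a \<Rightarrow> real" where "W y = tilt_exponent (b * h y)"
definition m :: real where "m = (\<integral>y. tilt_factor (b * h y) \<partial>M)"
definition Q :: "'a measure" where "Q = density M (\<lambda>y. ennreal (tilt_factor (b * h y) / m))"

lemma W_meas[measurable]: "W \<in> borel_measurable M"
  unfolding W_def[abs_def] by measurable

lemma cube_le: "2 * \<bar>s\<bar> ^ 3 \<le> s\<^sup>2 + s ^ 4" for s :: real
proof -
  have "0 \<le> (\<bar>s\<bar> - s\<^sup>2)\<^sup>2" by simp
  also have "\<dots> = s\<^sup>2 + s ^ 4 - 2 * \<bar>s\<bar> ^ 3"
    by (cases "s \<ge> 0") (simp_all add: power2_eq_square power3_eq_cube power4_eq_xxxx algebra_simps)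
  finally show ?thesis by simp
qed

lemma h2: "integrable M (\<lambda>y. (h y)\<^sup>2)"
  using var1 not_integrable_integral_eq by fastforce

lemma h3: "integrable M (\<lambda>y. \<bar>h y\<bar> ^ 3)" "(\<integral>y. \<bar>h y\<bar> ^ 3 \<partial>M) \<le> K" and K1: "1 \<le> K"
proof -
  have pw: "\<bar>h y\<bar> ^ 3 \<le> (h y)\<^sup>2 + h y ^ 4" for y
    using cube_le[of "h y"] zero_le_power[of "\<bar>h y\<bar>" 3] by linarith
  show i: "integrable M (\<lambda>y. \<bar>h y\<bar> ^ 3)"
  proof (rule Bochner_Integration.integrable_bound[OF Bochner_Integration.integrable_add[OF h2 h4]])
    show "AE y in M. norm (\<bar>h y\<bar> ^ 3) \<le> norm ((h y)\<^sup>2 + h y ^ 4)"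
      using pw by (intro AE_I2) (simp add: order_trans[OF pw])
  qed simp
  have "(\<integral>y. 2 * \<bar>h y\<bar> ^ 3 \<partial>M) \<le> (\<integral>y. (h y)\<^sup>2 + h y ^ 4 \<partial>M)"
    by (rule integral_mono) (use i h2 h4 cube_le in auto)
  then have l: "2 * (\<integral>y. \<bar>h y\<bar> ^ 3 \<partial>M) \<le> 1 + K" using i h2 h4 var1 K by simp
  have eq: "((h y)\<^sup>2 - 1)\<^sup>2 = h y ^ 4 - 2 * (h y)\<^sup>2 + 1" for y
    by (simp add: power2_eq_square power4_eq_xxxx algebra_simps)
  have "0 \<le> (\<integral>y. ((h y)\<^sup>2 - 1)\<^sup>2 \<partial>M)" by (rule Bochner_Integration.integral_nonneg) simp
  also have "\<dots> = (\<integral>y. h y ^ 4 \<partial>M) - 2 * 1 + 1"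
    unfolding eq using h2 h4 var1 by (simp add: prob_space)
  finally show K1: "1 \<le> K" using K by simp
  show "(\<integral>y. \<bar>h y\<bar> ^ 3 \<partial>M) \<le> K" using l K1 by simp
qed

lemma h1: "integrable M h" and h3': "integrable M (\<lambda>y. h y ^ 3)"
proof -
  show "integrable M h" using h2 by (rule integrable_of_square[rotated]) simp
  show "integrable M (\<lambda>y. h y ^ 3)"
    by (rule Bochner_Integration.integrable_bound[OF h3(1)]) (auto simp: power_abs)
qed

lemma b_small: "b \<le> 1 / 10000"
proof -
  have "b * 1 \<le> b * K" using K1 b0 by (intro mult_left_mono) auto
  then show ?thesis using bK by simp
qed

lemma e_small: "\<bar>e\<bar> \<le> 1 / 16" using e16 by (simp add: e_def)

lemma abs_g3: "\<bar>g3\<bar> \<le> K"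
proof -
  have "\<bar>g3\<bar> \<le> (\<integral>y. \<bar>h y ^ 3\<bar> \<partial>M)" unfolding g3_def by (rule integral_abs_bound)
  also have "\<dots> = (\<integral>y. \<bar>h y\<bar> ^ 3 \<partial>M)" by (simp add: power_abs)
  finally show ?thesis using h3(2) by simp
qed

lemma integral_close:
  fixes f g :: "'a \<Rightarrow> real"
  assumes [measurable]: "f \<in> borel_measurable M" and g: "integrable M g" and d: "integrable M d"
    and fg: "\<And>y. \<bar>f y - g y\<bar> \<le> d y" and D: "(\<integral>y. d y \<partial>M) \<le> D"
  shows "integrable M f" "\<bar>(\<integral>y. f y \<partial>M) - (\<integral>y. g y \<partial>M)\<bar> \<le> D"
proof -
  have i: "integrable M (\<lambda>y. f y - g y)"
    by (rule Bochner_Integration.integrable_bound[OF d]) (use g in \<open>auto intro!: AE_I2 order_trans[OF fg abs_ge_self]\<close>)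
  from Bochner_Integration.integrable_add[OF i g] show f: "integrable M f" by simp
  have "(\<integral>y. f y \<partial>M) - (\<integral>y. g y \<partial>M) = (\<integral>y. f y - g y \<partial>M)" using f g by simp
  moreover have "\<bar>\<integral>y. f y - g y \<partial>M\<bar> \<le> (\<integral>y. \<bar>f y - g y\<bar> \<partial>M)" by (rule integral_abs_bound)
  moreover have "(\<integral>y. \<bar>f y - g y\<bar> \<partial>M) \<le> (\<integral>y. d y \<partial>M)"
    by (rule integral_mono[OF integrable_abs[OF i] d fg])
  ultimately show "\<bar>(\<integral>y. f y \<partial>M) - (\<integral>y. g y \<partial>M)\<bar> \<le> D" using D by linarith
qed

text \<open>A pointwise error of order |b h|^3 becomes K b^3. Pointwise expansions of the tilting
  factor are turned into moments through this lemma and its fourth-order analogue.\<close>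

lemma integral_close3:
  fixes f g :: "'a \<Rightarrow> real"
  assumes "f \<in> borel_measurable M" "integrable M g" "c \<ge> 0"
    and fg: "\<And>y. \<bar>f y - g y\<bar> \<le> c * \<bar>b * h y\<bar> ^ 3"
  shows "integrable M f" "\<bar>(\<integral>y. f y \<partial>M) - (\<integral>y. g y \<partial>M)\<bar> \<le> c * (K * b ^ 3)"
proof -
  have eq: "c * \<bar>b * h y\<bar> ^ 3 = (c * b ^ 3) * \<bar>h y\<bar> ^ 3" for y
    using b0 by (simp add: abs_mult power_mult_distrib)
  have i: "integrable M (\<lambda>y. c * \<bar>b * h y\<bar> ^ 3)" unfolding eq using h3 by simp
  have "(\<integral>y. c * \<bar>b * h y\<bar> ^ 3 \<partial>M) = (c * b ^ 3) * (\<integral>y. \<bar>h y\<bar> ^ 3 \<partial>M)" unfolding eq using h3 by simp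
  also have "\<dots> \<le> (c * b ^ 3) * K" using h3 assms(3) b0 by (intro mult_left_mono) auto
  finally have le: "(\<integral>y. c * \<bar>b * h y\<bar> ^ 3 \<partial>M) \<le> c * (K * b ^ 3)" by (simp add: mult_ac)
  show "integrable M f" "\<bar>(\<integral>y. f y \<partial>M) - (\<integral>y. g y \<partial>M)\<bar> \<le> c * (K * b ^ 3)"
    using integral_close[OF assms(1,2) i fg le] by auto
qed

lemma integral_close4:
  fixes f g :: "'a \<Rightarrow> real"
  assumes "f \<in> borel_measurable M" "integrable M g" "c \<ge> 0"
    and fg: "\<And>y. \<bar>f y - g y\<bar> \<le> c * (b * h y) ^ 4"
  shows "integrable M f" "\<bar>(\<integral>y. f y \<partial>M) - (\<integral>y. g y \<partial>M)\<bar> \<le> c * (K * b ^ 4)"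
proof -
  have eq: "c * (b * h y) ^ 4 = (c * b ^ 4) * h y ^ 4" for y
    by (simp add: power_mult_distrib)
  have i: "integrable M (\<lambda>y. c * (b * h y) ^ 4)" unfolding eq using h4 by simp
  have "(\<integral>y. c * (b * h y) ^ 4 \<partial>M) = (c * b ^ 4) * (\<integral>y. h y ^ 4 \<partial>M)" unfolding eq using h4 by simp
  also have "\<dots> \<le> (c * b ^ 4) * K" using K assms(3) b0 by (intro mult_left_mono) auto
  finally have le: "(\<integral>y. c * (b * h y) ^ 4 \<partial>M) \<le> c * (K * b ^ 4)" by (simp add: mult_ac)
  show "integrable M f" "\<bar>(\<integral>y. f y \<partial>M) - (\<integral>y. g y \<partial>M)\<bar> \<le> c * (K * b ^ 4)"
    using integral_close[OF assms(1,2) i fg le] by auto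
qed

lemma tilt_factor_integrable: "integrable M (\<lambda>y. tilt_factor (b * h y))"
  by (rule integrable_const_bound[of _ 2]) (use tilt_factor_pos tilt_factor_le in \<open>auto simp: less_imp_le\<close>)

lemma m_taylor: "\<bar>m - 1 - b * e + b ^ 3 * g3 / 3\<bar> \<le> 5 * (K * b ^ 4)"
proof -
  have g: "integrable M (\<lambda>y. 1 + b * h y - b ^ 3 / 3 * h y ^ 3)"
    using h1 h3' by simp
  have "\<bar>tilt_factor (b * h y) - (1 + b * h y - b ^ 3 / 3 * h y ^ 3)\<bar> \<le> 5 * (b * h y) ^ 4" for y
    using tilt_factor_taylor[of "b * h y"] by (simp add: power_mult_distrib algebra_simps)
  from integral_close4(2)[OF _ g _ this]
  have "\<bar>m - (\<integral>y. 1 + b * h y - b ^ 3 / 3 * h y ^ 3 \<partial>M)\<bar> \<le> 5 * (K * b ^ 4)" by (simp add: m_def)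
  also have "(\<integral>y. 1 + b * h y - b ^ 3 / 3 * h y ^ 3 \<partial>M) = 1 + b * e - b ^ 3 / 3 * g3"
    using h1 h3' by (simp add: e_def g3_def prob_space)
  finally show ?thesis by (simp add: algebra_simps)
qed

lemma Kb: "K * b ^ 4 \<le> K * b ^ 3 / 10000" "K * b ^ 3 \<le> b\<^sup>2 / 10000" "b\<^sup>2 \<le> b / 10000" "K * b ^ 3 \<ge> 0" "b\<^sup>2 > 0"
proof -
  have "(K * b ^ 3) * b \<le> (K * b ^ 3) * (1 / 10000)" using b_small K1 b0 by (intro mult_left_mono) auto
  then show "K * b ^ 4 \<le> K * b ^ 3 / 10000" by (simp add: power3_eq_cube power4_eq_xxxx mult_ac)
  have "b\<^sup>2 * (b * K) \<le> b\<^sup>2 * (1 / 10000)" using bK by (intro mult_left_mono) auto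
  then show "K * b ^ 3 \<le> b\<^sup>2 / 10000" by (simp add: power3_eq_cube power2_eq_square mult_ac)
  have "b * b \<le> b * (1 / 10000)" using b_small b0 by (intro mult_left_mono) auto
  then show "b\<^sup>2 \<le> b / 10000" by (simp add: power2_eq_square)
  show "K * b ^ 3 \<ge> 0" "b\<^sup>2 > 0" using K1 b0 by auto
qed

lemma m_close: "\<bar>m - 1\<bar> \<le> b * \<bar>e\<bar> + K * b ^ 3"
proof -
  have "\<bar>b ^ 3 * g3 / 3\<bar> \<le> K * b ^ 3 / 3"
    using abs_g3 b0 by (simp add: abs_mult mult.commute)
  moreover have "\<bar>b * e\<bar> = b * \<bar>e\<bar>" using b0 by (simp add: abs_mult)
  ultimately show ?thesis using m_taylor Kb by linarith
qed

lemma m_bounds: "\<bar>m - 1\<bar> \<le> b" "1 / 2 \<le> m" "m \<le> 2" "m > 0"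
proof -
  have "b * \<bar>e\<bar> \<le> b * (1 / 16)" using e_small b0 by (intro mult_left_mono) auto
  then show 1: "\<bar>m - 1\<bar> \<le> b" using m_close Kb b0 by linarith
  show "1 / 2 \<le> m" "m \<le> 2" "m > 0" using 1 b_small by linarith+
qed

lemma sets_Q[measurable_cong]: "sets Q = sets M" by (simp add: Q_def)
lemma space_Q: "space Q = space M" by (simp add: Q_def)

lemma integrable_Q_iff:
  fixes f :: "'a \<Rightarrow> real"
  assumes [measurable]: "f \<in> borel_measurable M"
  shows "integrable Q f \<longleftrightarrow> integrable M (\<lambda>y. f y * tilt_factor (b * h y))"
proof -
  have "integrable Q f \<longleftrightarrow> integrable M (\<lambda>y. (1 / m) * (f y * tilt_factor (b * h y)))"
    unfolding Q_def using m_bounds tilt_factor_pos by (subst integrable_density) (auto simp: less_imp_le mult_ac)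
  also have "\<dots> \<longleftrightarrow> integrable M (\<lambda>y. f y * tilt_factor (b * h y))"
    using m_bounds(4) by (subst integrable_mult_left_iff) auto
  finally show ?thesis .
qed

lemma integral_Q:
  fixes f :: "'a \<Rightarrow> real"
  assumes [measurable]: "f \<in> borel_measurable M"
  shows "(\<integral>y. f y \<partial>Q) = (\<integral>y. f y * tilt_factor (b * h y) \<partial>M) / m"
proof -
  have "(\<integral>y. f y \<partial>Q) = (\<integral>y. (1 / m) * (f y * tilt_factor (b * h y)) \<partial>M)"
    unfolding Q_def using m_bounds tilt_factor_pos by (subst integral_density) (auto simp: less_imp_le mult_ac)
  then show ?thesis by simp
qed

lemma prob_space_Q: "prob_space Q"
proof
  have "emeasure Q (space Q) = (\<integral>\<^sup>+y. ennreal (tilt_factor (b * h y) / m) \<partial>M)"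
    unfolding Q_def by (simp add: emeasure_density cong: nn_integral_cong)
  also have "\<dots> = ennreal (\<integral>y. tilt_factor (b * h y) / m \<partial>M)"
    using tilt_factor_integrable m_bounds tilt_factor_pos by (intro nn_integral_eq_integral) (auto simp: less_imp_le)
  also have "(\<integral>y. tilt_factor (b * h y) / m \<partial>M) = 1" using m_bounds(4) by (simp add: m_def[symmetric])
  finally show "emeasure Q (space Q) = 1" by simp
qed

sublocale Q: prob_space Q by (rule prob_space_Q)

lemma sets_PQ: "sets (PiM I (\<lambda>_. Q)) = sets (PiM I (\<lambda>_. M))"
  by (intro sets_PiM_cong) (auto simp: sets_Q)

lemma space_PQ: "space (PiM I (\<lambda>_. Q)) = space (PiM I (\<lambda>_. M))"
  by (simp add: space_PiM space_Q)

text \<open>The weight e^T is a product over the coordinates, so tilting the product law and tilting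
  every factor agree on boxes.\<close>

lemma PiM_tilt:
  assumes I: "finite I"
  shows "PiM I (\<lambda>_::nat. Q) = density (PiM I (\<lambda>_. M)) (\<lambda>\<omega>. ennreal (exp (psum W I \<omega>) / m ^ card I))"
proof -
  interpret PQ: product_sigma_finite "\<lambda>_::nat. Q" by (rule Q.product_sf)
  interpret PM: product_sigma_finite "\<lambda>_::nat. M" by (rule product_sf)
  have eq: "ennreal (exp (psum W I \<omega>) / m ^ card I) = (\<Prod>i\<in>I. ennreal (tilt_factor (b * h (\<omega> i)) / m))" for \<omega>
    using I tilt_factor_pos m_bounds(4)
    by (simp add: prod_ennreal less_imp_le prod_dividef psum_def exp_sum W_def tilt_factor_tilt_exponent)
  let ?D = "density (PiM I (\<lambda>_. M)) (\<lambda>\<omega>. ennreal (exp (psum W I \<omega>) / m ^ card I))"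
  have "?D = PiM I (\<lambda>_. Q)"
  proof (rule PQ.PiM_eqI[OF I])
    show "sets ?D = sets (PiM I (\<lambda>_. Q))" by (simp add: sets_PQ)
    fix A :: "nat \<Rightarrow> 'a set" assume "\<And>i. i \<in> I \<Longrightarrow> A i \<in> sets Q"
    then have A[measurable]: "\<And>i. i \<in> I \<Longrightarrow> A i \<in> sets M" by (simp add: sets_Q)
    have "emeasure ?D (Pi\<^sub>E I A) = (\<integral>\<^sup>+\<omega>. ennreal (exp (psum W I \<omega>) / m ^ card I) * indicator (Pi\<^sub>E I A) \<omega> \<partial>PiM I (\<lambda>_. M))"
      using I A by (intro emeasure_density) (auto intro!: sets_PiM_I_finite)
    also have "\<dots> = (\<integral>\<^sup>+\<omega>. (\<Prod>i\<in>I. ennreal (tilt_factor (b * h (\<omega> i)) / m) * indicator (A i) (\<omega> i)) \<partial>PiM I (\<lambda>_. M))"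
    proof (rule nn_integral_cong)
      fix \<omega> assume "\<omega> \<in> space (PiM I (\<lambda>_. M))"
      then have "indicator (Pi\<^sub>E I A) \<omega> = (\<Prod>i\<in>I. indicator (A i) (\<omega> i) :: ennreal)"
        using I by (auto simp: indicator_def space_PiM PiE_iff prod_zero_iff)
      then show "ennreal (exp (psum W I \<omega>) / m ^ card I) * indicator (Pi\<^sub>E I A) \<omega> =
          (\<Prod>i\<in>I. ennreal (tilt_factor (b * h (\<omega> i)) / m) * indicator (A i) (\<omega> i))"
        by (simp add: eq prod.distrib)
    qed
    also have "\<dots> = (\<Prod>i\<in>I. \<integral>\<^sup>+y. ennreal (tilt_factor (b * h y) / m) * indicator (A i) y \<partial>M)"
      using I A by (intro PM.product_nn_integral_prod) auto
    also have "\<dots> = (\<Prod>i\<in>I. emeasure Q (A i))"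
      unfolding Q_def using A by (intro prod.cong) (auto simp: emeasure_density)
    finally show "emeasure ?D (Pi\<^sub>E I A) = (\<Prod>i\<in>I. emeasure Q (A i))" .
  qed
  then show ?thesis by simp
qed

text \<open>Change of measure in the manner of Cramer: under the tilted law an event at the level
  x^2/2 of T is no longer rare, and the rarity is carried by the explicit factor exp(- T).\<close>

lemma tilt_measure:
  assumes I: "finite I" and A[measurable]: "A \<in> sets (PiM I (\<lambda>_. M))"
  shows "integrable (PiM I (\<lambda>_. Q)) (\<lambda>\<omega>. exp (- psum W I \<omega>) * indicator A \<omega>)"
    "measure (PiM I (\<lambda>_. M)) A = m ^ card I * (\<integral>\<omega>. exp (- psum W I \<omega>) * indicator A \<omega> \<partial>PiM I (\<lambda>_. Q))"
proof -
  interpret P: prob_space "PiM I (\<lambda>_::nat. M)" by (rule prob_space_Pi)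
  have mc: "m ^ card I > 0" using m_bounds by simp
  have eq: "exp (psum W I \<omega>) * (exp (- psum W I \<omega>) * indicator A \<omega>) = (indicator A \<omega> :: real)" for \<omega>
    by (simp add: exp_minus)
  have iA: "integrable (PiM I (\<lambda>_::nat. M)) (\<lambda>\<omega>. indicator A \<omega> / m ^ card I)"
    using A by (intro integrable_divide integrable_real_indicator) (auto simp: P.emeasure_eq_measure)
  show "integrable (PiM I (\<lambda>_. Q)) (\<lambda>\<omega>. exp (- psum W I \<omega>) * indicator A \<omega>)"
    unfolding PiM_tilt[OF I] using mc iA by (subst integrable_density) (auto simp: eq)
  have "(\<integral>\<omega>. exp (- psum W I \<omega>) * indicator A \<omega> \<partial>PiM I (\<lambda>_. Q)) = (\<integral>\<omega>. indicator A \<omega> / m ^ card I \<partial>PiM I (\<lambda>_. M))"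
    unfolding PiM_tilt[OF I] using mc by (subst integral_density) (auto simp: eq)
  also have "\<dots> = measure (PiM I (\<lambda>_. M)) A / m ^ card I" by simp
  finally show "measure (PiM I (\<lambda>_. M)) A = m ^ card I * (\<integral>\<omega>. exp (- psum W I \<omega>) * indicator A \<omega> \<partial>PiM I (\<lambda>_. Q))"
    using m_bounds(4) by simp
qed

lemma tilt_measure_le:
  assumes I: "finite I" and A: "A \<in> sets (PiM I (\<lambda>_. M))"
    and G: "integrable (PiM I (\<lambda>_. Q)) G"
    and le: "\<And>\<omega>. \<omega> \<in> space (PiM I (\<lambda>_. Q)) \<Longrightarrow> exp (- psum W I \<omega>) * indicator A \<omega> \<le> G \<omega>"
  shows "measure (PiM I (\<lambda>_. M)) A \<le> m ^ card I * (\<integral>\<omega>. G \<omega> \<partial>PiM I (\<lambda>_. Q))"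
  unfolding tilt_measure(2)[OF I A] using m_bounds(4)
  by (intro mult_left_mono integral_mono tilt_measure(1)[OF I A] G le) auto

end

lemma abs_diff_cube_le: "\<bar>x - y\<bar> ^ 3 \<le> 4 * (\<bar>x\<bar> ^ 3 + \<bar>y\<bar> ^ 3)" for x y :: real
proof -
  have 1: "(p + q) ^ 3 \<le> 4 * (p ^ 3 + q ^ 3)" if "p \<ge> 0" "q \<ge> 0" for p q :: real
  proof -
    have "4 * (p ^ 3 + q ^ 3) - (p + q) ^ 3 = 3 * ((p + q) * (p - q)\<^sup>2)"
      by (simp add: power3_eq_cube power2_eq_square algebra_simps)
    moreover have "\<dots> \<ge> 0" using that by simp
    ultimately show ?thesis by linarith
  qed
  have "\<bar>x - y\<bar> ^ 3 \<le> (\<bar>x\<bar> + \<bar>y\<bar>) ^ 3" by (intro power_mono) auto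
  then show ?thesis using 1[of "\<bar>x\<bar>" "\<bar>y\<bar>"] by (meson abs_ge_zero order_trans)
qed

text \<open>Used when dividing by the normalizing constant m >= 1/2.\<close>

lemma le_twice: "p * (1 / 2) \<le> q \<Longrightarrow> q \<le> r \<Longrightarrow> p \<le> 2 * r" for p q r :: real
  by simp

lemma abs_diff_chain: "p \<le> P \<Longrightarrow> \<bar>A - B\<bar> \<le> p \<Longrightarrow> \<bar>B - C\<bar> \<le> q \<Longrightarrow> \<bar>A - C\<bar> \<le> P + q"
  for A B C p P q :: real
  by linarith

text \<open>The rate of the theorem with the absolute mean of a normalized summand in the place of
  1/\<open>\<tau>\<close>^3.\<close>

definition err :: "real \<Rightarrow> nat \<Rightarrow> real \<Rightarrow> real" where
  "err x n e = (1 + x ^ 4) / real n + (1 + x) * sqrt (real n) * \<bar>e\<bar> + (1 + x) / sqrt (real n)"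

section \<open>Mean, variance and third moment of the exponent under the tilted law\<close>

context tilting
begin

definition wbar :: real where "wbar = (\<integral>y. W y \<partial>Q)"
definition H :: "'a \<Rightarrow> real" where "H y = W y - wbar"
definition v :: real where "v = (\<integral>y. (H y)\<^sup>2 \<partial>Q)"

lemma H_meas[measurable]: "H \<in> borel_measurable M"
  unfolding H_def[abs_def] by measurable

lemma Q_measurable: "f \<in> borel_measurable M \<Longrightarrow> f \<in> borel_measurable Q"
  by (simp add: Q_def)

lemma W_first: "integrable M (\<lambda>y. W y * tilt_factor (b * h y))"
    "\<bar>(\<integral>y. W y * tilt_factor (b * h y) \<partial>M) - (b * e + b\<^sup>2 / 2)\<bar> \<le> 10 * (K * b ^ 3)"
proof -
  have g: "integrable M (\<lambda>y. b * h y + b\<^sup>2 / 2 * (h y)\<^sup>2)" using h1 h2 by simp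
  have gi: "(\<integral>y. b * h y + b\<^sup>2 / 2 * (h y)\<^sup>2 \<partial>M) = b * e + b\<^sup>2 / 2"
    using h1 h2 var1 by (simp add: e_def)
  have "\<bar>W y * tilt_factor (b * h y) - (b * h y + b\<^sup>2 / 2 * (h y)\<^sup>2)\<bar> \<le> 10 * \<bar>b * h y\<bar> ^ 3" for y
    using tilt_exponent_tilt_factor_first[of "b * h y"] by (simp add: W_def power_mult_distrib algebra_simps)
  from integral_close3[OF _ g _ this, unfolded gi] show "integrable M (\<lambda>y. W y * tilt_factor (b * h y))"
    "\<bar>(\<integral>y. W y * tilt_factor (b * h y) \<partial>M) - (b * e + b\<^sup>2 / 2)\<bar> \<le> 10 * (K * b ^ 3)" by simp_all
qed

lemma W_second: "integrable M (\<lambda>y. (W y)\<^sup>2 * tilt_factor (b * h y))"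
    "\<bar>(\<integral>y. (W y)\<^sup>2 * tilt_factor (b * h y) \<partial>M) - b\<^sup>2\<bar> \<le> 204 * (K * b ^ 3)"
proof -
  have g: "integrable M (\<lambda>y. b\<^sup>2 * (h y)\<^sup>2)" using h2 by simp
  have gi: "(\<integral>y. b\<^sup>2 * (h y)\<^sup>2 \<partial>M) = b\<^sup>2" using h2 var1 by simp
  have "\<bar>(W y)\<^sup>2 * tilt_factor (b * h y) - b\<^sup>2 * (h y)\<^sup>2\<bar> \<le> 204 * \<bar>b * h y\<bar> ^ 3" for y
    using tilt_exponent_tilt_factor_second[of "b * h y"] by (simp add: W_def power_mult_distrib)
  from integral_close3[OF _ g _ this, unfolded gi] show "integrable M (\<lambda>y. (W y)\<^sup>2 * tilt_factor (b * h y))"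
    "\<bar>(\<integral>y. (W y)\<^sup>2 * tilt_factor (b * h y) \<partial>M) - b\<^sup>2\<bar> \<le> 204 * (K * b ^ 3)" by simp_all
qed

lemma W_third: "integrable M (\<lambda>y. \<bar>W y\<bar> ^ 3 * tilt_factor (b * h y))"
    "(\<integral>y. \<bar>W y\<bar> ^ 3 * tilt_factor (b * h y) \<partial>M) \<le> 304 * (K * b ^ 3)"
proof -
  have "\<bar>\<bar>W y\<bar> ^ 3 * tilt_factor (b * h y) - 0\<bar> \<le> 304 * \<bar>b * h y\<bar> ^ 3" for y
    using tilt_exponent_tilt_factor_third[of "b * h y"] tilt_factor_pos[of "b * h y"] by (simp add: W_def abs_mult)
  from integral_close3[OF _ _ _ this] show "integrable M (\<lambda>y. \<bar>W y\<bar> ^ 3 * tilt_factor (b * h y))"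
    "(\<integral>y. \<bar>W y\<bar> ^ 3 * tilt_factor (b * h y) \<partial>M) \<le> 304 * (K * b ^ 3)" by (simp_all add: abs_le_iff)
qed

lemma be_small: "b * \<bar>e\<bar> \<le> b / 16" "b * \<bar>e\<bar> \<ge> 0"
proof -
  have "b * \<bar>e\<bar> \<le> b * (1 / 16)" using e_small b0 by (intro mult_left_mono) auto
  then show "b * \<bar>e\<bar> \<le> b / 16" by simp
qed (use b0 in simp)

text \<open>Numerator and normalizing constant are both known up to the bias b |e| and K b^3, and m
  >= 1/2 permits the division. The bias survives to first order; it shifts T away from
  x^2/2.\<close>

lemma wbar_close: "\<bar>wbar - b\<^sup>2 / 2\<bar> \<le> 3 * (b * \<bar>e\<bar>) + 22 * (K * b ^ 3)"
proof -
  define X where "X = (\<integral>y. W y * tilt_factor (b * h y) \<partial>M)"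
  have wm: "wbar * m = X" using integral_Q[of W] m_bounds(4) by (simp add: wbar_def X_def)
  have eqX: "(wbar - b\<^sup>2 / 2) * m = (X - (b * e + b\<^sup>2 / 2)) + b * e + b\<^sup>2 / 2 * (1 - m)"
    unfolding wm[symmetric] by (simp add: field_simps)
  have r: "\<bar>b\<^sup>2 / 2 * (1 - m)\<bar> \<le> 1 / 2 * (b * \<bar>e\<bar> + K * b ^ 3)"
  proof -
    have "b\<^sup>2 \<le> 1" using Kb(3) b_small by linarith
    then have "\<bar>b\<^sup>2 / 2\<bar> * \<bar>1 - m\<bar> \<le> 1 / 2 * (b * \<bar>e\<bar> + K * b ^ 3)"
      using m_close by (intro mult_mono) (auto simp: abs_minus_commute)
    then show ?thesis by (simp add: abs_mult)
  qed
  have q: "\<bar>b * e\<bar> = b * \<bar>e\<bar>" using b0 by (simp add: abs_mult)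
  have p: "\<bar>X - (b * e + b\<^sup>2 / 2)\<bar> \<le> 10 * (K * b ^ 3)" using W_first by (simp add: X_def)
  have lin: "\<bar>p + q + r\<bar> \<le> 3 / 2 * B + 11 * k" if "\<bar>p\<bar> \<le> 10 * k" "\<bar>q\<bar> = B" "\<bar>r\<bar> \<le> B / 2 + k / 2" "0 \<le> k" for p q r B k :: real
    using that by linarith
  have "\<bar>(wbar - b\<^sup>2 / 2) * m\<bar> \<le> 3 / 2 * (b * \<bar>e\<bar>) + 11 * (K * b ^ 3)"
    unfolding eqX by (rule lin[OF p q _ Kb(4)]) (use r in simp)
  moreover have "\<bar>(wbar - b\<^sup>2 / 2) * m\<bar> \<ge> \<bar>wbar - b\<^sup>2 / 2\<bar> * (1 / 2)"
    unfolding abs_mult using m_bounds by (intro mult_left_mono) auto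
  ultimately have "\<bar>wbar - b\<^sup>2 / 2\<bar> \<le> 2 * (3 / 2 * (b * \<bar>e\<bar>) + 11 * (K * b ^ 3))" by (rule le_twice[rotated])
  then show ?thesis by simp
qed

lemma wbar_abs: "\<bar>wbar\<bar> \<le> 3 * (b * \<bar>e\<bar>) + b\<^sup>2" "\<bar>wbar\<bar> \<le> b"
proof -
  show 1: "\<bar>wbar\<bar> \<le> 3 * (b * \<bar>e\<bar>) + b\<^sup>2" using wbar_close Kb by linarith
  show "\<bar>wbar\<bar> \<le> b" using 1 Kb be_small b0 by linarith
qed

lemma WQ: "integrable Q W" "integrable Q (\<lambda>y. (W y)\<^sup>2)" "integrable Q (\<lambda>y. \<bar>W y\<bar> ^ 3)"
  using W_first(1) W_second(1) W_third(1) by (auto simp: integrable_Q_iff)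

lemma b3: "b ^ 3 \<le> K * b ^ 3" using K1 b0 by (simp add: mult_le_cancel_right1)

text \<open>The second moment is b^2 up to K b^3. The square of the mean only adds b^4, which is
  absorbed, and the squared bias.\<close>

lemma v_close: "\<bar>v - b\<^sup>2\<bar> \<le> 412 * (K * b ^ 3) + 18 * (b * \<bar>e\<bar>)\<^sup>2"
proof -
  define Y where "Y = (\<integral>y. (W y)\<^sup>2 * tilt_factor (b * h y) \<partial>M)"
  define E2 where "E2 = (\<integral>y. (W y)\<^sup>2 \<partial>Q)"
  have "E2 * m = Y" using integral_Q[of "\<lambda>y. (W y)\<^sup>2"] m_bounds(4) by (simp add: E2_def Y_def)
  then have "(E2 - b\<^sup>2) * m = (Y - b\<^sup>2) + b\<^sup>2 * (1 - m)" by (simp add: algebra_simps)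
  moreover have "\<bar>b\<^sup>2 * (1 - m)\<bar> \<le> K * b ^ 3"
  proof -
    have "\<bar>b\<^sup>2 * (1 - m)\<bar> \<le> b\<^sup>2 * b"
      unfolding abs_mult using m_bounds(1) by (intro mult_mono) (auto simp: abs_minus_commute)
    then show ?thesis using b3 by (simp add: power2_eq_square power3_eq_cube)
  qed
  moreover have "\<bar>Y - b\<^sup>2\<bar> \<le> 204 * (K * b ^ 3)" using W_second by (simp add: Y_def)
  ultimately have "\<bar>(E2 - b\<^sup>2) * m\<bar> \<le> 205 * (K * b ^ 3)" by linarith
  moreover have "\<bar>(E2 - b\<^sup>2) * m\<bar> \<ge> \<bar>E2 - b\<^sup>2\<bar> * (1 / 2)"
    unfolding abs_mult using m_bounds by (intro mult_left_mono) auto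
  ultimately have "\<bar>E2 - b\<^sup>2\<bar> \<le> 2 * (205 * (K * b ^ 3))" by (rule le_twice[rotated])
  then have E2: "\<bar>E2 - b\<^sup>2\<bar> \<le> 410 * (K * b ^ 3)" by simp
  have v: "v = E2 - wbar\<^sup>2"
    using Q.variance_eq[OF WQ(1,2)] by (simp add: v_def H_def E2_def wbar_def)
  have "wbar\<^sup>2 \<le> (3 * (b * \<bar>e\<bar>) + b\<^sup>2)\<^sup>2"
    using power_mono[OF wbar_abs(1) abs_ge_zero, of 2] by simp
  also have "\<dots> \<le> 2 * (3 * (b * \<bar>e\<bar>))\<^sup>2 + 2 * (b\<^sup>2)\<^sup>2"
    by (smt (verit) power2_sum sum_squares_bound)
  also have "\<dots> \<le> 18 * (b * \<bar>e\<bar>)\<^sup>2 + 2 * (K * b ^ 3)"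
  proof -
    have "b ^ 3 * b \<le> b ^ 3 * 1" using b_small b0 by (intro mult_left_mono) auto
    then have "(b\<^sup>2)\<^sup>2 \<le> K * b ^ 3" using b3 by (simp add: power3_eq_cube power2_eq_square mult_ac)
    then show ?thesis by (simp add: power_mult_distrib)
  qed
  finally have "wbar\<^sup>2 \<le> 18 * (b * \<bar>e\<bar>)\<^sup>2 + 2 * (K * b ^ 3)" .
  then show ?thesis using v E2 zero_le_power2[of wbar] by linarith
qed

lemma v_bounds: "3 / 4 * b\<^sup>2 \<le> v" "v > 0"
proof -
  have "(b * \<bar>e\<bar>)\<^sup>2 \<le> (b / 16)\<^sup>2" using be_small by (intro power_mono) auto
  then have "(b * \<bar>e\<bar>)\<^sup>2 \<le> b\<^sup>2 / 256" by (simp add: power_divide)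
  then show 1: "3 / 4 * b\<^sup>2 \<le> v" using v_close Kb by linarith
  show "v > 0" using 1 Kb by linarith
qed

lemma sqrt_v: "b / 2 \<le> sqrt v"
proof (rule real_le_rsqrt)
  show "(b / 2)\<^sup>2 \<le> v" proof -
    have "(b / 2)\<^sup>2 = b\<^sup>2 / 4" by (simp add: power_divide)
    then show ?thesis using v_bounds(1) Kb(5) by linarith
  qed
qed

lemma H_mean: "(\<integral>y. H y \<partial>Q) = 0"
  using WQ(1) Q.prob_space by (simp add: H_def wbar_def space_Q)

lemma H_third: "integrable Q (\<lambda>y. \<bar>H y\<bar> ^ 3)" "(\<integral>y. \<bar>H y\<bar> ^ 3 \<partial>Q) \<le> 2500 * (K * b ^ 3)"
proof -
  have i: "integrable Q (\<lambda>y. 4 * (\<bar>W y\<bar> ^ 3 + \<bar>wbar\<bar> ^ 3))" using WQ by simp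
  have [measurable]: "H \<in> borel_measurable Q" by (rule Q_measurable) simp
  have pw: "\<bar>H y\<bar> ^ 3 \<le> 4 * (\<bar>W y\<bar> ^ 3 + \<bar>wbar\<bar> ^ 3)" for y unfolding H_def by (rule abs_diff_cube_le)
  show iH: "integrable Q (\<lambda>y. \<bar>H y\<bar> ^ 3)"
    by (rule Bochner_Integration.integrable_bound[OF i]) (auto intro!: AE_I2 order_trans[OF pw])
  have "(\<integral>y. \<bar>H y\<bar> ^ 3 \<partial>Q) \<le> (\<integral>y. 4 * (\<bar>W y\<bar> ^ 3 + \<bar>wbar\<bar> ^ 3) \<partial>Q)"
    by (rule integral_mono[OF iH i pw])
  also have "\<dots> = 4 * ((\<integral>y. \<bar>W y\<bar> ^ 3 \<partial>Q) + \<bar>wbar\<bar> ^ 3)"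
    using WQ Q.prob_space by simp
  also have "(\<integral>y. \<bar>W y\<bar> ^ 3 \<partial>Q) \<le> 608 * (K * b ^ 3)"
  proof -
    have "(\<integral>y. \<bar>W y\<bar> ^ 3 \<partial>Q) * m = (\<integral>y. \<bar>W y\<bar> ^ 3 * tilt_factor (b * h y) \<partial>M)"
      using integral_Q[of "\<lambda>y. \<bar>W y\<bar> ^ 3"] m_bounds(4) by simp
    moreover have "(\<integral>y. \<bar>W y\<bar> ^ 3 \<partial>Q) * (1 / 2) \<le> (\<integral>y. \<bar>W y\<bar> ^ 3 \<partial>Q) * m"
      using m_bounds by (intro mult_left_mono Bochner_Integration.integral_nonneg) auto
    ultimately show ?thesis using W_third(2) by linarith
  qed
  also have "\<bar>wbar\<bar> ^ 3 \<le> K * b ^ 3"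
    using power_mono[OF wbar_abs(2) abs_ge_zero, of 3] b3 by linarith
  finally show "(\<integral>y. \<bar>H y\<bar> ^ 3 \<partial>Q) \<le> 2500 * (K * b ^ 3)" using Kb(4) by simp
qed

lemma psum_H: "finite I \<Longrightarrow> psum W I \<omega> = psum H I \<omega> + card I * wbar"
  by (simp add: psum_def H_def sum_subtractf)

text \<open>Under the tilted law the standard deviation is at least b/2 and the ratio of third
  moment to variance is of order K b. The factor b cancels in the second term, which is thus a pure
  K / sqrt(card I).\<close>

lemma tilted_concentration:
  assumes I: "finite I" "I \<noteq> {}" and l: "l \<ge> 0"
  shows "measure (PiM I (\<lambda>_. Q)) {\<omega> \<in> space (PiM I (\<lambda>_. Q)). a \<le> psum W I \<omega> \<and> psum W I \<omega> \<le> a + l}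
    \<le> 2 * l / (b * sqrt (card I)) + 14000 * K / sqrt (card I)"
proof -
  define \<rho> where "\<rho> = (\<integral>y. \<bar>H y\<bar> ^ 3 \<partial>Q)"
  have \<rho>: "0 \<le> \<rho>" "\<rho> \<le> 2500 * (K * b ^ 3)" using H_third by (auto simp: \<rho>_def intro!: Bochner_Integration.integral_nonneg)
  define s where "s = sqrt (card I)"
  have s: "s > 0" using I by (simp add: s_def card_gt_0_iff)
  have "{\<omega> \<in> space (PiM I (\<lambda>_. Q)). a \<le> psum W I \<omega> \<and> psum W I \<omega> \<le> a + l} =
    {\<omega> \<in> space (PiM I (\<lambda>_. Q)). (a - card I * wbar) \<le> psum H I \<omega> \<and> psum H I \<omega> \<le> (a - card I * wbar) + l}"
    using psum_H[OF I(1)] by auto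
  then have "measure (PiM I (\<lambda>_. Q)) {\<omega> \<in> space (PiM I (\<lambda>_. Q)). a \<le> psum W I \<omega> \<and> psum W I \<omega> \<le> a + l}
     \<le> (l + 2 * \<rho> / v) / sqrt (card I * v)"
    using Q.psum_concentration[OF I Q_measurable[OF H_meas] H_third(1) H_mean v_def[symmetric] v_bounds(2) \<rho>_def[symmetric] l] by simp
  also have "\<dots> \<le> (l + 7000 * (K * b)) / (b / 2 * s)"
  proof (rule frac_le)
    have "2 * \<rho> / v \<le> 2 * (2500 * (K * b ^ 3)) / (3 / 4 * b\<^sup>2)"
      using \<rho> v_bounds Kb by (intro frac_le) auto
    also have "\<dots> = 20000 / 3 * (K * b)" using b0 by (simp add: power2_eq_square power3_eq_cube field_simps)
    also have "\<dots> \<le> 7000 * (K * b)" using K1 b0 by (intro mult_right_mono) auto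
    finally show "l + 2 * \<rho> / v \<le> l + 7000 * (K * b)" by simp
    show "0 < b / 2 * s" using b0 s by simp
    show "b / 2 * s \<le> sqrt (card I * v)" unfolding real_sqrt_mult s_def[symmetric]
      using sqrt_v s by (simp add: mult.commute mult_left_mono)
    show "0 \<le> l + 7000 * (K * b)" using l K1 b0 by simp
  qed
  also have "\<dots> = 2 * l / (b * s) + 14000 * K / s" using b0 s by (simp add: field_simps)
  finally show ?thesis by (simp add: s_def)
qed

text \<open>After standardizing, T > x^2/2 becomes Z > a and exp(- T) becomes exp(- x^2/2) exp(-
  \<open>\<kappa>\<close> (Z - a)). Berry-Esseen leads to \<open>mills2 \<kappa> a\<close>, and
  closeness of \<open>\<kappa>\<close> to x and of a to 0 leads on to
  \<open>mills x\<close>.\<close>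

lemma tilted_half_line:
  assumes I: "finite I" and n: "card I = n" "n \<ge> 1" and x: "x > 0" and bx: "b = x / sqrt n"
    and ne: "sqrt n * \<bar>e\<bar> \<le> 1 / 24" and Kx: "K * (x * b) \<le> 1 / 10000"
  shows "\<bar>(\<integral>\<omega>. exp (- psum W I \<omega>) * indicator {\<omega> \<in> space (PiM I (\<lambda>_. Q)). psum W I \<omega> > x\<^sup>2 / 2} \<omega> \<partial>PiM I (\<lambda>_. Q))
      - exp (- x\<^sup>2 / 2) * mills x\<bar> \<le> exp (- x\<^sup>2 / 2) * (350000 * K\<^sup>2 * err x n e / (1 + x))"
proof -
  let ?QI = "PiM I (\<lambda>_. Q)"
  interpret QI: prob_space ?QI by (rule Q.prob_space_Pi)
  define y where "y = sqrt n"
  have y: "y \<ge> 1" "y\<^sup>2 = n" "b * y = x" using n bx by (auto simp: y_def)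
  have I0: "I \<noteq> {}" using n by auto
  define \<rho> where "\<rho> = (\<integral>z. \<bar>H z\<bar> ^ 3 \<partial>Q)"
  have \<rho>: "0 \<le> \<rho>" "\<rho> \<le> 2500 * (K * b ^ 3)" using H_third by (auto simp: \<rho>_def intro!: Bochner_Integration.integral_nonneg)
  define \<kappa> where "\<kappa> = sqrt (n * v)"
  have \<kappa>eq: "\<kappa> = y * sqrt v" by (simp add: \<kappa>_def y_def real_sqrt_mult)
  have \<kappa>: "\<kappa> \<ge> x / 2" "\<kappa> > 0"
  proof -
    have "y * (b / 2) \<le> \<kappa>" unfolding \<kappa>eq using sqrt_v y by (intro mult_left_mono) auto
    then show "\<kappa> \<ge> x / 2" using y(3) by (simp add: mult.commute)
    then show "\<kappa> > 0" using x by simp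
  qed
  define a where "a = (x\<^sup>2 / 2 - n * wbar) / \<kappa>"
  define Z where "Z = (\<lambda>\<omega>. psum H I \<omega> / \<kappa>)"
  have [measurable]: "Z \<in> borel_measurable ?QI"
    unfolding Z_def using psum_measurable[OF Q_measurable[OF H_meas]] by simp
  \<comment> \<open>The Berry-Esseen constant 22 times the bound 20000/3 * K for the normalized
    third moment, rounded up.\<close>
  define \<delta> where "\<delta> = 150000 * K / y"
  have BE: "\<bar>measure ?QI {\<omega> \<in> space ?QI. Z \<omega> \<le> z} - Phi z\<bar> \<le> \<delta>" for z
  proof -
    have "\<bar>measure ?QI {\<omega> \<in> space ?QI. Z \<omega> \<le> z} - Phi z\<bar> \<le> 22 * (\<rho> / (v * sqrt v * y))"
      using Q.berry_esseen[OF I I0 Q_measurable[OF H_meas] H_third(1) H_mean v_def[symmetric] v_bounds(2) \<rho>_def[symmetric], of z]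
      by (simp add: Z_def \<kappa>_def y_def n)
    also have "\<rho> / (v * sqrt v * y) \<le> (2500 * (K * b ^ 3)) / (3 / 4 * b\<^sup>2 * (b / 2) * y)"
      using \<rho> v_bounds sqrt_v Kb b0 y by (intro frac_le mult_mono mult_pos_pos) auto
    also have "\<dots> = (20000 / 3) * K / y" using b0 y by (simp add: power2_eq_square power3_eq_cube field_simps)
    also have "22 * ((20000 / 3) * K / y) \<le> \<delta>" unfolding \<delta>_def using K1 y by (simp add: field_simps)
    finally show ?thesis by simp
  qed
  have eq: "exp (- psum W I \<omega>) * indicator {\<omega> \<in> space ?QI. psum W I \<omega> > x\<^sup>2 / 2} \<omega> =
      exp (- x\<^sup>2 / 2) * (indicator {a<..} (Z \<omega>) * exp (- (\<kappa> * (Z \<omega> - a))))" if "\<omega> \<in> space ?QI" for \<omega>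
  proof -
    have k: "\<kappa> * (Z \<omega> - a) = psum W I \<omega> - x\<^sup>2 / 2"
    proof -
      have "\<kappa> * Z \<omega> = psum H I \<omega>" "\<kappa> * a = x\<^sup>2 / 2 - n * wbar" using \<kappa>(2) by (simp_all add: Z_def a_def)
      then show ?thesis using psum_H[OF I, of \<omega>] n by (simp add: right_diff_distrib)
    qed
    have "psum W I \<omega> > x\<^sup>2 / 2 \<longleftrightarrow> Z \<omega> > a"
    proof -
      have "psum W I \<omega> > x\<^sup>2 / 2 \<longleftrightarrow> \<kappa> * (Z \<omega> - a) > 0" unfolding k by simp
      then show ?thesis using \<kappa>(2) by (simp add: zero_less_mult_iff)
    qed
    then show ?thesis using that unfolding k by (simp add: indicator_def flip: exp_add)
  qed
  have "(\<integral>\<omega>. exp (- psum W I \<omega>) * indicator {\<omega> \<in> space ?QI. psum W I \<omega> > x\<^sup>2 / 2} \<omega> \<partial>?QI) =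
      (\<integral>\<omega>. exp (- x\<^sup>2 / 2) * (indicator {a<..} (Z \<omega>) * exp (- (\<kappa> * (Z \<omega> - a)))) \<partial>?QI)"
    by (rule Bochner_Integration.integral_cong[OF refl eq])
  then have I1: "(\<integral>\<omega>. exp (- psum W I \<omega>) * indicator {\<omega> \<in> space ?QI. psum W I \<omega> > x\<^sup>2 / 2} \<omega> \<partial>?QI) =
      exp (- x\<^sup>2 / 2) * (\<integral>\<omega>. indicator {a<..} (Z \<omega>) * exp (- (\<kappa> * (Z \<omega> - a))) \<partial>?QI)"
    by simp
  have d1: "\<bar>(\<integral>\<omega>. indicator {a<..} (Z \<omega>) * exp (- (\<kappa> * (Z \<omega> - a))) \<partial>?QI) - mills2 \<kappa> a\<bar> \<le> 2 * \<delta>"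
    by (rule QI.exponential_functional_normal_approx[OF _ \<kappa>(2) BE]) simp
  have a_le: "\<bar>a\<bar> \<le> 6 * (y * \<bar>e\<bar>) + 44 * (K * (x * b))"
  proof -
    have xx: "x\<^sup>2 / 2 = n * (b\<^sup>2 / 2)" using y(2,3) by (simp add: power_mult_distrib[symmetric] flip: y(2)) (simp add: mult.commute)
    have "\<bar>x\<^sup>2 / 2 - n * wbar\<bar> = n * \<bar>wbar - b\<^sup>2 / 2\<bar>"
    proof -
      have "x\<^sup>2 / 2 - n * wbar = n * (b\<^sup>2 / 2 - wbar)" unfolding xx by (simp add: right_diff_distrib)
      then show ?thesis by (simp add: abs_mult abs_minus_commute)
    qed
    also have "\<dots> \<le> n * (3 * (b * \<bar>e\<bar>) + 22 * (K * b ^ 3))" using wbar_close by (intro mult_left_mono) auto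
    also have "\<dots> = (6 * (y * \<bar>e\<bar>) + 44 * (K * (x * b))) * (x / 2)"
      unfolding y(2)[symmetric] y(3)[symmetric] by (simp add: power2_eq_square power3_eq_cube algebra_simps)
    finally have "\<bar>x\<^sup>2 / 2 - n * wbar\<bar> \<le> (6 * (y * \<bar>e\<bar>) + 44 * (K * (x * b))) * (x / 2)" .
    also have "\<dots> \<le> (6 * (y * \<bar>e\<bar>) + 44 * (K * (x * b))) * \<kappa>"
      using \<kappa> y K1 x b0 by (intro mult_left_mono) auto
    finally show ?thesis using \<kappa>(2) by (simp add: a_def abs_divide pos_divide_le_eq)
  qed
  have a1: "\<bar>a\<bar> \<le> 1" using a_le ne Kx by (simp add: y_def)
  \<comment> \<open>The difference of the roots is recovered from v - b^2 through the conjugate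
    factor sqrt v + b, which is at least b.\<close>
  have \<kappa>x: "\<bar>\<kappa> - x\<bar> \<le> x * (412 * (K * b) + 18 * e\<^sup>2)"
  proof -
    have sv: "sqrt v > 0" using v_bounds by simp
    have "(sqrt v - b) * (sqrt v + b) = v - b\<^sup>2" using v_bounds by (simp add: algebra_simps power2_eq_square)
    then have "\<bar>sqrt v - b\<bar> * (sqrt v + b) = \<bar>v - b\<^sup>2\<bar>" using sv b0 by (metis abs_mult abs_of_pos add_pos_pos)
    moreover have "\<bar>sqrt v - b\<bar> * b \<le> \<bar>sqrt v - b\<bar> * (sqrt v + b)" using sv by (intro mult_left_mono) auto
    ultimately have "\<bar>sqrt v - b\<bar> * b \<le> 412 * (K * b ^ 3) + 18 * (b * \<bar>e\<bar>)\<^sup>2" using v_close by linarith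
    also have "\<dots> = (b * (412 * (K * b) + 18 * e\<^sup>2)) * b"
      by (simp add: power2_eq_square power3_eq_cube algebra_simps)
    finally have "\<bar>sqrt v - b\<bar> \<le> b * (412 * (K * b) + 18 * e\<^sup>2)"
      using b0 by (rule mult_right_le_imp_le)
    then have "y * \<bar>sqrt v - b\<bar> \<le> y * (b * (412 * (K * b) + 18 * e\<^sup>2))" using y by (intro mult_left_mono) auto
    moreover have "\<bar>\<kappa> - x\<bar> = y * \<bar>sqrt v - b\<bar>"
    proof -
      have "\<kappa> - x = y * (sqrt v - b)" using y(3) by (simp add: \<kappa>eq right_diff_distrib mult.commute)
      then show ?thesis using y by (simp add: abs_mult)
    qed
    ultimately show ?thesis unfolding y(3)[symmetric] by (simp only: mult_ac)
  qed
  define R where "R = err x n e"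
  have R: "b \<le> R" "y * \<bar>e\<bar> \<le> R" "(x * b)\<^sup>2 \<le> R" "(1 + x) / y \<le> R"
  proof -
    have t: "0 \<le> (1 + x ^ 4) / n" "0 \<le> (1 + x) * y * \<bar>e\<bar>" "0 \<le> (1 + x) / y" using x y n by auto
    have R': "R = (1 + x ^ 4) / n + (1 + x) * y * \<bar>e\<bar> + (1 + x) / y" by (simp add: R_def err_def y_def)
    show r4: "(1 + x) / y \<le> R" using t R' by linarith
    have "b = x / y" using y by (simp add: field_simps)
    then have "b \<le> (1 + x) / y" using y by (simp add: divide_right_mono)
    then show "b \<le> R" using r4 by linarith
    have "1 * (y * \<bar>e\<bar>) \<le> (1 + x) * (y * \<bar>e\<bar>)" using x y by (intro mult_right_mono) auto
    then have "y * \<bar>e\<bar> \<le> (1 + x) * y * \<bar>e\<bar>" by (simp add: mult.assoc)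
    then show "y * \<bar>e\<bar> \<le> R" using t R' by linarith
    have "(x * b)\<^sup>2 = x ^ 4 / n" unfolding \<open>b = x / y\<close> by (simp add: power_divide power_mult_distrib y(2) flip: power_mult power_add)
    also have "\<dots> \<le> (1 + x ^ 4) / n" by (simp add: divide_right_mono)
    finally show "(x * b)\<^sup>2 \<le> R" using t R' by linarith
  qed
  have e2: "e\<^sup>2 \<le> y * \<bar>e\<bar>" "(y * \<bar>e\<bar>)\<^sup>2 \<le> y * \<bar>e\<bar>"
  proof -
    have "\<bar>e\<bar> * \<bar>e\<bar> \<le> y * \<bar>e\<bar>" using e_small y by (intro mult_right_mono) auto
    then show "e\<^sup>2 \<le> y * \<bar>e\<bar>" by (simp add: power2_eq_square)
    have "(y * \<bar>e\<bar>) * (y * \<bar>e\<bar>) \<le> 1 * (y * \<bar>e\<bar>)" using ne y by (intro mult_right_mono) (auto simp: y_def)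
    then show "(y * \<bar>e\<bar>)\<^sup>2 \<le> y * \<bar>e\<bar>" by (simp add: power2_eq_square)
  qed
  \<comment> \<open>The rate m = x/2 lies below both \<open>\<kappa>\<close> and x.\<close>
  have "\<bar>mills2 \<kappa> a - mills x\<bar> \<le> 8 * (\<bar>\<kappa> - x\<bar> + \<bar>a\<bar>) / (1 + x / 2)\<^sup>2 + 4 * a\<^sup>2 / (1 + x / 2)"
    using x \<kappa> by (intro mills2_close a1) auto
  also have "\<dots> \<le> 8 * (\<bar>\<kappa> - x\<bar> + \<bar>a\<bar>) / ((1 + x) / 2)\<^sup>2 + 4 * a\<^sup>2 / ((1 + x) / 2)"
    using x by (intro add_mono divide_left_mono power_mono mult_pos_pos) auto
  also have "\<dots> = (32 * ((\<bar>\<kappa> - x\<bar> + \<bar>a\<bar>) / (1 + x)) + 8 * a\<^sup>2) / (1 + x)"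
    using x by (simp add: power2_eq_square divide_simps)
  also have "\<dots> \<le> (50000 * K\<^sup>2 * R) / (1 + x)"
  proof (rule divide_right_mono)
    have x1: "x \<le> 1 + x" "1 \<le> 1 + x" using x by auto
    have K2: "K \<le> K\<^sup>2" using K1 by (simp add: power2_eq_square mult_le_cancel_left1)
    have K3: "1 \<le> K\<^sup>2" using K1 by simp
    have "(\<bar>\<kappa> - x\<bar> + \<bar>a\<bar>) \<le> (412 * (K * b) + 18 * e\<^sup>2 + (6 * (y * \<bar>e\<bar>) + 44 * (K * b))) * (1 + x)"
    proof -
      have "x * (412 * (K * b) + 18 * e\<^sup>2) \<le> (1 + x) * (412 * (K * b) + 18 * e\<^sup>2)"
        using x1 K1 b0 by (intro mult_right_mono) auto
      moreover have "(6 * (y * \<bar>e\<bar>)) * 1 \<le> (6 * (y * \<bar>e\<bar>)) * (1 + x)" using x1 y by (intro mult_left_mono) auto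
      moreover have "44 * (K * b) * x \<le> 44 * (K * b) * (1 + x)" using x1 K1 b0 by (intro mult_left_mono) auto
      moreover have "44 * (K * (x * b)) = 44 * (K * b) * x" by simp
      moreover have "(412 * (K * b) + 18 * e\<^sup>2 + (6 * (y * \<bar>e\<bar>) + 44 * (K * b))) * (1 + x) =
        (1 + x) * (412 * (K * b) + 18 * e\<^sup>2) + (6 * (y * \<bar>e\<bar>)) * (1 + x) + 44 * (K * b) * (1 + x)"
        by (simp add: algebra_simps)
      ultimately show ?thesis using \<kappa>x a_le by linarith
    qed
    then have f1: "(\<bar>\<kappa> - x\<bar> + \<bar>a\<bar>) / (1 + x) \<le> 456 * (K * b) + 18 * e\<^sup>2 + 6 * (y * \<bar>e\<bar>)"
      using x by (simp add: pos_divide_le_eq algebra_simps)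
    have f2: "a\<^sup>2 \<le> 72 * (y * \<bar>e\<bar>)\<^sup>2 + 3872 * (K\<^sup>2 * (x * b)\<^sup>2)"
    proof -
      have "a\<^sup>2 \<le> (6 * (y * \<bar>e\<bar>) + 44 * (K * (x * b)))\<^sup>2" using power_mono[OF a_le abs_ge_zero, of 2] by simp
      also have "\<dots> \<le> 2 * (6 * (y * \<bar>e\<bar>))\<^sup>2 + 2 * (44 * (K * (x * b)))\<^sup>2"
        by (smt (verit) power2_sum sum_squares_bound)
      finally show ?thesis by (simp add: power_mult_distrib)
    qed
    have f3: "K * b \<le> K\<^sup>2 * R" using K2 R b0 K1 by (intro mult_mono) auto
    have f4: "y * \<bar>e\<bar> \<le> K\<^sup>2 * R"
    proof -
      have "1 * (y * \<bar>e\<bar>) \<le> K\<^sup>2 * R" using K3 R y by (intro mult_mono) auto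
      then show ?thesis by simp
    qed
    have f5: "K\<^sup>2 * (x * b)\<^sup>2 \<le> K\<^sup>2 * R" using R by (intro mult_left_mono) auto
    have lin: "32 * p + 8 * q \<le> 50000 * r"
      if "p \<le> 456 * k + 18 * e2 + 6 * t" "q \<le> 72 * t2 + 3872 * u" "k \<le> r" "t \<le> r" "u \<le> r" "e2 \<le> t" "t2 \<le> t" "0 \<le> t"
      for p q r k e2 t t2 u :: real using that by linarith
    have "32 * ((\<bar>\<kappa> - x\<bar> + \<bar>a\<bar>) / (1 + x)) + 8 * a\<^sup>2 \<le> 50000 * (K\<^sup>2 * R)" by (rule lin[OF f1 f2 f3 f4 f5 e2]) (use y in simp)
    then show "32 * ((\<bar>\<kappa> - x\<bar> + \<bar>a\<bar>) / (1 + x)) + 8 * a\<^sup>2 \<le> 50000 * K\<^sup>2 * R" by simp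
  qed (use x in simp)
  finally have d2: "\<bar>mills2 \<kappa> a - mills x\<bar> \<le> (50000 * K\<^sup>2 * R) / (1 + x)" .
  \<comment> \<open>The Berry-Esseen error has no decay in x, so it is here that the term (1+x) /
    sqrt n of \<open>err\<close> is indispensable.\<close>
  have "2 * \<delta> \<le> (300000 * K\<^sup>2 * R) / (1 + x)"
  proof -
    have "K * ((1 + x) / y) \<le> K\<^sup>2 * R"
      using R K1 x y by (intro mult_mono) (auto simp: power2_eq_square mult_le_cancel_left1)
    then have "300000 * (K * ((1 + x) / y)) \<le> 300000 * (K\<^sup>2 * R)" by simp
    moreover have "2 * \<delta> * (1 + x) = 300000 * (K * ((1 + x) / y))" by (simp add: \<delta>_def)
    ultimately show ?thesis using x by (simp add: pos_le_divide_eq mult.assoc)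
  qed
  then have "\<bar>(\<integral>\<omega>. indicator {a<..} (Z \<omega>) * exp (- (\<kappa> * (Z \<omega> - a))) \<partial>?QI) - mills x\<bar> \<le> (300000 * K\<^sup>2 * R) / (1 + x) + (50000 * K\<^sup>2 * R) / (1 + x)"
    by (rule abs_diff_chain[OF _ d1 d2])
  also have "\<dots> = 350000 * K\<^sup>2 * R / (1 + x)" by (simp add: add_divide_distrib[symmetric])
  finally have fin: "\<bar>(\<integral>\<omega>. indicator {a<..} (Z \<omega>) * exp (- (\<kappa> * (Z \<omega> - a))) \<partial>?QI) - mills x\<bar> \<le> 350000 * K\<^sup>2 * R / (1 + x)" .
  show ?thesis unfolding I1 right_diff_distrib[symmetric] abs_mult abs_exp_cancel R_def[symmetric]
    by (intro mult_left_mono fin) simp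
qed

end

subsection \<open>The self-normalized event\<close>

text \<open>In V - x^2 = (sqrt V - x) (sqrt V + x) the second factor dominates both |sqrt V - x| and
  x. The quadratic estimate bounds the width of the window; the linear one fits into exponential
  moments.\<close>

lemma sqrt_deviation:
  assumes "x > 0" "V \<ge> (0::real)"
  shows "(sqrt V - x)\<^sup>2 \<le> \<bar>V - x\<^sup>2\<bar>" "x\<^sup>2 * (sqrt V - x)\<^sup>2 \<le> (V - x\<^sup>2)\<^sup>2"
proof -
  have eq: "V - x\<^sup>2 = (sqrt V - x) * (sqrt V + x)" using assms by (simp add: algebra_simps power2_eq_square)
  have s: "sqrt V \<ge> 0" using assms by simp
  have "\<bar>sqrt V - x\<bar> * \<bar>sqrt V - x\<bar> \<le> \<bar>sqrt V - x\<bar> * \<bar>sqrt V + x\<bar>"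
    by (rule mult_left_mono) (use assms(1) s in linarith, simp)
  then show "(sqrt V - x)\<^sup>2 \<le> \<bar>V - x\<^sup>2\<bar>" unfolding eq abs_mult by (simp add: power2_eq_square)
  have "x\<^sup>2 \<le> (sqrt V + x)\<^sup>2" using assms s by (intro power_mono) auto
  then have "x\<^sup>2 * (sqrt V - x)\<^sup>2 \<le> (sqrt V + x)\<^sup>2 * (sqrt V - x)\<^sup>2" by (intro mult_right_mono) auto
  then show "x\<^sup>2 * (sqrt V - x)\<^sup>2 \<le> (V - x\<^sup>2)\<^sup>2" unfolding eq by (simp add: power_mult_distrib mult.commute)
qed

text \<open>The right side is 4 (exp g - exp(- g))^2, so a weighted second moment is reduced to two
  Laplace transforms. The subtracted 2 matters: it leaves a quantity of the size of the variance
  instead of order 1.\<close>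

lemma square_exp_le: "g\<^sup>2 * exp \<bar>g\<bar> \<le> 4 * (exp (2 * g) + exp (- (2 * g)) - 2)" for g :: real
proof -
  have *: "g\<^sup>2 * exp g \<le> 4 * (exp (2 * g) + exp (- (2 * g)) - 2)" if "g \<ge> 0" for g :: real
  proof -
    have "exp (g / 2) * (g / 2) \<le> exp g - exp (- g)"
    proof -
      have "1 + g / 2 \<le> exp (g / 2)" by (rule exp_ge_add_one_self)
      moreover have "exp (- (3 * g / 2)) \<le> 1" using that by simp
      ultimately have "exp (g / 2) * (g / 2) \<le> exp (g / 2) * (exp (g / 2) - exp (- (3 * g / 2)))"
        by (intro mult_left_mono) (linarith, simp)
      also have "\<dots> = exp g - exp (- g)" by (simp add: right_diff_distrib flip: exp_add)
      finally show ?thesis .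
    qed
    then have "(exp (g / 2) * (g / 2))\<^sup>2 \<le> (exp g - exp (- g))\<^sup>2" using that by (intro power_mono) auto
    moreover have "(exp (g / 2) * (g / 2))\<^sup>2 = exp g * g\<^sup>2 / 4"
      by (simp add: power_mult_distrib power_divide flip: exp_double)
    moreover have "(exp g - exp (- g))\<^sup>2 = exp (2 * g) + exp (- (2 * g)) - 2"
      by (simp add: power2_diff exp_double[symmetric] flip: exp_add)
    ultimately have "exp g * g\<^sup>2 / 4 \<le> exp (2 * g) + exp (- (2 * g)) - 2" by (simp only:)
    then show ?thesis by (simp add: mult.commute)
  qed
  show ?thesis using *[of g] *[of "-g"] by (cases "g \<ge> 0") (auto simp: add.commute)
qed

lemma exp_quadratic_upper: "\<bar>z\<bar> \<le> 2 \<Longrightarrow> exp z \<le> 1 + z + 4 * z\<^sup>2" for z :: real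
proof -
  assume z: "\<bar>z\<bar> \<le> 2"
  obtain t where t: "\<bar>t\<bar> \<le> \<bar>z\<bar>" "exp z = (\<Sum>m<2. z ^ m / fact m) + exp t / fact 2 * z\<^sup>2"
    using Maclaurin_exp_le[of z 2] by blast
  have "exp t \<le> exp 2" using t z by simp
  also have "exp 2 \<le> (8::real)"
  proof -
    have "exp 2 = exp 1 * exp (1::real)" by (simp flip: exp_add)
    also have "\<dots> \<le> 2.8 * 2.8" using e_less_272 by (intro mult_mono) auto
    finally show ?thesis by simp
  qed
  finally have "exp t / fact 2 * z\<^sup>2 \<le> 8 / fact 2 * z\<^sup>2" by (intro mult_right_mono divide_right_mono) auto
  then show ?thesis using t(2) by (simp add: eval_nat_numeral)
qed

text \<open>Cauchy-Schwarz: s + c r <= sqrt(1 + c^2) sqrt(s^2 + r^2) with c^2 = x^2 - 1 and r^2 = V.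
  However large the summand s is, the rest must pass its own self-normalized level with x^2 lowered
  by one.\<close>

lemma sqrt_two_terms:
  fixes s S V x :: real
  assumes x: "x \<ge> 1" and V: "V \<ge> 0" and gt: "s + S > x * sqrt (s\<^sup>2 + V)"
  shows "S > sqrt (x\<^sup>2 - 1) * sqrt V"
proof (rule ccontr)
  assume "\<not> S > sqrt (x\<^sup>2 - 1) * sqrt V"
  then have S: "s + S \<le> s + sqrt (x\<^sup>2 - 1) * sqrt V" by simp
  define c where "c = sqrt (x\<^sup>2 - 1)"
  have c: "c\<^sup>2 = x\<^sup>2 - 1" "c \<ge> 0" using x by (simp_all add: c_def power2_eq_square mult_ge1_I)
  define r where "r = sqrt V"
  have r: "r\<^sup>2 = V" "r \<ge> 0" using V by (simp_all add: r_def)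
  have "0 \<le> (c * s - r)\<^sup>2" by simp
  then have "(s + c * r)\<^sup>2 \<le> (1 + c\<^sup>2) * (s\<^sup>2 + r\<^sup>2)" by (simp add: power2_eq_square algebra_simps)
  then have "(s + c * r)\<^sup>2 \<le> x\<^sup>2 * (s\<^sup>2 + V)" using c r by simp
  then have "sqrt ((s + c * r)\<^sup>2) \<le> sqrt (x\<^sup>2 * (s\<^sup>2 + V))" by (rule real_sqrt_le_mono)
  then have "\<bar>s + c * r\<bar> \<le> x * sqrt (s\<^sup>2 + V)" using x by (simp add: real_sqrt_mult)
  then show False using S gt by (simp add: c_def r_def)
qed

text \<open>Multiplying out avoids a quotient by a possibly vanishing norm, and any index set is
  allowed because the induction passes to subsamples.\<close>

definition selfnorm_event :: "'a measure \<Rightarrow> ('a \<Rightarrow> real) \<Rightarrow> real \<Rightarrow> nat set \<Rightarrow> (nat \<Rightarrow> 'a) set" where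
  "selfnorm_event M h x I = {\<omega> \<in> space (PiM I (\<lambda>_. M)). psum h I \<omega> > x * sqrt (psum (\<lambda>z. (h z)\<^sup>2) I \<omega>)}"

lemma selfnorm_event_sets[measurable]:
  assumes [measurable]: "h \<in> borel_measurable M"
  shows "selfnorm_event M h x I \<in> sets (PiM I (\<lambda>_. M))"
proof -
  have [measurable]: "psum (\<lambda>z. (h z)\<^sup>2) I \<in> borel_measurable (PiM I (\<lambda>_. M))" by (rule psum_measurable) measurable
  show ?thesis unfolding selfnorm_event_def by measurable
qed

section \<open>The event as a half line with a random window, and tilted moments of the
  squares\<close>

context tilting
begin

definition V2 :: "nat set \<Rightarrow> (nat \<Rightarrow> 'a) \<Rightarrow> real" where "V2 I = psum (\<lambda>z. (b * h z)\<^sup>2) I"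

lemma V2_meas[measurable]: "V2 I \<in> borel_measurable (PiM I (\<lambda>_. M))"
  unfolding V2_def by (rule psum_measurable) measurable

lemma V2_nonneg: "V2 I \<omega> \<ge> 0" unfolding V2_def psum_def by (rule sum_nonneg) simp

lemma psum_W: "psum W I \<omega> = b * psum h I \<omega> - V2 I \<omega> / 2"
  unfolding V2_def psum_def W_def tilt_exponent_def
  by (simp add: sum_subtractf sum_distrib_left sum_divide_distrib)

text \<open>Completing the square: x (b V) - (b V)^2/2 = x^2/2 - (b V - x)^2/2. All randomness of
  the threshold is in the squared deviation of b V from x.\<close>

lemma event_iff:
  assumes "\<omega> \<in> space (PiM I (\<lambda>_. M))"
  shows "\<omega> \<in> selfnorm_event M h x I \<longleftrightarrow> psum W I \<omega> > x\<^sup>2 / 2 - (sqrt (V2 I \<omega>) - x)\<^sup>2 / 2"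
proof -
  have "V2 I \<omega> = b\<^sup>2 * psum (\<lambda>z. (h z)\<^sup>2) I \<omega>"
    by (simp add: V2_def psum_def power_mult_distrib sum_distrib_left)
  then have "sqrt (V2 I \<omega>) = b * sqrt (psum (\<lambda>z. (h z)\<^sup>2) I \<omega>)" using b0 by (simp add: real_sqrt_mult)
  then have "psum h I \<omega> > x * sqrt (psum (\<lambda>z. (h z)\<^sup>2) I \<omega>) \<longleftrightarrow> b * psum h I \<omega> > x * sqrt (V2 I \<omega>)"
    using b0 by (simp add: mult.left_commute)
  also have "\<dots> \<longleftrightarrow> psum W I \<omega> > x\<^sup>2 / 2 - (sqrt (V2 I \<omega>) - x)\<^sup>2 / 2"
    unfolding psum_W using V2_nonneg[of I \<omega>] by (simp add: power2_diff) (simp add: field_simps)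
  finally show ?thesis using assms by (simp add: selfnorm_event_def)
qed

lemma square_Q:
  shows "integrable Q (\<lambda>y. (b * h y)\<^sup>2)" "\<bar>(\<integral>y. (b * h y)\<^sup>2 \<partial>Q) - b\<^sup>2\<bar> \<le> 10 * (K * b ^ 3)"
    "integrable Q (\<lambda>y. (if \<bar>b * h y\<bar> \<le> 1 then (b * h y)\<^sup>2 else 0))"
    "\<bar>(\<integral>y. (if \<bar>b * h y\<bar> \<le> 1 then (b * h y)\<^sup>2 else 0) \<partial>Q) - b\<^sup>2\<bar> \<le> 10 * (K * b ^ 3)"
proof -
  \<comment> \<open>Plain and truncated squares satisfy the same pointwise estimate after
    multiplication by the tilting factor, so one argument serves for both.\<close>
  have gen: "integrable Q f \<and> \<bar>(\<integral>y. f y \<partial>Q) - b\<^sup>2\<bar> \<le> 10 * (K * b ^ 3)"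
    if [measurable]: "f \<in> borel_measurable M" and f: "\<And>y. \<bar>f y * tilt_factor (b * h y) - (b * h y)\<^sup>2\<bar> \<le> 4 * \<bar>b * h y\<bar> ^ 3" for f :: "'a \<Rightarrow> real"
  proof -
    have g: "integrable M (\<lambda>y. b\<^sup>2 * (h y)\<^sup>2)" using h2 by simp
    have gi: "(\<integral>y. b\<^sup>2 * (h y)\<^sup>2 \<partial>M) = b\<^sup>2" using h2 var1 by simp
    have "\<bar>f y * tilt_factor (b * h y) - b\<^sup>2 * (h y)\<^sup>2\<bar> \<le> 4 * \<bar>b * h y\<bar> ^ 3" for y
      using f[of y] by (simp add: power_mult_distrib)
    note c = integral_close3[OF _ g _ this, unfolded gi]
    have i: "integrable M (\<lambda>y. f y * tilt_factor (b * h y))" by (rule c(1)) auto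
    define Y where "Y = (\<integral>y. f y * tilt_factor (b * h y) \<partial>M)"
    have Y: "\<bar>Y - b\<^sup>2\<bar> \<le> 4 * (K * b ^ 3)" unfolding Y_def by (rule c(2)) auto
    define E2 where "E2 = (\<integral>y. f y \<partial>Q)"
    have "E2 * m = Y" using integral_Q[of f] m_bounds(4) by (simp add: E2_def Y_def)
    then have eq: "(E2 - b\<^sup>2) * m = (Y - b\<^sup>2) + b\<^sup>2 * (1 - m)" by (simp add: algebra_simps)
    have r: "\<bar>b\<^sup>2 * (1 - m)\<bar> \<le> K * b ^ 3"
    proof -
      have "\<bar>b\<^sup>2 * (1 - m)\<bar> \<le> b\<^sup>2 * b"
        unfolding abs_mult using m_bounds(1) by (intro mult_mono) (auto simp: abs_minus_commute)
      then show ?thesis using b3 by (simp add: power2_eq_square power3_eq_cube)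
    qed
    have lin: "\<bar>p + q\<bar> \<le> 5 * k" if "\<bar>p\<bar> \<le> 4 * k" "\<bar>q\<bar> \<le> k" for p q k :: real using that by linarith
    have "\<bar>(E2 - b\<^sup>2) * m\<bar> \<le> 5 * (K * b ^ 3)" unfolding eq by (rule lin[OF Y r])
    moreover have "\<bar>(E2 - b\<^sup>2) * m\<bar> \<ge> \<bar>E2 - b\<^sup>2\<bar> * (1 / 2)"
      unfolding abs_mult using m_bounds by (intro mult_left_mono) auto
    ultimately have "\<bar>E2 - b\<^sup>2\<bar> \<le> 2 * (5 * (K * b ^ 3))" by (rule le_twice[rotated])
    then show ?thesis using i by (simp add: E2_def integrable_Q_iff)
  qed
  show "integrable Q (\<lambda>y. (b * h y)\<^sup>2)" "\<bar>(\<integral>y. (b * h y)\<^sup>2 \<partial>Q) - b\<^sup>2\<bar> \<le> 10 * (K * b ^ 3)"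
    using gen[of "\<lambda>y. (b * h y)\<^sup>2"] square_tilt_factor(1) by auto
  show "integrable Q (\<lambda>y. (if \<bar>b * h y\<bar> \<le> 1 then (b * h y)\<^sup>2 else 0))"
    "\<bar>(\<integral>y. (if \<bar>b * h y\<bar> \<le> 1 then (b * h y)\<^sup>2 else 0) \<partial>Q) - b\<^sup>2\<bar> \<le> 10 * (K * b ^ 3)"
    using gen[of "\<lambda>y. (if \<bar>b * h y\<bar> \<le> 1 then (b * h y)\<^sup>2 else 0)"] square_tilt_factor(2) by auto
qed

lemma fourth_Q: "integrable Q (\<lambda>y. (b * h y) ^ 4)" "(\<integral>y. (b * h y) ^ 4 \<partial>Q) \<le> 4 * (K * b ^ 4)"
proof -
  have "\<bar>(b * h y) ^ 4 * tilt_factor (b * h y) - 0\<bar> \<le> 2 * (b * h y) ^ 4" for y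
    using tilt_factor_le[of "b * h y"] tilt_factor_pos[of "b * h y"] by (simp add: abs_mult mult.commute[of _ "tilt_factor _"] mult_right_mono)
  note c = integral_close4[OF _ _ _ this]
  have i: "integrable M (\<lambda>y. (b * h y) ^ 4 * tilt_factor (b * h y))" by (rule c(1)) auto
  show "integrable Q (\<lambda>y. (b * h y) ^ 4)" using i by (simp add: integrable_Q_iff)
  define E4 where "E4 = (\<integral>y. (b * h y) ^ 4 \<partial>Q)"
  have nn: "E4 \<ge> 0" unfolding E4_def by (rule Bochner_Integration.integral_nonneg) simp
  have "E4 * m = (\<integral>y. (b * h y) ^ 4 * tilt_factor (b * h y) \<partial>M)"
    using integral_Q[of "\<lambda>y. (b * h y) ^ 4"] m_bounds(4) by (simp add: E4_def)
  also have "\<dots> \<le> 2 * (K * b ^ 4)" using c(2) by simp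
  finally have "E4 * m \<le> 2 * (K * b ^ 4)" .
  moreover have "E4 * (1 / 2) \<le> E4 * m" using m_bounds nn by (intro mult_left_mono) auto
  ultimately have "E4 \<le> 2 * (2 * (K * b ^ 4))" by (rule le_twice[rotated])
  then show "(\<integral>y. (b * h y) ^ 4 \<partial>Q) \<le> 4 * (K * b ^ 4)" by (simp add: E4_def)
qed

text \<open>Centred at b^2 and not at the tilted mean, so that over the full sample the sum is
  exactly \<open>V2\<close> minus x^2.\<close>

definition gg :: "'a \<Rightarrow> real" where "gg z = (b * h z)\<^sup>2 - b\<^sup>2"

lemma gg_meas[measurable]: "gg \<in> borel_measurable M" unfolding gg_def[abs_def] by measurable

text \<open>Variance plus squared bias: the tilted fourth moment gives the first term, and the
  distance 10 K b^3 of the tilted mean from b^2, times the number of summands, gives the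
  second.\<close>

lemma gg_second_moment:
  assumes I: "finite I" and n: "card I \<le> n"
  shows "integrable (PiM I (\<lambda>_. Q)) (\<lambda>\<omega>. (psum gg I \<omega>)\<^sup>2)"
    "(\<integral>\<omega>. (psum gg I \<omega>)\<^sup>2 \<partial>PiM I (\<lambda>_. Q)) \<le> 8 * (K * (n * b ^ 4)) + 200 * (K * (n * b ^ 3))\<^sup>2"
proof -
  let ?Q = "PiM I (\<lambda>_. Q)"
  interpret QI: prob_space ?Q by (rule Q.prob_space_Pi)
  define f where "f = (\<lambda>y. (b * h y)\<^sup>2)"
  have [measurable]: "f \<in> borel_measurable M" unfolding f_def by measurable
  have fQ: "integrable Q f" using square_Q(1) by (simp add: f_def)
  have f2: "(f y)\<^sup>2 = (b * h y) ^ 4" for y by (simp add: f_def flip: power_mult)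
  have fQ2: "integrable Q (\<lambda>y. (f y)\<^sup>2)" unfolding f2 by (rule fourth_Q(1))
  define fb where "fb = (\<integral>y. f y \<partial>Q)"
  define c where "c = (\<lambda>y. f y - fb)"
  have [measurable]: "c \<in> borel_measurable M" unfolding c_def by measurable
  have c2: "integrable Q (\<lambda>y. (c y)\<^sup>2)" unfolding c_def using fQ fQ2 by (simp add: power2_diff)
  have c0: "(\<integral>y. c y \<partial>Q) = 0" using fQ Q.prob_space by (simp add: c_def fb_def)
  have cv: "(\<integral>y. (c y)\<^sup>2 \<partial>Q) \<le> 4 * (K * b ^ 4)"
  proof -
    have "(\<integral>y. (c y)\<^sup>2 \<partial>Q) \<le> (\<integral>y. (f y)\<^sup>2 \<partial>Q)"
      using Q.variance_eq[OF fQ fQ2] by (simp add: c_def fb_def)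
    then show ?thesis using fourth_Q(2) unfolding f2 by linarith
  qed
  note sm = Q.psum_second_moment[OF I Q_measurable[of c] c2 c0]
  have i: "integrable ?Q (\<lambda>\<omega>. (psum c I \<omega>)\<^sup>2)" using sm by simp
  define d where "d = card I * (fb - b\<^sup>2)"
  have eq: "psum gg I \<omega> = psum c I \<omega> + d" for \<omega>
    by (simp add: psum_def gg_def c_def f_def d_def sum_subtractf algebra_simps)
  have pw: "(psum gg I \<omega>)\<^sup>2 \<le> 2 * (psum c I \<omega>)\<^sup>2 + 2 * d\<^sup>2" for \<omega>
    unfolding eq by (smt (verit) power2_sum sum_squares_bound)
  have ib: "integrable ?Q (\<lambda>\<omega>. 2 * (psum c I \<omega>)\<^sup>2 + 2 * d\<^sup>2)" using i by simp
  have mg: "psum gg I \<in> borel_measurable ?Q" by (rule psum_measurable[OF Q_measurable[OF gg_meas]])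
  show ig: "integrable ?Q (\<lambda>\<omega>. (psum gg I \<omega>)\<^sup>2)"
    by (rule Bochner_Integration.integrable_bound[OF ib]) (use mg pw in auto)
  have "(\<integral>\<omega>. (psum gg I \<omega>)\<^sup>2 \<partial>?Q) \<le> (\<integral>\<omega>. 2 * (psum c I \<omega>)\<^sup>2 + 2 * d\<^sup>2 \<partial>?Q)"
    by (rule integral_mono[OF ig ib pw])
  also have "\<dots> = 2 * (card I * (\<integral>y. (c y)\<^sup>2 \<partial>Q)) + 2 * d\<^sup>2"
    using i sm QI.prob_space by simp
  also have "\<dots> \<le> 2 * (n * (4 * (K * b ^ 4))) + 2 * (n * (10 * (K * b ^ 3)))\<^sup>2"
  proof (intro add_mono mult_left_mono)
    show "card I * (\<integral>y. (c y)\<^sup>2 \<partial>Q) \<le> n * (4 * (K * b ^ 4))"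
      using cv n by (intro mult_mono) auto
    have "\<bar>d\<bar> \<le> n * (10 * (K * b ^ 3))"
      unfolding d_def abs_mult using square_Q(2) n by (intro mult_mono) (auto simp: fb_def f_def)
    then show "d\<^sup>2 \<le> (n * (10 * (K * b ^ 3)))\<^sup>2" using power_mono[of "\<bar>d\<bar>" _ 2] by simp
  qed auto
  also have "\<dots> = 8 * (K * (n * b ^ 4)) + 200 * (K * (n * b ^ 3))\<^sup>2"
    by (simp add: power_mult_distrib mult_ac)
  finally show "(\<integral>\<omega>. (psum gg I \<omega>)\<^sup>2 \<partial>?Q) \<le> 8 * (K * (n * b ^ 4)) + 200 * (K * (n * b ^ 3))\<^sup>2" .
qed

text \<open>The width of the window depends on the coordinates in \<open>I\<close> only, so that the
  concentration inequality applies to the remaining coordinates conditionally on these.\<close>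

lemma random_window:
  assumes IJ: "I \<inter> J = {}" "finite I" "finite J" "J \<noteq> {}" and n: "card I \<le> n" and x: "x > 0"
  shows "measure (PiM (I \<union> J) (\<lambda>_. Q)) {\<omega> \<in> space (PiM (I \<union> J) (\<lambda>_. Q)).
       c - 2 * (psum gg I \<omega>)\<^sup>2 / x\<^sup>2 \<le> psum W (I \<union> J) \<omega> \<and> psum W (I \<union> J) \<omega> \<le> c}
    \<le> 4 * (8 * (K * (n * b ^ 4)) + 200 * (K * (n * b ^ 3))\<^sup>2) / (x\<^sup>2 * (b * sqrt (card J))) + 14000 * K / sqrt (card J)"
proof -
  let ?P = "PiM (I \<union> J) (\<lambda>_. Q)" and ?I = "PiM I (\<lambda>_. Q)" and ?J = "PiM J (\<lambda>_. Q)"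
  interpret PS: product_sigma_finite "\<lambda>_::nat. Q" by (rule Q.product_sf)
  interpret P: prob_space ?P by (rule Q.prob_space_Pi)
  interpret QI: prob_space ?I by (rule Q.prob_space_Pi)
  interpret QJ: prob_space ?J by (rule Q.prob_space_Pi)
  define A where "A = {\<omega> \<in> space ?P. c - 2 * (psum gg I \<omega>)\<^sup>2 / x\<^sup>2 \<le> psum W (I \<union> J) \<omega> \<and> psum W (I \<union> J) \<omega> \<le> c}"
  have mW: "psum W (I \<union> J) \<in> borel_measurable ?P" by (rule psum_measurable[OF Q_measurable[OF W_meas]])
  have mg: "psum gg I \<in> borel_measurable ?P" unfolding psum_def[abs_def]
  proof (intro borel_measurable_sum)
    fix i assume "i \<in> I"
    then have "(\<lambda>\<omega>. \<omega> i) \<in> measurable ?P Q" by (intro measurable_component_singleton) auto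
    then show "(\<lambda>\<omega>. gg (\<omega> i)) \<in> borel_measurable ?P" by (rule measurable_compose[OF _ Q_measurable[OF gg_meas]])
  qed
  have mg': "(\<lambda>\<omega>. c - 2 * (psum gg I \<omega>)\<^sup>2 / x\<^sup>2) \<in> borel_measurable ?P"
    by (intro borel_measurable_diff borel_measurable_divide borel_measurable_times borel_measurable_power borel_measurable_const mg)
  have A: "A \<in> sets ?P" unfolding A_def
    by (intro sets.sets_Collect_conj borel_measurable_le mW mg' borel_measurable_const)
  have psI: "psum gg I (merge I J (\<omega>1, \<omega>2)) = psum gg I \<omega>1" for \<omega>1 \<omega>2
    unfolding psum_def by (intro sum.cong) (auto simp: merge_def)
  define B where "B = (\<lambda>\<omega>1. (4 / (x\<^sup>2 * (b * sqrt (card J)))) * (psum gg I \<omega>1)\<^sup>2 + 14000 * K / sqrt (card J))"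
  have inner: "measure ?J ((\<lambda>y. merge I J (\<omega>1, y)) -` A \<inter> space ?J) \<le> B \<omega>1" if "\<omega>1 \<in> space ?I" for \<omega>1
  proof -
    define l where "l = 2 * (psum gg I \<omega>1)\<^sup>2 / x\<^sup>2"
    define a where "a = c - l - psum W I \<omega>1"
    have l: "l \<ge> 0" by (simp add: l_def)
    have sub: "(\<lambda>y. merge I J (\<omega>1, y)) -` A \<inter> space ?J \<subseteq> {\<omega> \<in> space ?J. a \<le> psum W J \<omega> \<and> psum W J \<omega> \<le> a + l}"
    proof
      fix y assume y: "y \<in> (\<lambda>y. merge I J (\<omega>1, y)) -` A \<inter> space ?J"
      then have *: "merge I J (\<omega>1, y) \<in> A" "y \<in> space ?J" by auto
      show "y \<in> {\<omega> \<in> space ?J. a \<le> psum W J \<omega> \<and> psum W J \<omega> \<le> a + l}"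
        using * unfolding A_def by (simp add: psI psum_merge[OF IJ(1-3)] a_def l_def)
    qed
    have mJ: "psum W J \<in> borel_measurable ?J" by (rule psum_measurable[OF Q_measurable[OF W_meas]])
    have "measure ?J ((\<lambda>y. merge I J (\<omega>1, y)) -` A \<inter> space ?J) \<le> measure ?J {\<omega> \<in> space ?J. a \<le> psum W J \<omega> \<and> psum W J \<omega> \<le> a + l}"
      by (intro QJ.finite_measure_mono[OF sub] sets.sets_Collect_conj borel_measurable_le mJ borel_measurable_const)
    also have "\<dots> \<le> 2 * l / (b * sqrt (card J)) + 14000 * K / sqrt (card J)"
      by (rule tilted_concentration[OF IJ(3,4) l])
    also have "\<dots> = B \<omega>1" by (simp add: B_def l_def)
    finally show ?thesis .
  qed
  note sm = gg_second_moment[OF IJ(2) n]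
  have Bi: "integrable ?I B" unfolding B_def using sm(1) by simp
  have Bnn: "B \<omega> \<ge> 0" for \<omega> unfolding B_def using x b0 K1 by (intro add_nonneg_nonneg mult_nonneg_nonneg) auto
  \<comment> \<open>Fubini over the two groups of coordinates; the conditional bound
    \<open>B\<close> is linear in the squared deviation, so the second moment is all that is
    needed.\<close>
  have "emeasure ?P A = (\<integral>\<^sup>+\<omega>1. emeasure ?J ((\<lambda>y. merge I J (\<omega>1, y)) -` A \<inter> space ?J) \<partial>?I)"
    by (rule PS.emeasure_fold_integral[OF IJ(1-3) A])
  also have "\<dots> \<le> (\<integral>\<^sup>+\<omega>1. ennreal (B \<omega>1) \<partial>?I)"
    using inner by (intro nn_integral_mono) (auto simp: QJ.emeasure_eq_measure ennreal_leI)
  also have "\<dots> = ennreal (\<integral>\<omega>1. B \<omega>1 \<partial>?I)" using Bi Bnn by (intro nn_integral_eq_integral) auto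
  finally have "measure ?P A \<le> (\<integral>\<omega>1. B \<omega>1 \<partial>?I)"
    using Bnn by (simp add: P.emeasure_eq_measure ennreal_le_iff Bochner_Integration.integral_nonneg)
  also have "\<dots> = (4 / (x\<^sup>2 * (b * sqrt (card J)))) * (\<integral>\<omega>1. (psum gg I \<omega>1)\<^sup>2 \<partial>?I) + 14000 * K / sqrt (card J)"
    unfolding B_def using sm(1) QI.prob_space by simp
  also have "\<dots> \<le> (4 / (x\<^sup>2 * (b * sqrt (card J)))) * (8 * (K * (n * b ^ 4)) + 200 * (K * (n * b ^ 3))\<^sup>2) + 14000 * K / sqrt (card J)"
    using sm(2) x b0 by (intro add_mono mult_left_mono) auto
  finally show ?thesis unfolding A_def by (simp add: mult_ac)
qed

end

section \<open>Decomposition of the self-normalized event and bounds for its pieces\<close>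

context tilting
begin

lemma psum_W_meas[measurable]: "psum W I \<in> borel_measurable (PiM I (\<lambda>_. M))"
  by (rule psum_measurable[OF W_meas])

lemma window_meas:
  "(\<lambda>\<omega>. x\<^sup>2 / 2 - (sqrt (V2 I \<omega>) - x)\<^sup>2 / 2) \<in> borel_measurable (PiM I (\<lambda>_. M))"
  "(\<lambda>\<omega>. (sqrt (V2 I \<omega>) - x)\<^sup>2) \<in> borel_measurable (PiM I (\<lambda>_. M))" for x :: real
  by measurable

context
  fixes I :: "nat set" and n :: nat and x y R :: real
  assumes I: "finite I" and n: "card I = n" "n \<ge> 1" and x: "x > 0" and bx: "b = x / sqrt n"
    and ne: "sqrt n * \<bar>e\<bar> \<le> 1 / 24" and Kx: "K * (x * b) \<le> 1 / 10000"
  defines "y \<equiv> sqrt n" and "R \<equiv> err x n e"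
begin

lemma y: "y \<ge> 1" "y\<^sup>2 = n" "b * y = x" "y > 0"
  using n bx by (auto simp: y_def)

lemma n_pow: "n * b\<^sup>2 = x\<^sup>2" "n * b ^ 3 = x\<^sup>2 * b" "n * b ^ 4 = x\<^sup>2 * b\<^sup>2"
  unfolding y(2)[symmetric] y(3)[symmetric] by (simp_all add: power2_eq_square power3_eq_cube power4_eq_xxxx mult_ac)

lemma R_ge: "(1 + x) / y \<le> R" "(1 + x ^ 4) / n \<le> R" "R > 0"
proof -
  have t: "0 < (1 + x ^ 4) / n" "0 \<le> (1 + x) * y * \<bar>e\<bar>" "0 \<le> (1 + x) / y"
    using x y n by (auto intro!: divide_pos_pos add_pos_nonneg)
  have R': "R = (1 + x ^ 4) / n + (1 + x) * y * \<bar>e\<bar> + (1 + x) / y" by (simp add: R_def err_def y_def)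
  show "(1 + x) / y \<le> R" "(1 + x ^ 4) / n \<le> R" "R > 0" using t R' by linarith+
qed

lemma b2_n: "b\<^sup>2 = x\<^sup>2 / n" using n by (simp add: bx power_divide)

text \<open>With b^2 = x^2 / n the left sides have degree at most four in x over n, and powers
  between the second and the fourth are at most 1 + x^4.\<close>

lemma xb_bounds: "x * b\<^sup>2 * (1 + x) \<le> 2 * R" "b\<^sup>2 * (1 + x) \<le> 2 * R"
proof -
  have c: "x ^ 3 \<le> 1 + x ^ 4" "x\<^sup>2 \<le> 1 + x ^ 4" for x :: real
  proof -
    show "x\<^sup>2 \<le> 1 + x ^ 4"
    proof -
      have "0 \<le> (x\<^sup>2 - 1)\<^sup>2 + x\<^sup>2 * 1" by simp
      then show ?thesis by (simp add: power2_eq_square power4_eq_xxxx algebra_simps)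
    qed
    have "2 * x ^ 3 \<le> x\<^sup>2 + x ^ 4"
    proof -
      have "0 \<le> (x - x\<^sup>2)\<^sup>2" by simp
      then show ?thesis by (simp add: power2_eq_square power3_eq_cube power4_eq_xxxx algebra_simps)
    qed
    then show "x ^ 3 \<le> 1 + x ^ 4" using \<open>x\<^sup>2 \<le> 1 + x ^ 4\<close> zero_le_even_power[of 4 x] by simp
  qed
  have "x ^ 3 + x ^ 4 \<le> 2 * (1 + x ^ 4)" "x\<^sup>2 + x ^ 3 \<le> 2 * (1 + x ^ 4)"
    using c[of x] zero_le_even_power[of 4 x] by simp_all
  then have "(x ^ 3 + x ^ 4) / n \<le> 2 * (1 + x ^ 4) / n" "(x\<^sup>2 + x ^ 3) / n \<le> 2 * (1 + x ^ 4) / n"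
    by (auto intro!: divide_right_mono)
  moreover have "x * b\<^sup>2 * (1 + x) = (x ^ 3 + x ^ 4) / n" "b\<^sup>2 * (1 + x) = (x\<^sup>2 + x ^ 3) / n"
    unfolding b2_n by (simp_all add: power2_eq_square power3_eq_cube power4_eq_xxxx field_simps)
  moreover have "2 * (1 + x ^ 4) / n \<le> 2 * R"
    unfolding times_divide_eq_right[symmetric] using R_ge(2) by (intro mult_left_mono) auto
  ultimately show "x * b\<^sup>2 * (1 + x) \<le> 2 * R" "b\<^sup>2 * (1 + x) \<le> 2 * R" by simp_all
qed

lemma psum_gg: "psum gg I \<omega> = V2 I \<omega> - x\<^sup>2"
  using n n_pow(1) by (simp add: psum_def gg_def V2_def sum_subtractf)

lemma K_le_K2: "K \<le> K\<^sup>2" "1 \<le> K\<^sup>2"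
  using K1 by (auto simp: power2_eq_square mult_le_cancel_left1 intro: order_trans[OF K1])

text \<open>A fixed fraction of the sample is enough for concentration at the rate 1/sqrt n; the
  factor 4 leaves room for halves of unequal size.\<close>

lemma half_window:
  assumes ij: "I = I1 \<union> I2" "I1 \<inter> I2 = {}" "I2 \<noteq> {}" "n \<le> 4 * card I2"
  shows "measure (PiM I (\<lambda>_. Q)) {\<omega> \<in> space (PiM I (\<lambda>_. Q)).
       x\<^sup>2 / 2 - 2 * (psum gg I1 \<omega>)\<^sup>2 / x\<^sup>2 \<le> psum W I \<omega> \<and> psum W I \<omega> \<le> x\<^sup>2 / 2}
    \<le> 32000 * K\<^sup>2 * R / (1 + x)"
proof -
  have fin: "finite I1" "finite I2" using I ij by auto
  have c1: "card I1 \<le> n" using ij I n by (metis Un_upper1 card_mono)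
  define s where "s = sqrt (card I2)"
  have s: "y / 2 \<le> s" "s > 0"
  proof -
    have "y\<^sup>2 / 4 \<le> card I2" using ij(4) y(2) by simp
    then have "(y / 2)\<^sup>2 \<le> card I2" by (simp add: power_divide)
    then show "y / 2 \<le> s" unfolding s_def by (rule real_le_rsqrt)
    then show "s > 0" using y by simp
  qed
  define E where "E = 8 * (K * (x\<^sup>2 * b\<^sup>2)) + 200 * (K * (x\<^sup>2 * b))\<^sup>2"
  have E0: "E \<ge> 0" using K1 by (simp add: E_def)
  have "measure (PiM I (\<lambda>_. Q)) {\<omega> \<in> space (PiM I (\<lambda>_. Q)).
       x\<^sup>2 / 2 - 2 * (psum gg I1 \<omega>)\<^sup>2 / x\<^sup>2 \<le> psum W I \<omega> \<and> psum W I \<omega> \<le> x\<^sup>2 / 2}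
    \<le> 4 * E / (x\<^sup>2 * (b * s)) + 14000 * K / s"
    using random_window[OF ij(2) fin ij(3) c1 x, of "x\<^sup>2 / 2"] unfolding ij(1)[symmetric] n_pow E_def s_def .
  also have "\<dots> \<le> 4 * E / (x\<^sup>2 * (b * (y / 2))) + 14000 * K / (y / 2)"
    using s y x b0 E0 K1 by (intro add_mono divide_left_mono mult_left_mono mult_pos_pos) auto
  also have "4 * E / (x\<^sup>2 * (b * (y / 2))) = 64 * (K * (b * (1 / y))) + 1600 * (K\<^sup>2 * (x * b\<^sup>2))"
    unfolding y(3)[symmetric] E_def using y(4) b0 by (simp add: power2_eq_square field_simps)
  also have "64 * (K * (b * (1 / y))) + 1600 * (K\<^sup>2 * (x * b\<^sup>2)) + 14000 * K / (y / 2) \<le> 32000 * K\<^sup>2 * R / (1 + x)"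
  proof -
    have p1: "K * (b * (1 / y)) * (1 + x) \<le> K\<^sup>2 * R"
    proof -
      have "b * ((1 + x) / y) \<le> 1 * ((1 + x) / y)" using b_small x y by (intro mult_right_mono) auto
      then have "b * ((1 + x) / y) \<le> R" using R_ge by linarith
      then have "K * (b * ((1 + x) / y)) \<le> K\<^sup>2 * R" using K_le_K2 K1 b0 x y by (intro mult_mono) auto
      then show ?thesis by (simp add: mult_ac)
    qed
    have p2: "K\<^sup>2 * (x * b\<^sup>2) * (1 + x) \<le> 2 * (K\<^sup>2 * R)"
    proof -
      have "K\<^sup>2 * (x * b\<^sup>2 * (1 + x)) \<le> K\<^sup>2 * (2 * R)" using xb_bounds by (intro mult_left_mono) auto
      then show ?thesis by (simp add: mult_ac)
    qed
    have p3: "(14000 * K / (y / 2)) * (1 + x) \<le> 28000 * (K\<^sup>2 * R)"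
    proof -
      have "K * ((1 + x) / y) \<le> K\<^sup>2 * R" using K_le_K2 R_ge K1 x y by (intro mult_mono) auto
      then have "28000 * (K * ((1 + x) / y)) \<le> 28000 * (K\<^sup>2 * R)" by simp
      moreover have "(14000 * K / (y / 2)) * (1 + x) = 28000 * (K * ((1 + x) / y))" by simp
      ultimately show ?thesis by (simp only:)
    qed
    have lin: "64 * p + 1600 * q + r \<le> 32000 * k" if "p \<le> k" "q \<le> 2 * k" "r \<le> 28000 * k" "0 \<le> k" for p q r k :: real
      using that by linarith
    have "(64 * (K * (b * (1 / y))) + 1600 * (K\<^sup>2 * (x * b\<^sup>2)) + 14000 * K / (y / 2)) * (1 + x)
      = 64 * (K * (b * (1 / y)) * (1 + x)) + 1600 * (K\<^sup>2 * (x * b\<^sup>2) * (1 + x)) + (14000 * K / (y / 2)) * (1 + x)"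
      by (simp only: distrib_right mult.assoc)
    also have "\<dots> \<le> 32000 * (K\<^sup>2 * R)" by (rule lin[OF p1 p2 p3]) (use R_ge in simp)
    finally show ?thesis using x by (simp add: pos_le_divide_eq mult.assoc)
  qed
  finally show ?thesis by simp
qed

text \<open>The deviation \<open>V2\<close> - x^2 is g1 + g2, one term for each half, and (g1 +
  g2)^2 <= 4 max(g1^2, g2^2). The window is thus covered by two windows, each with a width that
  depends on one half only.\<close>

lemma window:
  "measure (PiM I (\<lambda>_. Q)) {\<omega> \<in> space (PiM I (\<lambda>_. Q)).
       x\<^sup>2 / 2 - (sqrt (V2 I \<omega>) - x)\<^sup>2 / 2 \<le> psum W I \<omega> \<and> psum W I \<omega> \<le> x\<^sup>2 / 2}
    \<le> 64000 * K\<^sup>2 * R / (1 + x)" (is "measure ?P ?A \<le> _")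
proof (cases "n = 1")
  case True
  interpret QI: prob_space ?P by (rule Q.prob_space_Pi)
  \<comment> \<open>A single observation cannot be split, but for n = 1 the claimed bound exceeds
    1.\<close>
  have "1 + x \<le> R" using R_ge(1) True by (simp add: y_def)
  then have "1 * (1 + x) \<le> (64000 * K\<^sup>2) * R" using K_le_K2 x by (intro mult_mono) auto
  then have "1 \<le> 64000 * K\<^sup>2 * R / (1 + x)" using x by (simp add: pos_le_divide_eq)
  then show ?thesis using QI.prob_le_1[of ?A] by linarith
next
  case False
  interpret QI: prob_space ?P by (rule Q.prob_space_Pi)
  have n2: "n \<ge> 2" using False n by simp
  obtain I1 where I1: "I1 \<subseteq> I" "card I1 = n div 2"
    using obtain_subset_with_card_n[of "n div 2" I] n by auto
  define I2 where "I2 = I - I1"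
  have fin: "finite I1" "finite I2" using I I1 by (auto simp: I2_def intro: finite_subset)
  have c2: "card I2 = n - n div 2" unfolding I2_def using I1 n fin by (simp add: card_Diff_subset)
  have ij: "I = I1 \<union> I2" "I1 \<inter> I2 = {}" "I = I2 \<union> I1" "I2 \<inter> I1 = {}" using I1 by (auto simp: I2_def)
  have ne': "I1 \<noteq> {}" "I2 \<noteq> {}" using n2 I1 c2 by auto
  have q: "n \<le> 4 * card I1" "n \<le> 4 * card I2" using n2 I1 c2 by auto
  define B where "B = (\<lambda>J. {\<omega> \<in> space ?P. x\<^sup>2 / 2 - 2 * (psum gg J \<omega>)\<^sup>2 / x\<^sup>2 \<le> psum W I \<omega> \<and> psum W I \<omega> \<le> x\<^sup>2 / 2})"
  have Bsets: "B J \<in> sets ?P" if "J \<subseteq> I" for J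
  proof -
    have mW: "psum W I \<in> borel_measurable ?P" by (rule psum_measurable[OF Q_measurable[OF W_meas]])
    have mg: "psum gg J \<in> borel_measurable ?P" unfolding psum_def[abs_def]
    proof (intro borel_measurable_sum)
      fix i assume "i \<in> J"
      then have "(\<lambda>\<omega>. \<omega> i) \<in> measurable ?P Q" using that by (intro measurable_component_singleton) auto
      then show "(\<lambda>\<omega>. gg (\<omega> i)) \<in> borel_measurable ?P" by (rule measurable_compose[OF _ Q_measurable[OF gg_meas]])
    qed
    show ?thesis unfolding B_def
      by (intro sets.sets_Collect_conj borel_measurable_le mW mg borel_measurable_const
        borel_measurable_diff borel_measurable_divide borel_measurable_times borel_measurable_power)
  qed
  have sub: "?A \<subseteq> B I1 \<union> B I2"
  proof
    fix \<omega> assume \<omega>: "\<omega> \<in> ?A"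
    define g1 g2 where "g1 = psum gg I1 \<omega>" and "g2 = psum gg I2 \<omega>"
    have "psum gg (I1 \<union> I2) \<omega> = g1 + g2"
      unfolding g1_def g2_def psum_def using fin ij by (intro sum.union_disjoint) auto
    then have "V2 I \<omega> - x\<^sup>2 = g1 + g2" unfolding psum_gg[symmetric] ij(1)[symmetric] .
    then have "x\<^sup>2 * (sqrt (V2 I \<omega>) - x)\<^sup>2 \<le> (g1 + g2)\<^sup>2"
      using sqrt_deviation(2)[OF x V2_nonneg, of I \<omega>] by simp
    also have "\<dots> \<le> 2 * g1\<^sup>2 + 2 * g2\<^sup>2" by (smt (verit) power2_sum sum_squares_bound)
    also have "\<dots> \<le> 4 * max (g1\<^sup>2) (g2\<^sup>2)" by simp
    finally have "(sqrt (V2 I \<omega>) - x)\<^sup>2 / 2 \<le> 2 * max (g1\<^sup>2) (g2\<^sup>2) / x\<^sup>2"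
      using x by (simp add: pos_le_divide_eq mult.commute)
    then have "(sqrt (V2 I \<omega>) - x)\<^sup>2 / 2 \<le> 2 * g1\<^sup>2 / x\<^sup>2 \<or> (sqrt (V2 I \<omega>) - x)\<^sup>2 / 2 \<le> 2 * g2\<^sup>2 / x\<^sup>2"
      by (auto simp: max_def split: if_splits)
    then show "\<omega> \<in> B I1 \<union> B I2" using \<omega> unfolding B_def g1_def g2_def by auto
  qed
  have "measure ?P ?A \<le> measure ?P (B I1 \<union> B I2)"
    using Bsets I1 I2_def by (intro QI.finite_measure_mono[OF sub]) auto
  also have "\<dots> \<le> measure ?P (B I1) + measure ?P (B I2)"
    using Bsets I1 I2_def by (intro measure_Un_le) auto
  also have "measure ?P (B I1) \<le> 32000 * K\<^sup>2 * R / (1 + x)"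
    unfolding B_def by (rule half_window[OF ij(1,2) ne'(2) q(2)])
  also have "measure ?P (B I2) \<le> 32000 * K\<^sup>2 * R / (1 + x)"
    unfolding B_def by (rule half_window[OF ij(3,4) ne'(1) q(1)])
  finally have "measure ?P ?A \<le> 32000 * K\<^sup>2 * R / (1 + x) + 32000 * K\<^sup>2 * R / (1 + x)" by simp
  also have "\<dots> = 64000 * K\<^sup>2 * R / (1 + x)" unfolding add_divide_distrib[symmetric] by simp
  finally show ?thesis .
qed

definition A1 where "A1 = {\<omega> \<in> space (PiM I (\<lambda>_. M)). psum W I \<omega> > x\<^sup>2 / 2}"
text \<open>The cap on the deviation keeps T above x^2/2 - 1/2, hence exp(- T) below 2 exp(-
  x^2/2).\<close>

definition A2 where "A2 = {\<omega> \<in> space (PiM I (\<lambda>_. M)). x\<^sup>2 / 2 - (sqrt (V2 I \<omega>) - x)\<^sup>2 / 2 \<le> psum W I \<omega> \<and> psum W I \<omega> \<le> x\<^sup>2 / 2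
  \<and> (sqrt (V2 I \<omega>) - x)\<^sup>2 \<le> 1}"
text \<open>With all b |h| at most 1 the squares coincide with their truncations, whose Laplace
  transforms are under control.\<close>

definition A3 where "A3 = {\<omega> \<in> space (PiM I (\<lambda>_. M)). x\<^sup>2 / 2 - (sqrt (V2 I \<omega>) - x)\<^sup>2 / 2 \<le> psum W I \<omega>
  \<and> (sqrt (V2 I \<omega>) - x)\<^sup>2 > 1 \<and> (\<forall>i\<in>I. \<bar>b * h (\<omega> i)\<bar> \<le> 1)}"
text \<open>Indexed by the large summand, so that a union bound leaves a single distinguished
  coordinate to split off.\<close>

definition A4 where "A4 i = {\<omega> \<in> space (PiM I (\<lambda>_. M)). \<omega> \<in> selfnorm_event M h x I \<and> \<bar>b * h (\<omega> i)\<bar> > 1}"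

lemma A_sets[measurable]: "A1 \<in> sets (PiM I (\<lambda>_. M))" "A2 \<in> sets (PiM I (\<lambda>_. M))" "A3 \<in> sets (PiM I (\<lambda>_. M))"
    "i \<in> I \<Longrightarrow> A4 i \<in> sets (PiM I (\<lambda>_. M))"
proof -
  show "A1 \<in> sets (PiM I (\<lambda>_. M))" unfolding A1_def
    by (intro borel_measurable_less psum_W_meas borel_measurable_const)
  show "A2 \<in> sets (PiM I (\<lambda>_. M))" unfolding A2_def
    by (intro sets.sets_Collect_conj borel_measurable_le window_meas psum_W_meas borel_measurable_const)
  have "{\<omega> \<in> space (PiM I (\<lambda>_. M)). \<forall>i\<in>I. \<bar>b * h (\<omega> i)\<bar> \<le> 1} \<in> sets (PiM I (\<lambda>_. M))"
    using I by measurable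
  then show "A3 \<in> sets (PiM I (\<lambda>_. M))" unfolding A3_def
    by (intro sets.sets_Collect_conj borel_measurable_le borel_measurable_less window_meas psum_W_meas borel_measurable_const)
  show "A4 i \<in> sets (PiM I (\<lambda>_. M))" if "i \<in> I" unfolding A4_def using that by measurable
qed

lemma event_lower: "A1 \<subseteq> selfnorm_event M h x I"
proof
  fix \<omega> assume "\<omega> \<in> A1"
  then have *: "\<omega> \<in> space (PiM I (\<lambda>_. M))" "psum W I \<omega> > x\<^sup>2 / 2" by (auto simp: A1_def)
  show "\<omega> \<in> selfnorm_event M h x I" unfolding event_iff[OF *(1)]
    using *(2) zero_le_power2[of "sqrt (V2 I \<omega>) - x"] by linarith
qed

lemma event_upper: "selfnorm_event M h x I \<subseteq> A1 \<union> A2 \<union> A3 \<union> (\<Union>i\<in>I. A4 i)"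
proof
  fix \<omega> assume ev: "\<omega> \<in> selfnorm_event M h x I"
  then have *: "\<omega> \<in> space (PiM I (\<lambda>_. M))" by (simp add: selfnorm_event_def)
  have "psum W I \<omega> > x\<^sup>2 / 2 - (sqrt (V2 I \<omega>) - x)\<^sup>2 / 2" using ev event_iff[OF *] by blast
  then show "\<omega> \<in> A1 \<union> A2 \<union> A3 \<union> (\<Union>i\<in>I. A4 i)"
    using * ev by (auto simp: A1_def A2_def A3_def A4_def not_less not_le)
qed

lemma A1_bound: "\<bar>measure (PiM I (\<lambda>_. M)) A1 - m ^ n * (exp (- x\<^sup>2 / 2) * mills x)\<bar> \<le> m ^ n * (exp (- x\<^sup>2 / 2) * (350000 * K\<^sup>2 * R / (1 + x)))"
proof -
  have eq: "A1 = {\<omega> \<in> space (PiM I (\<lambda>_. Q)). psum W I \<omega> > x\<^sup>2 / 2}" by (simp add: A1_def space_PQ)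
  have mn: "m ^ n > 0" using m_bounds by simp
  define X where "X = (\<integral>\<omega>. exp (- psum W I \<omega>) * indicator A1 \<omega> \<partial>PiM I (\<lambda>_. Q))"
  have P: "measure (PiM I (\<lambda>_. M)) A1 = m ^ n * X"
    using tilt_measure(2)[OF I A_sets(1)] by (simp add: X_def n)
  have "\<bar>X - exp (- x\<^sup>2 / 2) * mills x\<bar> \<le> exp (- x\<^sup>2 / 2) * (350000 * K\<^sup>2 * R / (1 + x))"
    using tilted_half_line[OF I n x bx ne Kx] unfolding eq[symmetric] X_def R_def .
  then have "m ^ n * \<bar>X - exp (- x\<^sup>2 / 2) * mills x\<bar> \<le> m ^ n * (exp (- x\<^sup>2 / 2) * (350000 * K\<^sup>2 * R / (1 + x)))"
    using mn by (intro mult_left_mono) auto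
  moreover have "m ^ n * \<bar>X - exp (- x\<^sup>2 / 2) * mills x\<bar> = \<bar>m ^ n * X - m ^ n * (exp (- x\<^sup>2 / 2) * mills x)\<bar>"
    using mn unfolding right_diff_distrib[symmetric] by (simp add: abs_mult)
  ultimately show ?thesis unfolding P by (simp only:)
qed

lemma A2_bound: "measure (PiM I (\<lambda>_. M)) A2 \<le> m ^ n * (exp (- x\<^sup>2 / 2) * (128000 * K\<^sup>2 * R / (1 + x)))"
proof -
  let ?Q = "PiM I (\<lambda>_. Q)"
  interpret QI: prob_space ?Q by (rule Q.prob_space_Pi)
  define B where "B = {\<omega> \<in> space ?Q. x\<^sup>2 / 2 - (sqrt (V2 I \<omega>) - x)\<^sup>2 / 2 \<le> psum W I \<omega> \<and> psum W I \<omega> \<le> x\<^sup>2 / 2}"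
  have "B \<in> sets (PiM I (\<lambda>_. M))" unfolding B_def space_PQ
    by (intro sets.sets_Collect_conj borel_measurable_le window_meas psum_W_meas borel_measurable_const)
  then have B: "B \<in> sets ?Q" by (simp add: sets_PQ)
  have e2: "exp (1 / 2) \<le> (2::real)" using exp_bound[of "1 / 2"] by (simp add: power2_eq_square)
  define c where "c = 2 * exp (- x\<^sup>2 / 2)"
  have "measure (PiM I (\<lambda>_. M)) A2 \<le> m ^ card I * (\<integral>\<omega>. c * indicator B \<omega> \<partial>?Q)"
  proof (rule tilt_measure_le[OF I A_sets(2)])
    show "integrable ?Q (\<lambda>\<omega>. c * indicator B \<omega>)"
      using B by (intro integrable_mult_right integrable_real_indicator) (auto simp: QI.emeasure_eq_measure)
    fix \<omega>
    show "exp (- psum W I \<omega>) * indicator A2 \<omega> \<le> c * indicator B \<omega>"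
    proof (cases "\<omega> \<in> A2")
      case True
      then have "\<omega> \<in> B" by (auto simp: A2_def B_def space_PQ)
      have "- psum W I \<omega> \<le> 1 / 2 + (- x\<^sup>2 / 2)" using True by (auto simp: A2_def)
      then have "exp (- psum W I \<omega>) \<le> exp (1 / 2) * exp (- x\<^sup>2 / 2)" by (simp flip: exp_add)
      also have "\<dots> \<le> c" unfolding c_def using e2 by (intro mult_right_mono) auto
      finally show ?thesis using True \<open>\<omega> \<in> B\<close> by simp
    qed (simp add: c_def)
  qed
  also have "(\<integral>\<omega>. c * indicator B \<omega> \<partial>?Q) = c * measure ?Q B" using B by simp
  also have "m ^ card I * (c * measure ?Q B) \<le> m ^ card I * (c * (64000 * K\<^sup>2 * R / (1 + x)))"
    using window m_bounds unfolding B_def c_def by (intro mult_left_mono) auto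
  also have "\<dots> = m ^ n * (exp (- x\<^sup>2 / 2) * (128000 * K\<^sup>2 * R / (1 + x)))" by (simp add: c_def n mult_ac)
  finally show ?thesis .
qed

text \<open>The deviation D = (sqrt V2 - x)^2 exceeds 1 here, and exp(- T) <= exp(- x^2/2) exp(D/2).
  For the centred truncated sum g both D/2 and x/2 are at most |g|, so a factor 4 g^2 / x^2 >= 1 may
  be inserted. The expectation of g^2 exp |g| is then of the order n K b^4 of a variance.\<close>

lemma A3_bound: "measure (PiM I (\<lambda>_. M)) A3 \<le> m ^ n * (exp (- x\<^sup>2 / 2) * (10000 * K\<^sup>2 * R / (1 + x)))"
proof -
  let ?Q = "PiM I (\<lambda>_. Q)"
  interpret QI: prob_space ?Q by (rule Q.prob_space_Pi)
  interpret PQ: product_sigma_finite "\<lambda>_::nat. Q" by (rule Q.product_sf)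
  define k where "k = (\<lambda>z. if \<bar>b * h z\<bar> \<le> 1 then (b * h z)\<^sup>2 else 0)"
  define kb where "kb = (\<integral>z. k z \<partial>Q)"
  have [measurable]: "k \<in> borel_measurable M" unfolding k_def by measurable
  have kQ: "integrable Q k" "\<bar>kb - b\<^sup>2\<bar> \<le> 10 * (K * b ^ 3)" using square_Q(3,4) by (auto simp: k_def kb_def)
  have k01: "0 \<le> k z" "k z \<le> 1" "(k z)\<^sup>2 \<le> (b * h z) ^ 4" for z
  proof -
    show "0 \<le> k z" "k z \<le> 1" by (auto simp: k_def abs_square_le_1)
    show "(k z)\<^sup>2 \<le> (b * h z) ^ 4" by (auto simp: k_def simp flip: power_mult)
  qed
  have kb01: "0 \<le> kb" "kb \<le> 1"
  proof -
    show "0 \<le> kb" unfolding kb_def using k01 by (intro Bochner_Integration.integral_nonneg)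
    have "kb \<le> (\<integral>z. 1 \<partial>Q)" unfolding kb_def using kQ k01 by (intro integral_mono) auto
    then show "kb \<le> 1" using Q.prob_space by simp
  qed
  have kQ2: "integrable Q (\<lambda>z. (k z)\<^sup>2)"
    by (rule Bochner_Integration.integrable_bound[OF fourth_Q(1)]) (use k01 in \<open>auto intro!: Q_measurable\<close>)
  have var: "(\<integral>z. (k z - kb)\<^sup>2 \<partial>Q) \<le> 4 * (K * b ^ 4)"
  proof -
    have "(\<integral>z. (k z - kb)\<^sup>2 \<partial>Q) \<le> (\<integral>z. (k z)\<^sup>2 \<partial>Q)"
      using Q.variance_eq[OF kQ(1) kQ2] by (simp add: kb_def)
    also have "\<dots> \<le> (\<integral>z. (b * h z) ^ 4 \<partial>Q)" by (rule integral_mono[OF kQ2 fourth_Q(1) k01(3)])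
    finally show ?thesis using fourth_Q(2) by linarith
  qed
  have ic: "integrable Q (\<lambda>z. k z - kb)" "integrable Q (\<lambda>z. (k z - kb)\<^sup>2)"
    using kQ kQ2 by (auto simp: power2_diff)
  \<comment> \<open>The logarithm of the Laplace transform is at most n times 4 t^2 times the
    variance 4 K b^4, with t^2 = 4; and n b^4 = x^2 b^2.\<close>
  define q where "q = 64 * (K * (x\<^sup>2 * b\<^sup>2))"
  have q: "0 \<le> q" "q \<le> 1"
  proof -
    show "0 \<le> q" using K1 by (simp add: q_def)
    have "1 * (x * b) \<le> K * (x * b)" using K1 x b0 by (intro mult_right_mono) auto
    then have "x * b \<le> 1 / 10000" using Kx by linarith
    then have "(K * (x * b)) * (x * b) \<le> (1 / 10000) * (1 / 10000)" using Kx K1 x b0 by (intro mult_mono) auto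
    then show "q \<le> 1" by (simp add: q_def power2_eq_square mult_ac)
  qed
  have mgf: "integrable ?Q (\<lambda>\<omega>. exp (t * psum (\<lambda>z. k z - kb) I \<omega>)) \<and> (\<integral>\<omega>. exp (t * psum (\<lambda>z. k z - kb) I \<omega>) \<partial>?Q) \<le> exp q"
    if t: "t = 2 \<or> t = - 2" for t :: real
  proof -
    have tb: "\<bar>t * (k z - kb)\<bar> \<le> 2" for z using t k01[of z] kb01 by auto
    have ie: "integrable Q (\<lambda>z. exp (t * (k z - kb)))"
    proof (rule Q.integrable_const_bound[of _ "exp 2"])
      show "AE z in Q. norm (exp (t * (k z - kb))) \<le> exp 2" using tb by (intro AE_I2) (auto simp: abs_le_iff)
    qed (auto intro!: Q_measurable)
    have le1: "(\<integral>z. exp (t * (k z - kb)) \<partial>Q) \<le> exp (64 * (K * b ^ 4))"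
    proof -
      have "(\<integral>z. exp (t * (k z - kb)) \<partial>Q) \<le> (\<integral>z. 1 + t * (k z - kb) + 4 * (t * (k z - kb))\<^sup>2 \<partial>Q)"
        using ie ic tb by (intro integral_mono exp_quadratic_upper) (auto simp: power_mult_distrib)
      also have "\<dots> = (\<integral>z. 1 + t * (k z - kb) + 16 * (k z - kb)\<^sup>2 \<partial>Q)"
        using t by (auto simp: power_mult_distrib intro!: Bochner_Integration.integral_cong)
      also have "\<dots> = 1 + t * (\<integral>z. k z - kb \<partial>Q) + 16 * (\<integral>z. (k z - kb)\<^sup>2 \<partial>Q)"
      proof -
        have i1: "integrable Q (\<lambda>z. t * (k z - kb))" "integrable Q (\<lambda>z. 16 * (k z - kb)\<^sup>2)" "integrable Q (\<lambda>z. 1::real)"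
          using ic by (auto intro!: integrable_mult_right)
        have "(\<integral>z. 1 + t * (k z - kb) + 16 * (k z - kb)\<^sup>2 \<partial>Q) = (\<integral>z. 1 \<partial>Q) + (\<integral>z. t * (k z - kb) \<partial>Q) + (\<integral>z. 16 * (k z - kb)\<^sup>2 \<partial>Q)"
          using i1 by (subst Bochner_Integration.integral_add, (intro Bochner_Integration.integrable_add i1)+)
            (subst Bochner_Integration.integral_add, (intro i1)+, rule refl)
        then show ?thesis using Q.prob_space by simp
      qed
      also have "(\<integral>z. k z - kb \<partial>Q) = 0" using kQ Q.prob_space by (simp add: kb_def)
      finally have "(\<integral>z. exp (t * (k z - kb)) \<partial>Q) \<le> 1 + 64 * (K * b ^ 4)" using var by linarith
      then show ?thesis using exp_ge_add_one_self[of "64 * (K * b ^ 4)"] by linarith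
    qed
    have eqp: "exp (t * psum (\<lambda>z. k z - kb) I \<omega>) = (\<Prod>i\<in>I. exp (t * (k (\<omega> i) - kb)))" for \<omega>
      using I by (simp add: psum_def exp_sum sum_distrib_left)
    have "(\<integral>\<omega>. exp (t * psum (\<lambda>z. k z - kb) I \<omega>) \<partial>?Q) = (\<Prod>i\<in>I. \<integral>z. exp (t * (k z - kb)) \<partial>Q)"
      unfolding eqp by (rule PQ.product_integral_prod[OF I]) (rule ie)
    also have "\<dots> = (\<integral>z. exp (t * (k z - kb)) \<partial>Q) ^ n" by (simp add: n)
    also have "\<dots> \<le> exp (64 * (K * b ^ 4)) ^ n"
      using le1 by (intro power_mono Bochner_Integration.integral_nonneg) auto
    also have "\<dots> = exp q"
      unfolding exp_of_nat_mult[symmetric] q_def n_pow(3)[symmetric] by (simp add: mult_ac)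
    finally show ?thesis unfolding eqp using PQ.product_integrable_prod[OF I, of "\<lambda>_ z. exp (t * (k z - kb))"] ie by auto
  qed
  define g where "g = psum (\<lambda>z. k z - kb) I"
  define F where "F = (\<lambda>\<omega>. (16 * exp (- x\<^sup>2 / 2) / x\<^sup>2) * (exp (2 * g \<omega>) + exp (- 2 * g \<omega>) - 2))"
  have i2: "integrable ?Q (\<lambda>\<omega>. exp (2 * g \<omega>))" "integrable ?Q (\<lambda>\<omega>. exp (- 2 * g \<omega>))"
    "(\<integral>\<omega>. exp (2 * g \<omega>) \<partial>?Q) \<le> exp q" "(\<integral>\<omega>. exp (- 2 * g \<omega>) \<partial>?Q) \<le> exp q"
    using mgf[of 2] mgf[of "-2"] by (auto simp: g_def)
  have key: "exp (- psum W I \<omega>) \<le> F \<omega>" if \<omega>: "\<omega> \<in> A3" for \<omega>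
  proof -
    define D where "D = (sqrt (V2 I \<omega>) - x)\<^sup>2"
    have D: "D > 1" "x\<^sup>2 / 2 - D / 2 \<le> psum W I \<omega>" "\<And>i. i \<in> I \<Longrightarrow> \<bar>b * h (\<omega> i)\<bar> \<le> 1"
      using \<omega> by (auto simp: A3_def D_def)
    have V: "V2 I \<omega> = psum k I \<omega>"
      unfolding V2_def psum_def k_def using D(3) by (intro sum.cong) auto
    \<comment> \<open>Total shift caused by centring the truncated squares at \<open>kb\<close>
      instead of b^2. It is at most x/1000, hence harmless against a deviation u >= x.\<close>
    define r where "r = n * (kb - b\<^sup>2)"
    have Vx: "V2 I \<omega> - x\<^sup>2 = g \<omega> + r"
      unfolding V g_def r_def n_pow(1)[symmetric] by (simp add: psum_def sum_subtractf n algebra_simps)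
    have r: "\<bar>r\<bar> \<le> x / 1000"
    proof -
      have "\<bar>r\<bar> \<le> n * (10 * (K * b ^ 3))" unfolding r_def abs_mult using kQ(2) by (intro mult_mono) auto
      also have "\<dots> = 10 * (K * (n * b ^ 3))" by simp
      also have "\<dots> = 10 * x * (K * (x * b))" unfolding n_pow(2) by (simp add: power2_eq_square)
      also have "\<dots> \<le> 10 * x * (1 / 10000)" using Kx x by (intro mult_left_mono) auto
      finally show ?thesis by simp
    qed
    define u where "u = \<bar>V2 I \<omega> - x\<^sup>2\<bar>"
    have "D \<le> u" unfolding D_def u_def by (rule sqrt_deviation(1)[OF x V2_nonneg])
    have "x\<^sup>2 * 1 \<le> x\<^sup>2 * D" using D(1) by (intro mult_left_mono) auto
    also have "\<dots> \<le> u\<^sup>2" unfolding D_def u_def using sqrt_deviation(2)[OF x V2_nonneg, of I \<omega>] by simp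
    finally have "x \<le> u" using x abs_le_square_iff[of x u] by (simp add: u_def)
    have lin: "\<bar>p\<bar> \<ge> w / 2" if "w = \<bar>p + r\<bar>" "\<bar>r\<bar> \<le> x / 1000" "x \<le> w" for p w :: real using that x by linarith
    have gu: "\<bar>g \<omega>\<bar> \<ge> u / 2" by (rule lin[OF _ r \<open>x \<le> u\<close>]) (simp add: u_def Vx)
    then have g1: "D / 2 \<le> \<bar>g \<omega>\<bar>" "x / 2 \<le> \<bar>g \<omega>\<bar>" using \<open>D \<le> u\<close> \<open>x \<le> u\<close> by linarith+
    have "(x / 2)\<^sup>2 \<le> \<bar>g \<omega>\<bar>\<^sup>2" using g1 x by (intro power_mono) auto
    then have gx: "1 \<le> 4 * (g \<omega>)\<^sup>2 / x\<^sup>2" using x by (simp add: power_divide pos_le_divide_eq)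
    have "- psum W I \<omega> \<le> - x\<^sup>2 / 2 + \<bar>g \<omega>\<bar>" using D(2) g1 by linarith
    then have "exp (- psum W I \<omega>) \<le> exp (- x\<^sup>2 / 2) * exp \<bar>g \<omega>\<bar>" by (simp flip: exp_add)
    also have "\<dots> \<le> exp (- x\<^sup>2 / 2) * exp \<bar>g \<omega>\<bar> * (4 * (g \<omega>)\<^sup>2 / x\<^sup>2)"
    proof -
      have "exp (- x\<^sup>2 / 2) * exp \<bar>g \<omega>\<bar> * 1 \<le> exp (- x\<^sup>2 / 2) * exp \<bar>g \<omega>\<bar> * (4 * (g \<omega>)\<^sup>2 / x\<^sup>2)"
        by (intro mult_left_mono gx) simp
      then show ?thesis by (simp only: mult_1_right)
    qed
    also have "\<dots> = (4 * exp (- x\<^sup>2 / 2) / x\<^sup>2) * ((g \<omega>)\<^sup>2 * exp \<bar>g \<omega>\<bar>)" by (simp add: mult_ac)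
    also have "\<dots> \<le> (4 * exp (- x\<^sup>2 / 2) / x\<^sup>2) * (4 * (exp (2 * g \<omega>) + exp (- (2 * g \<omega>)) - 2))"
      using square_exp_le by (intro mult_left_mono) auto
    also have "\<dots> = F \<omega>" by (simp add: F_def)
    finally show ?thesis .
  qed
  have Fnn: "0 \<le> F \<omega>" for \<omega>
  proof -
    have "0 \<le> 4 * (exp (2 * g \<omega>) + exp (- (2 * g \<omega>)) - 2)" by (rule order_trans[OF _ square_exp_le]) simp
    then have "0 \<le> exp (2 * g \<omega>) + exp (- (2 * g \<omega>)) - 2" by simp
    then show ?thesis unfolding F_def by (intro mult_nonneg_nonneg) auto
  qed
  have Fi: "integrable ?Q F" unfolding F_def using i2 by simp
  have "measure (PiM I (\<lambda>_. M)) A3 \<le> m ^ card I * (\<integral>\<omega>. F \<omega> \<partial>?Q)"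
  proof (rule tilt_measure_le[OF I A_sets(3) Fi])
    fix \<omega> show "exp (- psum W I \<omega>) * indicator A3 \<omega> \<le> F \<omega>"
      using key[of \<omega>] Fnn[of \<omega>] by (auto simp: indicator_def)
  qed
  also have "(\<integral>\<omega>. F \<omega> \<partial>?Q) = (16 * exp (- x\<^sup>2 / 2) / x\<^sup>2) * ((\<integral>\<omega>. exp (2 * g \<omega>) \<partial>?Q) + (\<integral>\<omega>. exp (- 2 * g \<omega>) \<partial>?Q) - 2)"
    unfolding F_def using i2 QI.prob_space by simp
  also have "\<dots> \<le> (16 * exp (- x\<^sup>2 / 2) / x\<^sup>2) * (4 * q)"
  proof (rule mult_left_mono)
    \<comment> \<open>Both Laplace transforms are at most exp q <= 1 + 2 q, and the constants cancel
      against the subtracted 2.\<close>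
    have "exp q \<le> 1 + q + q\<^sup>2" using q by (intro exp_bound) auto
    moreover have "q\<^sup>2 \<le> q" using q by (simp add: power2_eq_square mult_left_le_one_le)
    ultimately show "(\<integral>\<omega>. exp (2 * g \<omega>) \<partial>?Q) + (\<integral>\<omega>. exp (- 2 * g \<omega>) \<partial>?Q) - 2 \<le> 4 * q" using i2 by linarith
  qed simp
  also have "\<dots> = exp (- x\<^sup>2 / 2) * (4096 * (K * b\<^sup>2))" using x by (simp add: q_def)
  also have "\<dots> \<le> exp (- x\<^sup>2 / 2) * (10000 * K\<^sup>2 * R / (1 + x))"
  proof (rule mult_left_mono)
    have "K * (b\<^sup>2 * (1 + x)) \<le> K\<^sup>2 * (2 * R)" by (rule mult_mono[OF K_le_K2(1) xb_bounds(2)]) (use x in auto)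
    moreover have "0 \<le> K\<^sup>2 * R" using R_ge by simp
    moreover have lin: "4096 * p \<le> 10000 * k" if "p \<le> 2 * k" "0 \<le> k" for p k :: real using that by linarith
    ultimately have "4096 * (K * (b\<^sup>2 * (1 + x))) \<le> 10000 * (K\<^sup>2 * R)" by (intro lin) (simp_all only: mult.left_commute)
    then have "4096 * (K * b\<^sup>2) * (1 + x) \<le> 10000 * K\<^sup>2 * R" by (simp only: mult.assoc)
    then show "4096 * (K * b\<^sup>2) \<le> 10000 * K\<^sup>2 * R / (1 + x)" using x by (simp add: pos_le_divide_eq)
  qed simp
  finally show ?thesis using m_bounds by (simp add: n)
qed

text \<open>Markov's inequality for the fourth power. Summed over n indices it gives n K b^4 = K x^4
  / n, an admissible error.\<close>

lemma prob_large: "measure M {z \<in> space M. \<bar>b * h z\<bar> > 1} \<le> K * b ^ 4"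
proof -
  have i4: "integrable M (\<lambda>z. (b * h z) ^ 4)" using h4 by (simp add: power_mult_distrib)
  have "measure M {z \<in> space M. \<bar>b * h z\<bar> > 1} = (\<integral>z. indicator {z \<in> space M. \<bar>b * h z\<bar> > 1} z \<partial>M)"
    by (simp add: inf.absorb1)
  also have "\<dots> \<le> (\<integral>z. (b * h z) ^ 4 \<partial>M)"
  proof (rule integral_mono[OF _ i4])
    show "integrable M (indicator {z \<in> space M. \<bar>b * h z\<bar> > 1} :: 'a \<Rightarrow> real)"
      by (intro integrable_real_indicator) (auto simp: emeasure_eq_measure)
    fix z
    have "1 \<le> (b * h z) ^ 4" if "\<bar>b * h z\<bar> > 1"
    proof -
      have "1 \<le> \<bar>b * h z\<bar> ^ 4" using that by (intro one_le_power) simp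
      then show ?thesis by (simp add: power_even_abs)
    qed
    then show "indicator {z \<in> space M. \<bar>b * h z\<bar> > 1} z \<le> (b * h z) ^ 4" by (auto simp: indicator_def)
  qed
  also have "\<dots> = b ^ 4 * (\<integral>z. h z ^ 4 \<partial>M)" by (simp add: power_mult_distrib)
  also have "\<dots> \<le> b ^ 4 * K" using K by (intro mult_left_mono) auto
  finally show ?thesis by (simp add: mult.commute)
qed

text \<open>For x < 1 the level x^2 - 1 is negative and the other summands give nothing; the factor
  1 is the value of \<open>B\<close> in \<open>event_bounds\<close>.\<close>

lemma A4_bound_trivial:
  assumes "i \<in> I" shows "measure (PiM I (\<lambda>_. M)) (A4 i) \<le> K * b ^ 4 * 1"
proof -
  interpret P: prob_space "PiM I (\<lambda>_. M)" by (rule prob_space_Pi)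
  have "measure (PiM I (\<lambda>_. M)) (A4 i) \<le> measure (PiM I (\<lambda>_. M)) ((\<lambda>\<omega>. \<omega> i) -` {z \<in> space M. \<bar>b * h z\<bar> > 1} \<inter> space (PiM I (\<lambda>_. M)))"
  proof (rule P.finite_measure_mono)
    show "A4 i \<subseteq> (\<lambda>\<omega>. \<omega> i) -` {z \<in> space M. \<bar>b * h z\<bar> > 1} \<inter> space (PiM I (\<lambda>_. M))"
      using measurable_space[OF measurable_component_singleton[OF assms, of "\<lambda>_. M"]] by (auto simp: A4_def)
    show "(\<lambda>\<omega>. \<omega> i) -` {z \<in> space M. \<bar>b * h z\<bar> > 1} \<inter> space (PiM I (\<lambda>_. M)) \<in> P.events"
      using assms by (intro measurable_sets[OF measurable_component_singleton]) auto
  qed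
  also have "\<dots> = measure (distr (PiM I (\<lambda>_. M)) M (\<lambda>\<omega>. \<omega> i)) {z \<in> space M. \<bar>b * h z\<bar> > 1}"
    using assms by (subst measure_distr) auto
  also have "\<dots> \<le> K * b ^ 4" unfolding component_distr[OF assms] by (rule prob_large)
  finally show ?thesis by simp
qed

text \<open>By \<open>sqrt_two_terms\<close> the event forces a large coordinate i and,
  independently of it, the self-normalized event of the others at the lowered level; the
  probabilities multiply.\<close>

lemma A4_bound:
  assumes i: "i \<in> I" and x1: "x \<ge> 1"
    and B: "measure (PiM (I - {i}) (\<lambda>_. M)) (selfnorm_event M h (sqrt (x\<^sup>2 - 1)) (I - {i})) \<le> B"
  shows "measure (PiM I (\<lambda>_. M)) (A4 i) \<le> K * b ^ 4 * B"
proof -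
  define J where "J = I - {i}"
  have J: "finite J" "i \<notin> J" "insert i J = I" using I i by (auto simp: J_def)
  let ?P = "PiM I (\<lambda>_. M)" and ?J = "PiM J (\<lambda>_. M)"
  interpret P: prob_space ?P by (rule prob_space_Pi)
  interpret JJ: prob_space ?J by (rule prob_space_Pi)
  interpret MQ: pair_sigma_finite M ?J by (rule pair_sf) (rule J(1))
  define c where "c = sqrt (x\<^sup>2 - 1)"
  define L where "L = {z \<in> space M. \<bar>b * h z\<bar> > 1}"
  define S where "S = selfnorm_event M h c J"
  have [measurable]: "L \<in> sets M" unfolding L_def by measurable
  have [measurable]: "S \<in> sets ?J" unfolding S_def by (rule selfnorm_event_sets) simp
  have iL: "integrable M (indicator L :: 'a \<Rightarrow> real)" by (intro integrable_real_indicator) (auto simp: emeasure_eq_measure)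
  have iS: "integrable ?J (indicator S :: _ \<Rightarrow> real)" by (intro integrable_real_indicator) (auto simp: JJ.emeasure_eq_measure)
  have A4m: "A4 i \<in> sets ?P" by (rule A_sets(4)[OF i])
  have "measure ?P (A4 i) = (\<integral>\<omega>. indicator (A4 i) \<omega> \<partial>PiM (insert i J) (\<lambda>_. M))"
    unfolding J(3) using A4m by (simp add: inf.absorb1 sets.sets_into_space)
  also have "\<dots> = (\<integral>p. indicator (A4 i) (fun_upd (snd p) i (fst p)) \<partial>(M \<Otimes>\<^sub>M ?J))"
    by (rule integral_insert_eq[OF J(1,2)]) (use A4m in \<open>simp add: J(3)\<close>)
  also have "\<dots> \<le> (\<integral>p. indicator L (fst p) * indicator S (snd p) \<partial>(M \<Otimes>\<^sub>M ?J))"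
  proof (rule integral_mono)
    have mm: "(\<lambda>p. indicator (A4 i) (fun_upd (snd p) i (fst p))) \<in> borel_measurable (M \<Otimes>\<^sub>M ?J)"
      using measurable_compose[OF upd_measurable[of i J] borel_measurable_indicator[of "A4 i" "PiM (insert i J) (\<lambda>_. M)"]] A4m
      by (simp add: J(3))
    interpret PP: pair_prob_space M ?J ..
    show "integrable (M \<Otimes>\<^sub>M ?J) (\<lambda>p. indicator (A4 i) (fun_upd (snd p) i (fst p)) :: real)"
      by (rule PP.P.integrable_const_bound[of _ 1]) (use mm in \<open>auto simp: indicator_def\<close>)
    show "integrable (M \<Otimes>\<^sub>M ?J) (\<lambda>p. indicator L (fst p) * indicator S (snd p) :: real)"
      by (rule MQ.integrable_times[OF iL iS])
    fix p assume p: "p \<in> space (M \<Otimes>\<^sub>M ?J)"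
    obtain z \<omega> where pz: "p = (z, \<omega>)" by (cases p)
    have z: "z \<in> space M" "\<omega> \<in> space ?J" using p by (auto simp: pz space_pair_measure)
    have "z \<in> L \<and> \<omega> \<in> S" if A: "fun_upd \<omega> i z \<in> A4 i"
    proof
      show "z \<in> L" using A z by (auto simp: A4_def L_def)
      have "fun_upd \<omega> i z \<in> selfnorm_event M h x I" using A by (auto simp: A4_def)
      then have "psum h I (fun_upd \<omega> i z) > x * sqrt (psum (\<lambda>z. (h z)\<^sup>2) I (fun_upd \<omega> i z))"
        by (auto simp: selfnorm_event_def)
      then have "h z + psum h J \<omega> > x * sqrt ((h z)\<^sup>2 + psum (\<lambda>z. (h z)\<^sup>2) J \<omega>)"
        unfolding J(3)[symmetric] psum_upd[OF J(2,1)] .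
      then have "psum h J \<omega> > c * sqrt (psum (\<lambda>z. (h z)\<^sup>2) J \<omega>)" unfolding c_def
        by (rule sqrt_two_terms[OF x1, rotated]) (auto simp: psum_def intro: sum_nonneg)
      then show "\<omega> \<in> S" using z by (simp add: S_def selfnorm_event_def)
    qed
    then show "indicator (A4 i) (fun_upd (snd p) i (fst p)) \<le> indicator L (fst p) * (indicator S (snd p) :: real)"
      by (auto simp: pz indicator_def)
  qed
  also have "\<dots> = (\<integral>z. indicator L z \<partial>M) * (\<integral>\<omega>. indicator S \<omega> \<partial>?J)" by (rule MQ.integral_times[OF iL iS])
  also have "\<dots> = measure M L * measure ?J S" by simp
  also have "\<dots> \<le> (K * b ^ 4) * B"
    using prob_large B K1 unfolding L_def S_def J_def c_def by (intro mult_mono) auto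
  finally show ?thesis .
qed

text \<open>The first three pieces cost 350000 + 128000 + 10000, rounded up to 500000.
  \<open>B\<close> is left open: it is the induction hypothesis within the induction and the outcome
  of the induction in the sharp estimate.\<close>

lemma event_bounds:
  assumes B: "\<And>i. i \<in> I \<Longrightarrow> measure (PiM I (\<lambda>_. M)) (A4 i) \<le> K * b ^ 4 * B"
  shows "measure (PiM I (\<lambda>_. M)) (selfnorm_event M h x I) \<le>
      m ^ n * exp (- x\<^sup>2 / 2) * (mills x + 500000 * K\<^sup>2 * R / (1 + x)) + K * (x\<^sup>2 * b\<^sup>2) * B"
    and "measure (PiM I (\<lambda>_. M)) (selfnorm_event M h x I) \<ge>
      m ^ n * exp (- x\<^sup>2 / 2) * (mills x - 500000 * K\<^sup>2 * R / (1 + x))"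
proof -
  let ?P = "PiM I (\<lambda>_. M)"
  interpret P: prob_space ?P by (rule prob_space_Pi)
  define c where "c = m ^ n * exp (- x\<^sup>2 / 2)"
  define r where "r = K\<^sup>2 * R / (1 + x)"
  have c: "c > 0" using m_bounds by (simp add: c_def)
  have r: "r \<ge> 0" using R_ge x by (simp add: r_def)
  have b1: "\<bar>measure ?P A1 - c * mills x\<bar> \<le> c * (350000 * r)" using A1_bound by (simp add: c_def r_def mult_ac)
  have b2: "measure ?P A2 \<le> c * (128000 * r)" using A2_bound by (simp add: c_def r_def mult_ac)
  have b3: "measure ?P A3 \<le> c * (10000 * r)" using A3_bound by (simp add: c_def r_def mult_ac)
  have cr: "0 \<le> c * r" using c r by simp
  have "measure ?P (\<Union>i\<in>I. A4 i) \<le> (\<Sum>i\<in>I. measure ?P (A4 i))"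
    using I by (intro measure_UNION_le) (auto intro: A_sets)
  also have "\<dots> \<le> (\<Sum>i\<in>I. K * b ^ 4 * B)" by (intro sum_mono B)
  also have "\<dots> = K * (n * b ^ 4) * B" using n by simp
  finally have b4: "measure ?P (\<Union>i\<in>I. A4 i) \<le> K * (x\<^sup>2 * b\<^sup>2) * B" unfolding n_pow(3) .
  have U: "(\<Union>i\<in>I. A4 i) \<in> sets ?P" using I A_sets(4) by (intro sets.finite_UN) auto
  have "measure ?P (selfnorm_event M h x I) \<le> measure ?P (A1 \<union> A2 \<union> A3 \<union> (\<Union>i\<in>I. A4 i))"
    using A_sets U by (intro P.finite_measure_mono[OF event_upper] sets.Un) auto
  also have "\<dots> \<le> measure ?P (A1 \<union> A2 \<union> A3) + measure ?P (\<Union>i\<in>I. A4 i)"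
    using A_sets U by (intro measure_Un_le sets.Un) auto
  also have "measure ?P (A1 \<union> A2 \<union> A3) \<le> measure ?P (A1 \<union> A2) + measure ?P A3"
    using A_sets by (intro measure_Un_le sets.Un) auto
  also have "measure ?P (A1 \<union> A2) \<le> measure ?P A1 + measure ?P A2"
    using A_sets by (intro measure_Un_le sets.Un) auto
  finally have "measure ?P (selfnorm_event M h x I) \<le> measure ?P A1 + measure ?P A2 + measure ?P A3 + measure ?P (\<Union>i\<in>I. A4 i)"
    by simp
  also have "\<dots> \<le> c * mills x + 500000 * (c * r) + K * (x\<^sup>2 * b\<^sup>2) * B"
    using b1 b2 b3 b4 cr by (simp add: mult.left_commute[of c])
  finally show "measure ?P (selfnorm_event M h x I) \<le>
      m ^ n * exp (- x\<^sup>2 / 2) * (mills x + 500000 * K\<^sup>2 * R / (1 + x)) + K * (x\<^sup>2 * b\<^sup>2) * B"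
    unfolding c_def[symmetric] by (simp add: r_def distrib_left mult_ac)
  have "measure ?P A1 \<le> measure ?P (selfnorm_event M h x I)"
    by (intro P.finite_measure_mono[OF event_lower] selfnorm_event_sets h_meas)
  moreover have "c * mills x - 500000 * (c * r) \<le> measure ?P A1" using b1 cr by (simp add: mult.left_commute[of c])
  ultimately show "measure ?P (selfnorm_event M h x I) \<ge>
      m ^ n * exp (- x\<^sup>2 / 2) * (mills x - 500000 * K\<^sup>2 * R / (1 + x))"
    unfolding c_def[symmetric] by (simp add: r_def right_diff_distrib mult_ac)
qed

end

end

subsection \<open>Uniform tail asymptotics\<close>

lemma exp_1_5_le: "exp (3 / 2) \<le> (6::real)"
proof -
  have "exp (3 / 2) = exp 1 * exp (1 / 2 :: real)" by (simp flip: exp_add)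
  also have "\<dots> \<le> 2.72 * 2"
    using e_less_272 exp_bound[of "1 / 2"] by (intro mult_mono) (auto simp: power2_eq_square)
  finally show ?thesis by simp
qed

lemma mills_upper: "x \<ge> 0 \<Longrightarrow> (1 + x) * mills x \<le> 2"
proof -
  assume x: "x \<ge> 0"
  have "phi 0 \<le> 1" using pi_gt3 by (simp add: std_normal_density_def real_le_rsqrt)
  then show ?thesis using mills_bounds(2,3)[OF x] by (simp add: distrib_right)
qed

text \<open>The value 18 is the product of the bounds 6 for exp(3/2) and 3 for sqrt(2 pi).\<close>

lemma mills_lower: "x \<ge> 0 \<Longrightarrow> 1 / (1 + x) \<le> 18 * mills x"
proof -
  assume x: "x \<ge> 0"
  have s: "sqrt (2 * pi) \<le> 3" using pi_less_4 by (intro real_le_lsqrt) auto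
  have "exp (-1) * phi 1 = exp (- (3 / 2)) / sqrt (2 * pi)"
    by (simp add: std_normal_density_def flip: exp_add)
  also have "\<dots> \<ge> (1 / 6) / 3"
  proof (rule frac_le)
    show "1 / 6 \<le> exp (- (3 / 2 :: real))" using exp_1_5_le by (simp add: exp_minus field_simps)
  qed (use s pi_gt_zero in auto)
  finally have "1 / 18 \<le> (1 + x) * mills x" using mills_bounds(4)[OF x] by simp
  then show ?thesis using x by (simp add: field_simps)
qed

text \<open>The approximation of the theorem without its Mills factor: multiplied by
  \<open>mills x\<close> it equals 1 - Phi(x) times the cubic exponential. Upper bounds use 1/(1+x)
  in place of that factor.\<close>

definition lead :: "real \<Rightarrow> nat \<Rightarrow> real \<Rightarrow> real" where
  "lead x n g = exp (- x\<^sup>2 / 2) * exp (- (x ^ 3 * g) / (3 * sqrt n))"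

lemma lead_pos: "lead x n g > 0" by (simp add: lead_def)

context tilting
begin

text \<open>In n ln m, expanded by ln m = (m - 1) + O((m - 1)^2), the part with the third moment is
  the cubic exponent. \<open>\<rho>\<close> collects the bias n b e = x sqrt n e and the remainders
  of order K n b^4; its numerical bound makes exp(\<open>\<rho>\<close>) a bounded factor.\<close>

lemma m_power:
  assumes n: "n \<ge> 1" and x: "x > 0" and bx: "b = x / sqrt n"
    and t: "x * sqrt n * \<bar>e\<bar> \<le> 1 / 10" and Kx: "K * (x * b) \<le> 1 / 10000"
  obtains \<rho> where "m ^ n = exp (- (x ^ 3 * g3) / (3 * sqrt n)) * exp \<rho>"
    "\<bar>\<rho>\<bar> \<le> 9 * K * err x n e" "\<bar>\<rho>\<bar> \<le> 3 / 5"
proof -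
  define y where "y = sqrt n"
  have y: "y \<ge> 1" "y\<^sup>2 = n" "b * y = x" using n bx by (auto simp: y_def)
  define z where "z = m - 1"
  have z: "\<bar>z\<bar> \<le> 1 / 2" using m_bounds(1) b_small by (simp add: z_def)
  define \<rho> where "\<rho> = n * ln m + (x ^ 3 * g3) / (3 * y)"
  define tt where "tt = x * y * \<bar>e\<bar>"
  have tt: "0 \<le> tt" "tt \<le> 1 / 10" using t x y by (auto simp: tt_def y_def)
  define s where "s = x\<^sup>2 * b\<^sup>2"
  have npow: "n * b = x * y" "n * b ^ 3 = x ^ 3 / y" "n * b ^ 4 = s" "n * b\<^sup>2 = x\<^sup>2"
    unfolding y(2)[symmetric] y(3)[symmetric] s_def using y(1)
    by (simp_all add: power2_eq_square power3_eq_cube power4_eq_xxxx mult_ac)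
  have l: "\<bar>ln m - z\<bar> \<le> 2 * z\<^sup>2" using abs_ln_one_plus_x_minus_x_bound[OF z] by (simp add: z_def)
  have nl: "\<bar>n * ln m - n * z\<bar> \<le> 2 * (n * z\<^sup>2)"
  proof -
    have "\<bar>n * ln m - n * z\<bar> = n * \<bar>ln m - z\<bar>" unfolding right_diff_distrib[symmetric] abs_mult by simp
    also have "\<dots> \<le> n * (2 * z\<^sup>2)" by (intro mult_left_mono l) simp
    finally show ?thesis by simp
  qed
  have r1: "\<bar>n * z - (x * y * e - x ^ 3 * g3 / (3 * y))\<bar> \<le> 5 * (K * s)"
  proof -
    have "real n * \<bar>m - 1 - b * e + b ^ 3 * g3 / 3\<bar> \<le> n * (5 * (K * b ^ 4))"
      by (intro mult_left_mono m_taylor) simp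
    moreover have "real n * \<bar>m - 1 - b * e + b ^ 3 * g3 / 3\<bar> = \<bar>n * z - (n * b) * e + (n * b ^ 3) * g3 / 3\<bar>"
    proof -
      have "real n * \<bar>m - 1 - b * e + b ^ 3 * g3 / 3\<bar> = \<bar>real n * (m - 1 - b * e + b ^ 3 * g3 / 3)\<bar>" by (simp add: abs_mult)
      also have "real n * (m - 1 - b * e + b ^ 3 * g3 / 3) = n * z - (n * b) * e + (n * b ^ 3) * g3 / 3"
        unfolding z_def by (simp add: algebra_simps)
      finally show ?thesis .
    qed
    moreover have "n * (5 * (K * b ^ 4)) = 5 * (K * (n * b ^ 4))" by simp
    moreover have "n * z - (n * b) * e + (n * b ^ 3) * g3 / 3 = n * z - (x * y * e - x ^ 3 * g3 / (3 * y))"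
      unfolding npow by simp
    ultimately show ?thesis unfolding npow by (simp only:)
  qed
  have s0: "0 \<le> s" by (simp add: s_def)
  have r2: "2 * (n * z\<^sup>2) \<le> 4 * tt + 4 * s"
  proof -
    have "z\<^sup>2 \<le> (b * \<bar>e\<bar> + K * b ^ 3)\<^sup>2" using power_mono[OF m_close abs_ge_zero, of 2] by (simp add: z_def)
    also have "\<dots> \<le> 2 * (b * \<bar>e\<bar>)\<^sup>2 + 2 * (K * b ^ 3)\<^sup>2" by (smt (verit) power2_sum sum_squares_bound)
    finally have "2 * (n * z\<^sup>2) \<le> 2 * (n * (2 * (b * \<bar>e\<bar>)\<^sup>2 + 2 * (K * b ^ 3)\<^sup>2))" by (simp add: mult_left_mono)
    also have "\<dots> = 4 * ((n * b\<^sup>2) * e\<^sup>2) + 4 * ((n * b ^ 4) * (b * K)\<^sup>2)"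
      by (simp add: power2_eq_square power3_eq_cube power4_eq_xxxx algebra_simps)
    also have "\<dots> = 4 * (x * \<bar>e\<bar>)\<^sup>2 + 4 * (s * (b * K)\<^sup>2)" unfolding npow by (simp add: power_mult_distrib)
    also have "(x * \<bar>e\<bar>)\<^sup>2 \<le> tt"
    proof -
      have "(x * \<bar>e\<bar>) * 1 \<le> (x * \<bar>e\<bar>) * y" using x y by (intro mult_left_mono) auto
      then have a: "x * \<bar>e\<bar> \<le> tt" by (simp add: tt_def mult_ac)
      then have "(x * \<bar>e\<bar>) * (x * \<bar>e\<bar>) \<le> tt * 1" using tt x by (intro mult_mono) auto
      then show ?thesis by (simp add: power2_eq_square)
    qed
    also have "s * (b * K)\<^sup>2 \<le> s * 1"
    proof (intro mult_left_mono s0)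
      have "\<bar>b * K\<bar> \<le> 1" using bK b0 K1 by (simp add: abs_mult)
      then show "(b * K)\<^sup>2 \<le> 1" by (simp add: abs_square_le_1)
    qed
    finally show ?thesis by simp
  qed
  have xe: "\<bar>x * y * e\<bar> = tt" using x y by (simp add: tt_def abs_mult)
  have Ks: "s \<le> K * s" using K1 s0 by (simp add: mult_le_cancel_right1)
  have lin: "\<bar>L + w\<bar> \<le> 5 * p + 9 * k"
    if "\<bar>L - Z\<bar> \<le> 2 * q" "\<bar>Z - (f - w)\<bar> \<le> 5 * k" "2 * q \<le> 4 * p + 4 * s" "\<bar>f\<bar> = p" "s \<le> k" for L Z f w p q k s :: real
    using that by linarith
  have \<rho>1: "\<bar>\<rho>\<bar> \<le> 5 * tt + 9 * (K * s)" unfolding \<rho>_def by (rule lin[OF nl r1 r2 xe Ks])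
  have Ks2: "K * s \<le> 1 / 1000"
  proof -
    have "1 * (x * b) \<le> K * (x * b)" using K1 x b0 by (intro mult_right_mono) auto
    then have "x * b \<le> 1 / 10000" using Kx by linarith
    then have "(K * (x * b)) * (x * b) \<le> (1 / 10000) * (1 / 10000)" using Kx K1 x b0 by (intro mult_mono) auto
    then show ?thesis by (simp add: s_def power2_eq_square mult_ac)
  qed
  have R: "tt + s \<le> err x n e"
  proof -
    have "s = x ^ 4 / n" unfolding npow(3)[symmetric] using n x by (simp add: bx power_divide) (simp add: y_def power4_eq_xxxx)
    also have "\<dots> \<le> (1 + x ^ 4) / n" by (simp add: divide_right_mono)
    finally have "s \<le> (1 + x ^ 4) / n" .
    moreover have "tt \<le> (1 + x) * sqrt n * \<bar>e\<bar>" unfolding tt_def y_def by (intro mult_right_mono) auto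
    moreover have "0 \<le> (1 + x) / sqrt n" using x by simp
    ultimately show ?thesis unfolding err_def by linarith
  qed
  have "5 * tt + 9 * (K * s) \<le> 9 * K * err x n e"
  proof -
    have "tt \<le> K * tt" using K1 tt by (simp add: mult_le_cancel_right1)
    then have "5 * tt + 9 * (K * s) \<le> 9 * (K * (tt + s))" using tt by (simp add: distrib_left)
    also have "\<dots> \<le> 9 * (K * err x n e)" using R K1 by (intro mult_left_mono) auto
    finally show ?thesis by simp
  qed
  then have \<rho>2: "\<bar>\<rho>\<bar> \<le> 9 * K * err x n e" using \<rho>1 by linarith
  have \<rho>3: "\<bar>\<rho>\<bar> \<le> 3 / 5" using \<rho>1 Ks2 tt by linarith
  have "m ^ n = exp (n * ln m)" using m_bounds(4) by (simp add: exp_of_nat_mult)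
  also have "\<dots> = exp (- (x ^ 3 * g3) / (3 * sqrt n)) * exp \<rho>" by (simp add: \<rho>_def y_def flip: exp_add)
  finally show thesis using that \<rho>2 \<rho>3 by blast
qed

end

lemma err_bounded:
  assumes x: "x > 0" and n: "n \<ge> 1" and t: "x * sqrt n * \<bar>e\<bar> \<le> 1 / 10" "sqrt n * \<bar>e\<bar> \<le> 1 / 24"
    and xn: "x\<^sup>2 \<le> sqrt n / 10000" "x \<le> sqrt n / 10000"
  shows "err x n e \<le> 4" "0 \<le> err x n e"
proof -
  have s: "sqrt n \<ge> 1" using n by simp
  have "x ^ 4 = (x\<^sup>2)\<^sup>2" by (simp flip: power_mult)
  also have "\<dots> \<le> (sqrt n)\<^sup>2" by (rule power_mono) (use xn(1) s in linarith, simp)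
  finally have "(1 + x ^ 4) / n \<le> 2" using n by (simp add: pos_divide_le_eq)
  moreover have "(1 + x) * sqrt n * \<bar>e\<bar> \<le> 1 / 5" using t by (simp add: distrib_right)
  moreover have "(1 + x) / sqrt n \<le> 3 / 2"
  proof -
    have "1 + x \<le> 3 / 2 * sqrt n" using xn s by linarith
    then show ?thesis using s by (subst pos_divide_le_eq) auto
  qed
  ultimately show "err x n e \<le> 4" unfolding err_def by linarith
  show "0 \<le> err x n e" unfolding err_def using x by (intro add_nonneg_nonneg mult_nonneg_nonneg divide_nonneg_nonneg) auto
qed

text \<open>For x <= 1 the total exponent is at least -3/4, so the leading term is bounded below and
  the trivial bound 1 for a probability suffices.\<close>

lemma lead_small_x:
  assumes x: "0 \<le> x" "x \<le> 1" and K: "\<bar>g\<bar> \<le> K" "1 \<le> K" and n: "n \<ge> 1" and xn: "K * x\<^sup>2 \<le> sqrt n / 10000"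
  shows "1 \<le> 6 / (1 + x) * lead x n g"
proof -
  have s: "sqrt n \<ge> 1" using n by simp
  have "\<bar>x ^ 3 * g\<bar> \<le> x\<^sup>2 * K"
  proof -
    have "x ^ 3 * \<bar>g\<bar> \<le> x\<^sup>2 * K" using x K by (intro mult_mono power_decreasing) auto
    then show ?thesis using x by (simp add: abs_mult)
  qed
  then have "\<bar>x ^ 3 * g\<bar> \<le> (1 / 4) * (3 * sqrt n)" using xn s by (simp add: mult.commute)
  then have "x ^ 3 * g / (3 * sqrt n) \<le> 1 / 4" using s by (simp add: pos_divide_le_eq abs_le_iff)
  moreover have "x\<^sup>2 / 2 \<le> 1 / 2" using x by (simp add: power_le_one)
  ultimately have "- (3 / 4) \<le> - x\<^sup>2 / 2 + - (x ^ 3 * g) / (3 * sqrt n)" by simp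
  then have "exp (- (3 / 4)) \<le> lead x n g" unfolding lead_def by (simp flip: exp_add)
  moreover have "1 / 3 \<le> exp (- (3 / 4 :: real))"
  proof -
    have "exp (3 / 4) \<le> exp (1::real)" by simp
    then have "exp (3 / 4) \<le> (3::real)" using e_less_272 by linarith
    then show ?thesis by (simp add: exp_minus field_simps)
  qed
  ultimately have l: "1 / 3 \<le> lead x n g" by linarith
  have "3 \<le> 6 / (1 + x)" using x by (simp add: field_simps)
  then have "3 * (1 / 3) \<le> 6 / (1 + x) * lead x n g" using l x by (intro mult_mono) auto
  then show ?thesis by simp
qed

text \<open>Passing from (x, n) to (sqrt(x^2 - 1), n - 1) multiplies the Gaussian factor by
  exp(1/2), moves the cubic exponent by at most 1 and at most doubles 1/(1+x). With exp(3/2) <= 6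
  this makes 12.\<close>

lemma lead_shift:
  assumes x: "1 \<le> x" and K: "\<bar>g\<bar> \<le> K" "1 \<le> K" and n: "n \<ge> 2" and xn: "K * x\<^sup>2 \<le> sqrt n / 10000"
  defines "y \<equiv> sqrt (x\<^sup>2 - 1)"
  shows "1 / (1 + y) * lead y (n - 1) g \<le> 12 / (1 + x) * lead x n g"
proof -
  have x2: "x\<^sup>2 \<ge> 1" using x by simp
  have y: "y \<ge> 0" "y\<^sup>2 = x\<^sup>2 - 1" using x2 by (auto simp: y_def)
  have yx: "y \<le> x" using y x by (metis abs_le_square_iff abs_of_nonneg diff_le_eq le_add_same_cancel1 order_trans zero_le_one)
  have "x\<^sup>2 \<le> (1 + y)\<^sup>2" using y by (simp add: power2_sum)
  then have x1y: "x \<le> 1 + y" by (rule power2_le_imp_le) (use y in simp)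
  have f1: "1 / (1 + y) \<le> 2 / (1 + x)" using x1y y x by (simp add: field_simps)
  define s where "s = sqrt n"
  define s' where "s' = sqrt (real (n - 1))"
  have s: "1 \<le> s'" "s' \<le> s" "s\<^sup>2 = n" "s'\<^sup>2 = n - 1" "1 \<le> s" using n by (auto simp: s_def s'_def)
  have ss: "s - s' \<le> 1 / s"
  proof -
    have "(s - s') * (s + s') = 1" using s n by (simp add: algebra_simps of_nat_diff flip: power2_eq_square)
    moreover have "(s - s') * s \<le> (s - s') * (s + s')" using s by (intro mult_left_mono) auto
    ultimately show ?thesis using s by (simp add: pos_le_divide_eq)
  qed
  \<comment> \<open>The upper bound on this change comes from varying x with n fixed, the lower
    bound from varying n with x fixed.\<close>
  define d where "d = x ^ 3 / s - y ^ 3 / s'"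
  have up: "d \<le> 3 * x / s"
  proof -
    have "y ^ 3 / s \<le> y ^ 3 / s'" using s y by (intro divide_left_mono) auto
    moreover have "x ^ 3 - y ^ 3 \<le> 3 * x"
    proof -
      have "(x - y) * (x + y) = 1" using y by (simp add: algebra_simps power2_eq_square)
      moreover have "(x - y) * x \<le> (x - y) * (x + y)" using yx y by (intro mult_left_mono) auto
      ultimately have a: "(x - y) * x \<le> 1" by simp
      have "x ^ 3 - y ^ 3 = (x - y) * (x * x + x * y + y * y)" by (simp add: power3_eq_cube algebra_simps)
      also have "\<dots> \<le> (x - y) * (x * x + x * x + x * x)" using yx y x by (intro mult_left_mono add_mono mult_mono) auto
      also have "\<dots> = 3 * x * ((x - y) * x)" by (simp add: algebra_simps)
      also have "\<dots> \<le> 3 * x * 1" using a x by (intro mult_left_mono) auto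
      finally show ?thesis by simp
    qed
    then have "x ^ 3 / s - y ^ 3 / s \<le> 3 * x / s" using s by (simp add: diff_divide_distrib[symmetric] divide_right_mono)
    ultimately show ?thesis unfolding d_def by linarith
  qed
  have low: "- (x ^ 3 / s\<^sup>2) \<le> d"
  proof -
    have "y ^ 3 / s' \<le> x ^ 3 / s'" using s y yx by (intro divide_right_mono power_mono) auto
    moreover have "x ^ 3 / s' - x ^ 3 / s \<le> x ^ 3 / s\<^sup>2"
    proof -
      have "x ^ 3 / s' - x ^ 3 / s = x ^ 3 * ((s - s') / (s * s'))" using s by (simp add: field_simps)
      also have "(s - s') / (s * s') \<le> (1 / s) / (s * 1)" using ss s by (intro frac_le mult_left_mono) auto
      finally show ?thesis using x by (simp add: power2_eq_square mult_left_mono)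
    qed
    ultimately show ?thesis unfolding d_def by linarith
  qed
  have Kd: "K * \<bar>d\<bar> \<le> 1"
  proof -
    have "x * 1 \<le> x * x" using x by (intro mult_left_mono) auto
    then have "K * x \<le> K * x\<^sup>2" using K by (intro mult_left_mono) (auto simp: power2_eq_square)
    then have Kx: "K * x \<le> s / 10000" using xn by (simp add: s_def)
    then have p1: "K * (3 * x / s) \<le> 1" using s by (simp add: field_simps)
    have "1 * x \<le> K * x" using K x by (intro mult_right_mono) auto
    then have "x \<le> s" using Kx s by linarith
    then have "(K * x\<^sup>2) * x \<le> (s / 10000) * s" using xn x s K by (intro mult_mono) (auto simp: s_def)
    moreover have "(s / 10000) * s \<le> s\<^sup>2" by (simp add: power2_eq_square)
    moreover have "(K * x\<^sup>2) * x = K * x ^ 3" by (simp add: power2_eq_square power3_eq_cube)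
    ultimately have "K * x ^ 3 \<le> s\<^sup>2" by linarith
    then have p2: "K * (x ^ 3 / s\<^sup>2) \<le> 1" using s(5) by (simp add: divide_le_eq_1_pos)
    have "K * \<bar>d\<bar> \<le> K * max (3 * x / s) (x ^ 3 / s\<^sup>2)" using up low K by (intro mult_left_mono) auto
    then show ?thesis using p1 p2 by (auto simp: max_def split: if_splits)
  qed
  have "\<bar>g * d / 3\<bar> \<le> 1"
  proof -
    have "\<bar>g\<bar> * \<bar>d\<bar> \<le> K * \<bar>d\<bar>" using K by (intro mult_right_mono) auto
    then show ?thesis using Kd by (simp add: abs_mult)
  qed
  then have gd: "g * d / 3 \<le> 1" by linarith
  have "lead y (n - 1) g = lead x n g * exp (1 / 2 + g * d / 3)"
    unfolding lead_def exp_add[symmetric] d_def s_def[symmetric] s'_def[symmetric]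
    using y(2) by (simp add: field_simps)
  also have "\<dots> \<le> lead x n g * 6"
  proof (intro mult_left_mono)
    have "exp (1 / 2 + g * d / 3) \<le> exp (3 / 2)" unfolding exp_le_cancel_iff using gd by linarith
    then show "exp (1 / 2 + g * d / 3) \<le> 6" using exp_1_5_le by linarith
  qed (use lead_pos[of x n g] in simp)
  finally have "1 / (1 + y) * lead y (n - 1) g \<le> 2 / (1 + x) * (lead x n g * 6)"
    using f1 x y lead_pos[of y "n - 1" g] by (intro mult_mono) auto
  then show ?thesis by (simp add: mult_ac)
qed

section \<open>From a bound up to a constant to the relative error\<close>

context prob_space
begin

context
  fixes h :: "'a \<Rightarrow> real" and K :: real
  assumes h_meas: "h \<in> borel_measurable M"
    and h4: "integrable M (\<lambda>y. h y ^ 4)" and var1: "(\<integral>y. (h y)\<^sup>2 \<partial>M) = 1" and K: "(\<integral>y. h y ^ 4 \<partial>M) \<le> K"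
begin

lemma tiltingI:
  assumes "b > 0" "b * K \<le> 1 / 10000" "\<bar>\<integral>y. h y \<partial>M\<bar> \<le> 1 / 16"
  shows "tilting M h K b"
  by unfold_locales (use assms h_meas h4 var1 K in auto)

text \<open>Nonnegativity of E (h^2 - 1)^2, and AM-GM for the cube. Both are stated before any
  choice of b, because b changes along the induction.\<close>

lemma K_ge_1: "1 \<le> K" and third_le: "\<bar>\<integral>y. h y ^ 3 \<partial>M\<bar> \<le> K"
proof -
  have 4: "((h y)\<^sup>2 - 1)\<^sup>2 = h y ^ 4 - 2 * (h y)\<^sup>2 + 1" for y
    by (simp add: power2_eq_square power4_eq_xxxx algebra_simps)
  have h2: "integrable M (\<lambda>y. (h y)\<^sup>2)" using var1 not_integrable_integral_eq by fastforce
  have "0 \<le> (\<integral>y. ((h y)\<^sup>2 - 1)\<^sup>2 \<partial>M)" by (rule Bochner_Integration.integral_nonneg) simp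
  also have "\<dots> = (\<integral>y. h y ^ 4 \<partial>M) - 2 * 1 + 1"
    unfolding 4 using h2 h4 var1 by (simp add: prob_space)
  finally show K1: "1 \<le> K" using K by simp
  have pw: "\<bar>h y ^ 3\<bar> \<le> ((h y)\<^sup>2 + h y ^ 4) / 2" for y
  proof -
    have "0 \<le> (\<bar>h y\<bar> - (h y)\<^sup>2)\<^sup>2" by simp
    also have "\<dots> = (h y)\<^sup>2 + h y ^ 4 - 2 * \<bar>h y ^ 3\<bar>"
      by (cases "h y \<ge> 0") (simp_all add: power2_eq_square power3_eq_cube power4_eq_xxxx algebra_simps abs_mult)
    finally show ?thesis by simp
  qed
  have i: "integrable M (\<lambda>y. ((h y)\<^sup>2 + h y ^ 4) / 2)" using h2 h4 by simp
  have i3: "integrable M (\<lambda>y. h y ^ 3)"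
  proof (rule Bochner_Integration.integrable_bound[OF i])
    show "AE y in M. norm (h y ^ 3) \<le> norm (((h y)\<^sup>2 + h y ^ 4) / 2)"
      unfolding real_norm_def by (intro AE_I2 order_trans[OF pw abs_ge_self])
  qed (use h_meas in simp)
  have "\<bar>\<integral>y. h y ^ 3 \<partial>M\<bar> \<le> (\<integral>y. \<bar>h y ^ 3\<bar> \<partial>M)" by (rule integral_abs_bound)
  also have "\<dots> \<le> (\<integral>y. ((h y)\<^sup>2 + h y ^ 4) / 2 \<partial>M)" by (rule integral_mono[OF integrable_abs[OF i3] i pw])
  also have "\<dots> \<le> K" using h2 h4 var1 K K1 by simp
  finally show "\<bar>\<integral>y. h y ^ 3 \<partial>M\<bar> \<le> K" .
qed

text \<open>Removing a summand with \<open>\<bar>b * h\<bar> > 1\<close> lowers \<open>x\<^sup>2\<close> by at most one, which costs a bounded factor,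
  while the probability that such a summand exists is small: hence the induction on the sample size.\<close>

lemma crude_upper:
  assumes "finite I" "card I = n" "n \<ge> 1" "0 \<le> x" "K * x\<^sup>2 \<le> sqrt n / 10000"
    "sqrt n * \<bar>\<integral>y. h y \<partial>M\<bar> \<le> 1 / 24" "x * sqrt n * \<bar>\<integral>y. h y \<partial>M\<bar> \<le> 1 / 10"
  shows "measure (PiM I (\<lambda>_. M)) (selfnorm_event M h x I) \<le> 10000000 * K\<^sup>2 * (1 / (1 + x) * lead x n (\<integral>y. h y ^ 3 \<partial>M))"
  using assms
proof (induction n arbitrary: I x)
  case 0
  then show ?case by simp
next
  case (Suc k)
  define n where "n = Suc k"
  note prems = Suc.prems[folded n_def]
  define g where "g = (\<integral>y. h y ^ 3 \<partial>M)"
  define e where "e = (\<integral>y. h y \<partial>M)"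
  interpret P: prob_space "PiM I (\<lambda>_. M)" by (rule prob_space_Pi)
  have K2: "1 \<le> K\<^sup>2" using K_ge_1 by simp
  have l0: "lead x n g > 0" by (rule lead_pos)
  show ?case
  proof (cases "x < 1")
    case True
    have a: "1 \<le> 6 / (1 + x) * lead x n g"
      unfolding g_def using prems True by (intro lead_small_x[OF _ _ third_le K_ge_1]) auto
    have f0: "0 \<le> 1 / (1 + x) * lead x n g" using prems(4) l0 by simp
    have "6 * (1 / (1 + x) * lead x n g) \<le> (10000000 * K\<^sup>2) * (1 / (1 + x) * lead x n g)"
      using K2 by (intro mult_right_mono f0) simp
    then have "1 \<le> 10000000 * K\<^sup>2 * (1 / (1 + x) * lead x n g)" using a by simp
    then show ?thesis using P.prob_le_1 unfolding g_def n_def by (meson order_trans)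
  next
    case False
    then have x: "x \<ge> 1" by simp
    define y where "y = sqrt (x\<^sup>2 - 1)"
    \<comment> \<open>For x >= 1 the range condition already forces sqrt n >= 10000, so there is a
      summand to spare.\<close>
    have "1 * 1 \<le> K * x\<^sup>2" using K_ge_1 x by (intro mult_mono) auto
    then have sn: "10000 \<le> sqrt n" using prems(5) by simp
    then have "sqrt 4 \<le> sqrt n" by (simp add: real_sqrt_four)
    then have n4: "n \<ge> 4" by (simp only: real_sqrt_le_iff)
    have kn: "k = n - 1" "k \<ge> 1" using n4 by (auto simp: n_def)
    define b where "b = x / sqrt n"
    have b0: "b > 0" unfolding b_def by (rule divide_pos_pos) (use x sn in linarith)+
    have Kxb: "K * (x * b) \<le> 1 / 10000"
    proof -
      have "K * (x * b) = K * x\<^sup>2 / sqrt n" by (simp add: b_def power2_eq_square)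
      moreover have "sqrt n > 0" using sn by linarith
      ultimately show ?thesis using prems(5) by (simp add: pos_divide_le_eq)
    qed
    have bK: "b * K \<le> 1 / 10000"
    proof -
      have "(K * b) * 1 \<le> (K * b) * x" using x K_ge_1 b0 by (intro mult_left_mono) auto
      then show ?thesis using Kxb by (simp add: mult_ac)
    qed
    have e16: "\<bar>\<integral>y. h y \<partial>M\<bar> \<le> 1 / 16"
    proof -
      have "1 * \<bar>\<integral>y. h y \<partial>M\<bar> \<le> sqrt n * \<bar>\<integral>y. h y \<partial>M\<bar>" by (rule mult_right_mono) (use sn in linarith, simp)
      then show ?thesis using prems(6) by linarith
    qed
    interpret T: tilting M h K b by (rule tiltingI[OF b0 bK e16])
    have Te: "T.e = e" "T.g3 = g" by (simp_all add: T.e_def T.g3_def e_def g_def)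
    have y: "0 \<le> y" "y \<le> x" "y\<^sup>2 = x\<^sup>2 - 1"
    proof -
      have "x\<^sup>2 \<ge> 1" using x by simp
      then show "0 \<le> y" "y\<^sup>2 = x\<^sup>2 - 1" by (auto simp: y_def)
      show "y \<le> x" unfolding y_def using x by (intro real_le_lsqrt) auto
    qed
    have sk: "sqrt n - 1 \<le> sqrt k" "sqrt k \<le> sqrt n"
    proof -
      have "(sqrt n - 1)\<^sup>2 \<le> k" using sn by (simp add: power2_diff n_def)
      then show "sqrt n - 1 \<le> sqrt k" by (rule real_le_rsqrt)
      show "sqrt k \<le> sqrt n" by (simp add: n_def)
    qed
    define B where "B = 10000000 * K\<^sup>2 * (1 / (1 + y) * lead y k g)"
    have IH: "measure (PiM (I - {i}) (\<lambda>_. M)) (selfnorm_event M h y (I - {i})) \<le> B" if "i \<in> I" for i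
      unfolding B_def g_def
    proof (rule Suc.IH)
      show "finite (I - {i})" "card (I - {i}) = k" using prems that by (auto simp: n_def)
      show "1 \<le> k" "0 \<le> y" using kn y by auto
      \<comment> \<open>The range condition is inherited: its left side drops by K >= 1, its right
        side by at most 1/10000.\<close>
      have "K * y\<^sup>2 = K * x\<^sup>2 - K" using y by (simp add: right_diff_distrib)
      then show "K * y\<^sup>2 \<le> sqrt k / 10000" using prems(5) sk K_ge_1 by linarith
      have "sqrt k * \<bar>\<integral>y. h y \<partial>M\<bar> \<le> sqrt n * \<bar>\<integral>y. h y \<partial>M\<bar>" using sk by (intro mult_right_mono) auto
      then show "sqrt k * \<bar>\<integral>y. h y \<partial>M\<bar> \<le> 1 / 24" using prems(6) by linarith
      have "y * sqrt k * \<bar>\<integral>y. h y \<partial>M\<bar> \<le> x * sqrt n * \<bar>\<integral>y. h y \<partial>M\<bar>" using sk y x by (intro mult_right_mono mult_mono) auto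
      then show "y * sqrt k * \<bar>\<integral>y. h y \<partial>M\<bar> \<le> 1 / 10" using prems(7) by linarith
    qed
    have x0: "x > 0" using x by simp
    have ne: "sqrt n * \<bar>T.e\<bar> \<le> 1 / 24" using prems(6) by (simp add: Te e_def)
    define R where "R = err x n e"
    have ub: "measure (PiM I (\<lambda>_. M)) (selfnorm_event M h x I) \<le>
      T.m ^ n * exp (- x\<^sup>2 / 2) * (mills x + 500000 * K\<^sup>2 * R / (1 + x)) + K * (x\<^sup>2 * b\<^sup>2) * B"
      unfolding R_def Te(1)[symmetric]
    proof (rule T.event_bounds(1)[OF prems(1-3) x0 b_def ne Kxb])
      fix i assume "i \<in> I"
      then show "measure (PiM I (\<lambda>_. M)) (T.A4 I x i) \<le> K * b ^ 4 * B"
        using IH by (intro T.A4_bound[OF prems(1-3) x0 b_def ne Kxb]) (auto simp: y_def x)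
    qed
    obtain \<rho> where \<rho>: "T.m ^ n = exp (- (x ^ 3 * g) / (3 * sqrt n)) * exp \<rho>" "\<bar>\<rho>\<bar> \<le> 3 / 5"
      using T.m_power[OF prems(3) x0 b_def _ Kxb] prems(7) unfolding Te e_def[symmetric] by metis
    have e2: "exp \<rho> \<le> 2"
    proof -
      have "exp \<rho> \<le> exp (3 / 5)" using \<rho>(2) by simp
      also have "\<dots> \<le> 2" using exp_bound[of "3 / 5"] by (simp add: power2_eq_square)
      finally show ?thesis .
    qed
    have xn: "x\<^sup>2 \<le> sqrt n / 10000" "x \<le> sqrt n / 10000"
    proof -
      have "1 * x\<^sup>2 \<le> K * x\<^sup>2" using K_ge_1 by (intro mult_right_mono) auto
      then show 1: "x\<^sup>2 \<le> sqrt n / 10000" using prems(5) by linarith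
      have "x * 1 \<le> x * x" using x by (intro mult_left_mono) auto
      then show "x \<le> sqrt n / 10000" using 1 by (simp add: power2_eq_square)
    qed
    have R: "R \<le> 4" "0 \<le> R" unfolding R_def
      using err_bounded[OF x0 prems(3) _ _ xn, of e] prems(6,7) by (auto simp: e_def)
    define f where "f = 1 / (1 + x) * lead x n g"
    have f0: "f > 0" using x l0 by (simp add: f_def)
    have t1: "T.m ^ n * exp (- x\<^sup>2 / 2) * (mills x + 500000 * K\<^sup>2 * R / (1 + x)) \<le> (5000000 * K\<^sup>2) * f"
    proof -
      have "mills x \<le> 2 / (1 + x)" using mills_upper[of x] x by (simp add: pos_le_divide_eq mult.commute)
      moreover have "500000 * K\<^sup>2 * R / (1 + x) \<le> 500000 * K\<^sup>2 * 4 / (1 + x)"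
        using R x by (intro divide_right_mono mult_left_mono) auto
      moreover have "2 / (1 + x) \<le> 2 * K\<^sup>2 / (1 + x)" using K2 x by (intro divide_right_mono) auto
      ultimately have "mills x + 500000 * K\<^sup>2 * R / (1 + x) \<le> 2 * K\<^sup>2 / (1 + x) + 500000 * K\<^sup>2 * 4 / (1 + x)" by (rule_tac add_mono) auto
      also have "\<dots> \<le> (2500000 * K\<^sup>2) * (1 / (1 + x))"
        unfolding add_divide_distrib[symmetric] using x by (simp add: divide_right_mono)
      finally have a: "mills x + 500000 * K\<^sup>2 * R / (1 + x) \<le> (2500000 * K\<^sup>2) * (1 / (1 + x))" .
      have b: "T.m ^ n * exp (- x\<^sup>2 / 2) = lead x n g * exp \<rho>" unfolding \<rho>(1) lead_def by (simp add: mult_ac)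
      have c: "lead x n g * exp \<rho> \<le> lead x n g * 2" using e2 l0 by (intro mult_left_mono) auto
      have "T.m ^ n * exp (- x\<^sup>2 / 2) * (mills x + 500000 * K\<^sup>2 * R / (1 + x)) \<le> (lead x n g * 2) * ((2500000 * K\<^sup>2) * (1 / (1 + x)))"
        unfolding b using a c l0 mills_bounds(1)[of x] x R by (intro mult_mono) auto
      also have "\<dots> = (5000000 * K\<^sup>2) * f" by (simp add: f_def)
      finally show ?thesis .
    qed
    \<comment> \<open>The recursive term regains a factor 12 from \<open>lead_shift\<close> but
      carries K x^2 b^2 <= 1/10000, so it stays below half of the constant and the induction
      closes.\<close>
    have t2: "K * (x\<^sup>2 * b\<^sup>2) * B \<le> (5000000 * K\<^sup>2) * f"
    proof -
      have B: "B \<le> 10000000 * K\<^sup>2 * (12 * f)" unfolding B_def kn(1)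
        using lead_shift[OF x third_le K_ge_1 _ prems(5)] n4 K2 unfolding y_def[symmetric] f_def g_def[symmetric]
        by (intro mult_left_mono) auto
      have "x * b \<le> 1"
      proof -
        have "1 * (x * b) \<le> K * (x * b)" using K_ge_1 x b0 by (intro mult_right_mono) auto
        then show ?thesis using Kxb by linarith
      qed
      then have "(K * (x * b)) * (x * b) \<le> (1 / 10000) * 1" using Kxb K_ge_1 x b0 by (intro mult_mono) auto
      then have "K * (x\<^sup>2 * b\<^sup>2) \<le> 1 / 10000" by (simp add: power2_eq_square mult_ac)
      then have "K * (x\<^sup>2 * b\<^sup>2) * B \<le> (1 / 10000) * (10000000 * K\<^sup>2 * (12 * f))"
        using B K_ge_1 y(1) lead_pos[of y k g] by (intro mult_mono) (auto simp: B_def)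
      also have "\<dots> \<le> (5000000 * K\<^sup>2) * f"
      proof -
        have "12000 * (K\<^sup>2 * f) \<le> 5000000 * (K\<^sup>2 * f)" using f0 by (intro mult_right_mono) auto
        then show ?thesis by simp
      qed
      finally show ?thesis .
    qed
    have "measure (PiM I (\<lambda>_. M)) (selfnorm_event M h x I) \<le> (5000000 * K\<^sup>2) * f + (5000000 * K\<^sup>2) * f" using ub t1 t2 by linarith
    then show ?thesis unfolding f_def g_def n_def by simp
  qed
qed

text \<open>The crude bound is inserted in the term of a large summand. Its prefactor K x^2 b^2 is
  at most K \<open>err\<close>, so a bound that is right only up to a constant is enough for a
  relative error.\<close>

lemma selfnorm_tail:
  assumes I: "finite I" "card I = n" "n \<ge> 1" and x: "x > 0"
    and Kx: "K * x\<^sup>2 \<le> sqrt n / 10000" "K * x \<le> sqrt n / 10000"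
    and ne: "sqrt n * \<bar>\<integral>y. h y \<partial>M\<bar> \<le> 1 / 24" and xne: "x * sqrt n * \<bar>\<integral>y. h y \<partial>M\<bar> \<le> 1 / 10"
  defines "L \<equiv> lead x n (\<integral>y. h y ^ 3 \<partial>M) * mills x"
  shows "\<bar>measure (PiM I (\<lambda>_. M)) (selfnorm_event M h x I) - L\<bar> \<le> 3000000000 * K ^ 3 * err x n (\<integral>y. h y \<partial>M) * L"
proof -
  define g where "g = (\<integral>y. h y ^ 3 \<partial>M)"
  define e where "e = (\<integral>y. h y \<partial>M)"
  interpret P: prob_space "PiM I (\<lambda>_. M)" by (rule prob_space_Pi)
  have sn: "sqrt n \<ge> 1" using I by simp
  define b where "b = x / sqrt n"
  have b0: "b > 0" unfolding b_def by (rule divide_pos_pos) (use x sn in linarith)+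
  have Kxb: "K * (x * b) \<le> 1 / 10000"
  proof -
    have "K * (x * b) = K * x\<^sup>2 / sqrt n" by (simp add: b_def power2_eq_square)
    then show ?thesis using Kx(1) sn by (simp add: pos_divide_le_eq)
  qed
  have bK: "b * K \<le> 1 / 10000"
  proof -
    have "b * K = K * x / sqrt n" by (simp add: b_def)
    then show ?thesis using Kx(2) sn by (simp add: pos_divide_le_eq)
  qed
  have e16: "\<bar>\<integral>y. h y \<partial>M\<bar> \<le> 1 / 16"
  proof -
    have "1 * \<bar>\<integral>y. h y \<partial>M\<bar> \<le> sqrt n * \<bar>\<integral>y. h y \<partial>M\<bar>" by (rule mult_right_mono) (use sn in linarith, simp)
    then show ?thesis using ne by linarith
  qed
  interpret T: tilting M h K b by (rule tiltingI[OF b0 bK e16])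
  have Te: "T.e = e" "T.g3 = g" by (simp_all add: T.e_def T.g3_def e_def g_def)
  have ne': "sqrt n * \<bar>T.e\<bar> \<le> 1 / 24" using ne by (simp add: Te e_def)
  have xn: "x\<^sup>2 \<le> sqrt n / 10000" "x \<le> sqrt n / 10000"
  proof -
    have "1 * x\<^sup>2 \<le> K * x\<^sup>2" "1 * x \<le> K * x" using K_ge_1 x by (auto intro!: mult_right_mono)
    then show "x\<^sup>2 \<le> sqrt n / 10000" "x \<le> sqrt n / 10000" using Kx by linarith+
  qed
  define R where "R = err x n e"
  have R: "0 \<le> R" unfolding R_def using err_bounded(2)[OF x I(3) _ _ xn, of e] ne xne by (auto simp: e_def)
  define D where "D = lead x n g"
  have D: "D > 0" by (simp add: D_def lead_pos)
  define f where "f = D * (1 / (1 + x))"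
  have f: "f > 0" using x D by (simp add: f_def)
  \<comment> \<open>For x < 1 the trivial value 1 will do because the leading term is bounded below;
    for x >= 1 the crude bound at the lowered level is used.\<close>
  obtain B where B: "\<And>i. i \<in> I \<Longrightarrow> measure (PiM I (\<lambda>_. M)) (T.A4 I x i) \<le> K * b ^ 4 * B" "0 \<le> B" "B \<le> 120000000 * K\<^sup>2 * f"
  proof (cases "x < 1")
    case True
    show ?thesis
    proof (rule that[of 1])
      show "measure (PiM I (\<lambda>_. M)) (T.A4 I x i) \<le> K * b ^ 4 * 1" if "i \<in> I" for i
        using that by (rule T.A4_bound_trivial[OF I x b_def ne' Kxb])
      have "1 \<le> 6 / (1 + x) * D"
        unfolding g_def D_def using x True I Kx by (intro lead_small_x[OF _ _ third_le K_ge_1]) auto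
      then have "1 \<le> 6 * f" by (simp add: f_def)
      moreover have "6 * f \<le> (120000000 * K\<^sup>2) * f" using K_ge_1 f by (intro mult_right_mono) (auto intro: order_trans[OF _ mult_left_mono[of 1]])
      ultimately show "1 \<le> 120000000 * K\<^sup>2 * f" by linarith
    qed simp
  next
    case False
    then have x1: "x \<ge> 1" by simp
    have "1 * 1 \<le> K * x\<^sup>2" using K_ge_1 x1 by (intro mult_mono) auto
    then have sn': "10000 \<le> sqrt n" using Kx by simp
    then have "sqrt 4 \<le> sqrt n" by (simp add: real_sqrt_four)
    then have n4: "n \<ge> 4" by (simp only: real_sqrt_le_iff)
    define y where "y = sqrt (x\<^sup>2 - 1)"
    define k where "k = n - 1"
    have y: "0 \<le> y" "y \<le> x" "y\<^sup>2 = x\<^sup>2 - 1"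
    proof -
      have "x\<^sup>2 \<ge> 1" using x1 by simp
      then show "0 \<le> y" "y\<^sup>2 = x\<^sup>2 - 1" by (auto simp: y_def)
      show "y \<le> x" unfolding y_def using x by (intro real_le_lsqrt) auto
    qed
    have sk: "sqrt n - 1 \<le> sqrt k" "sqrt k \<le> sqrt n"
    proof -
      have "(sqrt n - 1)\<^sup>2 \<le> k" using sn' n4 by (simp add: power2_diff k_def of_nat_diff)
      then show "sqrt n - 1 \<le> sqrt k" by (rule real_le_rsqrt)
      show "sqrt k \<le> sqrt n" by (simp add: k_def)
    qed
    define B where "B = 10000000 * K\<^sup>2 * (1 / (1 + y) * lead y k g)"
    show ?thesis
    proof (rule that[of B])
      show "0 \<le> B" using y lead_pos[of y k g] by (simp add: B_def)
      have "B \<le> 10000000 * K\<^sup>2 * (12 / (1 + x) * D)" unfolding B_def k_def D_def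
        using lead_shift[OF x1 third_le K_ge_1 _ Kx(1)] n4 unfolding y_def[symmetric] g_def[symmetric]
        by (intro mult_left_mono) auto
      then show "B \<le> 120000000 * K\<^sup>2 * f" by (simp add: f_def mult_ac)
      fix i assume i: "i \<in> I"
      have "measure (PiM (I - {i}) (\<lambda>_. M)) (selfnorm_event M h y (I - {i})) \<le> B"
        unfolding B_def g_def
      proof (rule crude_upper)
        show "finite (I - {i})" "card (I - {i}) = k" using I i by (auto simp: k_def)
        show "1 \<le> k" "0 \<le> y" using n4 y by (auto simp: k_def)
        have "K * y\<^sup>2 = K * x\<^sup>2 - K" using y by (simp add: right_diff_distrib)
        then show "K * y\<^sup>2 \<le> sqrt k / 10000" using Kx(1) sk K_ge_1 by linarith
        have "sqrt k * \<bar>\<integral>y. h y \<partial>M\<bar> \<le> sqrt n * \<bar>\<integral>y. h y \<partial>M\<bar>" using sk by (intro mult_right_mono) auto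
        then show "sqrt k * \<bar>\<integral>y. h y \<partial>M\<bar> \<le> 1 / 24" using ne by linarith
        have "y * sqrt k * \<bar>\<integral>y. h y \<partial>M\<bar> \<le> x * sqrt n * \<bar>\<integral>y. h y \<partial>M\<bar>" using sk y x by (intro mult_right_mono mult_mono) auto
        then show "y * sqrt k * \<bar>\<integral>y. h y \<partial>M\<bar> \<le> 1 / 10" using xne by linarith
      qed
      then show "measure (PiM I (\<lambda>_. M)) (T.A4 I x i) \<le> K * b ^ 4 * B"
        using i x1 by (intro T.A4_bound[OF I x b_def ne' Kxb]) (auto simp: y_def)
    qed
  qed
  obtain \<rho> where \<rho>: "T.m ^ n = exp (- (x ^ 3 * g) / (3 * sqrt n)) * exp \<rho>" "\<bar>\<rho>\<bar> \<le> 9 * K * R" "\<bar>\<rho>\<bar> \<le> 3 / 5"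
    using T.m_power[OF I(3) x b_def _ Kxb] xne unfolding Te e_def[symmetric] R_def by metis
  have e35: "exp (3 / 5) \<le> (2::real)" using exp_bound[of "3 / 5"] by (simp add: power2_eq_square)
  have er: "exp \<rho> \<le> 2" using \<rho>(3) e35 by (smt (verit) exp_le_cancel_iff)
  have er1: "\<bar>exp \<rho> - 1\<bar> \<le> 18 * K * R"
  proof -
    have "\<bar>exp \<rho> - exp 0\<bar> \<le> \<bar>\<rho> - 0\<bar> * exp (max \<rho> 0)" by (rule exp_diff_le)
    also have "\<dots> \<le> (9 * K * R) * 2" using \<rho> er by (intro mult_mono) (auto simp: max_def)
    finally show ?thesis by simp
  qed
  define P where "P = measure (PiM I (\<lambda>_. M)) (selfnorm_event M h x I)"
  define q where "q = 500000 * K\<^sup>2 * R"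
  have mD: "T.m ^ n * exp (- x\<^sup>2 / 2) = D * exp \<rho>" unfolding \<rho>(1) D_def lead_def by (simp add: mult_ac)
  have ub: "P \<le> D * exp \<rho> * (mills x + q / (1 + x)) + K * (x\<^sup>2 * b\<^sup>2) * B"
    using T.event_bounds(1)[OF I x b_def ne' Kxb B(1)] unfolding mD P_def Te R_def q_def .
  have lb: "P \<ge> D * exp \<rho> * (mills x - q / (1 + x))"
    using T.event_bounds(2)[OF I x b_def ne' Kxb B(1)] unfolding mD P_def Te R_def q_def .
  have t2: "K * (x\<^sup>2 * b\<^sup>2) * B \<le> 120000000 * K ^ 3 * R * f"
  proof -
    have "x\<^sup>2 * b\<^sup>2 = x ^ 4 / n" using I by (simp add: b_def power_divide power2_eq_square power4_eq_xxxx)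
    also have "\<dots> \<le> (1 + x ^ 4) / n" by (simp add: divide_right_mono)
    also have "\<dots> \<le> R" unfolding R_def err_def using x by simp
    finally have "K * (x\<^sup>2 * b\<^sup>2) * B \<le> K * R * (120000000 * K\<^sup>2 * f)"
      using B K_ge_1 R by (intro mult_mono) auto
    then show ?thesis by (simp add: power2_eq_square power3_eq_cube mult_ac)
  qed
  have q0: "0 \<le> q" using R by (simp add: q_def)
  define G where "G = D * mills x"
  have G0: "G \<ge> 0" using D mills_bounds(1)[of x] x by (simp add: G_def)
  \<comment> \<open>Errors are measured against 1/(1+x), the claim against the Mills ratio;
    \<open>mills_lower\<close> makes them comparable.\<close>
  have fG: "f \<le> 18 * G"
  proof -
    have "D * (1 / (1 + x)) \<le> D * (18 * mills x)" using mills_lower[of x] x D by (intro mult_left_mono) auto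
    then show ?thesis by (simp add: f_def G_def)
  qed
  have a1: "\<bar>G * exp \<rho> - G\<bar> \<le> (18 * K * R) * G"
  proof -
    have "G * exp \<rho> - G = G * (exp \<rho> - 1)" by (simp add: algebra_simps)
    then have "\<bar>G * exp \<rho> - G\<bar> = G * \<bar>exp \<rho> - 1\<bar>" using G0 by (simp add: abs_mult)
    also have "\<dots> \<le> G * (18 * K * R)" using er1 G0 by (intro mult_left_mono) auto
    finally show ?thesis by (simp add: mult.commute)
  qed
  have a2: "D * exp \<rho> * (q / (1 + x)) \<le> 2 * q * f"
  proof -
    have "D * exp \<rho> * (q / (1 + x)) = exp \<rho> * (q * f)" by (simp add: f_def)
    also have "\<dots> \<le> 2 * (q * f)" using er q0 f by (intro mult_right_mono) auto
    finally show ?thesis by simp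
  qed
  have e1: "D * exp \<rho> * (mills x + q / (1 + x)) = G * exp \<rho> + D * exp \<rho> * (q / (1 + x))"
    "D * exp \<rho> * (mills x - q / (1 + x)) = G * exp \<rho> - D * exp \<rho> * (q / (1 + x))"
    by (simp_all add: G_def algebra_simps)
  have lin: "\<bar>P - G\<bar> \<le> a + u + w"
    if "P \<le> E + s + w'" "P \<ge> E - s" "w' \<le> w" "0 \<le> w" "s \<le> u" "\<bar>E - G\<bar> \<le> a" for P G a u w w' E s :: real
    using that by linarith
  have "\<bar>P - G\<bar> \<le> (18 * K * R) * G + 2 * q * f + 120000000 * K ^ 3 * R * f"
    by (rule lin[OF ub[unfolded e1] lb[unfolded e1] t2 _ a2 a1]) (use K_ge_1 R f in auto)
  also have "\<dots> \<le> 3000000000 * K ^ 3 * R * G"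
  proof -
    define w where "w = K ^ 3 * R * G"
    have K3: "K \<le> K ^ 3" "K\<^sup>2 \<le> K ^ 3"
      using K_ge_1 power_increasing[of 1 3 K] power_increasing[of 2 3 K] by auto
    have RG: "0 \<le> R * G" using R G0 by simp
    have p1: "(18 * K * R) * G \<le> 18 * w"
      using mult_right_mono[OF K3(1) RG] by (simp add: w_def mult_ac)
    have Rf: "R * f \<le> 18 * (R * G)" using mult_left_mono[OF fG R] by (simp add: mult_ac)
    have p2: "2 * q * f \<le> 18000000 * w"
    proof -
      have "K\<^sup>2 * (R * f) \<le> K ^ 3 * (18 * (R * G))" by (rule mult_mono[OF K3(2) Rf]) (use R f K_ge_1 in auto)
      then show ?thesis by (simp add: q_def w_def mult_ac)
    qed
    have p3: "120000000 * K ^ 3 * R * f \<le> 2160000000 * w"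
    proof -
      have "K ^ 3 * (R * f) \<le> K ^ 3 * (18 * (R * G))" using Rf K_ge_1 by (intro mult_left_mono) auto
      then show ?thesis by (simp add: w_def mult_ac)
    qed
    have "0 \<le> w" using RG K_ge_1 by (simp add: w_def mult.assoc)
    then have "(18 * K * R) * G + 2 * q * f + 120000000 * K ^ 3 * R * f \<le> 3000000000 * w" using p1 p2 p3 by linarith
    then show ?thesis by (simp add: w_def mult_ac)
  qed
  finally show ?thesis unfolding P_def G_def D_def L_def R_def e_def g_def .
qed

end

end

subsection \<open>Moments of the winsorized variable\<close>

lemma winsor_measurable[measurable]: "winsor \<tau> \<in> borel_measurable borel"
  unfolding winsor_def[abs_def] by measurable

lemma winsor_props:
  assumes "\<tau> > 0"
  shows "\<bar>winsor \<tau> y\<bar> \<le> \<bar>y\<bar>" "\<bar>winsor \<tau> y - y\<bar> \<le> \<bar>y\<bar>" "\<bar>y\<bar> \<le> \<tau> \<Longrightarrow> winsor \<tau> y = y"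
  using assms by (auto simp: winsor_def)

text \<open>The deviation vanishes unless |y| > \<open>\<tau>\<close>; there it is at most |y|, and
  every missing factor |y| is paid for by 1 <= |y|/\<open>\<tau>\<close>. The values k = 0, 1, 2
  give the bias, the variance gap and the third-moment gap.\<close>

lemma winsor_deviation:
  assumes \<tau>: "\<tau> > 0" and k: "k \<le> 3"
  shows "\<bar>winsor \<tau> y - y\<bar> * \<bar>y\<bar> ^ k \<le> y ^ 4 / \<tau> ^ (3 - k)"
proof (cases "\<bar>y\<bar> \<le> \<tau>")
  case False
  then have y: "\<tau> < \<bar>y\<bar>" by simp
  have "\<bar>winsor \<tau> y - y\<bar> * \<bar>y\<bar> ^ k * \<tau> ^ (3 - k) \<le> \<bar>y\<bar> * \<bar>y\<bar> ^ k * \<bar>y\<bar> ^ (3 - k)"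
    using winsor_props(2)[OF \<tau>, of y] y \<tau> by (intro mult_mono power_mono) auto
  also have "\<dots> = \<bar>y\<bar> ^ (1 + k + (3 - k))" by (simp only: power_add power_one_right)
  also have "\<dots> = y ^ 4" using k by (simp add: power_even_abs)
  finally show ?thesis using \<tau> by (simp add: pos_le_divide_eq)
qed (use winsor_props(3)[OF \<tau>] \<tau> in simp)

text \<open>Where winsorizing acts, |\<open>\<mu>\<close>| <= \<open>\<tau>\<close> < |y| bounds
  both centred values by 2 |y|, and differences of squares and cubes contain the deviation as a
  factor.\<close>

lemma winsor_centered_differences:
  assumes \<tau>: "\<tau> > 0" and \<mu>: "\<bar>\<mu>\<bar> \<le> \<tau>"
  shows "\<bar>(winsor \<tau> y - \<mu>)\<^sup>2 - (y - \<mu>)\<^sup>2\<bar> \<le> 4 * (y ^ 4 / \<tau>\<^sup>2)"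
    "\<bar>(winsor \<tau> y - \<mu>) ^ 3 - (y - \<mu>) ^ 3\<bar> \<le> 12 * (y ^ 4 / \<tau>)"
proof -
  define d where "d = \<bar>winsor \<tau> y - y\<bar>"
  define p q where "p = winsor \<tau> y - \<mu>" and "q = y - \<mu>"
  have pq: "\<bar>p - q\<bar> = d" by (simp add: p_def q_def d_def)
  have d0: "d \<ge> 0" by (simp add: d_def)
  have bd: "d = 0 \<or> (\<bar>p\<bar> \<le> 2 * \<bar>y\<bar> \<and> \<bar>q\<bar> \<le> 2 * \<bar>y\<bar>)"
  proof (cases "\<bar>y\<bar> \<le> \<tau>")
    case False
    then show ?thesis using \<mu> winsor_props(1)[OF \<tau>, of y] unfolding p_def q_def by auto
  qed (simp add: d_def winsor_props(3)[OF \<tau>])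
  have d1: "d * \<bar>y\<bar> \<le> y ^ 4 / \<tau>\<^sup>2" "d * \<bar>y\<bar>\<^sup>2 \<le> y ^ 4 / \<tau>"
    using winsor_deviation[OF \<tau>, of 1 y] winsor_deviation[OF \<tau>, of 2 y] by (simp_all add: d_def)
  have "\<bar>p\<^sup>2 - q\<^sup>2\<bar> = d * \<bar>p + q\<bar>"
    unfolding pq[symmetric] abs_mult[symmetric] by (simp add: power2_eq_square algebra_simps)
  also have "\<dots> \<le> 4 * (d * \<bar>y\<bar>)"
  proof (cases "d = 0")
    case False
    then have "\<bar>p + q\<bar> \<le> 4 * \<bar>y\<bar>" using bd by linarith
    then have "d * \<bar>p + q\<bar> \<le> d * (4 * \<bar>y\<bar>)" using d0 by (intro mult_left_mono)
    then show ?thesis by simp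
  qed simp
  finally show "\<bar>(winsor \<tau> y - \<mu>)\<^sup>2 - (y - \<mu>)\<^sup>2\<bar> \<le> 4 * (y ^ 4 / \<tau>\<^sup>2)" using d1 unfolding p_def q_def by linarith
  have "\<bar>p ^ 3 - q ^ 3\<bar> = d * \<bar>p * p + p * q + q * q\<bar>"
    unfolding pq[symmetric] abs_mult[symmetric] by (simp add: power3_eq_cube algebra_simps)
  also have "\<dots> \<le> 12 * (d * \<bar>y\<bar>\<^sup>2)"
  proof (cases "d = 0")
    case False
    then have pq2: "\<bar>p\<bar> \<le> 2 * \<bar>y\<bar>" "\<bar>q\<bar> \<le> 2 * \<bar>y\<bar>" using bd by auto
    have lin: "\<bar>a + b + c\<bar> \<le> 3 * t" if "\<bar>a\<bar> \<le> t" "\<bar>b\<bar> \<le> t" "\<bar>c\<bar> \<le> t" for a b c t :: real using that by linarith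
    have "\<bar>p * p\<bar> \<le> (2 * \<bar>y\<bar>) * (2 * \<bar>y\<bar>)" "\<bar>p * q\<bar> \<le> (2 * \<bar>y\<bar>) * (2 * \<bar>y\<bar>)" "\<bar>q * q\<bar> \<le> (2 * \<bar>y\<bar>) * (2 * \<bar>y\<bar>)"
      unfolding abs_mult using pq2 by (intro mult_mono; simp)+
    then have "\<bar>p * p + p * q + q * q\<bar> \<le> 3 * ((2 * \<bar>y\<bar>) * (2 * \<bar>y\<bar>))" by (rule lin)
    then have "\<bar>p * p + p * q + q * q\<bar> \<le> 12 * \<bar>y\<bar>\<^sup>2" by (simp add: power2_eq_square)
    then have "d * \<bar>p * p + p * q + q * q\<bar> \<le> d * (12 * \<bar>y\<bar>\<^sup>2)" using d0 by (intro mult_left_mono)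
    then show ?thesis by simp
  qed simp
  finally show "\<bar>(winsor \<tau> y - \<mu>) ^ 3 - (y - \<mu>) ^ 3\<bar> \<le> 12 * (y ^ 4 / \<tau>)" using d1 unfolding p_def q_def by linarith
qed

lemma fourth_power_sum_le: "(p + q) ^ 4 \<le> 8 * (p ^ 4 + q ^ 4)" for p q :: real
proof -
  have "(p + q)\<^sup>2 \<le> 2 * (p\<^sup>2 + q\<^sup>2)" by (smt (verit) power2_sum sum_squares_bound)
  then have "((p + q)\<^sup>2)\<^sup>2 \<le> (2 * (p\<^sup>2 + q\<^sup>2))\<^sup>2" by (intro power_mono) auto
  also have "\<dots> \<le> 4 * (2 * ((p\<^sup>2)\<^sup>2 + (q\<^sup>2)\<^sup>2))"
  proof -
    have "(p\<^sup>2 + q\<^sup>2)\<^sup>2 \<le> 2 * ((p\<^sup>2)\<^sup>2 + (q\<^sup>2)\<^sup>2)" by (smt (verit) power2_sum sum_squares_bound)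
    moreover have "(2 * (p\<^sup>2 + q\<^sup>2))\<^sup>2 = 4 * (p\<^sup>2 + q\<^sup>2)\<^sup>2" unfolding power_mult_distrib by simp
    ultimately show ?thesis by simp
  qed
  finally show ?thesis by (simp flip: power_mult)
qed

text \<open>The left side is a weighted geometric mean of the two terms on the right, with weights
  2/3 and 1/3. With y = sqrt n it absorbs the cost of exchanging third moments into the admissible
  rate.\<close>

lemma geometric_mean_bound:
  fixes x y \<tau> :: real
  assumes x: "x > 0" and y: "y > 0" and \<tau>: "\<tau> > 0"
  shows "x ^ 3 / (y * \<tau>) \<le> x ^ 4 / y\<^sup>2 + x * y / \<tau> ^ 3"
proof -
  define u where "u = x ^ 3 / (y * \<tau>)"
  have u: "u \<ge> 0" using assms by (simp add: u_def)
  have a: "x ^ 4 / y\<^sup>2 = u * (x * \<tau> / y)"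
    using assms by (simp add: u_def power2_eq_square power3_eq_cube power4_eq_xxxx)
  have c: "x * y / \<tau> ^ 3 = u * ((y / (x * \<tau>)) * (y / (x * \<tau>)))"
    using assms by (simp add: u_def power2_eq_square power3_eq_cube field_simps)
  have pos: "0 \<le> x ^ 4 / y\<^sup>2" "0 \<le> x * y / \<tau> ^ 3" using assms by auto
  have "u \<le> x ^ 4 / y\<^sup>2 + x * y / \<tau> ^ 3"
  proof (cases "y \<le> x * \<tau>")
    case True
    then have "u * 1 \<le> u * (x * \<tau> / y)" using y by (intro mult_left_mono u) simp
    then show ?thesis using a pos by linarith
  next
    case False
    then have q: "1 \<le> y / (x * \<tau>)" using assms by simp
    then have "1 * 1 \<le> (y / (x * \<tau>)) * (y / (x * \<tau>))" by (intro mult_mono) auto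
    then have "u * 1 \<le> u * ((y / (x * \<tau>)) * (y / (x * \<tau>)))" by (intro mult_left_mono u) simp
    then show ?thesis using c pos by linarith
  qed
  then show ?thesis by (simp add: u_def)
qed

text \<open>A common scale B cancels. If the norm vanishes then so does the sum, the quotient takes
  the value 0, and both conditions fail because x > 0.\<close>

lemma selfnorm_winsor_event:
  assumes B: "B > 0" and x: "x > 0"
  shows "{\<omega> \<in> space (PiM {..<n} (\<lambda>_. D)). selfnorm_winsor \<tau> \<mu> n \<omega> > x} =
    selfnorm_event D (\<lambda>z. (winsor \<tau> z - \<mu>) / B) x {..<n}"
proof -
  have "selfnorm_winsor \<tau> \<mu> n \<omega> > x \<longleftrightarrow>
      psum (\<lambda>z. (winsor \<tau> z - \<mu>) / B) {..<n} \<omega> > x * sqrt (psum (\<lambda>z. ((winsor \<tau> z - \<mu>) / B)\<^sup>2) {..<n} \<omega>)" for \<omega>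
  proof -
    define S where "S = (\<Sum>i<n. winsor \<tau> (\<omega> i) - \<mu>)"
    define V where "V = (\<Sum>i<n. (winsor \<tau> (\<omega> i) - \<mu>)\<^sup>2)"
    have V0: "V \<ge> 0" unfolding V_def by (rule sum_nonneg) simp
    have p1: "psum (\<lambda>z. (winsor \<tau> z - \<mu>) / B) {..<n} \<omega> = S / B"
      by (simp add: psum_def S_def sum_divide_distrib)
    have p2: "sqrt (psum (\<lambda>z. ((winsor \<tau> z - \<mu>) / B)\<^sup>2) {..<n} \<omega>) = sqrt V / B"
      using B by (simp add: psum_def V_def power_divide real_sqrt_divide flip: sum_divide_distrib)
    have "S / sqrt V > x \<longleftrightarrow> S > x * sqrt V"
    proof (cases "V = 0")
      case True
      then have "\<forall>i<n. (winsor \<tau> (\<omega> i) - \<mu>)\<^sup>2 = 0" unfolding V_def by (subst (asm) sum_nonneg_eq_0_iff) auto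
      then have "S = 0" unfolding S_def by simp
      then show ?thesis using True x by simp
    next
      case False
      then have "sqrt V > 0" using V0 by simp
      then show ?thesis by (simp add: pos_less_divide_eq)
    qed
    moreover have "S > x * sqrt V \<longleftrightarrow> S / B > x * (sqrt V / B)"
      using B by (simp add: divide_less_cancel)
    ultimately show ?thesis unfolding p1 p2 selfnorm_winsor_def S_def[symmetric] V_def[symmetric] by simp
  qed
  then show ?thesis unfolding selfnorm_event_def by auto
qed

section \<open>Transfer from normalized summands to the winsorized sample\<close>

definition third_gap :: "real \<Rightarrow> real \<Rightarrow> real" where
  "third_gap s m4 = 96 * m4 / s ^ 3 + (1 + 16 * m4) * (32 * sqrt m4 / s ^ 4)"

definition tail_const :: "real \<Rightarrow> real \<Rightarrow> real" where
  "tail_const s m4 = (3000000000 * (32 * m4 / s ^ 4) ^ 3 * (1 + 2 * m4 / s) + third_gap s m4) * exp (2 * third_gap s m4)"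

text \<open>The gap splits into a change of the third moment and a change of the scale from s to B.
  The latter is of order 1/\<open>\<tau>\<close>^2, and 4 sqrt m4 <= \<open>\<tau>\<close> s trades
  one power so that both parts are of order 1/\<open>\<tau>\<close>.\<close>

lemma normalized_third_moment_gap:
  fixes B s w3 u3 m4 \<tau> :: real
  assumes s: "s > 0" and B: "s / 2 \<le> B" "B \<le> 2 * s" and \<tau>: "\<tau> > 0" "4 * sqrt m4 \<le> \<tau> * s" and m4: "m4 \<ge> 0"
    and d2: "\<bar>B\<^sup>2 - s\<^sup>2\<bar> \<le> 4 * (m4 / \<tau>\<^sup>2)" and d3: "\<bar>w3 - u3\<bar> \<le> 12 * (m4 / \<tau>)" and u3: "\<bar>u3\<bar> \<le> 1 + 16 * m4"
  shows "\<bar>w3 / B ^ 3 - u3 / s ^ 3\<bar> \<le> third_gap s m4 / \<tau>"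
proof -
  have B0: "B > 0" using s B by linarith
  have B3: "s ^ 3 / 8 \<le> B ^ 3"
  proof -
    have "(s / 2) ^ 3 \<le> B ^ 3" using B s by (intro power_mono) auto
    then show ?thesis by (simp add: power_divide)
  qed
  have p1: "\<bar>(w3 - u3) / B ^ 3\<bar> \<le> 96 * m4 / s ^ 3 / \<tau>"
  proof -
    have "\<bar>w3 - u3\<bar> / B ^ 3 \<le> (12 * (m4 / \<tau>)) / (s ^ 3 / 8)" using d3 B3 s m4 \<tau> by (intro frac_le) auto
    then show ?thesis using B0 by (simp add: abs_divide mult_ac)
  qed
  have p2: "\<bar>s ^ 3 - B ^ 3\<bar> \<le> 12 * m4 * s / \<tau>\<^sup>2"
  proof -
    have "\<bar>s ^ 3 - B ^ 3\<bar> = \<bar>B - s\<bar> * (B * B + B * s + s * s)"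
    proof -
      have "s ^ 3 - B ^ 3 = - ((B - s) * (B * B + B * s + s * s))" by (simp add: power3_eq_cube algebra_simps)
      then have "\<bar>s ^ 3 - B ^ 3\<bar> = \<bar>B - s\<bar> * \<bar>B * B + B * s + s * s\<bar>" by (simp only: abs_minus_cancel abs_mult)
      also have "\<bar>B * B + B * s + s * s\<bar> = B * B + B * s + s * s" using B0 s by (intro abs_of_nonneg) simp
      finally show ?thesis .
    qed
    also have "\<dots> \<le> \<bar>B - s\<bar> * ((B + s) * (B + s))" using B0 s by (intro mult_left_mono) (auto simp: algebra_simps)
    also have "\<dots> = \<bar>B\<^sup>2 - s\<^sup>2\<bar> * (B + s)"
    proof -
      have "\<bar>B\<^sup>2 - s\<^sup>2\<bar> = \<bar>(B - s) * (B + s)\<bar>" by (simp add: power2_eq_square algebra_simps)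
      also have "\<dots> = \<bar>B - s\<bar> * (B + s)" unfolding abs_mult using B0 s by simp
      finally show ?thesis by (simp only: mult.assoc)
    qed
    also have "\<dots> \<le> (4 * (m4 / \<tau>\<^sup>2)) * (3 * s)" using d2 B B0 s m4 by (intro mult_mono) auto
    finally show ?thesis by simp
  qed
  have p3: "\<bar>s ^ 3 - B ^ 3\<bar> / (B ^ 3 * s ^ 3) \<le> 32 * sqrt m4 / s ^ 4 / \<tau>"
  proof -
    have "m4 = sqrt m4 * sqrt m4" using m4 by simp
    also have "\<dots> \<le> sqrt m4 * (\<tau> * s / 4)" using \<tau> m4 by (intro mult_left_mono) auto
    finally have m: "m4 \<le> sqrt m4 * (\<tau> * s / 4)" .
    have "\<bar>s ^ 3 - B ^ 3\<bar> / (B ^ 3 * s ^ 3) \<le> (12 * m4 * s / \<tau>\<^sup>2) / (s ^ 3 / 8 * s ^ 3)"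
      using p2 B3 s m4 by (intro frac_le mult_right_mono) auto
    also have "\<dots> = m4 * (96 * s / (\<tau>\<^sup>2 * (s ^ 3 * s ^ 3)))" by simp
    also have "\<dots> \<le> (sqrt m4 * (\<tau> * s / 4)) * (96 * s / (\<tau>\<^sup>2 * (s ^ 3 * s ^ 3)))"
      using m s by (intro mult_right_mono) auto
    also have "\<dots> = 24 * sqrt m4 / s ^ 4 / \<tau>"
      using s \<tau>(1) by (simp add: power2_eq_square power3_eq_cube power4_eq_xxxx field_simps)
    also have "\<dots> \<le> 32 * sqrt m4 / s ^ 4 / \<tau>" using s \<tau> m4 by (intro divide_right_mono mult_right_mono) auto
    finally show ?thesis .
  qed
  have "w3 / B ^ 3 - u3 / s ^ 3 = (w3 - u3) / B ^ 3 + u3 * ((s ^ 3 - B ^ 3) / (B ^ 3 * s ^ 3))"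
    using B0 s by (simp add: field_simps)
  moreover have "\<bar>u3 * ((s ^ 3 - B ^ 3) / (B ^ 3 * s ^ 3))\<bar> \<le> (1 + 16 * m4) * (32 * sqrt m4 / s ^ 4 / \<tau>)"
  proof -
    have "\<bar>(s ^ 3 - B ^ 3) / (B ^ 3 * s ^ 3)\<bar> = \<bar>s ^ 3 - B ^ 3\<bar> / (B ^ 3 * s ^ 3)" using B0 s by (simp add: abs_divide)
    then show ?thesis unfolding abs_mult using p3 u3 m4 by (intro mult_mono) auto
  qed
  moreover have "third_gap s m4 / \<tau> = 96 * m4 / s ^ 3 / \<tau> + (1 + 16 * m4) * (32 * sqrt m4 / s ^ 4 / \<tau>)"
    by (simp add: third_gap_def add_divide_distrib)
  ultimately show ?thesis using p1 by linarith
qed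

text \<open>The scale B is the root of the second moment about \<open>\<mu>\<close>, not the
  standard deviation of the winsorized variable: then h has second moment exactly 1, and the bias
  appears as its mean e alone.\<close>

lemma winsorized_tail:
  fixes D :: "real measure" and n :: nat and \<tau> x c \<mu> \<sigma> m4 :: real
  assumes D: "prob_space D" "sets D = sets borel" "integrable D (\<lambda>y. y ^ 4)"
    and \<mu>: "(\<integral>y. y \<partial>D) = \<mu>" and \<sigma>2: "(\<integral>y. (y - \<mu>)\<^sup>2 \<partial>D) = \<sigma>\<^sup>2" and m4: "(\<integral>y. y ^ 4 \<partial>D) = m4"
    and \<sigma>: "\<sigma> > 0" and n: "n \<ge> 1" and \<tau>: "\<tau> > 0" "4 * sqrt m4 \<le> \<tau> * \<sigma>" "64 * (sqrt n * (m4 / \<sigma>)) \<le> \<tau> ^ 3"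
    and x: "x > 0" "x\<^sup>2 \<le> c * sqrt n" "x \<le> c * sqrt n" "x * sqrt n \<le> c * \<tau> ^ 3"
    and c: "0 \<le> c" "c \<le> 1" "c * m4 \<le> \<sigma> / 20" "c * m4 \<le> \<sigma> ^ 4 / 320000"
  defines "P \<equiv> measure (PiM {..<n} (\<lambda>_. D)) {\<omega> \<in> space (PiM {..<n} (\<lambda>_. D)). selfnorm_winsor \<tau> \<mu> n \<omega> > x}"
    and "L \<equiv> (1 - Phi x) * exp (- (x ^ 3 * (\<integral>y. (y - \<mu>) ^ 3 \<partial>D)) / (3 * sqrt n * \<sigma> ^ 3))"
    and "E \<equiv> (1 + x ^ 4) / n + (1 + x) * sqrt n / \<tau> ^ 3 + (1 + x) / sqrt n"
  shows "\<bar>P - L\<bar> \<le> tail_const \<sigma> m4 * E * L"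
proof -
  interpret D: prob_space D by (rule D(1))
  note [measurable_cong] = D(2)
  have y4: "integrable D (\<lambda>y. y ^ 4)" by (rule D(3))
  have y2le: "y\<^sup>2 \<le> 1 + y ^ 4" and y3le: "\<bar>y\<bar> ^ 3 \<le> 1 + y ^ 4" for y :: real
  proof -
    have "0 \<le> (y\<^sup>2 - 1)\<^sup>2 + y\<^sup>2 * 1" by simp
    then show 1: "y\<^sup>2 \<le> 1 + y ^ 4" by (simp add: power2_eq_square power4_eq_xxxx algebra_simps)
    have "0 \<le> (\<bar>y\<bar> - y\<^sup>2)\<^sup>2" by simp
    also have "\<dots> = y\<^sup>2 + y ^ 4 - 2 * \<bar>y\<bar> ^ 3"
      by (cases "y \<ge> 0") (simp_all add: power2_eq_square power3_eq_cube power4_eq_xxxx algebra_simps)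
    finally have "2 * \<bar>y\<bar> ^ 3 \<le> y\<^sup>2 + y ^ 4" by simp
    moreover have "0 \<le> y ^ 4" by simp
    moreover have "p \<le> 1 + r" if "2 * p \<le> q + r" "q \<le> 1 + r" "0 \<le> r" for p q r :: real using that by linarith
    ultimately show "\<bar>y\<bar> ^ 3 \<le> 1 + y ^ 4" using 1 by blast
  qed
  have lower: "integrable D (\<lambda>y. (f y)\<^sup>2) \<and> integrable D (\<lambda>y. f y ^ 3) \<and> integrable D f"
    if [measurable]: "f \<in> borel_measurable D" and f4: "integrable D (\<lambda>y. f y ^ 4)" for f :: "real \<Rightarrow> real"
  proof -
    have i: "integrable D (\<lambda>y. 1 + f y ^ 4)" using f4 by simp
    have a: "integrable D (\<lambda>y. (f y)\<^sup>2)"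
      by (rule Bochner_Integration.integrable_bound[OF i]) (auto intro!: AE_I2 simp: y2le)
    have "integrable D (\<lambda>y. \<bar>f y\<bar> ^ 3)"
      by (rule Bochner_Integration.integrable_bound[OF i]) (auto intro!: AE_I2 simp: y3le)
    then have b: "integrable D (\<lambda>y. f y ^ 3)"
      by (rule Bochner_Integration.integrable_bound) (auto simp: power_abs)
    show ?thesis using a b D.integrable_of_square[of f] by auto
  qed
  have id: "(\<lambda>y. y) \<in> borel_measurable D" by measurable
  have y1: "integrable D (\<lambda>y. y)" and y2: "integrable D (\<lambda>y. y\<^sup>2)" using lower[OF id y4] by auto
  define s2 where "s2 = (\<integral>y. y\<^sup>2 \<partial>D)"
  have v: "\<sigma>\<^sup>2 = s2 - \<mu>\<^sup>2" using D.variance_eq[OF y1 y2] by (simp add: \<sigma>2 \<mu> s2_def)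
  have y22: "integrable D (\<lambda>y. (y\<^sup>2)\<^sup>2)" using y4 by (simp flip: power_mult)
  have s22: "s2\<^sup>2 \<le> m4"
    using D.variance_eq[OF y2 y22] D.variance_positive[of "\<lambda>y. y\<^sup>2"] by (simp add: s2_def m4 flip: power_mult)
  have s20: "s2 > 0" using v \<sigma> zero_le_power2[of \<mu>] zero_less_power[OF \<sigma>, of 2] by linarith
  have m40: "m4 > 0" using s22 s20 by (smt (verit) zero_less_power)
  have \<mu>4: "\<mu> ^ 4 \<le> m4"
  proof -
    have "\<mu>\<^sup>2 \<le> s2" using v zero_le_power2[of \<sigma>] by linarith
    then have "(\<mu>\<^sup>2)\<^sup>2 \<le> s2\<^sup>2" by (intro power_mono) auto
    then show ?thesis using s22 by (simp flip: power_mult)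
  qed
  \<comment> \<open>Both \<open>\<mu>\<close>^2 and \<open>\<sigma>\<close>^2 are at most E Y^2,
    whose square is at most E Y^4, so |\<open>\<mu>\<close>| \<open>\<sigma>\<close> <= sqrt
    m4.\<close>
  have \<mu>\<tau>: "\<bar>\<mu>\<bar> \<le> \<tau>"
  proof -
    have "\<mu>\<^sup>2 \<le> s2" "\<sigma>\<^sup>2 \<le> s2" using v zero_le_power2[of \<sigma>] zero_le_power2[of \<mu>] by linarith+
    then have "\<mu>\<^sup>2 * \<sigma>\<^sup>2 \<le> s2 * s2" using s20 by (intro mult_mono) auto
    then have "(\<bar>\<mu>\<bar> * \<sigma>)\<^sup>2 \<le> s2\<^sup>2" unfolding power_mult_distrib power2_abs power2_eq_square[of s2] .
    then have "(\<bar>\<mu>\<bar> * \<sigma>)\<^sup>2 \<le> m4" using s22 by linarith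
    then have "\<bar>\<mu>\<bar> * \<sigma> \<le> sqrt m4" by (rule real_le_rsqrt)
    also have "\<dots> \<le> 4 * sqrt m4" using m40 by simp
    also have "\<dots> \<le> \<tau> * \<sigma>" by (rule \<tau>(2))
    finally show ?thesis using \<sigma> by simp
  qed
  have cent4: "integrable D (\<lambda>y. (f y - \<mu>) ^ 4) \<and> (\<integral>y. (f y - \<mu>) ^ 4 \<partial>D) \<le> 16 * m4"
    if [measurable]: "f \<in> borel_measurable D" and f: "\<And>y. \<bar>f y\<bar> \<le> \<bar>y\<bar>" for f :: "real \<Rightarrow> real"
  proof -
    have pw: "(f y - \<mu>) ^ 4 \<le> 8 * (y ^ 4 + \<mu> ^ 4)" for y
    proof -
      have "\<bar>f y\<bar> ^ 4 \<le> \<bar>y\<bar> ^ 4" using f by (intro power_mono) auto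
      then have "f y ^ 4 \<le> y ^ 4" by (simp add: power_even_abs)
      moreover have "(f y + - \<mu>) ^ 4 \<le> 8 * (f y ^ 4 + (- \<mu>) ^ 4)" by (rule fourth_power_sum_le)
      ultimately show ?thesis by simp
    qed
    have i: "integrable D (\<lambda>y. 8 * (y ^ 4 + \<mu> ^ 4))" using y4 by simp
    have q: "norm ((f y - \<mu>) ^ 4) \<le> norm (8 * (y ^ 4 + \<mu> ^ 4))" for y
      unfolding real_norm_def by (rule order_trans[OF _ abs_ge_self]) (use pw in simp)
    have j: "integrable D (\<lambda>y. (f y - \<mu>) ^ 4)"
      by (rule Bochner_Integration.integrable_bound[OF i _ AE_I2[OF q]]) measurable
    have "(\<integral>y. (f y - \<mu>) ^ 4 \<partial>D) \<le> (\<integral>y. 8 * (y ^ 4 + \<mu> ^ 4) \<partial>D)" by (rule integral_mono[OF j i pw])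
    also have "\<dots> = 8 * (m4 + \<mu> ^ 4)" using y4 m4 D.prob_space by simp
    finally show ?thesis using j \<mu>4 by simp
  qed
  define w where "w = (\<lambda>y. winsor \<tau> y - \<mu>)"
  have wm[measurable]: "w \<in> borel_measurable D" unfolding w_def by measurable
  have wm': "winsor \<tau> \<in> borel_measurable D" by measurable
  have w4: "integrable D (\<lambda>y. w y ^ 4)" "(\<integral>y. w y ^ 4 \<partial>D) \<le> 16 * m4"
    using cent4[OF wm' winsor_props(1)[OF \<tau>(1)]] by (auto simp: w_def)
  have w123: "integrable D (\<lambda>y. (w y)\<^sup>2)" "integrable D (\<lambda>y. w y ^ 3)" "integrable D w" using lower[OF wm w4(1)] by auto
  have cm: "(\<lambda>y. y - \<mu>) \<in> borel_measurable D" by measurable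
  have c4: "integrable D (\<lambda>y. (y - \<mu>) ^ 4)" "(\<integral>y. (y - \<mu>) ^ 4 \<partial>D) \<le> 16 * m4" using cent4[OF id] by auto
  have c123: "integrable D (\<lambda>y. (y - \<mu>)\<^sup>2)" "integrable D (\<lambda>y. (y - \<mu>) ^ 3)" using lower[OF cm c4(1)] by auto
  define u3 where "u3 = (\<integral>y. (y - \<mu>) ^ 3 \<partial>D)"
  define w3 where "w3 = (\<integral>y. w y ^ 3 \<partial>D)"
  have u3: "\<bar>u3\<bar> \<le> 1 + 16 * m4"
  proof -
    have "\<bar>u3\<bar> \<le> (\<integral>y. \<bar>(y - \<mu>) ^ 3\<bar> \<partial>D)" unfolding u3_def by (rule integral_abs_bound)
    also have "\<dots> \<le> (\<integral>y. 1 + (y - \<mu>) ^ 4 \<partial>D)"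
    proof (rule integral_mono[OF integrable_abs[OF c123(2)]])
      show "\<bar>(y - \<mu>) ^ 3\<bar> \<le> 1 + (y - \<mu>) ^ 4" for y using y3le[of "y - \<mu>"] by (simp add: power_abs)
    qed (use c4 in simp)
    also have "\<dots> \<le> 1 + 16 * m4" using c4 D.prob_space by simp
    finally show ?thesis .
  qed
  have gap: "\<bar>(\<integral>y. f y \<partial>D) - (\<integral>y. g y \<partial>D)\<bar> \<le> k * m4"
    if f: "integrable D f" and g: "integrable D g" and fg: "\<And>y. \<bar>f y - g y\<bar> \<le> k * y ^ 4" for f g :: "real \<Rightarrow> real" and k
  proof -
    have i: "integrable D (\<lambda>y. k * y ^ 4)" using y4 by simp
    have "\<bar>(\<integral>y. f y \<partial>D) - (\<integral>y. g y \<partial>D)\<bar> = \<bar>\<integral>y. f y - g y \<partial>D\<bar>" using f g by simp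
    also have "\<dots> \<le> (\<integral>y. \<bar>f y - g y\<bar> \<partial>D)" by (rule integral_abs_bound)
    also have "\<dots> \<le> (\<integral>y. k * y ^ 4 \<partial>D)"
      by (rule integral_mono[OF integrable_abs[OF Bochner_Integration.integrable_diff[OF f g]] i fg])
    finally show ?thesis by (simp add: m4)
  qed
  define B where "B = sqrt (\<integral>y. (w y)\<^sup>2 \<partial>D)"
  have B2: "B\<^sup>2 = (\<integral>y. (w y)\<^sup>2 \<partial>D)" by (simp add: B_def)
  have d2: "\<bar>B\<^sup>2 - \<sigma>\<^sup>2\<bar> \<le> 4 * (m4 / \<tau>\<^sup>2)"
  proof -
    have "\<bar>B\<^sup>2 - \<sigma>\<^sup>2\<bar> \<le> (4 / \<tau>\<^sup>2) * m4" unfolding B2 \<sigma>2[symmetric]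
      by (rule gap[OF w123(1) c123(1)]) (use winsor_centered_differences(1)[OF \<tau>(1) \<mu>\<tau>] in \<open>simp add: w_def\<close>)
    then show ?thesis by simp
  qed
  have d3: "\<bar>w3 - u3\<bar> \<le> 12 * (m4 / \<tau>)"
  proof -
    have "\<bar>w3 - u3\<bar> \<le> (12 / \<tau>) * m4" unfolding w3_def u3_def
      by (rule gap[OF w123(2) c123(2)]) (use winsor_centered_differences(2)[OF \<tau>(1) \<mu>\<tau>] in \<open>simp add: w_def\<close>)
    then show ?thesis by simp
  qed
  have d1: "\<bar>\<integral>y. w y \<partial>D\<bar> \<le> m4 / \<tau> ^ 3"
  proof -
    have i: "integrable D (\<lambda>y. y - \<mu>)" using y1 by simp
    have "\<bar>(\<integral>y. w y \<partial>D) - (\<integral>y. y - \<mu> \<partial>D)\<bar> \<le> (1 / \<tau> ^ 3) * m4"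
      by (rule gap[OF w123(3) i]) (use winsor_deviation[OF \<tau>(1), of 0] in \<open>simp add: w_def\<close>)
    moreover have "(\<integral>y. y - \<mu> \<partial>D) = 0" using y1 \<mu> D.prob_space by simp
    ultimately show ?thesis by simp
  qed
  \<comment> \<open>Squaring 4 sqrt m4 <= \<open>\<tau>\<close> \<open>\<sigma>\<close>: winsorizing
    changes the second moment by at most a quarter of the variance.\<close>
  have \<tau>m: "4 * (m4 / \<tau>\<^sup>2) \<le> \<sigma>\<^sup>2 / 4"
  proof -
    have "(4 * sqrt m4)\<^sup>2 \<le> (\<tau> * \<sigma>)\<^sup>2" using \<tau> m40 by (intro power_mono) auto
    then have "16 * m4 \<le> \<tau>\<^sup>2 * \<sigma>\<^sup>2" using m40 by (simp add: power_mult_distrib)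
    then show ?thesis using \<tau> by (simp add: field_simps)
  qed
  have B2b: "3 / 4 * \<sigma>\<^sup>2 \<le> B\<^sup>2" "B\<^sup>2 \<le> 5 / 4 * \<sigma>\<^sup>2" using d2 \<tau>m by linarith+
  have Bnn: "B \<ge> 0" by (simp add: B_def)
  have \<sigma>20: "\<sigma>\<^sup>2 > 0" using \<sigma> by simp
  have B: "\<sigma> / 2 \<le> B" "B \<le> 2 * \<sigma>" "B > 0"
  proof -
    have "(\<sigma> / 2)\<^sup>2 \<le> B\<^sup>2" using B2b \<sigma>20 unfolding power_divide by simp
    then show 1: "\<sigma> / 2 \<le> B" using Bnn by (rule power2_le_imp_le)
    have "B\<^sup>2 \<le> (2 * \<sigma>)\<^sup>2" using B2b \<sigma>20 unfolding power_mult_distrib by simp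
    then show "B \<le> 2 * \<sigma>" by (rule power2_le_imp_le) (use \<sigma> in simp)
    show "B > 0" using 1 \<sigma> by linarith
  qed
  define h where "h = (\<lambda>y. w y / B)"
  \<comment> \<open>The fourth moment 16 m4 divided by B^4 >= 9/16 \<open>\<sigma>\<close>^4 gives
    256/9, rounded up to 32.\<close>
  define K where "K = 32 * m4 / \<sigma> ^ 4"
  have hm: "h \<in> borel_measurable D" unfolding h_def by measurable
  have h4: "integrable D (\<lambda>y. h y ^ 4)" using w4 by (simp add: h_def power_divide)
  have h2: "(\<integral>y. (h y)\<^sup>2 \<partial>D) = 1" using B by (simp add: h_def power_divide flip: B2)
  have hK: "(\<integral>y. h y ^ 4 \<partial>D) \<le> K"
  proof -
    have "(\<integral>y. h y ^ 4 \<partial>D) = (\<integral>y. w y ^ 4 \<partial>D) / B ^ 4" by (simp add: h_def power_divide)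
    also have "\<dots> \<le> 16 * m4 / (9 / 16 * \<sigma> ^ 4)"
    proof (rule frac_le)
      have "(3 / 4 * \<sigma>\<^sup>2)\<^sup>2 \<le> (B\<^sup>2)\<^sup>2" using B2b \<sigma>20 by (intro power_mono) auto
      then show "9 / 16 * \<sigma> ^ 4 \<le> B ^ 4" unfolding power_mult_distrib by (simp add: power2_eq_square[of "3/4"] flip: power_mult)
    qed (use w4 m40 \<sigma> in auto)
    also have "\<dots> \<le> K" unfolding K_def using \<sigma> m40 by (simp add: field_simps)
    finally show ?thesis .
  qed
  define e where "e = (\<integral>y. h y \<partial>D)"
  have e: "\<bar>e\<bar> \<le> (2 * m4 / \<sigma>) / \<tau> ^ 3"
  proof -
    have "\<bar>e\<bar> = \<bar>\<integral>y. w y \<partial>D\<bar> / B" using B by (simp add: e_def h_def)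
    also have "\<dots> \<le> (m4 / \<tau> ^ 3) / (\<sigma> / 2)" using d1 B \<sigma> m40 \<tau> by (intro frac_le) auto
    finally show ?thesis by (simp add: mult_ac)
  qed
  have sn: "sqrt n \<ge> 1" using n by simp
  have \<tau>3: "\<tau> ^ 3 > 0" using \<tau> by simp
  \<comment> \<open>The bias is at most 2 m4 / (\<open>\<sigma>\<close> \<open>\<tau>\<close>^3), so
    the factor 64 = 4^3 in the third hypothesis on \<open>\<tau>\<close> even gives 1/32.\<close>
  have ne: "sqrt n * \<bar>e\<bar> \<le> 1 / 24"
  proof -
    have "sqrt n * \<bar>e\<bar> \<le> sqrt n * ((2 * m4 / \<sigma>) / \<tau> ^ 3)" using e by (intro mult_left_mono) auto
    also have "\<dots> = (2 * (sqrt n * (m4 / \<sigma>))) / \<tau> ^ 3" by simp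
    also have "\<dots> \<le> 1 / 24"
    proof -
      define q where "q = sqrt n * (m4 / \<sigma>)"
      have "2 * q \<le> 1 / 24 * \<tau> ^ 3" using \<tau>(3) \<tau>3 unfolding q_def[symmetric] by linarith
      then show ?thesis unfolding q_def[symmetric] using \<tau>3 by (simp only: pos_divide_le_eq)
    qed
    finally show ?thesis .
  qed
  have xne: "x * sqrt n * \<bar>e\<bar> \<le> 1 / 10"
  proof -
    have "x * sqrt n * \<bar>e\<bar> \<le> (c * \<tau> ^ 3) * ((2 * m4 / \<sigma>) / \<tau> ^ 3)"
      by (rule mult_mono[OF x(4) e]) (use c \<tau>3 in auto)
    also have "\<dots> = 2 * (c * m4 / \<sigma>)" using \<tau>3 by simp
    also have "\<dots> \<le> 2 * (1 / 20)" using c(3) \<sigma> by (intro mult_left_mono) (auto simp: pos_divide_le_eq)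
    finally show ?thesis by simp
  qed
  have K0: "K > 0" using m40 \<sigma> by (simp add: K_def)
  have Kc: "K * c \<le> 1 / 10000"
  proof -
    have "K * c = 32 * (c * m4) / \<sigma> ^ 4" by (simp add: K_def)
    also have "\<dots> \<le> 1 / 10000" using c(4) \<sigma> by (subst pos_divide_le_eq) auto
    finally show ?thesis .
  qed
  have Kcn: "K * (c * sqrt n) \<le> sqrt n / 10000"
  proof -
    have "(K * c) * sqrt n \<le> (1 / 10000) * sqrt n" using Kc by (intro mult_right_mono) auto
    then show ?thesis by simp
  qed
  have Kx: "K * x\<^sup>2 \<le> sqrt n / 10000" "K * x \<le> sqrt n / 10000"
  proof -
    have "K * x\<^sup>2 \<le> K * (c * sqrt n)" "K * x \<le> K * (c * sqrt n)" using x K0 by (auto intro!: mult_left_mono)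
    then show "K * x\<^sup>2 \<le> sqrt n / 10000" "K * x \<le> sqrt n / 10000" using Kcn by linarith+
  qed
  define g where "g = (\<integral>y. h y ^ 3 \<partial>D)"
  define L0 where "L0 = lead x n g * mills x"
  have g: "g = w3 / B ^ 3" by (simp add: g_def h_def w3_def power_divide)
  have Peq: "P = measure (PiM {..<n} (\<lambda>_. D)) (selfnorm_event D h x {..<n})"
    unfolding P_def h_def w_def using selfnorm_winsor_event[OF B(3) x(1)] by simp
  have main: "\<bar>P - L0\<bar> \<le> 3000000000 * K ^ 3 * err x n e * L0"
    unfolding Peq L0_def g_def e_def
    by (rule D.selfnorm_tail[OF hm h4 h2 hK _ _ n x(1) Kx ne[unfolded e_def] xne[unfolded e_def]]) auto
  define G where "G = third_gap \<sigma> m4"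
  have G0: "G \<ge> 0" using \<sigma> m40 by (simp add: G_def third_gap_def)
  have gg: "\<bar>g - u3 / \<sigma> ^ 3\<bar> \<le> G / \<tau>" unfolding g G_def
    by (rule normalized_third_moment_gap[OF \<sigma> B(1,2) \<tau>(1,2) _ d2 d3 u3]) (use m40 in simp)
  define u where "u = x ^ 3 / (sqrt n * \<tau>)"
  have u0: "u \<ge> 0" using x \<tau> by (simp add: u_def)
  have E0: "0 \<le> (1 + x ^ 4) / n" "0 \<le> (1 + x) * sqrt n / \<tau> ^ 3" "0 \<le> (1 + x) / sqrt n" using x \<tau>3 by auto
  have uac: "u \<le> x ^ 4 / n + x * sqrt n / \<tau> ^ 3"
    using geometric_mean_bound[OF x(1) _ \<tau>(1), of "sqrt n"] n by (simp add: u_def)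
  have uE: "u \<le> E"
  proof -
    have "x ^ 4 / n \<le> (1 + x ^ 4) / n" by (simp add: divide_right_mono)
    moreover have "x * sqrt n / \<tau> ^ 3 \<le> (1 + x) * sqrt n / \<tau> ^ 3" using \<tau>3 by (intro divide_right_mono mult_right_mono) auto
    ultimately show ?thesis using uac E0 unfolding E_def by linarith
  qed
  have u2: "u \<le> 2"
  proof -
    have "c * sqrt n \<le> 1 * sqrt n" by (intro mult_right_mono) (use c in auto)
    then have "x\<^sup>2 \<le> sqrt n" using x(2) by linarith
    then have "(x\<^sup>2)\<^sup>2 \<le> (sqrt n)\<^sup>2" by (intro power_mono) auto
    then have "x ^ 4 \<le> n" by (simp flip: power_mult)
    then have "x ^ 4 / n \<le> 1" using n by simp
    moreover have "x * sqrt n / \<tau> ^ 3 \<le> 1"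
    proof -
      have "c * \<tau> ^ 3 \<le> 1 * \<tau> ^ 3" by (intro mult_right_mono) (use c \<tau>3 in auto)
      then have "x * sqrt n \<le> \<tau> ^ 3" using x(4) by linarith
      then show ?thesis using \<tau>3 by (simp only: divide_le_eq_1_pos)
    qed
    ultimately show ?thesis using uac by linarith
  qed
  \<comment> \<open>Logarithm of the ratio between the leading terms with the winsorized and with
    the original third moment. It is small like u and also bounded, so exp(\<open>\<eta>\<close>) -
    1 is linear in u.\<close>
  define \<eta> where "\<eta> = x ^ 3 / (3 * sqrt n) * (u3 / \<sigma> ^ 3 - g)"
  have \<eta>: "\<bar>\<eta>\<bar> \<le> G * u"
  proof -
    have "\<bar>\<eta>\<bar> = x ^ 3 / (3 * sqrt n) * \<bar>g - u3 / \<sigma> ^ 3\<bar>" unfolding \<eta>_def abs_mult using x by (simp add: abs_minus_commute)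
    also have "\<dots> \<le> x ^ 3 / (3 * sqrt n) * (G / \<tau>)" using gg x by (intro mult_left_mono) auto
    also have "\<dots> = G * u / 3" by (simp add: u_def mult_ac)
    also have "\<dots> \<le> G * u" using G0 u0 by simp
    finally show ?thesis .
  qed
  have L0eq: "L0 = L * exp \<eta>"
  proof -
    have "- (x ^ 3 * g) / (3 * sqrt n) = - (x ^ 3 * u3) / (3 * sqrt n * \<sigma> ^ 3) + \<eta>"
      unfolding \<eta>_def right_diff_distrib by simp
    then have "exp (- (x ^ 3 * g) / (3 * sqrt n)) = exp (- (x ^ 3 * u3) / (3 * sqrt n * \<sigma> ^ 3)) * exp \<eta>"
      by (simp only: exp_add)
    then show ?thesis unfolding L0_def L_def lead_def one_minus_Phi_mills u3_def[symmetric] by (simp only: mult_ac)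
  qed
  have L: "L \<ge> 0" unfolding L_def using Phi_bounds(2)[of x] by simp
  have EE: "E \<ge> 0" using E0 by (simp add: E_def)
  have exG: "exp \<bar>\<eta>\<bar> \<le> exp (2 * G)"
  proof -
    have "G * u \<le> G * 2" using G0 u2 by (intro mult_left_mono)
    then show ?thesis using \<eta> by simp
  qed
  have ex1: "exp \<eta> \<le> exp (2 * G)" by (rule order_trans[OF _ exG]) simp
  have dL: "\<bar>L0 - L\<bar> \<le> G * exp (2 * G) * E * L"
  proof -
    have "\<bar>exp \<eta> - exp 0\<bar> \<le> \<bar>\<eta> - 0\<bar> * exp (max \<eta> 0)" by (rule exp_diff_le)
    also have "\<dots> \<le> (G * u) * exp (2 * G)"
    proof (rule mult_mono)
      show "exp (max \<eta> 0) \<le> exp (2 * G)" using ex1 G0 by (auto simp: max_def)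
    qed (use \<eta> G0 u0 in auto)
    also have "\<dots> \<le> (G * E) * exp (2 * G)" using uE G0 by (intro mult_right_mono mult_left_mono) auto
    finally have "\<bar>exp \<eta> - 1\<bar> \<le> (G * E) * exp (2 * G)" by simp
    then have "L * \<bar>exp \<eta> - 1\<bar> \<le> L * ((G * E) * exp (2 * G))" using L by (intro mult_left_mono)
    moreover have "\<bar>L0 - L\<bar> = L * \<bar>exp \<eta> - 1\<bar>"
    proof -
      have "L0 - L = L * (exp \<eta> - 1)" by (simp add: L0eq algebra_simps)
      then show ?thesis using L by (simp add: abs_mult)
    qed
    ultimately show ?thesis by (simp add: mult_ac)
  qed
  have errE: "err x n e \<le> (1 + 2 * m4 / \<sigma>) * E"
  proof -
    define k where "k = 2 * m4 / \<sigma>"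
    have k0: "k \<ge> 0" using m40 \<sigma> by (simp add: k_def)
    have "(1 + x) * sqrt n * \<bar>e\<bar> \<le> (1 + x) * sqrt n * (k / \<tau> ^ 3)" using e x unfolding k_def by (intro mult_left_mono) auto
    then have a: "(1 + x) * sqrt n * \<bar>e\<bar> \<le> k * ((1 + x) * sqrt n / \<tau> ^ 3)" by (simp add: mult_ac)
    have "k * ((1 + x) * sqrt n / \<tau> ^ 3) \<le> k * E" using E0 k0 unfolding E_def by (intro mult_left_mono) auto
    moreover have "(1 + x ^ 4) / n + (1 + x) / sqrt n \<le> E" using E0 unfolding E_def by linarith
    moreover have "(1 + k) * E = E + k * E" by (simp add: algebra_simps)
    ultimately show ?thesis using a unfolding err_def k_def[symmetric] by linarith
  qed
  define q where "q = 1 + 2 * m4 / \<sigma>"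
  have q0: "q \<ge> 0" using m40 \<sigma> by (simp add: q_def)
  have err0: "0 \<le> err x n e" unfolding err_def using x by (intro add_nonneg_nonneg mult_nonneg_nonneg divide_nonneg_nonneg) auto
  have "3000000000 * K ^ 3 * err x n e * (L * exp \<eta>) \<le> 3000000000 * K ^ 3 * (q * E) * (L * exp (2 * G))"
  proof (rule mult_mono)
    show "3000000000 * K ^ 3 * err x n e \<le> 3000000000 * K ^ 3 * (q * E)"
      using errE K0 unfolding q_def[symmetric] by (intro mult_left_mono) auto
    show "L * exp \<eta> \<le> L * exp (2 * G)" using ex1 L by (rule mult_left_mono)
  qed (use L K0 EE q0 in auto)
  then have "3000000000 * K ^ 3 * err x n e * L0 \<le> 3000000000 * K ^ 3 * (q * E) * (L * exp (2 * G))"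
    unfolding L0eq .
  then have "\<bar>P - L\<bar> \<le> 3000000000 * K ^ 3 * (q * E) * (L * exp (2 * G)) + G * exp (2 * G) * E * L"
    by (rule abs_diff_chain[OF _ main dL])
  also have "\<dots> = (3000000000 * K ^ 3 * q + G) * exp (2 * G) * E * L"
    by (simp add: algebra_simps)
  also have "\<dots> = tail_const \<sigma> m4 * E * L"
    unfolding tail_const_def G_def K_def q_def ..
  finally show ?thesis .
qed

text \<open>The first quotient keeps the bias x sqrt n |e| below 1/10. In the second, 320000 = 32 *
  10000 ensures the range K x^2 <= sqrt n / 10000 with K = 32 m4 / s^4. The default 1 makes the
  constant positive at all arguments.\<close>

definition range_const :: "real \<Rightarrow> real \<Rightarrow> real" where
  "range_const s m4 = (if s > 0 \<and> m4 > 0 then min 1 (min (s / (20 * m4)) (s ^ 4 / (320000 * m4))) else 1)"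

lemma range_const_pos: "range_const s m4 > 0"
  by (simp add: range_const_def)

lemma range_const_bounds:
  assumes "s > 0" "m4 \<ge> 0"
  shows "range_const s m4 \<le> 1" "range_const s m4 * m4 \<le> s / 20" "range_const s m4 * m4 \<le> s ^ 4 / 320000"
proof -
  have "range_const s m4 \<le> 1 \<and> range_const s m4 * m4 \<le> s / 20 \<and> range_const s m4 * m4 \<le> s ^ 4 / 320000"
  proof (cases "m4 > 0")
    case True
    then have r: "range_const s m4 = min 1 (min (s / (20 * m4)) (s ^ 4 / (320000 * m4)))"
      using assms by (simp add: range_const_def)
    have "range_const s m4 \<le> s / (20 * m4)" "range_const s m4 \<le> s ^ 4 / (320000 * m4)" "range_const s m4 \<le> 1"
      unfolding r by simp_all
    then show ?thesis using True by (simp add: pos_le_divide_eq mult_ac)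
  next
    case False
    then show ?thesis using assms by (simp add: range_const_def)
  qed
  then show "range_const s m4 \<le> 1" "range_const s m4 * m4 \<le> s / 20" "range_const s m4 * m4 \<le> s ^ 4 / 320000" by auto
qed

text \<open>The factor 4 is what both uses of the lower bound on \<open>\<tau>\<close> ask for: as
  n^(1/6) >= 1, the first entry of the maximum gives 4 sqrt m4 <= \<open>\<tau>\<close>
  \<open>\<sigma>\<close>, and cubing the second gives 64 sqrt n m4 / \<open>\<sigma>\<close> <=
  \<open>\<tau>\<close>^3.\<close>

lemma winsorized_tail_relative:
  fixes D :: "real measure" and n :: nat and \<tau> x \<mu> \<sigma> m4 :: real
  assumes D: "prob_space D" "sets D = sets borel" "integrable D (\<lambda>y. y ^ 4)"
    and \<mu>: "\<mu> = (\<integral>y. y \<partial>D)" and \<sigma>: "\<sigma> = sqrt (\<integral>y. (y - \<mu>)\<^sup>2 \<partial>D)" "\<sigma> > 0" and m4: "m4 = (\<integral>y. y ^ 4 \<partial>D)"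
    and n: "n \<ge> 1" and \<tau>: "\<tau> > 0" "\<tau> \<ge> 4 * real n powr (1/6) * max (sqrt m4 / \<sigma>) ((m4 / \<sigma>) powr (1/3))"
    and x: "0 < x" "x < range_const \<sigma> m4 * min (real n powr (1/4)) (\<tau> ^ 3 * real n powr (-1/2))"
  shows "\<exists>O1. \<bar>O1\<bar> \<le> \<bar>tail_const \<sigma> m4\<bar> + 1 \<and>
    measure (PiM {..<n} (\<lambda>_. D)) {\<omega> \<in> space (PiM {..<n} (\<lambda>_. D)). selfnorm_winsor \<tau> \<mu> n \<omega> > x}
      = (1 - Phi x) * exp (- (x ^ 3 * (\<integral>y. (y - \<mu>) ^ 3 \<partial>D)) / (3 * sqrt (real n) * \<sigma> ^ 3))
        * (1 + O1 * ((1 + x ^ 4) / real n + (1 + x) * sqrt (real n) / \<tau> ^ 3 + (1 + x) / sqrt (real n)))"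
proof -
  define c where "c = range_const \<sigma> m4"
  have m40: "m4 \<ge> 0" unfolding m4 by (rule Bochner_Integration.integral_nonneg) simp
  note c = range_const_bounds[OF \<sigma>(2) m40, folded c_def]
  have c0: "0 \<le> c" using range_const_pos[of \<sigma> m4] by (simp add: c_def)
  have n1: "real n \<ge> 1" using n by simp
  have \<sigma>2: "(\<integral>y. (y - \<mu>)\<^sup>2 \<partial>D) = \<sigma>\<^sup>2"
    unfolding \<sigma>(1) by (simp add: Bochner_Integration.integral_nonneg)
  have n6: "real n powr (1/6) \<ge> 1" using n1 by (intro ge_one_powr_ge_zero) auto
  have t2: "4 * sqrt m4 \<le> \<tau> * \<sigma>"
  proof -
    have "4 * 1 * (sqrt m4 / \<sigma>) \<le> 4 * real n powr (1/6) * max (sqrt m4 / \<sigma>) ((m4 / \<sigma>) powr (1/3))"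
      using n6 m40 \<sigma>(2) by (intro mult_mono) auto
    then have "4 * (sqrt m4 / \<sigma>) \<le> \<tau>" using \<tau>(2) by simp
    then show ?thesis using \<sigma>(2) by (simp add: field_simps)
  qed
  have t3: "64 * (sqrt n * (m4 / \<sigma>)) \<le> \<tau> ^ 3"
  proof -
    define q where "q = m4 / \<sigma>"
    have q: "q \<ge> 0" using m40 \<sigma>(2) by (simp add: q_def)
    have "4 * real n powr (1/6) * q powr (1/3) \<le> 4 * real n powr (1/6) * max (sqrt m4 / \<sigma>) ((m4 / \<sigma>) powr (1/3))"
      unfolding q_def by (intro mult_left_mono) auto
    then have "4 * real n powr (1/6) * q powr (1/3) \<le> \<tau>" using \<tau>(2) by linarith
    then have "(4 * real n powr (1/6) * q powr (1/3)) ^ 3 \<le> \<tau> ^ 3" by (intro power_mono) auto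
    moreover have "(real n powr (1/6)) ^ 3 = sqrt n"
      by (subst powr_power) (use n in \<open>simp_all add: powr_half_sqrt\<close>)
    moreover have "(q powr (1/3)) ^ 3 = q"
    proof (cases "q = 0")
      case False
      then show ?thesis by (subst powr_power) (use q in simp_all)
    qed simp
    ultimately show ?thesis unfolding power_mult_distrib q_def[symmetric] by simp
  qed
  have n4: "(real n powr (1/4))\<^sup>2 = sqrt n"
    by (subst powr_power) (use n in \<open>simp_all add: powr_half_sqrt\<close>)
  have nm: "real n powr (-1/2) = 1 / sqrt n"
  proof -
    have "real n powr (-1/2) = real n powr (- (1/2))" by simp
    also have "\<dots> = 1 / sqrt n" unfolding powr_minus_divide by (simp add: powr_half_sqrt)
    finally show ?thesis .
  qed
  have xa: "x \<le> c * real n powr (1/4)" "x \<le> c * (\<tau> ^ 3 * (1 / sqrt n))"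
  proof -
    have "c * min (real n powr (1/4)) (\<tau> ^ 3 * real n powr (-1/2)) \<le> c * real n powr (1/4)"
      "c * min (real n powr (1/4)) (\<tau> ^ 3 * real n powr (-1/2)) \<le> c * (\<tau> ^ 3 * real n powr (-1/2))"
      using c0 by (intro mult_left_mono; simp)+
    then show "x \<le> c * real n powr (1/4)" "x \<le> c * (\<tau> ^ 3 * (1 / sqrt n))"
      using x(2) unfolding c_def[symmetric] nm by linarith+
  qed
  \<comment> \<open>Squaring produces c^2, which c <= 1 lowers to c.\<close>
  have x2: "x\<^sup>2 \<le> c * sqrt n"
  proof -
    have "x\<^sup>2 \<le> (c * real n powr (1/4))\<^sup>2" using xa(1) x(1) by (intro power_mono) auto
    also have "\<dots> = c * (c * sqrt n)" unfolding power_mult_distrib n4 by (simp add: power2_eq_square)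
    also have "\<dots> \<le> 1 * (c * sqrt n)" using c c0 by (intro mult_right_mono) auto
    finally show ?thesis by simp
  qed
  have x1: "x \<le> c * sqrt n"
  proof -
    have "real n powr (1/4) \<le> real n powr (1/2)" using n1 by (intro powr_mono) auto
    then have "c * real n powr (1/4) \<le> c * sqrt n" using c0 by (simp add: powr_half_sqrt mult_left_mono)
    then show ?thesis using xa(1) by linarith
  qed
  have sn: "sqrt n > 0" using n by simp
  have x3: "x * sqrt n \<le> c * \<tau> ^ 3"
  proof -
    have "x * sqrt n \<le> c * (\<tau> ^ 3 * (1 / sqrt n)) * sqrt n" using xa(2) by (intro mult_right_mono) auto
    also have "\<dots> = c * \<tau> ^ 3" using sn by simp
    finally show ?thesis .
  qed
  define P where "P = measure (PiM {..<n} (\<lambda>_. D)) {\<omega> \<in> space (PiM {..<n} (\<lambda>_. D)). selfnorm_winsor \<tau> \<mu> n \<omega> > x}"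
  define L where "L = (1 - Phi x) * exp (- (x ^ 3 * (\<integral>y. (y - \<mu>) ^ 3 \<partial>D)) / (3 * sqrt (real n) * \<sigma> ^ 3))"
  define E where "E = (1 + x ^ 4) / real n + (1 + x) * sqrt (real n) / \<tau> ^ 3 + (1 + x) / sqrt (real n)"
  have bound: "\<bar>P - L\<bar> \<le> tail_const \<sigma> m4 * E * L"
    unfolding P_def L_def E_def
    by (rule winsorized_tail[OF D \<mu>[symmetric] \<sigma>2 m4[symmetric] \<sigma>(2) n \<tau>(1) t2 t3 x(1) x2 x1 x3 c0 c])
  have L: "L > 0"
  proof -
    have "0 < 1 / (1 + x)" using x(1) by simp
    then have "mills x > 0" using mills_lower[of x] x(1) by linarith
    then show ?thesis unfolding L_def one_minus_Phi_mills by simp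
  qed
  have E: "E > 0"
  proof -
    have "0 \<le> (1 + x ^ 4) / real n" "0 \<le> (1 + x) * sqrt (real n) / \<tau> ^ 3" "0 < (1 + x) / sqrt (real n)"
      using x(1) \<tau>(1) sn by auto
    then show ?thesis unfolding E_def by linarith
  qed
  \<comment> \<open>The claimed identity solved for the error factor, which is possible because E
    and L are positive.\<close>
  define O1 where "O1 = (P - L) / (E * L)"
  have "\<bar>O1\<bar> = \<bar>P - L\<bar> / (E * L)" using L E by (simp add: O1_def abs_mult)
  also have "\<dots> \<le> tail_const \<sigma> m4" using bound L E by (simp add: pos_divide_le_eq mult.assoc)
  finally have "\<bar>O1\<bar> \<le> \<bar>tail_const \<sigma> m4\<bar> + 1" by linarith
  moreover have "P = L * (1 + O1 * E)" using L E by (simp add: O1_def field_simps)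
  ultimately show ?thesis unfolding P_def L_def E_def by blast
qed

theorem theorem4p1:
  "\<exists>c1 > 0. \<exists>C2 A :: real \<Rightarrow> real \<Rightarrow> real \<Rightarrow> real.
     (\<forall>s m3 m4. C2 s m3 m4 > 0 \<and> A s m3 m4 > 0) \<and>
     (\<forall>(D :: real measure) (n :: nat) (\<tau> :: real) (x :: real).
        prob_space D \<longrightarrow> sets D = sets borel \<longrightarrow>
        integrable D (\<lambda>y. y ^ 4) \<longrightarrow>
        (let \<mu> = (\<integral>y. y \<partial>D);
             \<sigma> = sqrt (\<integral>y. (y - \<mu>)\<^sup>2 \<partial>D);
             m3 = (\<integral>y. \<bar>y\<bar> ^ 3 \<partial>D);
             m4 = (\<integral>y. y ^ 4 \<partial>D);
             P = PiM {..<n} (\<lambda>_. D)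
         in \<sigma> > 0 \<longrightarrow> n \<ge> 1 \<longrightarrow> \<tau> > 0 \<longrightarrow>
            \<tau> \<ge> c1 * real n powr (1/6) * max (sqrt m4 / \<sigma>) ((m4 / \<sigma>) powr (1/3)) \<longrightarrow>
            0 < x \<longrightarrow> x < C2 \<sigma> m3 m4 * min (real n powr (1/4)) (\<tau> ^ 3 * real n powr (-1/2)) \<longrightarrow>
            (\<exists>O1. \<bar>O1\<bar> \<le> A \<sigma> m3 m4 \<and>
               measure P {\<omega> \<in> space P. selfnorm_winsor \<tau> \<mu> n \<omega> > x}
               = (1 - Phi x)
                 * exp (- (x ^ 3 * (\<integral>y. (y - \<mu>) ^ 3 \<partial>D)) / (3 * sqrt (real n) * \<sigma> ^ 3))
                 * (1 + O1 * ((1 + x ^ 4) / real n + (1 + x) * sqrt (real n) / \<tau> ^ 3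
                              + (1 + x) / sqrt (real n))))))"
proof (intro exI conjI)
  show "(4::real) > 0" by simp
  \<comment> \<open>The witnesses for \<open>C2\<close> and \<open>A\<close> are fixed by
    unification with this line. The absolute value and the added 1 make \<open>A\<close> positive at
    arguments of either sign.\<close>
  show "\<forall>s m3 m4. (\<lambda>s m3 m4. range_const s m4) s m3 m4 > 0 \<and> (\<lambda>s m3 m4. \<bar>tail_const s m4\<bar> + 1) s m3 m4 > 0"
    by (simp add: range_const_pos add_nonneg_pos)
qed (unfold Let_def, intro allI impI, rule winsorized_tail_relative; (assumption | rule refl))

end
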